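(* Let $k$ be a field with $\mathrm{char}\,k\neq3$, and let $s,t$ be independent variables over $k$. In each of the items (1)–(5) it is assumed that the displayed sextic polynomial $g^{(H_1,H_2)}$ has no multiple root. (1) The polynomial $$g^{(\mathfrak S_3,\mathfrak S_3)}=X^6+\frac{2t}{s(4s+27)}X^4+\frac{t}{s^2(4s+27)}X^3+\frac{t^2}{s^2(4s+27)^2}X^2+\frac{t^2}{s^3(4s+27)^2}X+\frac{(s-t)t^2}{s^4(4s+27)^3}$$ is irreducible over $k(s,t)$ and $k$-generic for $\mathfrak S_3\times\mathfrak S_3$. (2) Writing $\delta_t=t^2+3t+9$, the polynomial $$g^{(\mathfrak S_3,C_3)}=X^6-\frac{6\delta_t}{s(4s+27)}X^4-\frac{(2t+3)\delta_t}{s^2(4s+27)}X^3+\frac{9\delta_t^2}{s^2(4s+27)^2}X^2+\frac{3(2t+3)\delta_t^2}{s^3(4s+27)^2}X+\frac{\delta_t^2(4st^2+27t^2+12st+9s+81t+243)}{s^4(4s+27)^3}$$ is irreducible over $k(s,t)$ and $k$-generic for $\mathfrak S_3\times C_3\cong C_3\wr C_2\cong(C_3\times C_3)\rtimes C_2$. (3) The polynomial $$g^{(\mathfrak S_3,C_2)}=X^6-\frac{2t}{s(4s+27)}X^4+\frac{t^2}{s^2(4s+27)^2}X^2+\frac{t^3}{s^4(4s+27)^3}$$ is irreducible over $k(s,t)$ and $k$-generic for $\mathfrak S_3\times C_2\cong D_6$ (the dihedral group of order $12$). (4) Assume in this item that $\mathrm{char}\,k\ne2$. The polynomial $$g^{(\mathfrak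 S_3,\{1\})}=X^6-\frac{2}{s(4s+27)}X^4+\frac{1}{s^2(4s+27)^2}X^2+\frac{1}{s^4(4s+27)^3}$$ is irreducible over $k(s,t)$ and $k$-generic for $\mathfrak S_3$. The polynomial $$h^{\mathfrak S_3}(s;X)=X^6-2s(4s+27)X^4+s^2(4s+27)^2X^2+s^2(4s+27)^3$$ is also $k$-generic for $\mathfrak S_3$ (with one parameter $s$), and $X^3+sX+s$ and $h^{\mathfrak S_3}(s;X)$ have the same splitting field over $k(s)$. (5) The polynomial $$g^{(C_3,C_2)}=X^6-\frac{6t}{s^2+3s+9}X^4+\frac{9t^2}{(s^2+3s+9)^2}X^2-\frac{(2s+3)^2t^3}{(s^2+3s+9)^4}$$ is irreducible over $k(s,t)$ and $k$-generic for $C_3\times C_2\cong C_6$. Accordingly, in each case the group $H_1\times H_2$ is regarded as a transitive subgroup of $\mathfrak S_6$.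
   Context: $\mathfrak S_n$ is the symmetric group of degree $n$ and $C_n$ the cyclic group of order $n$. A polynomial $F(t_1,\ldots,t_r;X)\in k(t_1,\ldots,t_r)[X]$ (with $t_1,\ldots,t_r$ independent variables) is called $k$-generic for a finite group $G$ if the Galois group of $F$ over $k(t_1,\ldots,t_r)$ is isomorphic to $G$ and every Galois extension $L/M$ with group $G$, where $M\supset k$ is an infinite field, is the splitting field over $M$ of $F(a_1,\ldots,a_r;X)$ for some $(a_1,\ldots,a_r)\in M^r$. *)

theory Defs
  imports
    "HOL-Algebra.Algebraic_Closure_Type"
    "HOL-Algebra.Bij"
    "HOL-Algebra.Sym_Groups"
    "HOL-Algebra.Elementary_Groups"
    "HOL-Algebra.Product_Groups"
    "HOL-Computational_Algebra.Computational_Algebra"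
begin

section \<open>Field extensions inside an ambient field\<close>

text \<open>
  An extension \<open>L/M\<close> is a pair of subfields \<open>M \<subseteq> L\<close> of the universe of a type of class
  \<^class>\<open>field\<close>.
\<close>

definition is_subfield :: "'w::field set \<Rightarrow> bool" where
  "is_subfield F \<longleftrightarrow> 0 \<in> F \<and> 1 \<in> F \<and>
     (\<forall>x\<in>F. \<forall>y\<in>F. x + y \<in> F \<and> x * y \<in> F) \<and> (\<forall>x\<in>F. - x \<in> F \<and> inverse x \<in> F)"

definition adjoin :: "'w::field set \<Rightarrow> 'w set \<Rightarrow> 'w set" where
  "adjoin M S = \<Inter>{F. is_subfield F \<and> M \<union> S \<subseteq> F}"

definition poly_over :: "'w::field set \<Rightarrow> 'w poly \<Rightarrow> bool" where
  "poly_over M f \<longleftrightarrow> (\<forall>i. Polynomial.coeff f i \<in> M)"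

definition galois_group :: "'w::field set \<Rightarrow> 'w set \<Rightarrow> ('w \<Rightarrow> 'w) monoid" where
  "galois_group M L = (BijGroup L)\<lparr>carrier := {\<sigma> \<in> Bij L.
     (\<forall>x\<in>L. \<forall>y\<in>L. \<sigma> (x + y) = \<sigma> x + \<sigma> y \<and> \<sigma> (x * y) = \<sigma> x * \<sigma> y) \<and> (\<forall>x\<in>M. \<sigma> x = x)}\<rparr>"

definition galois_extension :: "'w::field set \<Rightarrow> 'w set \<Rightarrow> bool" where
  "galois_extension M L \<longleftrightarrow> is_subfield M \<and> is_subfield L \<and> M \<subseteq> L \<and>
     (\<forall>x\<in>L. \<exists>f. f \<noteq> 0 \<and> poly_over M f \<and> poly f x = 0) \<and>
     {x \<in> L. \<forall>\<sigma>\<in>carrier (galois_group M L). \<sigma> x = x} = M"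

definition is_splitting_field :: "'w::field set \<Rightarrow> 'w set \<Rightarrow> 'w poly \<Rightarrow> bool" where
  "is_splitting_field M L f \<longleftrightarrow> f \<noteq> 0 \<and> poly_over M f \<and>
     (\<exists>xs. f = Polynomial.smult (Polynomial.lead_coeff f) (\<Prod>x\<leftarrow>xs. [:- x, 1:]) \<and>
           L = adjoin M (set xs))"

definition field_embedding :: "('k::field \<Rightarrow> 'w::field) \<Rightarrow> bool" where
  "field_embedding \<iota> \<longleftrightarrow> \<iota> 1 = 1 \<and>
     (\<forall>x y. \<iota> (x + y) = \<iota> x + \<iota> y) \<and> (\<forall>x y. \<iota> (x * y) = \<iota> x * \<iota> y)"


section \<open>The Galois group of a polynomial\<close>

definition ac_roots :: "'a::field poly \<Rightarrow> 'a alg_closure set" where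
  "ac_roots F = {x. poly (map_poly to_ac F) x = 0}"

definition ac_splitting_field :: "'a::field poly \<Rightarrow> 'a alg_closure set" where
  "ac_splitting_field F = adjoin (range to_ac) (ac_roots F)"

definition poly_galois_group :: "'a::field poly \<Rightarrow> ('a alg_closure \<Rightarrow> 'a alg_closure) monoid" where
  "poly_galois_group F = galois_group (range to_ac) (ac_splitting_field F)"

definition no_multiple_root :: "'a::field poly \<Rightarrow> bool" where
  "no_multiple_root F \<longleftrightarrow> rsquarefree (map_poly to_ac F)"

text \<open>
  \<open>G\<close> becomes a transitive subgroup of the symmetric group of degree \<open>n\<close> by means of a
  numbering \<open>r\<close> of the \<open>n\<close> roots of \<open>F\<close>: it is embedded onto the permutation group of the
  roots induced by the Galois group.
\<close>

definition transitive_galois_action :: "nat \<Rightarrow> 'g monoid \<Rightarrow> 'a::field poly \<Rightarrow> bool" where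
  "transitive_galois_action n G F \<longleftrightarrow> (\<exists>r \<phi>.
     bij_betw r {1..n} (ac_roots F) \<and>
     \<phi> \<in> mon G (sym_group n) \<and>
     \<phi> ` carrier G = {p \<in> carrier (sym_group n).
        \<exists>\<sigma>\<in>carrier (poly_galois_group F). \<forall>i\<in>{1..n}. \<sigma> (r i) = r (p i)} \<and>
     (\<forall>i\<in>{1..n}. \<forall>j\<in>{1..n}. \<exists>x\<in>carrier G. \<phi> x i = j))"


section \<open>Generic polynomials\<close>

text \<open>
  The field \<open>k(s)\<close> is \<open>'k poly fract\<close>, and \<open>k(s,t)\<close> is \<open>'k poly poly fract\<close>, the fraction field
  of \<open>k[s][t]\<close>: the inner indeterminate is \<open>s\<close>, the outer one is \<open>t\<close>.
\<close>

definition var1_s :: "'k::field poly fract" where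
  "var1_s = Fract [:0, 1:] 1"

definition var2_s :: "'k::field poly poly fract" where
  "var2_s = Fract [:[:0, 1:]:] 1"

definition var2_t :: "'k::field poly poly fract" where
  "var2_t = Fract [:0, 1:] 1"

definition eval1 :: "('k::field \<Rightarrow> 'w::field) \<Rightarrow> 'w \<Rightarrow> 'k poly \<Rightarrow> 'w" where
  "eval1 \<iota> a p = poly (map_poly \<iota> p) a"

definition eval2 :: "('k::field \<Rightarrow> 'w::field) \<Rightarrow> 'w \<times> 'w \<Rightarrow> 'k poly poly \<Rightarrow> 'w" where
  "eval2 \<iota> = (\<lambda>(a, b) p. poly (map_poly (eval1 \<iota> a) p) b)"

text \<open>
  With \<open>e\<close> the evaluation of \<open>k[t\<^sub>1,\<dots>,t\<^sub>r]\<close> at a point \<open>a\<close>, the polynomial \<open>f\<close> is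
  \<open>F(a\<^sub>1,\<dots>,a\<^sub>r;X)\<close>; this includes that every coefficient of \<open>F\<close> is defined at \<open>a\<close>, i.e. has a
  representation whose denominator does not vanish there.
\<close>

definition specializes_to :: "('p::idom \<Rightarrow> 'w::field) \<Rightarrow> 'p fract poly \<Rightarrow> 'w poly \<Rightarrow> bool" where
  "specializes_to e F f \<longleftrightarrow> (\<forall>i. \<exists>p q. q \<noteq> 0 \<and> e q \<noteq> 0 \<and>
     Polynomial.coeff F i = Fract p q \<and> Polynomial.coeff f i = e p / e q)"

text \<open>
  Here \<open>'p\<close> is \<open>k[t\<^sub>1,\<dots>,t\<^sub>r]\<close>, \<open>pts M\<close> is \<open>M\<^sup>r\<close> and \<open>ev \<iota> a\<close> is evaluation at \<open>a\<close> along
  \<open>\<iota> : k \<rightarrow> M\<close>. A definition cannot quantify over types, so the fields \<open>M \<subseteq> L\<close> range over the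
  subfields of one type \<open>'w\<close>, which is to be left arbitrary in a theorem.
\<close>

definition k_generic_wrt ::
  "(('k::field \<Rightarrow> 'w::field) \<Rightarrow> 'pt \<Rightarrow> 'p::idom \<Rightarrow> 'w) \<Rightarrow> ('w set \<Rightarrow> 'pt set) \<Rightarrow>
   'p fract poly \<Rightarrow> 'g monoid \<Rightarrow> bool" where
  "k_generic_wrt ev pts F G \<longleftrightarrow>
     poly_galois_group F \<cong> G \<and>
     (\<forall>\<iota> M L. field_embedding \<iota> \<and> range \<iota> \<subseteq> M \<and> infinite M \<and>
        galois_extension M L \<and> galois_group M L \<cong> G \<longrightarrow>
        (\<exists>a\<in>pts M. \<exists>f. specializes_to (ev \<iota> a) F f \<and> is_splitting_field M L f))"

definition k_generic1 :: "'w::field itself \<Rightarrow> 'k::field poly fract poly \<Rightarrow> 'g monoid \<Rightarrow> bool" where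
  "k_generic1 _ F G \<longleftrightarrow>
     k_generic_wrt (eval1 :: ('k \<Rightarrow> 'w) \<Rightarrow> 'w \<Rightarrow> 'k poly \<Rightarrow> 'w) (\<lambda>M. M) F G"

definition k_generic2 :: "'w::field itself \<Rightarrow> 'k::field poly poly fract poly \<Rightarrow> 'g monoid \<Rightarrow> bool" where
  "k_generic2 _ F G \<longleftrightarrow>
     k_generic_wrt (eval2 :: ('k \<Rightarrow> 'w) \<Rightarrow> 'w \<times> 'w \<Rightarrow> 'k poly poly \<Rightarrow> 'w) (\<lambda>M. M \<times> M) F G"


section \<open>Groups\<close>

abbreviation C :: "nat \<Rightarrow> int monoid" where
  "C n \<equiv> integer_mod_group n"

abbreviation S3 :: "(nat \<Rightarrow> nat) monoid" where
  "S3 \<equiv> sym_group 3"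

definition semidirect :: "'n monoid \<Rightarrow> 'h monoid \<Rightarrow> ('h \<Rightarrow> 'n \<Rightarrow> 'n) \<Rightarrow> ('n \<times> 'h) monoid" where
  "semidirect N H \<theta> =
     \<lparr>carrier = carrier N \<times> carrier H,
      monoid.mult = (\<lambda>(n, h) (n', h'). (n \<otimes>\<^bsub>N\<^esub> \<theta> h n', h \<otimes>\<^bsub>H\<^esub> h')),
      one = (\<one>\<^bsub>N\<^esub>, \<one>\<^bsub>H\<^esub>)\<rparr>"

text \<open>The regular wreath product: \<open>H\<close> permutes the factors of \<open>N\<^sup>H\<close> by translation.\<close>

definition wreath :: "'n monoid \<Rightarrow> 'h monoid \<Rightarrow> (('h \<Rightarrow> 'n) \<times> 'h) monoid" where
  "wreath N H = semidirect (product_group (carrier H) (\<lambda>_. N)) H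
     (\<lambda>h f. \<lambda>x\<in>carrier H. f (inv\<^bsub>H\<^esub> h \<otimes>\<^bsub>H\<^esub> x))"

definition swap_action :: "int \<Rightarrow> int \<times> int \<Rightarrow> int \<times> int" where
  "swap_action h = (\<lambda>(x, y). if h = 0 then (x, y) else (y, x))"

text \<open>The dihedral group of order \<open>2 * n\<close>.\<close>

definition dihedral :: "nat \<Rightarrow> (int \<times> int) monoid" where
  "dihedral n = semidirect (C n) (C 2) (\<lambda>h x. if h = 0 then x else inv\<^bsub>C n\<^esub> x)"


section \<open>The sextic polynomials\<close>

definition g_S3_S3 :: "'a::field \<Rightarrow> 'a \<Rightarrow> 'a poly" where
  "g_S3_S3 s t =
     monom 1 6
     + monom (2 * t / (s * (4 * s + 27))) 4
     + monom (t / (s^2 * (4 * s + 27))) 3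
     + monom (t^2 / (s^2 * (4 * s + 27)^2)) 2
     + monom (t^2 / (s^3 * (4 * s + 27)^2)) 1
     + monom ((s - t) * t^2 / (s^4 * (4 * s + 27)^3)) 0"

definition g_S3_C3 :: "'a::field \<Rightarrow> 'a \<Rightarrow> 'a poly" where
  "g_S3_C3 s t = (let \<delta> = t^2 + 3 * t + 9 in
     monom 1 6
     - monom (6 * \<delta> / (s * (4 * s + 27))) 4
     - monom ((2 * t + 3) * \<delta> / (s^2 * (4 * s + 27))) 3
     + monom (9 * \<delta>^2 / (s^2 * (4 * s + 27)^2)) 2
     + monom (3 * (2 * t + 3) * \<delta>^2 / (s^3 * (4 * s + 27)^2)) 1
     + monom (\<delta>^2 * (4 * s * t^2 + 27 * t^2 + 12 * s * t + 9 * s + 81 * t + 243)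
              / (s^4 * (4 * s + 27)^3)) 0)"

definition g_S3_C2 :: "'a::field \<Rightarrow> 'a \<Rightarrow> 'a poly" where
  "g_S3_C2 s t =
     monom 1 6
     - monom (2 * t / (s * (4 * s + 27))) 4
     + monom (t^2 / (s^2 * (4 * s + 27)^2)) 2
     + monom (t^3 / (s^4 * (4 * s + 27)^3)) 0"

definition g_S3_1 :: "'a::field \<Rightarrow> 'a poly" where
  "g_S3_1 s =
     monom 1 6
     - monom (2 / (s * (4 * s + 27))) 4
     + monom (1 / (s^2 * (4 * s + 27)^2)) 2
     + monom (1 / (s^4 * (4 * s + 27)^3)) 0"

definition h_S3 :: "'a::field \<Rightarrow> 'a poly" where
  "h_S3 s =
     monom 1 6
     - monom (2 * s * (4 * s + 27)) 4
     + monom (s^2 * (4 * s + 27)^2) 2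
     + monom (s^2 * (4 * s + 27)^3) 0"

definition g_C3_C2 :: "'a::field \<Rightarrow> 'a \<Rightarrow> 'a poly" where
  "g_C3_C2 s t =
     monom 1 6
     - monom (6 * t / (s^2 + 3 * s + 9)) 4
     + monom (9 * t^2 / (s^2 + 3 * s + 9)^2) 2
     - monom ((2 * s + 3)^2 * t^3 / (s^2 + 3 * s + 9)^4) 0"

definition f_S3 :: "'a::field \<Rightarrow> 'a poly" where
  "f_S3 s = monom 1 3 + monom s 1 + monom s 0"

end

theory Submission
  imports Defs
begin

text \<open>
  A group \<open>S3\<close>, \<open>C 3\<close> or \<open>C 2\<close> acts on the roots of \<open>X\<^sup>3 + s X + s\<close>, of Shanks' cubic or of
  \<open>X\<^sup>2 - d\<close>. In each case the parameter and the roots are rational functions of a single root or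
  ratio of roots, so that over a field not algebraic in the parameter every permutation in the
  group is induced by a substitution; two independent parameters give the product of the groups.

  The roots of the sextics are either the sums \<open>(\<Sum>i. z\<^sub>i y\<^sub>\<pi>\<^sub>i) / 3\<close> over the bijections
  \<open>\<pi>\<close>, where \<open>z\<^sub>i = 1 / (3 x\<^sub>i\<^sup>2 + s)\<close> is the reciprocal of the derivative of \<open>X\<^sup>3 + s X + s\<close> at its
  root \<open>x\<^sub>i\<close> and the \<open>y\<^sub>i\<close> are the roots of a second cubic, or the products \<open>\<plusminus> x\<^sub>i v\<close> of the roots of
  a cubic and a square root. They are permuted transitively, and they generate the compositum.

  For genericity, the linear independence of the automorphisms of \<open>L/M\<close> yields elements of \<open>L\<close>
  that are permuted as the roots are; normalized to trace zero and scaled, respectively replaced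
  by an orbit of \<open>y \<mapsto> - 1 / (1 + y)\<close>, they are the roots of a member of the family. Since no
  nontrivial automorphism fixes them all, they generate \<open>L\<close>.
\<close>

section \<open>Subfields and adjunction\<close>

text \<open>Everything takes place among subfields of one ambient type, and two devices carry the
  Galois theory. To produce automorphisms: the roots generate a purely transcendental extension
  \<open>F(W)\<close>, and permuting them yields another transcendental generator \<open>W'\<close>
  of the same field, so \<open>W \<mapsto> W'\<close> extends to an automorphism. Irreducibility is
  deduced afterwards, from transitivity. To recover \<open>L\<close> from a few elements:
  interpolation at the conjugates of a separating element, which exists because \<open>M\<close> is
  infinite, replaces the Galois correspondence. With two parameters the obstacle is asymmetry, as
  \<open>t\<close> is adjoined after \<open>s\<close>. Steinitz exchange makes \<open>s\<close>
  transcendental over \<open>B(t)\<close> too, so each group acts while the roots of the other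
  polynomial stay fixed. The reciprocals \<open>z_i\<close> are chosen because they sum to zero and
  have second symmetric function \<open>- 3 / A\<close> with \<open>A = s (4 s + 27)\<close>. Hence
  the three sums over even bijections and the three over odd ones are roots of two cubics that
  differ only in the constant term; the sextic is a quadratic in \<open>X^3 + (p / A) X\<close>. The
  division by 3 removes the 9 that the symmetric functions of second degree would contain.\<close>

named_theorems subfield_intros

lemma subfield_zero [subfield_intros]: "is_subfield F \<Longrightarrow> 0 \<in> F"
  and subfield_one [subfield_intros]: "is_subfield F \<Longrightarrow> 1 \<in> F"
  and subfield_add [subfield_intros]: "is_subfield F \<Longrightarrow> x \<in> F \<Longrightarrow> y \<in> F \<Longrightarrow> x + y \<in> F"
  and subfield_mult [subfield_intros]: "is_subfield F \<Longrightarrow> x \<in> F \<Longrightarrow> y \<in> F \<Longrightarrow> x * y \<in> F"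
  and subfield_uminus [subfield_intros]: "is_subfield F \<Longrightarrow> x \<in> F \<Longrightarrow> - x \<in> F"
  and subfield_inverse [subfield_intros]: "is_subfield F \<Longrightarrow> x \<in> F \<Longrightarrow> inverse x \<in> F"
  by (auto simp: is_subfield_def)

lemma subfield_diff [subfield_intros]: "is_subfield F \<Longrightarrow> x \<in> F \<Longrightarrow> y \<in> F \<Longrightarrow> x - y \<in> F"
  using subfield_add[of F x "- y"] subfield_uminus[of F y] by simp

lemma subfield_divide [subfield_intros]: "is_subfield F \<Longrightarrow> x \<in> F \<Longrightarrow> y \<in> F \<Longrightarrow> x / y \<in> F"
  using subfield_mult[of F x "inverse y"] subfield_inverse[of F y] by (simp add: divide_inverse)

lemma subfield_power [subfield_intros]: "is_subfield F \<Longrightarrow> x \<in> F \<Longrightarrow> x ^ n \<in> F"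
  by (induction n) (auto intro: subfield_intros)

lemma subfield_of_nat [subfield_intros]: "is_subfield F \<Longrightarrow> of_nat n \<in> F"
  by (induction n) (auto intro: subfield_intros)

lemma subfield_numeral [subfield_intros]: "is_subfield F \<Longrightarrow> numeral n \<in> F"
  using subfield_of_nat[of F "numeral n"] by simp

lemma subfield_sum [subfield_intros]:
  "is_subfield F \<Longrightarrow> (\<And>i. i \<in> A \<Longrightarrow> f i \<in> F) \<Longrightarrow> sum f A \<in> F"
  by (induction A rule: infinite_finite_induct) (auto intro: subfield_intros)

lemma subfield_adjoin [simp, intro]: "is_subfield (adjoin M S)"
  by (auto simp: adjoin_def is_subfield_def)

lemma adjoin_base: "M \<subseteq> adjoin M S"
  and adjoin_gens: "S \<subseteq> adjoin M S"
  by (auto simp: adjoin_def)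

lemma adjoin_least: "is_subfield F \<Longrightarrow> M \<subseteq> F \<Longrightarrow> S \<subseteq> F \<Longrightarrow> adjoin M S \<subseteq> F"
  by (auto simp: adjoin_def)

lemma adjoin_mono: "M \<subseteq> M' \<Longrightarrow> S \<subseteq> S' \<Longrightarrow> adjoin M S \<subseteq> adjoin M' S'"
  unfolding adjoin_def by (intro Inter_anti_mono) auto

lemma adjoin_eqI:
  assumes "M \<subseteq> adjoin M' S'" "S \<subseteq> adjoin M' S'" "M' \<subseteq> adjoin M S" "S' \<subseteq> adjoin M S"
  shows "adjoin M S = adjoin M' S'"
  using assms by (intro equalityI adjoin_least) auto

lemma adjoin_adjoin: "adjoin (adjoin M S) T = adjoin M (S \<union> T)"
proof (rule equalityI)
  show "adjoin (adjoin M S) T \<subseteq> adjoin M (S \<union> T)"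
    using adjoin_base[of M "S \<union> T"] adjoin_gens[of "S \<union> T" M] adjoin_mono[of M M S "S \<union> T"] by (intro adjoin_least subfield_adjoin) auto
  show "adjoin M (S \<union> T) \<subseteq> adjoin (adjoin M S) T"
    using adjoin_base[of "adjoin M S" T] adjoin_gens[of T "adjoin M S"]
      adjoin_base[of M S] adjoin_gens[of S M] by (intro adjoin_least) auto
qed

lemma adjoin_subfield: "is_subfield M \<Longrightarrow> S \<subseteq> M \<Longrightarrow> adjoin M S = M"
  using adjoin_least[of M M S] adjoin_base[of M S] by auto

section \<open>Polynomials with coefficients in a subfield\<close>

lemma poly_over_closed:
  assumes F: "is_subfield F"
  shows "poly_over F 0" "a \<in> F \<Longrightarrow> poly_over F [:a:]"
    "poly_over F p \<Longrightarrow> poly_over F q \<Longrightarrow> poly_over F (p + q)"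
    "poly_over F p \<Longrightarrow> poly_over F (- p)"
    "poly_over F p \<Longrightarrow> poly_over F q \<Longrightarrow> poly_over F (p - q)"
    "poly_over F p \<Longrightarrow> poly_over F q \<Longrightarrow> poly_over F (p * q)"
    "a \<in> F \<Longrightarrow> poly_over F p \<Longrightarrow> poly_over F (Polynomial.smult a p)"
    "a \<in> F \<Longrightarrow> poly_over F p \<Longrightarrow> poly_over F (pCons a p)"
    "a \<in> F \<Longrightarrow> poly_over F (Polynomial.monom a n)"
  using F by (auto simp: poly_over_def coeff_mult coeff_pCons split: nat.splits intro!: subfield_intros)

lemma poly_over_poly: "is_subfield F \<Longrightarrow> poly_over F p \<Longrightarrow> x \<in> F \<Longrightarrow> poly p x \<in> F"
  unfolding poly_altdef by (intro subfield_intros) (auto simp: poly_over_def)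

lemma poly_over_sum: "is_subfield F \<Longrightarrow> (\<And>i. i \<in> A \<Longrightarrow> poly_over F (f i)) \<Longrightarrow> poly_over F (sum f A)"
  by (induction A rule: infinite_finite_induct) (auto intro: poly_over_closed)

lemma poly_over_mono: "F \<subseteq> F' \<Longrightarrow> poly_over F p \<Longrightarrow> poly_over F' p"
  by (auto simp: poly_over_def)

text \<open>\<open>\<sigma>\<close> is total on the ambient type, but only its values on
  \<open>L\<close> are constrained, and its target is not fixed. So automorphisms of
  \<open>L\<close> and substitutions of one transcendental element for another are both instances.
  The condition \<open>\<sigma> 1 = 1\<close> excludes the zero map.\<close>

locale subfield_hom =
  fixes L :: "'w::field set" and \<sigma> :: "'w \<Rightarrow> 'w"
  assumes L: "is_subfield L"
    and add: "x \<in> L \<Longrightarrow> y \<in> L \<Longrightarrow> \<sigma> (x + y) = \<sigma> x + \<sigma> y"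
    and mult: "x \<in> L \<Longrightarrow> y \<in> L \<Longrightarrow> \<sigma> (x * y) = \<sigma> x * \<sigma> y"
    and one: "\<sigma> 1 = 1"
begin

lemma zero: "\<sigma> 0 = 0"
  by (metis L add add.right_neutral add_left_imp_eq subfield_zero)

lemma uminus: "x \<in> L \<Longrightarrow> \<sigma> (- x) = - \<sigma> x"
  using add[of x "- x"] zero L by (simp add: subfield_uminus add_eq_0_iff2)

lemma diff: "x \<in> L \<Longrightarrow> y \<in> L \<Longrightarrow> \<sigma> (x - y) = \<sigma> x - \<sigma> y"
  using add[of x "- y"] uminus[of y] L by (simp add: subfield_uminus)

lemma eq_0_iff: "x \<in> L \<Longrightarrow> \<sigma> x = 0 \<longleftrightarrow> x = 0"
  using mult[of x "inverse x"] one zero L by (cases "x = 0") (auto simp: subfield_inverse)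

lemma inverse: "x \<in> L \<Longrightarrow> \<sigma> (inverse x) = inverse (\<sigma> x)"
  using mult[of x "inverse x"] one zero L
  by (cases "x = 0") (auto simp: subfield_inverse intro: inverse_unique[symmetric])

lemma divide: "x \<in> L \<Longrightarrow> y \<in> L \<Longrightarrow> \<sigma> (x / y) = \<sigma> x / \<sigma> y"
  using mult[of x "Fields.inverse y"] inverse[of y] L by (simp add: subfield_inverse divide_inverse)

lemma power: "x \<in> L \<Longrightarrow> \<sigma> (x ^ n) = \<sigma> x ^ n"
  by (induction n) (auto simp: one mult L subfield_intros)

lemma of_nat: "\<sigma> (of_nat n) = of_nat n"
  by (induction n) (auto simp: one zero add L subfield_intros)

lemma numeral: "\<sigma> (numeral n) = numeral n"
  using of_nat[of "numeral n"] by simp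

lemma sum: "(\<And>i. i \<in> A \<Longrightarrow> f i \<in> L) \<Longrightarrow> \<sigma> (sum f A) = (\<Sum>i\<in>A. \<sigma> (f i))"
  by (induction A rule: infinite_finite_induct) (auto simp: zero add L subfield_intros)

lemma inj: "inj_on \<sigma> L"
  by (rule inj_onI) (metis L diff eq_0_iff right_minus_eq subfield_diff)

lemma poly:
  assumes "poly_over M p" "M \<subseteq> L" "\<And>c. c \<in> M \<Longrightarrow> \<sigma> c = c" "x \<in> L"
  shows "\<sigma> (poly p x) = poly p (\<sigma> x)"
proof -
  have c: "Polynomial.coeff p i \<in> M" for i using assms by (auto simp: poly_over_def)
  have "\<sigma> (Polynomial.coeff p i * x ^ i) = Polynomial.coeff p i * \<sigma> x ^ i" for i
    using c[of i] assms L by (subst mult) (auto simp: power intro: subfield_intros)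
  then show ?thesis unfolding poly_altdef using c assms L
    by (subst sum) (auto intro!: subfield_intros)
qed

text \<open>The elements of \<open>L\<close> that are mapped into \<open>F\<close> form a subfield,
  so it suffices to test generators.\<close>

lemma image_adjoin:
  assumes "is_subfield F" "adjoin M S \<subseteq> L" "\<sigma> ` M \<subseteq> F" "\<sigma> ` S \<subseteq> F"
  shows "\<sigma> ` adjoin M S \<subseteq> F"
proof -
  have "is_subfield {x \<in> L. \<sigma> x \<in> F}"
    using assms(1) L unfolding is_subfield_def
    by (auto simp: is_subfield_def zero one add mult uminus inverse)
  then have "adjoin M S \<subseteq> {x \<in> L. \<sigma> x \<in> F}"
    using assms adjoin_base[of M S] adjoin_gens[of S M] by (intro adjoin_least) auto
  then show ?thesis by auto
qed

end

text \<open>The equalizer of two homomorphisms is a subfield.\<close>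

lemma subfield_hom_eq_on_adjoin:
  assumes "subfield_hom L \<sigma>" "subfield_hom L \<tau>" "adjoin M S \<subseteq> L"
    and "\<And>x. x \<in> M \<union> S \<Longrightarrow> \<sigma> x = \<tau> x" and "x \<in> adjoin M S"
  shows "\<sigma> x = \<tau> x"
proof -
  interpret s: subfield_hom L \<sigma> by fact
  interpret t: subfield_hom L \<tau> by fact
  have "is_subfield {x \<in> L. \<sigma> x = \<tau> x}"
    using s.L unfolding is_subfield_def
    by (auto simp: s.zero s.one s.add s.mult s.uminus s.inverse t.zero t.one t.add t.mult t.uminus t.inverse)
  then have "adjoin M S \<subseteq> {x \<in> L. \<sigma> x = \<tau> x}"
    using assms adjoin_base[of M S] adjoin_gens[of S M] by (intro adjoin_least) auto
  then show ?thesis using assms(5) by auto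
qed

section \<open>Galois groups\<close>

text \<open>Preservation of 1 is not part of \<open>galois_group\<close>. It follows because 1 is
  idempotent and bijectivity rules out \<open>\<sigma> 1 = 0\<close>.\<close>

lemma galois_hom:
  assumes "is_subfield L" "\<sigma> \<in> carrier (galois_group M L)"
  shows "subfield_hom L \<sigma>"
proof
  show "\<sigma> (x + y) = \<sigma> x + \<sigma> y" "\<sigma> (x * y) = \<sigma> x * \<sigma> y" if "x \<in> L" "y \<in> L" for x y
    using assms that by (auto simp: galois_group_def)
  have b: "bij_betw \<sigma> L L" using assms by (auto simp: galois_group_def Bij_def)
  have "\<sigma> 0 = 0"
    by (metis assms(1) \<open>0 \<in> L \<Longrightarrow> 0 \<in> L \<Longrightarrow> \<sigma> (0 + 0) = \<sigma> 0 + \<sigma> 0\<close>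
        add.right_neutral add_left_imp_eq subfield_zero)
  then have "\<sigma> 1 \<noteq> 0"
    using b assms(1) by (metis bij_betw_def inj_on_def subfield_one subfield_zero zero_neq_one)
  then show "\<sigma> 1 = 1"
    using assms \<open>1 \<in> L \<Longrightarrow> 1 \<in> L \<Longrightarrow> \<sigma> (1 * 1) = \<sigma> 1 * \<sigma> 1\<close> by (simp add: subfield_one)
qed fact

lemma galois_fix: "\<sigma> \<in> carrier (galois_group M L) \<Longrightarrow> x \<in> M \<Longrightarrow> \<sigma> x = x"
  by (auto simp: galois_group_def)

lemma galois_bij: "\<sigma> \<in> carrier (galois_group M L) \<Longrightarrow> bij_betw \<sigma> L L"
  by (auto simp: galois_group_def Bij_def)

lemma galois_in: "\<sigma> \<in> carrier (galois_group M L) \<Longrightarrow> x \<in> L \<Longrightarrow> \<sigma> x \<in> L"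
  using galois_bij[of \<sigma> M L] by (auto simp: bij_betw_def)

lemma galois_ext: "\<sigma> \<in> carrier (galois_group M L) \<Longrightarrow> \<sigma> \<in> extensional L"
  by (auto simp: galois_group_def Bij_def)

text \<open>The restriction is there because \<open>Bij L\<close> consists of extensional
  functions.\<close>

lemma galois_groupI:
  assumes "subfield_hom L \<sigma>" "\<sigma> ` L = L" "\<And>x. x \<in> M \<Longrightarrow> \<sigma> x = x" "M \<subseteq> L"
  shows "restrict \<sigma> L \<in> carrier (galois_group M L)"
proof -
  interpret subfield_hom L \<sigma> by fact
  have "bij_betw \<sigma> L L" using inj assms(2) by (simp add: bij_betw_def)
  then have "bij_betw (restrict \<sigma> L) L L"
    by (subst bij_betw_cong[of L _ \<sigma>]) auto
  then show ?thesis
    using assms(3,4) L by (auto simp: galois_group_def Bij_def subfield_intros add mult subset_iff)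
qed

lemma galois_group_mult:
  assumes "\<sigma> \<in> carrier (galois_group M L)" "\<tau> \<in> carrier (galois_group M L)"
  shows "\<sigma> \<otimes>\<^bsub>galois_group M L\<^esub> \<tau> = compose L \<sigma> \<tau>"
  using assms by (auto simp: galois_group_def BijGroup_def)

lemma galois_group_one: "\<one>\<^bsub>galois_group M L\<^esub> = restrict id L"
  by (simp add: galois_group_def BijGroup_def id_def)

lemma galois_compose:
  assumes L: "is_subfield L" and "M \<subseteq> L"
    and s: "\<sigma> \<in> carrier (galois_group M L)" and t: "\<tau> \<in> carrier (galois_group M L)"
  shows "compose L \<sigma> \<tau> \<in> carrier (galois_group M L)"
proof -
  interpret s: subfield_hom L \<sigma> using galois_hom[OF L s] .
  interpret t: subfield_hom L \<tau> using galois_hom[OF L t] .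
  have "compose L \<sigma> \<tau> \<in> Bij L" using s t by (auto simp: galois_group_def compose_Bij)
  then show ?thesis
    using assms galois_in[OF s] galois_in[OF t] galois_fix[OF s] galois_fix[OF t]
    by (auto simp: galois_group_def compose_def subset_iff subfield_intros
        s.add s.mult t.add t.mult)
qed

lemma galois_inverse:
  assumes L: "is_subfield L" and "M \<subseteq> L" and s: "\<sigma> \<in> carrier (galois_group M L)"
  shows "restrict (inv_into L \<sigma>) L \<in> carrier (galois_group M L)"
proof -
  interpret s: subfield_hom L \<sigma> using galois_hom[OF L s] .
  let ?i = "inv_into L \<sigma>"
  have im: "\<sigma> ` L = L" using galois_bij[OF s] by (simp add: bij_betw_def)
  have i: "?i x \<in> L" "\<sigma> (?i x) = x" if "x \<in> L" for x
    using that im by (auto simp: inv_into_into f_inv_into_f)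
  have eq: "?i x = y" if "x \<in> L" "y \<in> L" "\<sigma> y = x" for x y
    using that s.inj by (auto simp: inv_into_f_f)
  show ?thesis
  proof (rule galois_groupI)
    show "subfield_hom L ?i"
      by unfold_locales (auto intro!: eq L subfield_intros i simp: s.add s.mult i s.one)
    show "?i ` L = L" using i s.inj im by (metis bij_betw_def bij_betw_inv_into galois_bij s)
    show "?i x = x" if "x \<in> M" for x using that assms by (auto intro!: eq galois_fix[OF s])
  qed fact
qed

lemma group_galois_group:
  assumes L: "is_subfield L" and M: "M \<subseteq> L"
  shows "group (galois_group M L)"
proof (rule groupI)
  show "\<one>\<^bsub>galois_group M L\<^esub> \<in> carrier (galois_group M L)"
    unfolding galois_group_one using L M
    by (intro galois_groupI) (auto simp: subfield_hom_def)
  show "x \<otimes>\<^bsub>galois_group M L\<^esub> y \<in> carrier (galois_group M L)"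
    if "x \<in> carrier (galois_group M L)" "y \<in> carrier (galois_group M L)" for x y
    using that galois_compose[OF L M] by (simp add: galois_group_mult)
  show "x \<otimes>\<^bsub>galois_group M L\<^esub> y \<otimes>\<^bsub>galois_group M L\<^esub> z = x \<otimes>\<^bsub>galois_group M L\<^esub> (y \<otimes>\<^bsub>galois_group M L\<^esub> z)"
    if "x \<in> carrier (galois_group M L)" "y \<in> carrier (galois_group M L)" "z \<in> carrier (galois_group M L)" for x y z
    using that galois_compose[OF L M] galois_in[of z M L]
    by (simp add: galois_group_mult compose_def fun_eq_iff)
  show "\<one>\<^bsub>galois_group M L\<^esub> \<otimes>\<^bsub>galois_group M L\<^esub> x = x" if "x \<in> carrier (galois_group M L)" for x
    using that \<open>\<one>\<^bsub>galois_group M L\<^esub> \<in> carrier (galois_group M L)\<close> galois_ext[OF that] galois_in[OF that]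
    by (simp add: galois_group_mult) (auto simp: galois_group_one compose_def extensional_def fun_eq_iff)
  show "\<exists>y\<in>carrier (galois_group M L). y \<otimes>\<^bsub>galois_group M L\<^esub> x = \<one>\<^bsub>galois_group M L\<^esub>"
    if x: "x \<in> carrier (galois_group M L)" for x
  proof (rule bexI)
    have "inj_on x L" using galois_bij[OF x] by (simp add: bij_betw_def)
    then show "restrict (inv_into L x) L \<otimes>\<^bsub>galois_group M L\<^esub> x = \<one>\<^bsub>galois_group M L\<^esub>"
      using galois_inverse[OF L M x] x galois_in[OF x]
      by (simp add: galois_group_mult) (auto simp: galois_group_one compose_def fun_eq_iff)
  qed (rule galois_inverse[OF L M x])
qed

section \<open>Algebraic and transcendental elements\<close>

definition algebraic_over :: "'w::field set \<Rightarrow> 'w \<Rightarrow> bool" where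
  "algebraic_over F x \<longleftrightarrow> (\<exists>p. p \<noteq> 0 \<and> poly_over F p \<and> poly p x = 0)"

lemma algebraic_over_mono: "F \<subseteq> F' \<Longrightarrow> algebraic_over F x \<Longrightarrow> algebraic_over F' x"
  unfolding algebraic_over_def by (blast intro: poly_over_mono)

lemma algebraic_over_mem: "is_subfield F \<Longrightarrow> x \<in> F \<Longrightarrow> algebraic_over F x"
  unfolding algebraic_over_def
  by (rule exI[of _ "[:- x, 1:]"]) (auto intro!: poly_over_closed subfield_intros)

text \<open>Gaussian elimination, by induction on the number of equations. It stands in for
  dimension theory over the subfield \<open>F\<close>.\<close>

lemma homogeneous_system_solution:
  assumes "finite J" "finite I" "card J < card I" "is_subfield F"
    and "\<And>i j. i \<in> I \<Longrightarrow> j \<in> J \<Longrightarrow> c i j \<in> F"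
  shows "\<exists>d. (\<forall>i\<in>I. d i \<in> F) \<and> (\<exists>i\<in>I. d i \<noteq> 0) \<and> (\<forall>j\<in>J. (\<Sum>i\<in>I. d i * c i j) = 0)"
  using assms(1-3,5)
proof (induction J arbitrary: I c rule: finite_induct)
  case empty
  then have "I \<noteq> {}" by auto
  then show ?case using assms(4) by (intro exI[of _ "\<lambda>_. 1"]) (auto intro: subfield_intros)
next
  case (insert j J)
  show ?case
  proof (cases "\<forall>i\<in>I. c i j = 0")
    case True
    have "\<exists>d. (\<forall>i\<in>I. d i \<in> F) \<and> (\<exists>i\<in>I. d i \<noteq> 0) \<and> (\<forall>j\<in>J. (\<Sum>i\<in>I. d i * c i j) = 0)"
      using insert by (intro insert.IH) auto
    then show ?thesis using True by auto
  next
    case False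
    then obtain k where k: "k \<in> I" "c k j \<noteq> 0" by auto
    define I' where "I' = I - {k}"
    \<comment> \<open>Equation \<open>j\<close> is solved for the unknown \<open>k\<close>, whose
      coefficient is nonzero, and the result is substituted into the remaining equations.\<close>
    define c' where "c' i l = c i l - c i j / c k j * c k l" for i l
    have I: "I = insert k I'" "k \<notin> I'" "finite I'" using k insert by (auto simp: I'_def)
    have "card J < card I'" using insert I by simp
    moreover have "c' i l \<in> F" if "i \<in> I'" "l \<in> J" for i l
      unfolding c'_def using that I insert.prems(3) assms(4) by (intro subfield_intros) auto
    ultimately obtain d where d: "\<forall>i\<in>I'. d i \<in> F" "\<exists>i\<in>I'. d i \<noteq> 0"
      "\<forall>l\<in>J. (\<Sum>i\<in>I'. d i * c' i l) = 0"
      using insert.IH[of I' c'] I by auto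
    define e where "e i = (if i = k then - (\<Sum>i\<in>I'. d i * c i j) / c k j else d i)" for i
    have S: "(\<Sum>i\<in>I. e i * c i l) = (\<Sum>i\<in>I'. d i * c i l) - (\<Sum>i\<in>I'. d i * c i j) / c k j * c k l" for l
    proof -
      have "(\<Sum>i\<in>I'. e i * c i l) = (\<Sum>i\<in>I'. d i * c i l)"
        using I by (intro sum.cong) (auto simp: e_def)
      then show ?thesis using I by (simp add: e_def)
    qed
    have "(\<Sum>i\<in>I. e i * c i l) = 0" if "l \<in> insert j J" for l
    proof (cases "l = j")
      case True
      then show ?thesis using S[of l] k by simp
    next
      case False
      have "(\<Sum>i\<in>I. e i * c i l) = (\<Sum>i\<in>I'. d i * c' i l)"
        unfolding S c'_def by (simp add: right_diff_distrib sum_subtractf sum_distrib_right sum_divide_distrib mult.assoc)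
      then show ?thesis using d that False by auto
    qed
    moreover have "\<forall>i\<in>I. e i \<in> F"
      using d I insert.prems(3) assms(4) unfolding e_def by (auto intro!: subfield_intros)
    moreover have "\<exists>i\<in>I. e i \<noteq> 0" using d(2) I by (auto simp: e_def)
    ultimately show ?thesis by blast
  qed
qed

text \<open>The \<open>card J + 1\<close> powers of \<open>x\<close> from \<open>1\<close> to
  \<open>x ^ card J\<close> are combinations of \<open>card J\<close> elements, hence linearly
  dependent over \<open>F\<close>.\<close>

lemma algebraic_if_finite_span:
  assumes F: "is_subfield F" and J: "finite J"
    and R: "1 \<in> R" "\<And>v. v \<in> R \<Longrightarrow> x * v \<in> R"
    and span: "\<And>v. v \<in> R \<Longrightarrow> \<exists>c. (\<forall>j\<in>J. c j \<in> F) \<and> v = (\<Sum>j\<in>J. c j * b j)"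
  shows "algebraic_over F x"
proof -
  define n where "n = card J"
  have pow: "x ^ i \<in> R" for i by (induction i) (auto simp: R)
  have "\<forall>i. \<exists>c. (\<forall>j\<in>J. c j \<in> F) \<and> x ^ i = (\<Sum>j\<in>J. c j * b j)"
    using span[OF pow] by auto
  then obtain c where c: "\<And>i j. j \<in> J \<Longrightarrow> c i j \<in> F" "\<And>i. x ^ i = (\<Sum>j\<in>J. c i j * b j)"
    by metis
  obtain d where d: "\<forall>i\<in>{..n}. d i \<in> F" "\<exists>i\<in>{..n}. d i \<noteq> 0"
      "\<forall>j\<in>J. (\<Sum>i\<in>{..n}. d i * c i j) = 0"
    using homogeneous_system_solution[of J "{..n}" F c] J F c(1) n_def by auto
  define p where "p = (\<Sum>i\<le>n. Polynomial.monom (d i) i)"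
  have cp: "Polynomial.coeff p i = (if i \<le> n then d i else 0)" for i
    unfolding p_def by (simp add: coeff_sum if_distrib cong: if_cong)
  have "poly p x = (\<Sum>i\<le>n. d i * x ^ i)" by (simp add: p_def poly_sum poly_monom)
  also have "\<dots> = (\<Sum>i\<le>n. \<Sum>j\<in>J. d i * c i j * b j)"
    by (simp add: c(2) sum_distrib_left mult.assoc)
  also have "\<dots> = (\<Sum>j\<in>J. (\<Sum>i\<le>n. d i * c i j) * b j)"
    by (subst sum.swap) (simp add: sum_distrib_right)
  also have "\<dots> = 0" using d(3) by simp
  finally have "poly p x = 0" .
  moreover have "p \<noteq> 0" using d(2) cp by (metis atMost_iff coeff_0)
  moreover have "poly_over F p" using d(1) F by (auto simp: poly_over_def cp subfield_zero)
  ultimately show ?thesis unfolding algebraic_over_def by blast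
qed

text \<open>Division with remainder by an annihilating polynomial of degree \<open>n\<close>,
  performed as a Horner scheme so that all coefficients visibly remain in \<open>F\<close>.\<close>

lemma algebraic_reduce:
  assumes F: "is_subfield F" and a: "algebraic_over F a"
  obtains n where "\<And>p. poly_over F p \<Longrightarrow> \<exists>c. (\<forall>i\<in>{..<n}. c i \<in> F) \<and> poly p a = (\<Sum>i<n. c i * a ^ i)"
proof -
  obtain m where m: "m \<noteq> 0" "poly_over F m" "poly m a = 0" using a by (auto simp: algebraic_over_def)
  define n where "n = Polynomial.degree m"
  have n: "n > 0" using m by (cases "n = 0") (auto simp: n_def elim!: degree_eq_zeroE)
  have *: "\<exists>r. poly_over F r \<and> Polynomial.degree r < n \<and> poly r a = poly p a" if "poly_over F p" for p
    using that
  proof (induction p)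
    case 0
    then show ?case using n by (intro exI[of _ 0]) (auto intro: poly_over_closed F)
  next
    case (pCons c p)
    have c: "c \<in> F" "poly_over F p"
      using pCons.prems by (auto simp: poly_over_def coeff_pCons split: nat.splits)
    obtain r where r: "poly_over F r" "Polynomial.degree r < n" "poly r a = poly p a"
      using pCons.IH c by blast
    define k where "k = Polynomial.coeff (pCons c r) n / Polynomial.lead_coeff m"
    define q where "q = pCons c r - Polynomial.smult k m"
    have "k \<in> F" unfolding k_def using m(2) poly_over_closed(8)[OF F c(1) r(1)] F
      by (auto simp: poly_over_def intro!: subfield_intros)
    then have "poly_over F q" unfolding q_def using m(2) r(1) c(1) F by (intro poly_over_closed)
    moreover have "Polynomial.degree q < n"
    proof -
      have "Polynomial.coeff q n = 0" using m(1) by (simp add: q_def k_def n_def)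
      moreover have "Polynomial.degree q \<le> n" unfolding q_def
        using r(2) degree_pCons_le[of c r] degree_smult_le[of k m]
        by (intro degree_diff_le) (auto simp: n_def)
      ultimately show ?thesis using n eq_zero_or_degree_less[of q n] by auto
    qed
    moreover have "poly q a = poly (pCons c p) a" using r m by (simp add: q_def)
    ultimately show ?case by blast
  qed
  show thesis
  proof (rule that)
    fix p assume "poly_over F p"
    then obtain r where r: "poly_over F r" "Polynomial.degree r < n" "poly r a = poly p a"
      using * by blast
    have "poly r a = (\<Sum>i<n. Polynomial.coeff r i * a ^ i)"
      unfolding poly_altdef using r(2)
      by (intro sum.mono_neutral_left) (auto simp: coeff_eq_0)
    then show "\<exists>c. (\<forall>i\<in>{..<n}. c i \<in> F) \<and> poly p a = (\<Sum>i<n. c i * a ^ i)"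
      using r by (intro exI[of _ "Polynomial.coeff r"]) (auto simp: poly_over_def)
  qed
qed

text \<open>Powers of \<open>X\<close> are divided out. A nonzero constant term is what later turns
  the inverse of \<open>u\<close> into a polynomial in \<open>u\<close>.\<close>

lemma nonzero_const_annihilator:
  assumes "f \<noteq> 0" "poly_over F f" "poly f u = 0" "u \<noteq> 0"
  shows "\<exists>g. poly_over F g \<and> Polynomial.coeff g 0 \<noteq> 0 \<and> poly g u = 0"
  using assms
proof (induction f)
  case (pCons c f)
  show ?case
  proof (cases "c = 0")
    case True
    have "poly_over F f" using pCons.prems(2) unfolding poly_over_def by (metis coeff_pCons_Suc)
    then show ?thesis using True pCons by auto
  qed (use pCons.prems in \<open>intro exI[of _ "pCons c f"]; simp\<close>)
qed simp

text \<open>The ring \<open>F[a]\<close> is already a field: each of its elements is algebraic over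
  \<open>F\<close> by the finite spanning set of powers of \<open>a\<close>, and an algebraic
  element has its inverse in the ring it generates.\<close>

lemma adjoin_algebraic:
  assumes F: "is_subfield F" and a: "algebraic_over F a"
  shows "adjoin F {a} = {poly p a | p. poly_over F p}"
proof
  let ?R = "{poly p a | p. poly_over F p}"
  obtain n where n: "\<And>p. poly_over F p \<Longrightarrow> \<exists>c. (\<forall>i\<in>{..<n}. c i \<in> F) \<and> poly p a = (\<Sum>i<n. c i * a ^ i)"
    using algebraic_reduce[OF F a] by blast
  have add: "u + v \<in> ?R" and mult: "u * v \<in> ?R" if "u \<in> ?R" "v \<in> ?R" for u v
    using that F by (clarsimp, metis poly_add poly_over_closed(3))
      (use that F in \<open>clarsimp, metis poly_mult poly_over_closed(6)\<close>)
  have const: "c \<in> ?R" if "c \<in> F" for c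
    using that by (auto intro!: exI[of _ "[:c:]"] poly_over_closed F)
  have inv: "inverse u \<in> ?R" if u: "u \<in> ?R" for u
  proof (cases "u = 0")
    case False
    have "algebraic_over F u"
    proof (rule algebraic_if_finite_span[where J = "{..<n}" and R = ?R])
      show "1 \<in> ?R" using const subfield_one[OF F] by blast
    qed (use F n u mult in auto)
    then obtain g where g: "poly_over F g" "Polynomial.coeff g 0 \<noteq> 0" "poly g u = 0"
      using nonzero_const_annihilator False unfolding algebraic_over_def by blast
    obtain g0 h where gh: "g = pCons g0 h" by (cases g)
    have h: "poly_over F h" using g(1) unfolding gh poly_over_def by (metis coeff_pCons_Suc)
    have g0: "g0 \<in> F" using g(1) unfolding gh poly_over_def by (metis coeff_pCons_0)
    obtain p where p: "poly_over F p" "u = poly p a" using u by auto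
    \<comment> \<open>From \<open>g0 + u h(u) = 0\<close> with \<open>g0\<close> nonzero, the
      inverse of \<open>u\<close> is \<open>- h(u) / g0\<close>.\<close>
    have "u * poly h u = - g0" using g(3) gh by (simp add: add_eq_0_iff add.commute)
    then have "inverse u = - poly h u / g0"
      using False g(2) gh by (simp add: field_simps)
    also have "\<dots> = poly (Polynomial.smult (- inverse g0) (pcompose h p)) a"
      using p by (simp add: poly_pcompose divide_inverse)
    also have "\<dots> \<in> ?R"
    proof -
      have "poly_over F (pcompose h p)"
        using h
      proof (induction h)
        case 0 then show ?case by (simp add: poly_over_closed F)
      next
        case (pCons c h)
        have "c \<in> F" "poly_over F h" using pCons.prems unfolding poly_over_def
          by (metis coeff_pCons_0, metis coeff_pCons_Suc)
        then show ?case using pCons p F by (auto simp: pcompose_pCons intro!: poly_over_closed)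
      qed
      then show ?thesis using g0 F
        by (auto intro!: exI[of _ "Polynomial.smult (- inverse g0) (pcompose h p)"] poly_over_closed subfield_intros)
    qed
    finally show ?thesis .
  qed (use const[OF subfield_zero[OF F]] in simp)
  have "is_subfield ?R"
    unfolding is_subfield_def
  proof (intro conjI ballI)
    show "0 \<in> ?R" "1 \<in> ?R"
      by (rule const[OF subfield_zero[OF F]], rule const[OF subfield_one[OF F]])
    fix x assume x: "x \<in> ?R"
    have "-1 \<in> ?R" by (rule const[OF subfield_uminus[OF F subfield_one[OF F]]])
    from mult[OF this x] show "- x \<in> ?R" by simp
    show "inverse x \<in> ?R" by (rule inv[OF x])
    fix y assume "y \<in> ?R"
    then show "x + y \<in> ?R" "x * y \<in> ?R" using add[OF x] mult[OF x] by blast+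
  qed
  moreover have "a \<in> ?R" using F
    by (auto intro!: exI[of _ "[:0, 1:]"] poly_over_closed subfield_intros)
  ultimately show "adjoin F {a} \<subseteq> ?R" using const by (intro adjoin_least) auto
  show "?R \<subseteq> adjoin F {a}"
    using adjoin_base[of F "{a}"] adjoin_gens[of "{a}" F]
    by (auto intro!: poly_over_poly intro: poly_over_mono)
qed

text \<open>The products \<open>a ^ i * y ^ j\<close> with bounded exponents span the polynomial
  expressions in \<open>y\<close> over \<open>F(a)\<close>, now with coefficients in
  \<open>F\<close>.\<close>

lemma algebraic_over_trans:
  assumes F: "is_subfield F" and a: "algebraic_over F a" and y: "algebraic_over (adjoin F {a}) y"
  shows "algebraic_over F y"
proof -
  let ?E = "adjoin F {a}"
  let ?R = "{poly p y | p. poly_over ?E p}"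
  have E: "is_subfield ?E" by simp
  obtain n where n: "\<And>p. poly_over F p \<Longrightarrow> \<exists>c. (\<forall>i\<in>{..<n}. c i \<in> F) \<and> poly p a = (\<Sum>i<n. c i * a ^ i)"
    using algebraic_reduce[OF F a] by blast
  obtain m where m: "\<And>p. poly_over ?E p \<Longrightarrow> \<exists>c. (\<forall>i\<in>{..<m}. c i \<in> ?E) \<and> poly p y = (\<Sum>i<m. c i * y ^ i)"
    using algebraic_reduce[OF E y] by blast
  show ?thesis
  proof (rule algebraic_if_finite_span[where J = "{..<m} \<times> {..<n}" and R = ?R and b = "\<lambda>(j, i). a ^ i * y ^ j"])
    show "1 \<in> ?R"
      by (auto intro!: exI[of _ "[:1:]"] poly_over_closed E subfield_intros)
    show "y * v \<in> ?R" if v: "v \<in> ?R" for v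
    proof -
      obtain p where "poly_over ?E p" "v = poly p y" using v by auto
      then show ?thesis
        using E by (auto intro!: exI[of _ "pCons 0 p"] poly_over_closed subfield_intros)
    qed
    fix v assume "v \<in> ?R"
    then obtain p where p: "poly_over ?E p" "v = poly p y" by auto
    obtain c where c: "\<forall>i\<in>{..<m}. c i \<in> ?E" "v = (\<Sum>i<m. c i * y ^ i)" using m p by blast
    have "\<forall>j\<in>{..<m}. \<exists>d. (\<forall>i\<in>{..<n}. d i \<in> F) \<and> c j = (\<Sum>i<n. d i * a ^ i)"
    proof
      fix j assume "j \<in> {..<m}"
      then obtain q where "poly_over F q" "c j = poly q a"
        using c(1) adjoin_algebraic[OF F a] by blast
      then show "\<exists>d. (\<forall>i\<in>{..<n}. d i \<in> F) \<and> c j = (\<Sum>i<n. d i * a ^ i)" using n by metis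
    qed
    then obtain d where d: "\<forall>j\<in>{..<m}. (\<forall>i\<in>{..<n}. d j i \<in> F) \<and> c j = (\<Sum>i<n. d j i * a ^ i)"
      by metis
    have "v = (\<Sum>j<m. \<Sum>i<n. d j i * (a ^ i * y ^ j))"
      unfolding c(2) using d by (intro sum.cong) (auto simp: sum_distrib_right mult.assoc)
    also have "\<dots> = (\<Sum>x\<in>{..<m} \<times> {..<n}. (case x of (j, i) \<Rightarrow> d j i) * (case x of (j, i) \<Rightarrow> a ^ i * y ^ j))"
      by (simp add: sum.cartesian_product split_def)
    finally show "\<exists>c. (\<forall>j\<in>{..<m} \<times> {..<n}. c j \<in> F) \<and>
        v = (\<Sum>j\<in>{..<m} \<times> {..<n}. c j * (case j of (j, i) \<Rightarrow> a ^ i * y ^ j))"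
      using d by (intro exI[of _ "\<lambda>(j, i). d j i"]) auto
  qed (use F in auto)
qed

lemma algebraic_over_adjoin:
  "is_subfield F \<Longrightarrow> algebraic_over F a \<Longrightarrow> y \<in> adjoin F {a} \<Longrightarrow> algebraic_over F y"
  by (rule algebraic_over_trans) (auto intro: algebraic_over_mem)

section \<open>Substitution of transcendental elements and Steinitz exchange\<close>

lemma adjoin_simple_fractions:
  assumes F: "is_subfield F" and "x \<in> adjoin F {a}"
  shows "\<exists>p q. poly_over F p \<and> poly_over F q \<and> poly q a \<noteq> 0 \<and> x = poly p a / poly q a"
proof -
  let ?R = "{x. \<exists>p q. poly_over F p \<and> poly_over F q \<and> poly q a \<noteq> 0 \<and> x = poly p a / poly q a}"
  have const: "c \<in> ?R" if "c \<in> F" for c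
    unfolding mem_Collect_eq using that F
    by (rule_tac exI[of _ "[:c:]"], rule_tac exI[of _ "[:1:]"]) (auto intro!: poly_over_closed subfield_intros)
  have "is_subfield ?R"
    unfolding is_subfield_def
  proof (intro conjI ballI)
    show "0 \<in> ?R" "1 \<in> ?R"
      by (rule const[OF subfield_zero[OF F]], rule const[OF subfield_one[OF F]])
    fix x assume "x \<in> ?R"
    then obtain p q where x: "poly_over F p" "poly_over F q" "poly q a \<noteq> 0" "x = poly p a / poly q a"
      by auto
    show "- x \<in> ?R" unfolding mem_Collect_eq using x F
      by (rule_tac exI[of _ "- p"], rule_tac exI[of _ q]) (auto intro!: poly_over_closed)
    show "inverse x \<in> ?R"
    proof (cases "poly p a = 0")
      case True
      then show ?thesis using x const[OF subfield_zero[OF F]] by simp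
    next
      case False
      then show ?thesis unfolding mem_Collect_eq using x
        by (rule_tac exI[of _ q], rule_tac exI[of _ p]) simp
    qed
    fix y assume "y \<in> ?R"
    then obtain p' q' where y: "poly_over F p'" "poly_over F q'" "poly q' a \<noteq> 0" "y = poly p' a / poly q' a"
      by auto
    show "x + y \<in> ?R" unfolding mem_Collect_eq using x y F
      by (rule_tac exI[of _ "p * q' + p' * q"], rule_tac exI[of _ "q * q'"]) (auto intro!: poly_over_closed simp: add_frac_eq)
    show "x * y \<in> ?R" unfolding mem_Collect_eq using x y F
      by (rule_tac exI[of _ "p * p'"], rule_tac exI[of _ "q * q'"]) (auto intro!: poly_over_closed simp: add_frac_eq)
  qed
  moreover have "a \<in> ?R" unfolding mem_Collect_eq using F
    by (rule_tac exI[of _ "[:0, 1:]"], rule_tac exI[of _ "[:1:]"]) (auto intro!: poly_over_closed subfield_intros)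
  ultimately have "adjoin F {a} \<subseteq> ?R" using const by (intro adjoin_least) auto
  then show ?thesis using assms(2) by auto
qed

text \<open>Substitute \<open>a'\<close> for \<open>a\<close> in a fraction of polynomials.
  Transcendence of \<open>a\<close> makes the result independent of the representation, and
  transcendence of \<open>a'\<close> keeps the denominators nonzero.\<close>

lemma transcendental_hom:
  assumes F: "is_subfield F" and a: "\<not> algebraic_over F a" and a': "\<not> algebraic_over F a'"
  shows "\<exists>\<sigma>. subfield_hom (adjoin F {a}) \<sigma> \<and> \<sigma> a = a' \<and> (\<forall>c\<in>F. \<sigma> c = c)"
proof -
  define rep where "rep x y \<longleftrightarrow> (\<exists>p q. poly_over F p \<and> poly_over F q \<and> q \<noteq> 0 \<and>
      x = poly p a / poly q a \<and> y = poly p a' / poly q a')" for x y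
  define \<sigma> where "\<sigma> x = (SOME y. rep x y)" for x
  have nz: "poly q a \<noteq> 0" "poly q a' \<noteq> 0" if "poly_over F q" "q \<noteq> 0" for q
    using that a a' by (auto simp: algebraic_over_def)
  have uniq: "y = y'" if "rep x y" "rep x y'" for x y y'
  proof -
    obtain p q where 1: "poly_over F p" "poly_over F q" "q \<noteq> 0" "x = poly p a / poly q a" "y = poly p a' / poly q a'"
      using \<open>rep x y\<close> by (auto simp: rep_def)
    obtain p' q' where 2: "poly_over F p'" "poly_over F q'" "q' \<noteq> 0" "x = poly p' a / poly q' a" "y' = poly p' a' / poly q' a'"
      using \<open>rep x y'\<close> by (auto simp: rep_def)
    have "poly (p * q' - p' * q) a = 0" using 1 2 nz[of q] nz[of q'] by (simp add: field_simps)
    moreover have "poly_over F (p * q' - p' * q)" using 1 2 F by (intro poly_over_closed)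
    ultimately have "p * q' - p' * q = 0" using a by (auto simp: algebraic_over_def)
    then have "poly (p * q' - p' * q) a' = 0" by simp
    then show "y = y'" using 1 2 nz[of q] nz[of q'] by (simp add: frac_eq_eq)
  qed
  have sig: "\<sigma> x = y" if "rep x y" for x y
    unfolding \<sigma>_def using uniq that by (metis someI_ex)
  have ex: "\<exists>y. rep x y" if "x \<in> adjoin F {a}" for x
    using adjoin_simple_fractions[OF F that] unfolding rep_def by (metis poly_0)
  have const: "rep c c" if "c \<in> F" for c unfolding rep_def
    using that F by (intro exI[of _ "[:c:]"] exI[of _ "[:1:]"]) (auto intro!: poly_over_closed subfield_intros)
  have add: "rep (x + x') (y + y')" and mult: "rep (x * x') (y * y')" if xy: "rep x y" "rep x' y'" for x y x' y'
  proof -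
    obtain p q where 1: "poly_over F p" "poly_over F q" "q \<noteq> 0" "x = poly p a / poly q a" "y = poly p a' / poly q a'"
      using \<open>rep x y\<close> by (auto simp: rep_def)
    obtain p' q' where 2: "poly_over F p'" "poly_over F q'" "q' \<noteq> 0" "x' = poly p' a / poly q' a" "y' = poly p' a' / poly q' a'"
      using \<open>rep x' y'\<close> by (auto simp: rep_def)
    show "rep (x + x') (y + y')" unfolding rep_def using 1 2 nz[of q] nz[of q'] F
      by (rule_tac exI[of _ "p * q' + p' * q"], rule_tac exI[of _ "q * q'"])
        (auto intro!: poly_over_closed simp: add_frac_eq)
    show "rep (x * x') (y * y')" unfolding rep_def using 1 2 F
      by (rule_tac exI[of _ "p * p'"], rule_tac exI[of _ "q * q'"]) (auto intro!: poly_over_closed)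
  qed
  have "rep a a'" unfolding rep_def using F
    by (intro exI[of _ "[:0, 1:]"] exI[of _ "[:1:]"]) (auto intro!: poly_over_closed subfield_intros)
  moreover have "subfield_hom (adjoin F {a}) \<sigma>"
  proof
    show "\<sigma> 1 = 1" using const F by (intro sig) (auto intro: subfield_intros)
    fix x y assume "x \<in> adjoin F {a}" "y \<in> adjoin F {a}"
    then obtain x' y' where "rep x x'" "rep y y'" using ex by blast
    then show "\<sigma> (x + y) = \<sigma> x + \<sigma> y" "\<sigma> (x * y) = \<sigma> x * \<sigma> y"
      using sig add mult by metis+
  qed simp
  ultimately show ?thesis using sig const by auto
qed

text \<open>The substitution is onto because its image is a subfield containing \<open>F\<close> and
  the second generator \<open>a'\<close>.\<close>

lemma transcendental_automorphism:
  assumes F: "is_subfield F" and a: "\<not> algebraic_over F a" and a': "\<not> algebraic_over F a'"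
    and eq: "adjoin F {a'} = adjoin F {a}"
  shows "\<exists>\<sigma>\<in>carrier (galois_group F (adjoin F {a})). \<sigma> a = a'"
proof -
  let ?L = "adjoin F {a}"
  obtain \<sigma> where s: "subfield_hom ?L \<sigma>" "\<sigma> a = a'" "\<forall>c\<in>F. \<sigma> c = c"
    using transcendental_hom[OF F a a'] by blast
  interpret subfield_hom ?L \<sigma> by fact
  have a_in: "a \<in> ?L" using adjoin_gens[of "{a}" F] by auto
  have F_in: "F \<subseteq> ?L" by (rule adjoin_base)
  have "is_subfield (\<sigma> ` ?L)"
    unfolding is_subfield_def
  proof (intro conjI ballI)
    show "0 \<in> \<sigma> ` ?L" "1 \<in> \<sigma> ` ?L" using zero one L by (metis image_eqI subfield_zero, metis image_eqI subfield_one)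
    fix x assume "x \<in> \<sigma> ` ?L"
    then obtain u where u: "u \<in> ?L" "x = \<sigma> u" by auto
    show "- x \<in> \<sigma> ` ?L" using u uminus L by (metis image_eqI subfield_uminus)
    show "Fields.inverse x \<in> \<sigma> ` ?L" using u inverse L by (metis image_eqI subfield_inverse)
    fix y assume "y \<in> \<sigma> ` ?L"
    then obtain v where v: "v \<in> ?L" "y = \<sigma> v" by auto
    show "x + y \<in> \<sigma> ` ?L" using u v add L by (metis image_eqI subfield_add)
    show "x * y \<in> \<sigma> ` ?L" using u v mult L by (metis image_eqI subfield_mult)
  qed
  moreover have "F \<subseteq> \<sigma> ` ?L" using s(3) F_in by (metis image_iff subset_iff)
  moreover have "a' \<in> \<sigma> ` ?L" using s(2) a_in by auto
  ultimately have 1: "?L \<subseteq> \<sigma> ` ?L" unfolding eq[symmetric] by (intro adjoin_least) (auto simp: eq)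
  have 2: "\<sigma> ` ?L \<subseteq> ?L"
    using s F_in adjoin_gens[of "{a'}" F] eq by (intro image_adjoin) auto
  from 1 2 have "restrict \<sigma> ?L \<in> carrier (galois_group F ?L)"
    using s F_in by (intro galois_groupI) auto
  then show ?thesis using s(2) a_in by (intro bexI[of _ "restrict \<sigma> ?L"]) auto
qed

lemma common_denominator:
  fixes p :: "'w::field poly"
  assumes "1 \<in> S" "0 \<in> S" "\<And>x y. x \<in> S \<Longrightarrow> y \<in> S \<Longrightarrow> x * y \<in> S"
    and "\<And>i. \<exists>x\<in>S. \<exists>y\<in>S. y \<noteq> 0 \<and> Polynomial.coeff p i = x / y"
  shows "\<exists>d\<in>S. d \<noteq> 0 \<and> (\<forall>i. d * Polynomial.coeff p i \<in> S)"
  using assms(4)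
proof (induction p)
  case 0
  then show ?case using assms by auto
next
  case (pCons c p)
  have "\<And>i. \<exists>x\<in>S. \<exists>y\<in>S. y \<noteq> 0 \<and> Polynomial.coeff p i = x / y"
    using pCons.prems by (metis coeff_pCons_Suc)
  then obtain d where d: "d \<in> S" "d \<noteq> 0" "\<And>i. d * Polynomial.coeff p i \<in> S" using pCons.IH by blast
  obtain x y where xy: "x \<in> S" "y \<in> S" "y \<noteq> 0" "c = x / y"
    using pCons.prems[of 0] by auto
  have "(d * y) * Polynomial.coeff (pCons c p) i \<in> S" for i
  proof (cases i)
    case 0
    then show ?thesis using xy d assms(3)[of d x] by simp
  next
    case (Suc j)
    then show ?thesis using assms(3)[OF xy(2) d(3)[of j]] by (simp add: ac_simps)
  qed
  then show ?case using d xy assms(3) by (intro bexI[of _ "d * y"]) auto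
qed

text \<open>A polynomial relation for \<open>a\<close> over \<open>F(b)\<close>, cleared of
  denominators, is sorted by powers of \<open>b\<close> instead. The new coefficients are
  polynomials in \<open>a\<close> over \<open>F\<close>; one of these polynomials is nonzero, and
  its value at \<open>a\<close> stays nonzero because \<open>a\<close> is transcendental over
  \<open>F\<close>.\<close>

lemma algebraic_exchange:
  assumes F: "is_subfield F" and ab: "algebraic_over (adjoin F {b}) a" and a: "\<not> algebraic_over F a"
  shows "algebraic_over (adjoin F {a}) b"
proof -
  let ?S = "{poly p b | p. poly_over F p}"
  obtain f where f: "f \<noteq> 0" "poly_over (adjoin F {b}) f" "poly f a = 0"
    using ab by (auto simp: algebraic_over_def)
  have "\<exists>d\<in>?S. d \<noteq> 0 \<and> (\<forall>i. d * Polynomial.coeff f i \<in> ?S)"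
  proof (rule common_denominator)
    show "1 \<in> ?S" using F by (auto intro!: exI[of _ "[:1:]"] poly_over_closed subfield_intros)
    show "0 \<in> ?S" using F by (auto intro!: exI[of _ 0] poly_over_closed)
    show "x * y \<in> ?S" if "x \<in> ?S" "y \<in> ?S" for x y
      using that F by clarsimp (metis poly_mult poly_over_closed(6))
    show "\<exists>x\<in>?S. \<exists>y\<in>?S. y \<noteq> 0 \<and> Polynomial.coeff f i = x / y" for i
    proof -
      have "Polynomial.coeff f i \<in> adjoin F {b}" using f(2) by (simp add: poly_over_def)
      from adjoin_simple_fractions[OF F this] show ?thesis by blast
    qed
  qed
  then obtain d where d: "d \<noteq> 0" "\<forall>i. d * Polynomial.coeff f i \<in> ?S" by blast
  then have "\<forall>i. \<exists>p. poly_over F p \<and> d * Polynomial.coeff f i = poly p b" by auto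
  then obtain P where P: "\<And>i. poly_over F (P i)" "\<And>i. d * Polynomial.coeff f i = poly (P i) b" by metis
  define n where "n = Polynomial.degree f"
  \<comment> \<open>A common bound for the degrees in \<open>b\<close>, so that the double sum runs
    over a rectangle and can be swapped.\<close>
  define N where "N = Max ((\<lambda>i. Polynomial.degree (P i)) ` {..n})"
  define q where "q j = (\<Sum>i\<le>n. Polynomial.monom (Polynomial.coeff (P i) j) i)" for j
  define g where "g = (\<Sum>j\<le>N. Polynomial.monom (poly (q j) a) j)"
  have deg: "Polynomial.degree (P i) \<le> N" if "i \<le> n" for i unfolding N_def using that by auto
  have qo: "poly_over F (q j)" for j
    unfolding q_def using P(1) F by (intro poly_over_sum poly_over_closed) (auto simp: poly_over_def)
  have "poly g b = (\<Sum>j\<le>N. \<Sum>i\<le>n. Polynomial.coeff (P i) j * a ^ i * b ^ j)"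
    by (simp add: g_def q_def poly_sum poly_monom sum_distrib_right)
  also have "\<dots> = (\<Sum>i\<le>n. (\<Sum>j\<le>N. Polynomial.coeff (P i) j * b ^ j) * a ^ i)"
    by (subst sum.swap) (simp add: sum_distrib_left sum_distrib_right ac_simps)
  also have "\<dots> = (\<Sum>i\<le>n. poly (P i) b * a ^ i)"
  proof (intro sum.cong refl arg_cong2[where f = "(*)"])
    fix i assume "i \<in> {..n}"
    then show "(\<Sum>j\<le>N. Polynomial.coeff (P i) j * b ^ j) = poly (P i) b"
      unfolding poly_altdef using deg[of i]
      by (intro sum.mono_neutral_right) (auto simp: coeff_eq_0)
  qed
  also have "\<dots> = (\<Sum>i\<le>n. d * Polynomial.coeff f i * a ^ i)"
    using P(2) by simp
  also have "\<dots> = d * poly f a"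
    by (simp add: poly_altdef n_def sum_distrib_left ac_simps)
  finally have "poly g b = 0" using f(3) by simp
  moreover have "g \<noteq> 0"
  proof -
    have "poly (P n) b \<noteq> 0" by (metis P(2) d(1) f(1) leading_coeff_0_iff mult_eq_0_iff n_def)
    then obtain j where j: "Polynomial.coeff (P n) j \<noteq> 0" by (metis poly_0 leading_coeff_0_iff)
    then have "j \<le> N" using deg[of n] le_degree[OF j] by simp
    have "Polynomial.coeff (q j) n \<noteq> 0" using j by (simp add: q_def coeff_sum)
    then have "q j \<noteq> 0" by auto
    then have "poly (q j) a \<noteq> 0" using a qo by (auto simp: algebraic_over_def)
    moreover have "Polynomial.coeff g j = poly (q j) a" using \<open>j \<le> N\<close> by (simp add: g_def coeff_sum)
    ultimately show ?thesis by auto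
  qed
  moreover have "poly_over (adjoin F {a}) g"
    unfolding g_def using adjoin_base[of F "{a}"] adjoin_gens[of "{a}" F]
    by (intro poly_over_sum poly_over_closed poly_over_poly) (auto intro: poly_over_mono qo)
  ultimately show ?thesis unfolding algebraic_over_def by blast
qed

declare One_nat_def [simp del]

section \<open>Galois groups acting on labelled families\<close>

lemma galois_fix_adjoin:
  assumes L: "is_subfield L" and s: "\<sigma> \<in> carrier (galois_group M L)" and S: "M \<subseteq> L" "S \<subseteq> L" "\<And>x. x \<in> S \<Longrightarrow> \<sigma> x = x"
  shows "\<sigma> \<in> carrier (galois_group (adjoin M S) L)"
proof -
  have "subfield_hom L (\<lambda>x. x)" using L by unfold_locales auto
  moreover have "adjoin M S \<subseteq> L" using S L by (intro adjoin_least)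
  ultimately have "\<sigma> x = x" if "x \<in> adjoin M S" for x
    using that galois_fix[OF s] S(3)
    by (intro subfield_hom_eq_on_adjoin[of L \<sigma> "\<lambda>x. x" M S x] galois_hom[OF L s]) auto
  then show ?thesis using s by (auto simp: galois_group_def)
qed

lemma galois_restrict_base:
  "\<sigma> \<in> carrier (galois_group M L) \<Longrightarrow> K \<subseteq> M \<Longrightarrow> \<sigma> \<in> carrier (galois_group K L)"
  by (auto simp: galois_group_def)

lemma galois_eqI:
  assumes L: "is_subfield L" "adjoin M S = L"
    and s: "\<sigma> \<in> carrier (galois_group M L)" "\<tau> \<in> carrier (galois_group M L)"
    and eq: "\<And>x. x \<in> S \<Longrightarrow> \<sigma> x = \<tau> x"
  shows "\<sigma> = \<tau>"
proof (rule extensionalityI[OF galois_ext[OF s(1)] galois_ext[OF s(2)]])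
  fix x assume "x \<in> L"
  then show "\<sigma> x = \<tau> x"
    using assms galois_fix[OF s(1)] galois_fix[OF s(2)]
    by (intro subfield_hom_eq_on_adjoin[of L \<sigma> \<tau> M S x] galois_hom[of L _ M]) auto
qed

text \<open>Every automorphism moves the labels as exactly one element of \<open>H\<close> does:
  existence is \<open>all\<close>, uniqueness is \<open>faithful\<close>. The resulting map is
  injective since the family generates \<open>L\<close>, and surjective by
  \<open>ex\<close>.\<close>

lemma galois_group_iso_of_action:
  assumes H: "group H" and M: "M \<subseteq> L" and L: "is_subfield L" "adjoin M (x ` I) = L"
    and act: "\<And>h i. h \<in> carrier H \<Longrightarrow> i \<in> I \<Longrightarrow> \<alpha> h i \<in> I"
      "\<And>h h' i. h \<in> carrier H \<Longrightarrow> h' \<in> carrier H \<Longrightarrow> i \<in> I \<Longrightarrow> \<alpha> (h \<otimes>\<^bsub>H\<^esub> h') i = \<alpha> h (\<alpha> h' i)"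
    and faithful: "\<And>h h'. h \<in> carrier H \<Longrightarrow> h' \<in> carrier H \<Longrightarrow> (\<And>i. i \<in> I \<Longrightarrow> x (\<alpha> h i) = x (\<alpha> h' i)) \<Longrightarrow> h = h'"
    and ex: "\<And>h. h \<in> carrier H \<Longrightarrow> \<exists>\<sigma>\<in>carrier (galois_group M L). \<forall>i\<in>I. \<sigma> (x i) = x (\<alpha> h i)"
    and all: "\<And>\<sigma>. \<sigma> \<in> carrier (galois_group M L) \<Longrightarrow> \<exists>h\<in>carrier H. \<forall>i\<in>I. \<sigma> (x i) = x (\<alpha> h i)"
  shows "galois_group M L \<cong> H"
proof -
  let ?G = "galois_group M L"
  have xL: "x i \<in> L" if "i \<in> I" for i using that L adjoin_gens[of "x ` I" M] by auto
  define \<theta> where "\<theta> \<sigma> = (SOME h. h \<in> carrier H \<and> (\<forall>i\<in>I. \<sigma> (x i) = x (\<alpha> h i)))" for \<sigma>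
  have th: "\<theta> \<sigma> \<in> carrier H" "\<And>i. i \<in> I \<Longrightarrow> \<sigma> (x i) = x (\<alpha> (\<theta> \<sigma>) i)" if "\<sigma> \<in> carrier ?G" for \<sigma>
    using someI_ex[of "\<lambda>h. h \<in> carrier H \<and> (\<forall>i\<in>I. \<sigma> (x i) = x (\<alpha> h i))"] all[OF that]
    unfolding \<theta>_def[symmetric] by blast+
  have "\<theta> \<in> iso ?G H"
  proof (rule isoI)
    show "\<theta> \<in> hom ?G H"
    proof (rule homI)
      fix \<sigma> \<tau> assume st: "\<sigma> \<in> carrier ?G" "\<tau> \<in> carrier ?G"
      have c: "\<sigma> \<otimes>\<^bsub>?G\<^esub> \<tau> \<in> carrier ?G"
        using st galois_compose[OF L(1) M] by (simp add: galois_group_mult)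
      show "\<theta> (\<sigma> \<otimes>\<^bsub>?G\<^esub> \<tau>) = \<theta> \<sigma> \<otimes>\<^bsub>H\<^esub> \<theta> \<tau>"
      proof (rule faithful)
        fix i assume i: "i \<in> I"
        have "x (\<alpha> (\<theta> (\<sigma> \<otimes>\<^bsub>?G\<^esub> \<tau>)) i) = (\<sigma> \<otimes>\<^bsub>?G\<^esub> \<tau>) (x i)" using th(2)[OF c i] by simp
        also have "\<dots> = \<sigma> (\<tau> (x i))" using st xL[OF i] by (simp add: galois_group_mult compose_def)
        also have "\<dots> = x (\<alpha> (\<theta> \<sigma>) (\<alpha> (\<theta> \<tau>) i))"
          using th[OF st(1)] th[OF st(2)] act i by simp
        finally show "x (\<alpha> (\<theta> (\<sigma> \<otimes>\<^bsub>?G\<^esub> \<tau>)) i) = x (\<alpha> (\<theta> \<sigma> \<otimes>\<^bsub>H\<^esub> \<theta> \<tau>) i)"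
          using act th(1) st i by simp
      qed (use st c th(1) group.is_monoid[OF H] in \<open>auto intro: monoid.m_closed\<close>)
    qed (use th in auto)
    show "bij_betw \<theta> (carrier ?G) (carrier H)"
    proof (rule bij_betwI')
      show "(\<theta> \<sigma> = \<theta> \<tau>) = (\<sigma> = \<tau>)" if "\<sigma> \<in> carrier ?G" "\<tau> \<in> carrier ?G" for \<sigma> \<tau>
        using th[OF that(1)] th[OF that(2)] by (auto intro!: galois_eqI[OF L that])
      show "\<theta> \<sigma> \<in> carrier H" if "\<sigma> \<in> carrier ?G" for \<sigma> using th that by auto
      fix h assume h: "h \<in> carrier H"
      then obtain \<sigma> where s: "\<sigma> \<in> carrier ?G" "\<forall>i\<in>I. \<sigma> (x i) = x (\<alpha> h i)" using ex by blast
      then have "h = \<theta> \<sigma>" using h th[OF s(1)] by (intro faithful) auto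
      then show "\<exists>\<sigma>\<in>carrier ?G. h = \<theta> \<sigma>" using s by auto
    qed
  qed
  then show ?thesis by (rule is_isoI)
qed

section \<open>Rational parametrisations of cubic and quadratic extensions\<close>

text \<open>Vieta's relations for \<open>X^3 + p X + q\<close>, so multiplicities are counted. The
  roots carry labels 1, 2, 3 in order that groups can act on the labels.\<close>

definition cubic_roots :: "'w::field \<Rightarrow> 'w \<Rightarrow> (nat \<Rightarrow> 'w) \<Rightarrow> bool" where
  "cubic_roots p q x \<longleftrightarrow> x 1 + x 2 + x 3 = 0 \<and>
     x 1 * x 2 + x 1 * x 3 + x 2 * x 3 = p \<and> x 1 * x 2 * x 3 = - q"

text \<open>
  The orbit of an element under the transformation \<open>y \<mapsto> - 1 / (1 + y)\<close> of order three; these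
  are the roots of Shanks' cubic \<open>X\<^sup>3 - t X\<^sup>2 - (t + 3) X - 1\<close>.
\<close>

definition shanks_roots :: "'w::field \<Rightarrow> (nat \<Rightarrow> 'w) \<Rightarrow> bool" where
  "shanks_roots t y \<longleftrightarrow> y 1 \<noteq> 0 \<and> y 1 \<noteq> - 1 \<and> y 2 = - 1 / (1 + y 1) \<and> y 3 = - 1 / (1 + y 2) \<and>
     y 1 + y 2 + y 3 = t"

definition opposite_roots :: "'w::field \<Rightarrow> (nat \<Rightarrow> 'w) \<Rightarrow> bool" where
  "opposite_roots d v \<longleftrightarrow> v 1 ^ 2 = d \<and> v 2 = - v 1"

lemma cubic_rootsD:
  assumes "cubic_roots p q x"
  shows "x 1 + x 2 + x 3 = 0" "x 1 * x 2 + x 1 * x 3 + x 2 * x 3 = p" "x 1 * x 2 * x 3 = - q"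
    "x 3 = - x 1 - x 2"
proof -
  show *: "x 1 + x 2 + x 3 = 0" "x 1 * x 2 + x 1 * x 3 + x 2 * x 3 = p" "x 1 * x 2 * x 3 = - q"
    using assms unfolding cubic_roots_def by blast+
  show "x 3 = - x 1 - x 2" using minus_unique[OF *(1)] by simp
qed

lemma cubic_expand:
  fixes z :: "'a::comm_ring_1"
  shows "(z - a) * (z - b) * (z - c) = z ^ 3 - (a + b + c) * z ^ 2 + (a * b + a * c + b * c) * z - a * b * c"
  by (simp add: algebra_simps power2_eq_square power3_eq_cube)

lemma shanks_rootsD:
  assumes "shanks_roots t y"
  shows "y 1 \<noteq> 0" "y 1 \<noteq> - 1" "y 2 = - 1 / (1 + y 1)" "y 3 = - 1 / (1 + y 2)" "y 1 + y 2 + y 3 = t"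
  using assms unfolding shanks_roots_def by blast+

text \<open>Rotation of the labels 1, 2, 3; the shift by one passes from labels to residues modulo 3
  and back.\<close>

definition rot :: "int \<Rightarrow> nat \<Rightarrow> nat" where
  "rot c i = (i - 1 + nat c) mod 3 + 1"

definition flip :: "int \<Rightarrow> nat \<Rightarrow> nat" where
  "flip c i = (if c = 0 then i else 3 - i)"

lemma ball_13: "(\<forall>i\<in>{1..3::nat}. P i) \<longleftrightarrow> P 1 \<and> P 2 \<and> P 3"
  and image_13: "f ` {1..3::nat} = {f 1, f 2, f 3}"
proof -
  have "{1..3::nat} = {1, 2, 3}" by auto
  then show "(\<forall>i\<in>{1..3::nat}. P i) \<longleftrightarrow> P 1 \<and> P 2 \<and> P 3" "f ` {1..3::nat} = {f 1, f 2, f 3}" by auto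
qed

lemma atLeastAtMost_13: "{1..3::nat} = {1, 2, 3}"
  and atLeastAtMost_12: "{1..2::nat} = {1, 2}"
  by auto

lemma permutes_13:
  assumes "h permutes {1..3::nat}"
  shows "(h 1, h 2, h 3) \<in> {(1,2,3), (1,3,2), (2,1,3), (2,3,1), (3,1,2), (3,2,1)}"
proof -
  have "h 1 \<in> {1..3}" "h 2 \<in> {1..3}" "h 3 \<in> {1..3}"
    using permutes_in_image[OF assms] by auto
  moreover have "h 1 \<noteq> h 2" "h 1 \<noteq> h 3" "h 2 \<noteq> h 3"
    by (simp_all add: inj_eq[OF permutes_inj[OF assms]])
  ultimately show ?thesis unfolding atLeastAtMost_13
    by (elim insertE emptyE) simp_all
qed

lemma cubic_roots_permute:
  assumes "cubic_roots p q x" "h permutes {1..3}"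
  shows "cubic_roots p q (x \<circ> h)"
  using permutes_13[OF assms(2)] assms(1) unfolding cubic_roots_def o_def
  by (elim insertE emptyE) (simp_all add: ac_simps)

text \<open>Equality of the two coefficients says that the second and third symmetric functions are
  opposite. They are homogeneous of degrees 2 and 3, so this relation fixes the scale of a
  trace-zero triple that is known up to proportionality.\<close>

lemma cubic_roots_ratio:
  assumes c: "cubic_roots s s x" and s: "s \<noteq> 0"
  defines "W \<equiv> x 2 / x 1"
  shows "x 1 = - 1 - 1 / (W ^ 2 + W)" "x 2 = W * x 1" "x 3 = - x 1 - x 2"
proof -
  have n: "x 1 \<noteq> 0" "x 2 \<noteq> 0" "x 3 \<noteq> 0" using c s by (auto simp: cubic_roots_def)
  show x3: "x 3 = - x 1 - x 2" using c by (rule cubic_rootsD(4))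
  show x2: "x 2 = W * x 1" using n by (simp add: W_def)
  have "x 3 = - (x 1 * (W + 1))" unfolding x3 by (subst x2) (simp add: algebra_simps)
  then have W: "W \<noteq> 0" "W + 1 \<noteq> 0" using n by (auto simp: W_def)
  have e: "x 1 * x 2 + x 1 * x 3 + x 2 * x 3 = - (x 1 * x 2 * x 3)"
    using c by (simp add: cubic_roots_def)
  have "x 1 ^ 2 * (x 1 * (W ^ 2 + W) + (W ^ 2 + W) + 1) = 0"
  proof -
    have "x 1 ^ 2 * (x 1 * (W ^ 2 + W) + (W ^ 2 + W) + 1) =
        - (x 1 * x 2 + x 1 * x 3 + x 2 * x 3) - x 1 * x 2 * x 3"
      unfolding x3 by (subst (1 2 3 4 5 6) x2) (simp add: algebra_simps power2_eq_square)
    then show ?thesis using e by simp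
  qed
  then have "x 1 * (W ^ 2 + W) + ((W ^ 2 + W) + 1) = 0" using n by (simp add: add.assoc)
  then have "x 1 * (W ^ 2 + W) = - (W ^ 2 + W) - 1"
    using eq_neg_iff_add_eq_0[of "x 1 * (W ^ 2 + W)" "W ^ 2 + W + 1"] by simp
  moreover have "W ^ 2 + W \<noteq> 0" using W by (metis mult_eq_0_iff distrib_left mult.right_neutral power2_eq_square)
  ultimately have "x 1 = (- (W ^ 2 + W) - 1) / (W ^ 2 + W)" by (simp add: eq_divide_eq)
  moreover have "(- T - 1) / T = - 1 - 1 / T" if "T \<noteq> 0" for T :: 'a
    using that by (simp add: field_simps)
  ultimately show "x 1 = - 1 - 1 / (W ^ 2 + W)" using \<open>W ^ 2 + W \<noteq> 0\<close> by metis
qed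

text \<open>The generator is the ratio \<open>x 2 / x 1\<close>, which is transcendental over
  \<open>F\<close> because \<open>s\<close> lies in the field it generates. The relabelled roots
  satisfy the same formulas in terms of their own ratio, so the substitution of ratios sends
  \<open>x i\<close> to \<open>x (h i)\<close> and therefore fixes the symmetric function
  \<open>s\<close>.\<close>

lemma S3_automorphism:
  assumes F: "is_subfield F" and s: "\<not> algebraic_over F s" and x: "cubic_roots s s x" and h: "h permutes {1..3}"
  shows "\<exists>\<sigma>\<in>carrier (galois_group (adjoin F {s}) (adjoin F (x ` {1..3}))). \<forall>i\<in>{1..3}. \<sigma> (x i) = x (h i)"
proof -
  have s0: "s \<noteq> 0" using algebraic_over_mem[OF F subfield_zero[OF F]] s by auto
  define W where "W y = y 2 / y 1" for y :: "nat \<Rightarrow> 'a"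
  have rr: "y 1 = - 1 - 1 / (W y ^ 2 + W y)" "y 2 = W y * y 1" "y 3 = - y 1 - y 2"
    if y: "cubic_roots s s y" for y
    using cubic_roots_ratio[OF y s0] unfolding W_def .
  have gen: "adjoin F {W y} = adjoin F (y ` {1..3})" if y: "cubic_roots s s y" for y
  proof (rule adjoin_eqI)
    have W: "W y \<in> adjoin F {W y}" by (rule subsetD[OF adjoin_gens]) simp
    have 1: "y 1 \<in> adjoin F {W y}"
      by (subst rr(1)[OF y], intro subfield_diff subfield_divide subfield_add subfield_power
          subfield_one subfield_uminus subfield_adjoin W)
    have 2: "y 2 \<in> adjoin F {W y}"
      by (subst rr(2)[OF y], intro subfield_mult subfield_adjoin W 1)
    have 3: "y 3 \<in> adjoin F {W y}"
      by (subst rr(3)[OF y], intro subfield_diff subfield_uminus subfield_adjoin 1 2)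
    show "y ` {1..3} \<subseteq> adjoin F {W y}" using 1 2 3 unfolding image_13 by simp
    have "y 1 \<in> adjoin F (y ` {1..3})" "y 2 \<in> adjoin F (y ` {1..3})"
      by (rule subsetD[OF adjoin_gens]; simp)+
    then show "{W y} \<subseteq> adjoin F (y ` {1..3})" unfolding W_def
      by (auto intro: subfield_intros)
  qed (rule adjoin_base)+
  have trans: "\<not> algebraic_over F (W y)" if y: "cubic_roots s s y" for y
  proof
    assume W: "algebraic_over F (W y)"
    have "y i \<in> adjoin F {W y}" if "i \<in> {1..3}" for i
      unfolding gen[OF y] by (rule subsetD[OF adjoin_gens]) (use that in auto)
    then have "y 1 * y 2 + y 1 * y 3 + y 2 * y 3 \<in> adjoin F {W y}"
      by (intro subfield_add subfield_mult subfield_adjoin) auto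
    then have "s \<in> adjoin F {W y}" unfolding cubic_rootsD(2)[OF y] .
    then show False using algebraic_over_adjoin[OF F W] s by auto
  qed
  define x' where "x' = x \<circ> h"
  have x': "cubic_roots s s x'" unfolding x'_def by (rule cubic_roots_permute[OF x h])
  have im: "x' ` {1..3} = x ` {1..3}" unfolding x'_def image_comp[symmetric] using permutes_image[OF h] by simp
  let ?L = "adjoin F (x ` {1..3})"
  have "adjoin F {W x'} = adjoin F {W x}" unfolding gen[OF x] gen[OF x'] im ..
  then obtain \<sigma> where \<sigma>: "\<sigma> \<in> carrier (galois_group F ?L)" "\<sigma> (W x) = W x'"
    using transcendental_automorphism[OF F trans[OF x] trans[OF x']] unfolding gen[OF x] by blast
  interpret subfield_hom ?L \<sigma> by (rule galois_hom[OF _ \<sigma>(1)]) simp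
  have xL: "x 1 \<in> ?L" "x 2 \<in> ?L" "x 3 \<in> ?L" by (rule subsetD[OF adjoin_gens]; simp)+
  have WL: "W x \<in> ?L" unfolding W_def using xL by (auto intro: subfield_intros)
  have "\<sigma> (- 1 - 1 / (W x ^ 2 + W x)) = - 1 - 1 / (W x' ^ 2 + W x')"
    using WL L by (simp add: diff divide add power uminus one \<sigma> subfield_intros)
  then have 1: "\<sigma> (x 1) = x' 1" by (simp only: rr(1)[OF x, symmetric] rr(1)[OF x', symmetric])
  have "\<sigma> (W x * x 1) = W x' * x' 1" using WL xL by (simp add: mult \<sigma> 1)
  then have 2: "\<sigma> (x 2) = x' 2" by (simp only: rr(2)[OF x, symmetric] rr(2)[OF x', symmetric])
  have "\<sigma> (- x 1 - x 2) = - x' 1 - x' 2" using xL L by (simp add: diff uminus 1 2 subfield_intros)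
  then have 3: "\<sigma> (x 3) = x' 3" by (simp only: rr(3)[OF x, symmetric] rr(3)[OF x', symmetric])
  have "\<sigma> (x 1 * x 2 + x 1 * x 3 + x 2 * x 3) = x' 1 * x' 2 + x' 1 * x' 3 + x' 2 * x' 3"
    using xL L by (simp add: add mult 1 2 3 subfield_intros)
  then have ss: "\<sigma> s = s" unfolding cubic_rootsD(2)[OF x] cubic_rootsD(2)[OF x'] .
  have "x 1 * x 2 + x 1 * x 3 + x 2 * x 3 \<in> ?L" using xL L by (intro subfield_add subfield_mult)
  then have sL: "s \<in> ?L" unfolding cubic_rootsD(2)[OF x] .
  have "\<sigma> \<in> carrier (galois_group (adjoin F {s}) ?L)"
    using ss sL by (intro galois_fix_adjoin \<sigma> adjoin_base) auto
  moreover have "\<forall>i\<in>{1..3}. \<sigma> (x i) = x (h i)" unfolding ball_13 using 1 2 3 by (simp add: x'_def)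
  ultimately show ?thesis by blast
qed

lemma C3_cases: "c \<in> carrier (C 3) \<longleftrightarrow> c = 0 \<or> c = 1 \<or> c = 2"
  and C2_cases: "c \<in> carrier (C 2) \<longleftrightarrow> c = 0 \<or> c = 1"
  by (auto simp: carrier_integer_mod_group)

lemma rot_simps [simp]:
  "rot 0 1 = 1" "rot 0 2 = 2" "rot 0 3 = 3" "rot 1 1 = 2" "rot 1 2 = 3" "rot 1 3 = 1"
  "rot 2 1 = 3" "rot 2 2 = 1" "rot 2 3 = 2" "rot 0 (Suc 0) = 1" "rot 1 (Suc 0) = 2" "rot 2 (Suc 0) = 3"
  by (simp_all add: rot_def)

lemma flip_simps [simp]: "flip 0 i = i" "flip 1 1 = 2" "flip 1 2 = 1" "flip 1 (Suc 0) = 2"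
  by (simp_all add: flip_def)

lemma shanks_roots_cycle:
  assumes "shanks_roots t y"
  shows "y 1 = - 1 / (1 + y 3)" "y 2 \<noteq> 0" "y 2 \<noteq> - 1" "y 3 \<noteq> 0" "y 3 \<noteq> - 1" "y 3 = - (1 + y 1) / y 1"
proof -
  have y: "y 1 \<noteq> 0" "y 1 \<noteq> - 1" "1 + y 1 \<noteq> 0" "y 2 = - 1 / (1 + y 1)" "y 3 = - 1 / (1 + y 2)"
    using assms by (auto simp: shanks_roots_def add_eq_0_iff)
  have 1: "1 + y 2 = y 1 / (1 + y 1)" using y by (simp add: field_simps)
  show y3: "y 3 = - (1 + y 1) / y 1" unfolding y(5) 1 using y by simp
  have 2: "1 + y 3 = - 1 / y 1" unfolding y3 using y by (simp add: field_simps)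
  show "y 1 = - 1 / (1 + y 3)" unfolding 2 using y by simp
  show "y 2 \<noteq> 0" "y 3 \<noteq> 0" using y y3 by auto
  have "1 + y 2 \<noteq> 0" "1 + y 3 \<noteq> 0" unfolding 1 2 using y by auto
  then show "y 2 \<noteq> - 1" "y 3 \<noteq> - 1" by (auto simp: add_eq_0_iff)
qed

lemma shanks_roots_rotate:
  assumes "shanks_roots t y" "c \<in> carrier (C 3)"
  shows "shanks_roots t (y \<circ> rot c)"
proof -
  note facts = shanks_rootsD[OF assms(1)] shanks_roots_cycle(1-5)[OF assms(1)]
  have sums: "y 2 + y 3 + y 1 = t" "y 3 + y 1 + y 2 = t"
    unfolding facts(5)[symmetric] by (simp_all only: ac_simps)
  consider "c = 0" | "c = 1" | "c = 2" using assms(2) unfolding C3_cases by blast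
  then show ?thesis
  proof cases
    case 1 show ?thesis unfolding 1 shanks_roots_def o_def rot_simps by (intro conjI facts sums)
  next
    case 2 show ?thesis unfolding 2 shanks_roots_def o_def rot_simps by (intro conjI facts sums)
  next
    case 3 show ?thesis unfolding 3 shanks_roots_def o_def rot_simps by (intro conjI facts sums)
  qed
qed

lemma shanks_roots_symmetric:
  assumes y: "shanks_roots t y"
  shows "y 1 * y 2 + y 1 * y 3 + y 2 * y 3 = - (t + 3)" "y 1 * y 2 * y 3 = 1"
proof -
  have n: "y 1 \<noteq> 0" "1 + y 1 \<noteq> 0" and y2: "y 2 = - 1 / (1 + y 1)"
    using y by (auto simp: shanks_roots_def add_eq_0_iff)
  note y3 = shanks_roots_cycle(6)[OF y]
  have t: "t = y 1 + y 2 + y 3" using shanks_rootsD(5)[OF y] by simp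
  show "y 1 * y 2 + y 1 * y 3 + y 2 * y 3 = - (t + 3)" unfolding t y2 y3 using n
    by (simp add: divide_simps) (simp add: algebra_simps)
  show "y 1 * y 2 * y 3 = 1" unfolding y2 y3 using n by (simp add: divide_simps)
qed

text \<open>Here one root suffices as generator, since the other two arise from it by the
  transformation of order three; a rotation replaces \<open>y 1\<close> by another member of the
  same orbit and preserves the sum \<open>t\<close>.\<close>

lemma C3_automorphism:
  assumes F: "is_subfield F" and t: "\<not> algebraic_over F t" and y: "shanks_roots t y" and c: "c \<in> carrier (C 3)"
  shows "\<exists>\<sigma>\<in>carrier (galois_group (adjoin F {t}) (adjoin F (y ` {1..3}))). \<forall>i\<in>{1..3}. \<sigma> (y i) = y (rot c i)"
proof -
  have gen: "adjoin F {y 1} = adjoin F (y ` {1..3})" if y: "shanks_roots t y" for y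
  proof (rule adjoin_eqI)
    have 1: "y 1 \<in> adjoin F {y 1}" by (rule subsetD[OF adjoin_gens]) simp
    have 2: "y 2 \<in> adjoin F {y 1}" unfolding shanks_rootsD(3)[OF y]
      using 1 by (intro subfield_divide subfield_uminus subfield_add subfield_one subfield_adjoin)
    have "y 3 \<in> adjoin F {y 1}" unfolding shanks_roots_cycle(6)[OF y]
      using 1 by (intro subfield_divide subfield_uminus subfield_add subfield_one subfield_adjoin)
    then show "y ` {1..3} \<subseteq> adjoin F {y 1}" using 1 2 unfolding image_13 by simp
    show "{y 1} \<subseteq> adjoin F (y ` {1..3})" using adjoin_gens[of "y ` {1..3}" F] by auto
  qed (rule adjoin_base)+
  have trans: "\<not> algebraic_over F (y 1)" if y: "shanks_roots t y" for y
  proof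
    assume a: "algebraic_over F (y 1)"
    have "y i \<in> adjoin F {y 1}" if "i \<in> {1..3}" for i
      unfolding gen[OF y] by (rule subsetD[OF adjoin_gens]) (use that in auto)
    then have "y 1 + y 2 + y 3 \<in> adjoin F {y 1}"
      by (intro subfield_add subfield_adjoin) auto
    then have "t \<in> adjoin F {y 1}" unfolding shanks_rootsD(5)[OF y] .
    then show False using algebraic_over_adjoin[OF F a] t by auto
  qed
  define y' where "y' = y \<circ> rot c"
  have y': "shanks_roots t y'" unfolding y'_def by (rule shanks_roots_rotate[OF y c])
  have im: "y' ` {1..3} = y ` {1..3}" unfolding y'_def image_13 using c by (auto simp: C3_cases)
  let ?L = "adjoin F (y ` {1..3})"
  have "adjoin F {y' 1} = adjoin F {y 1}" unfolding gen[OF y] gen[OF y'] im ..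
  then obtain \<sigma> where \<sigma>: "\<sigma> \<in> carrier (galois_group F ?L)" "\<sigma> (y 1) = y' 1"
    using transcendental_automorphism[OF F trans[OF y] trans[OF y']] unfolding gen[OF y] by blast
  interpret subfield_hom ?L \<sigma> by (rule galois_hom[OF _ \<sigma>(1)]) simp
  have yL: "y 1 \<in> ?L" "y 2 \<in> ?L" "y 3 \<in> ?L" by (rule subsetD[OF adjoin_gens]; simp)+
  have "\<sigma> (- 1 / (1 + y 1)) = - 1 / (1 + y' 1)" "\<sigma> (- 1 / (1 + y 2)) = - 1 / (1 + \<sigma> (y 2))"
    using yL L by (simp_all add: divide add uminus one \<sigma> subfield_intros)
  then have 2: "\<sigma> (y 2) = y' 2" and 3: "\<sigma> (y 3) = y' 3"
    unfolding shanks_rootsD(3,4)[OF y, symmetric] using shanks_rootsD(3,4)[OF y'] by simp_all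
  have "\<sigma> (y 1 + y 2 + y 3) = y' 1 + y' 2 + y' 3"
    using yL L by (simp add: add 2 3 \<sigma> subfield_intros)
  then have ss: "\<sigma> t = t" unfolding shanks_rootsD(5)[OF y] shanks_rootsD(5)[OF y'] .
  have "y 1 + y 2 + y 3 \<in> ?L" using yL L by (intro subfield_add)
  then have tL: "t \<in> ?L" unfolding shanks_rootsD(5)[OF y] .
  have "\<sigma> \<in> carrier (galois_group (adjoin F {t}) ?L)"
    using ss tL by (intro galois_fix_adjoin \<sigma> adjoin_base) auto
  moreover have "\<forall>i\<in>{1..3}. \<sigma> (y i) = y (rot c i)" unfolding ball_13 using \<sigma> 2 3 by (simp add: y'_def)
  ultimately show ?thesis by blast
qed

lemma C2_automorphism:
  assumes F: "is_subfield F" and d: "\<not> algebraic_over F d" and v: "opposite_roots d v" and c: "c \<in> carrier (C 2)"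
  shows "\<exists>\<sigma>\<in>carrier (galois_group (adjoin F {d}) (adjoin F (v ` {1..2}))). \<forall>i\<in>{1..2}. \<sigma> (v i) = v (flip c i)"
proof -
  have v2: "v 2 = - v 1" "v 1 ^ 2 = d" using v by (auto simp: opposite_roots_def)
  have gen: "adjoin F {w} = adjoin F (v ` {1..2})" if w: "w = v 1 \<or> w = - v 1" for w
  proof (rule adjoin_eqI)
    have 1: "w \<in> adjoin F {w}" "- w \<in> adjoin F {w}"
      using adjoin_gens[of "{w}" F] by (auto intro: subfield_intros)
    then show "v ` {1..2} \<subseteq> adjoin F {w}" using w v2 by (auto simp: atLeastAtMost_12)
    show "{w} \<subseteq> adjoin F (v ` {1..2})"
      using w v2 adjoin_gens[of "v ` {1..2}" F] by (auto simp: atLeastAtMost_12)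
  qed (rule adjoin_base)+
  have trans: "\<not> algebraic_over F w" if w: "w = v 1 \<or> w = - v 1" for w
  proof
    assume a: "algebraic_over F w"
    have "w ^ 2 \<in> adjoin F {w}" using adjoin_gens[of "{w}" F] by (auto intro: subfield_intros)
    then show False using algebraic_over_adjoin[OF F a] d v2 w by auto
  qed
  define w where "w = v (flip c 1)"
  have w: "w = v 1 \<or> w = - v 1" using c v2 by (auto simp: w_def C2_cases)
  let ?L = "adjoin F (v ` {1..2})"
  obtain \<sigma> where \<sigma>: "\<sigma> \<in> carrier (galois_group F ?L)" "\<sigma> (v 1) = w"
    using transcendental_automorphism[OF F trans trans, of "v 1" w] gen[of "v 1"] gen[of w] w by auto
  interpret subfield_hom ?L \<sigma> by (rule galois_hom[OF _ \<sigma>(1)]) simp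
  have vL: "v 1 \<in> ?L" by (rule subsetD[OF adjoin_gens]) simp
  have 2: "\<sigma> (v 2) = - w" unfolding v2 using vL \<sigma> by (simp add: uminus)
  have "\<sigma> (v 1 ^ 2) = w ^ 2" using vL \<sigma> by (simp add: power)
  then have ss: "\<sigma> d = d" using v2 w by auto
  have "v 1 ^ 2 \<in> ?L" using vL L by (intro subfield_intros)
  then have "d \<in> ?L" using v2 by simp
  then have "\<sigma> \<in> carrier (galois_group (adjoin F {d}) ?L)"
    using ss by (intro galois_fix_adjoin \<sigma> adjoin_base) auto
  moreover have "\<forall>i\<in>{1..2}. \<sigma> (v i) = v (flip c i)"
    using \<sigma>(2) 2 v2 c by (auto simp: w_def C2_cases atLeastAtMost_12)
  ultimately show ?thesis by blast
qed

section \<open>Automorphisms act on the labels through the expected group\<close>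

lemma cubic_roots_iff:
  assumes "cubic_roots p q x"
  shows "z ^ 3 + p * z + q = 0 \<longleftrightarrow> z \<in> x ` {1..3}"
proof -
  have "z ^ 3 + p * z + q = (z - x 1) * (z - x 2) * (z - x 3)"
    unfolding cubic_expand cubic_rootsD(1-3)[OF assms] by simp
  then show ?thesis unfolding image_13 by auto
qed

text \<open>Roots are sent to roots of the same cubic. Distinctness of the roots makes the induced
  map of labels injective, hence a permutation.\<close>

lemma galois_S3_action:
  assumes L: "is_subfield L" and \<sigma>: "\<sigma> \<in> carrier (galois_group M L)" and x: "cubic_roots p q x"
    and "p \<in> M" "q \<in> M" "M \<subseteq> L" and xL: "x ` {1..3} \<subseteq> L" and inj: "inj_on x {1..3}"
  shows "\<exists>h\<in>carrier S3. \<forall>i\<in>{1..3}. \<sigma> (x i) = x (h i)"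
proof -
  interpret subfield_hom L \<sigma> by (rule galois_hom[OF L \<sigma>])
  have "\<sigma> (x i) \<in> x ` {1..3}" if i: "i \<in> {1..3}" for i
  proof -
    have xi: "x i \<in> L" using xL i by auto
    have "x i ^ 3 + p * x i + q = 0" using i cubic_roots_iff[OF x] by auto
    then have "\<sigma> (x i ^ 3 + p * x i + q) = 0" by (simp add: zero)
    also have "\<sigma> (x i ^ 3 + p * x i + q) = \<sigma> (x i) ^ 3 + p * \<sigma> (x i) + q"
      using xi assms galois_fix[OF \<sigma>] by (simp add: add mult power subset_iff subfield_intros)
    finally show ?thesis using cubic_roots_iff[OF x] by auto
  qed
  then have "\<forall>i\<in>{1..3}. \<exists>j\<in>{1..3}. \<sigma> (x i) = x j" by blast
  then obtain f where f: "\<forall>i\<in>{1..3}. f i \<in> {1..3} \<and> \<sigma> (x i) = x (f i)" by metis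
  \<comment> \<open>Elements of \<open>S3\<close> are permutations of all natural numbers that fix
    everything outside \<open>{1..3}\<close>.\<close>
  define h where "h i = (if i \<in> {1..3} then f i else i)" for i
  have "inj_on h {1..3}"
  proof (rule inj_onI)
    fix i j :: nat assume ij: "i \<in> {1..3}" "j \<in> {1..3}" "h i = h j"
    then have "\<sigma> (x i) = \<sigma> (x j)" using f by (simp add: h_def)
    then have "x i = x j" using inj_onD[OF local.inj, of "x i" "x j"] ij xL by (simp add: image_subset_iff)
    then show "i = j" using assms(8) ij by (auto dest: inj_onD)
  qed
  moreover have "h ` {1..3} \<subseteq> {1..3}" using f by (auto simp: h_def)
  ultimately have "bij_betw h {1..3} {1..3}" by (simp add: bij_betw_def endo_inj_surj)
  then have "h permutes {1..3}" by (rule bij_imp_permutes) (auto simp: h_def)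
  then show ?thesis using f by (intro bexI[of _ h]) (auto simp: h_def sym_group_carrier)
qed

text \<open>The image of \<open>y 1\<close> is one of the three roots, and it determines the images
  of \<open>y 2\<close> and \<open>y 3\<close>, because these are obtained from \<open>y 1\<close>
  by a rational function with integer coefficients. This leaves only the rotations.\<close>

lemma galois_C3_action:
  assumes L: "is_subfield L" and \<sigma>: "\<sigma> \<in> carrier (galois_group M L)" and y: "shanks_roots t y"
    and t: "t \<in> M" "M \<subseteq> L" and yL: "y ` {1..3} \<subseteq> L"
  shows "\<exists>c\<in>carrier (C 3). \<forall>i\<in>{1..3}. \<sigma> (y i) = y (rot c i)"
proof -
  interpret subfield_hom L \<sigma> by (rule galois_hom[OF L \<sigma>])
  have yi: "y 1 \<in> L" "y 2 \<in> L" "y 3 \<in> L" using yL by auto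
  have eq: "z ^ 3 - t * z ^ 2 - (t + 3) * z - 1 = (z - y 1) * (z - y 2) * (z - y 3)" for z
    unfolding cubic_expand shanks_roots_symmetric[OF y] shanks_rootsD(5)[OF y] by (simp add: algebra_simps)
  have "\<sigma> (y 1 ^ 3 - t * y 1 ^ 2 - (t + 3) * y 1 - 1) = 0" unfolding eq by (simp add: zero)
  moreover have "\<sigma> (y 1 ^ 3 - t * y 1 ^ 2 - (t + 3) * y 1 - 1) =
      \<sigma> (y 1) ^ 3 - t * \<sigma> (y 1) ^ 2 - (t + 3) * \<sigma> (y 1) - 1"
    using yi t L galois_fix[OF \<sigma> t(1)]
    by (simp add: add mult power diff one numeral subset_iff subfield_intros)
  ultimately have "\<sigma> (y 1) = y 1 \<or> \<sigma> (y 1) = y 2 \<or> \<sigma> (y 1) = y 3" using eq[of "\<sigma> (y 1)"] by auto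
  moreover have "\<sigma> (- 1 / (1 + y 1)) = - 1 / (1 + \<sigma> (y 1))" "\<sigma> (- 1 / (1 + y 2)) = - 1 / (1 + \<sigma> (y 2))"
    using yi L by (simp_all add: divide add uminus one subfield_intros)
  then have "\<sigma> (y 2) = - 1 / (1 + \<sigma> (y 1))" "\<sigma> (y 3) = - 1 / (1 + \<sigma> (y 2))"
    unfolding shanks_rootsD(3,4)[OF y, symmetric] .
  moreover note shanks_rootsD(3,4)[OF y] shanks_roots_cycle(1)[OF y]
  ultimately have "(\<sigma> (y 1) = y 1 \<and> \<sigma> (y 2) = y 2 \<and> \<sigma> (y 3) = y 3) \<or>
      (\<sigma> (y 1) = y 2 \<and> \<sigma> (y 2) = y 3 \<and> \<sigma> (y 3) = y 1) \<or> (\<sigma> (y 1) = y 3 \<and> \<sigma> (y 2) = y 1 \<and> \<sigma> (y 3) = y 2)"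
    by metis
  then show ?thesis unfolding ball_13
    by (elim disjE) (rule bexI[of _ 0], auto simp: C3_cases, rule bexI[of _ 1], auto simp: C3_cases,
        rule bexI[of _ 2], auto simp: C3_cases)
qed

lemma galois_C2_action:
  assumes L: "is_subfield L" and \<sigma>: "\<sigma> \<in> carrier (galois_group M L)" and v: "opposite_roots d v"
    and d: "d \<in> M" "M \<subseteq> L" and vL: "v 1 \<in> L"
  shows "\<exists>c\<in>carrier (C 2). \<forall>i\<in>{1..2}. \<sigma> (v i) = v (flip c i)"
proof -
  interpret subfield_hom L \<sigma> by (rule galois_hom[OF L \<sigma>])
  have v2: "v 2 = - v 1" "v 1 ^ 2 = d" using v by (auto simp: opposite_roots_def)
  have "\<sigma> (v 1) ^ 2 = v 1 ^ 2" using galois_fix[OF \<sigma> d(1)] v2 power[OF vL, of 2] by simp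
  then have "\<sigma> (v 1) = v 1 \<or> \<sigma> (v 1) = - v 1" by (simp add: power2_eq_iff)
  moreover have "\<sigma> (v 2) = - \<sigma> (v 1)" using v2 vL by (simp add: uminus)
  ultimately show ?thesis unfolding atLeastAtMost_12 using v2
    by (elim disjE) (rule bexI[of _ 0], auto simp: C2_cases, rule bexI[of _ 1], auto simp: C2_cases)
qed

section \<open>Finite Galois extensions of infinite fields\<close>

locale finite_galois =
  fixes M L :: "'w::field set"
  assumes galois: "galois_extension M L" and inf: "infinite M"
    and fin: "finite (carrier (galois_group M L))"
begin

abbreviation G where "G \<equiv> carrier (galois_group M L)"

lemma M: "is_subfield M" and L: "is_subfield L" and MsubL: "M \<subseteq> L"
  using galois by (auto simp: galois_extension_def)

lemma in_L: "\<sigma> \<in> G \<Longrightarrow> x \<in> L \<Longrightarrow> \<sigma> x \<in> L"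
  by (rule galois_in)

lemma hom: "\<sigma> \<in> G \<Longrightarrow> subfield_hom L \<sigma>"
  by (rule galois_hom[OF L])

lemma fixed: "x \<in> L \<Longrightarrow> (\<And>\<sigma>. \<sigma> \<in> G \<Longrightarrow> \<sigma> x = x) \<Longrightarrow> x \<in> M"
  using galois unfolding galois_extension_def by blast

sublocale gal: group "galois_group M L"
  by (rule group_galois_group[OF L MsubL])

lemma mult_apply: "\<sigma> \<in> G \<Longrightarrow> \<tau> \<in> G \<Longrightarrow> x \<in> L \<Longrightarrow> (\<sigma> \<otimes>\<^bsub>galois_group M L\<^esub> \<tau>) x = \<sigma> (\<tau> x)"
  by (simp add: galois_group_mult compose_def)

lemma bij_mult: "\<sigma> \<in> G \<Longrightarrow> bij_betw (\<lambda>\<tau>. \<sigma> \<otimes>\<^bsub>galois_group M L\<^esub> \<tau>) G G"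
  using gal.inj_on_cmult gal.surj_const_mult by (auto simp: bij_betw_def)

text \<open>Candidates are \<open>w c\<close>, the sum of the \<open>xs ! i * c ^ i\<close>. If
  \<open>g\<close> and \<open>h\<close> agree on it, then \<open>c\<close> is a root of the nonzero
  polynomial \<open>P g h\<close>; finitely many pairs exclude only finitely many \<open>c\<close>
  in the infinite field \<open>M\<close>.\<close>

lemma exists_separating_element:
  assumes S: "finite S" "S \<subseteq> L" and sep: "\<And>g h. g \<in> G \<Longrightarrow> h \<in> G \<Longrightarrow> g \<noteq> h \<Longrightarrow> \<exists>x\<in>S. g x \<noteq> h x"
  shows "\<exists>w\<in>adjoin M S. inj_on (\<lambda>g. g w) G"
proof -
  obtain xs where xs: "set xs = S" using finite_list[OF S(1)] by blast
  define n where "n = length xs"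
  have xL: "xs ! i \<in> S" "xs ! i \<in> L" if "i < n" for i using that xs S by (auto simp: n_def)
  define w where "w c = (\<Sum>i<n. xs ! i * c ^ i)" for c
  define P where "P g h = (\<Sum>i<n. Polynomial.monom (g (xs ! i) - h (xs ! i)) i)" for g h :: "'w \<Rightarrow> 'w"
  have P0: "P g h \<noteq> 0" if gh: "g \<in> G" "h \<in> G" "g \<noteq> h" for g h
  proof -
    obtain i where i: "i < n" "g (xs ! i) \<noteq> h (xs ! i)"
      using sep[OF gh] xs by (auto simp: n_def in_set_conv_nth)
    then have "Polynomial.coeff (P g h) i \<noteq> 0" by (simp add: P_def coeff_sum)
    then show ?thesis by auto
  qed
  define bad where "bad = (\<Union>g\<in>G. \<Union>h\<in>G - {g}. {c. poly (P g h) c = 0})"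
  have "finite bad" unfolding bad_def using fin P0
    by (intro finite_UN_I) (auto intro!: poly_roots_finite)
  then have "\<not> M \<subseteq> bad" using inf finite_subset by blast
  then obtain c where c: "c \<in> M" "c \<notin> bad" by auto
  have gw: "g (w c) = (\<Sum>i<n. g (xs ! i) * c ^ i)" if g: "g \<in> G" for g
  proof -
    interpret subfield_hom L g by (rule hom[OF g])
    show ?thesis unfolding w_def
      using xL c MsubL L galois_fix[OF g c(1)]
      by (subst sum) (auto simp: mult power subset_iff subfield_power intro!: subfield_mult sum.cong)
  qed
  have "inj_on (\<lambda>g. g (w c)) G"
  proof (rule inj_onI, rule ccontr)
    fix g h assume gh: "g \<in> G" "h \<in> G" "g (w c) = h (w c)" "g \<noteq> h"
    then have "poly (P g h) c = 0"
      by (simp add: P_def poly_sum poly_monom gw left_diff_distrib sum_subtractf)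
    then show False using c gh by (auto simp: bad_def)
  qed
  moreover have "w c \<in> adjoin M S"
    unfolding w_def using adjoin_base[of M S] adjoin_gens[of S M] c xL
    by (intro subfield_sum subfield_mult subfield_power subfield_adjoin) auto
  ultimately show ?thesis by blast
qed

text \<open>Used for two sets: \<open>A = G\<close> gives the characteristic polynomial of
  \<open>w\<close> over \<open>M\<close>, and \<open>A = G - {g}\<close> gives, up to a factor, the
  Lagrange polynomial at the conjugate \<open>g w\<close> of a separating element.\<close>

definition conj_poly where "conj_poly w A = (\<Prod>h\<in>A. [:- h w, 1:])" for w and A :: "('w \<Rightarrow> 'w) set"

lemma coeff_prod_linear:
  assumes s: "\<sigma> \<in> G" and A: "finite A" "\<And>h. h \<in> A \<Longrightarrow> f h \<in> L"
  shows "Polynomial.coeff (\<Prod>h\<in>A. [:- f h, 1:]) j \<in> L \<and>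
    \<sigma> (Polynomial.coeff (\<Prod>h\<in>A. [:- f h, 1:]) j) = Polynomial.coeff (\<Prod>h\<in>A. [:- \<sigma> (f h), 1:]) j"
  using A
proof (induction A arbitrary: j rule: finite_induct)
  case empty
  interpret subfield_hom L \<sigma> by (rule hom[OF s])
  show ?case using L by (cases j) (auto simp: one_pCons coeff_pCons zero one subfield_intros)
next
  case (insert h A)
  interpret subfield_hom L \<sigma> by (rule hom[OF s])
  have "f h \<in> L" using insert by auto
  then show ?case using insert.IH insert.prems insert.hyps L
    by (cases j) (auto simp: coeff_pCons zero uminus mult diff subfield_mult subfield_diff subfield_uminus)
qed

lemma conj_poly_over:
  assumes w: "w \<in> L"
  shows "poly_over M (conj_poly w G)"
  unfolding poly_over_def
proof
  fix j
  have hw: "h w \<in> L" if "h \<in> G" for h using that w in_L by auto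
  show "Polynomial.coeff (conj_poly w G) j \<in> M"
  proof (rule fixed)
    show "Polynomial.coeff (conj_poly w G) j \<in> L"
      unfolding conj_poly_def using coeff_prod_linear[OF gal.one_closed fin, of "\<lambda>h. h w"] hw by blast
    fix \<sigma> assume s: "\<sigma> \<in> G"
    have "\<sigma> (Polynomial.coeff (conj_poly w G) j) = Polynomial.coeff (\<Prod>h\<in>G. [:- \<sigma> (h w), 1:]) j"
      unfolding conj_poly_def using coeff_prod_linear[OF s fin, of "\<lambda>h. h w"] hw by blast
    also have "(\<Prod>h\<in>G. [:- \<sigma> (h w), 1:]) = (\<Prod>h\<in>G. [:- (\<sigma> \<otimes>\<^bsub>galois_group M L\<^esub> h) w, 1:])"
      using s w by (intro prod.cong) (simp_all add: mult_apply)
    also have "\<dots> = conj_poly w G"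
      unfolding conj_poly_def by (rule prod.reindex_bij_betw[OF bij_mult[OF s], of "\<lambda>h. [:- h w, 1:]"])
    finally show "\<sigma> (Polynomial.coeff (conj_poly w G) j) = Polynomial.coeff (conj_poly w G) j" .
  qed
qed

lemma trace_in_base:
  assumes "\<theta> \<in> L"
  shows "(\<Sum>g\<in>G. g \<theta>) \<in> M"
proof (rule fixed)
  show "(\<Sum>g\<in>G. g \<theta>) \<in> L" using assms L in_L by (intro subfield_sum) auto
  fix \<sigma> assume s: "\<sigma> \<in> G"
  interpret subfield_hom L \<sigma> by (rule hom[OF s])
  have "\<sigma> (\<Sum>g\<in>G. g \<theta>) = (\<Sum>g\<in>G. (\<sigma> \<otimes>\<^bsub>galois_group M L\<^esub> g) \<theta>)"
    using assms in_L s by (subst sum) (auto simp: mult_apply)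
  also have "\<dots> = (\<Sum>g\<in>G. g \<theta>)"
    by (rule sum.reindex_bij_betw[OF bij_mult[OF s], of "\<lambda>h. h \<theta>"])
  finally show "\<sigma> (\<Sum>g\<in>G. g \<theta>) = (\<Sum>g\<in>G. g \<theta>)" .
qed

text \<open>The coefficient of degree \<open>j + 1\<close> of the product expresses the coefficient
  \<open>j\<close> of \<open>P\<close> by the coefficient \<open>j + 1\<close>. The induction
  descends from the degree of \<open>P\<close>, above which the coefficients vanish.\<close>

lemma poly_over_synthetic_division:
  assumes F: "is_subfield F" and P: "poly_over F ([:- w, 1:] * P)" and w: "w \<in> F"
  shows "poly_over F P"
proof -
  have "\<forall>j. Polynomial.degree P < j + k \<longrightarrow> Polynomial.coeff P j \<in> F" for k
  proof (induction k)
    case 0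
    then show ?case using F by (auto simp: coeff_eq_0 subfield_zero)
  next
    case (Suc k)
    show ?case
    proof (intro allI impI)
      fix j assume "Polynomial.degree P < j + Suc k"
      then have "Polynomial.coeff P (Suc j) \<in> F" using Suc by auto
      moreover have "Polynomial.coeff ([:- w, 1:] * P) (Suc j) \<in> F" using P unfolding poly_over_def by blast
      ultimately have "Polynomial.coeff ([:- w, 1:] * P) (Suc j) + w * Polynomial.coeff P (Suc j) \<in> F"
        using F w by (intro subfield_add subfield_mult)
      then show "Polynomial.coeff P j \<in> F" by simp
    qed
  qed
  then show ?thesis unfolding poly_over_def by (metis less_add_Suc2 add_Suc_right)
qed

lemma conj_poly_others:
  assumes w: "w \<in> L" "inj_on (\<lambda>g. g w) G" and g: "g \<in> G" "h \<in> G"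
  shows "poly (conj_poly w (G - {g})) (h w) = 0 \<longleftrightarrow> h \<noteq> g"
proof -
  have "poly (conj_poly w (G - {g})) (h w) = (\<Prod>k\<in>G - {g}. h w - k w)"
    by (simp add: conj_poly_def poly_prod)
  also have "\<dots> = 0 \<longleftrightarrow> (\<exists>k\<in>G - {g}. h w = k w)" using fin by simp
  also have "\<dots> \<longleftrightarrow> h \<noteq> g" using inj_on_eq_iff[OF w(2)] g by blast
  finally show ?thesis .
qed

text \<open>Lagrange interpolation. Let \<open>P\<close> be the product of \<open>X - g w\<close>
  over \<open>g\<close> different from the identity; its coefficients lie in \<open>M(w)\<close>.
  Weighting the traces of \<open>\<theta> * w ^ j\<close>, which lie in \<open>M\<close>, with these
  coefficients gives the sum of \<open>g \<theta> * P(g w)\<close>, in which only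
  \<open>\<theta> * P(w)\<close> survives.\<close>

lemma adjoin_separating_element:
  assumes w: "w \<in> L" "inj_on (\<lambda>g. g w) G"
  shows "adjoin M {w} = L"
proof
  show "adjoin M {w} \<subseteq> L" using w MsubL L by (intro adjoin_least) auto
  show "L \<subseteq> adjoin M {w}"
  proof
    fix \<theta> assume th: "\<theta> \<in> L"
    let ?e = "\<one>\<^bsub>galois_group M L\<^esub>" and ?F = "adjoin M {w}"
    have e: "?e x = x" if "x \<in> L" for x using that by (auto simp: galois_group_one)
    define P where "P = conj_poly w (G - {?e})"
    have wF: "w \<in> ?F" using adjoin_gens[of "{w}" M] by auto
    have "conj_poly w G = [:- ?e w, 1:] * P"
      unfolding conj_poly_def P_def by (rule prod.remove[OF fin]) simp
    then have "poly_over M ([:- w, 1:] * P)" using conj_poly_over[OF w(1)] e w by simp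
    then have P: "poly_over ?F P"
      by (intro poly_over_synthetic_division[OF subfield_adjoin poly_over_mono[OF adjoin_base] wF])
    have tr: "(\<Sum>g\<in>G. g (\<theta> * w ^ j)) \<in> ?F" for j
      using trace_in_base[OF subfield_mult[OF L th subfield_power[OF L w(1)]]] adjoin_base by blast
    have gm: "g (\<theta> * w ^ j) = g \<theta> * g w ^ j" if "g \<in> G" for g j
      using subfield_hom.mult[OF hom[OF that] th subfield_power[OF L w(1)]]
        subfield_hom.power[OF hom[OF that] w(1)] by simp
    have "(\<Sum>j\<le>Polynomial.degree P. Polynomial.coeff P j * (\<Sum>g\<in>G. g (\<theta> * w ^ j))) \<in> ?F"
      using P by (intro subfield_sum subfield_mult tr subfield_adjoin) (auto simp: poly_over_def)
    also have "(\<Sum>j\<le>Polynomial.degree P. Polynomial.coeff P j * (\<Sum>g\<in>G. g (\<theta> * w ^ j))) =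
        (\<Sum>j\<le>Polynomial.degree P. Polynomial.coeff P j * (\<Sum>g\<in>G. g \<theta> * g w ^ j))"
      by (intro sum.cong refl arg_cong2[where f = "(*)"] gm)
    also have "\<dots> = (\<Sum>g\<in>G. g \<theta> * poly P (g w))"
      unfolding poly_altdef sum_distrib_left by (subst sum.swap) (simp add: ac_simps)
    also have "\<dots> = (\<Sum>g\<in>{?e}. g \<theta> * poly P (g w))"
      unfolding P_def using fin conj_poly_others[OF w gal.one_closed]
      by (intro sum.mono_neutral_right) auto
    finally have 1: "\<theta> * poly P w \<in> ?F" using e th w by simp
    have "poly P w \<noteq> 0" using conj_poly_others[OF w gal.one_closed gal.one_closed] e w by (simp add: P_def)
    moreover have "\<theta> * poly P w / poly P w \<in> ?F"
      using 1 P wF by (intro subfield_divide poly_over_poly[of ?F P]) auto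
    ultimately show "\<theta> \<in> ?F" by simp
  qed
qed

text \<open>A separating element can be found inside \<open>adjoin M S\<close>, and it alone
  generates \<open>L\<close>.\<close>

lemma adjoin_eq_top:
  assumes S: "finite S" "S \<subseteq> L" and sep: "\<And>g h. g \<in> G \<Longrightarrow> h \<in> G \<Longrightarrow> (\<And>x. x \<in> S \<Longrightarrow> g x = h x) \<Longrightarrow> g = h"
  shows "adjoin M S = L"
proof
  show sub: "adjoin M S \<subseteq> L" using S MsubL L by (intro adjoin_least) auto
  obtain w where w: "w \<in> adjoin M S" "inj_on (\<lambda>g. g w) G"
    using exists_separating_element[OF S] sep by blast
  then have "L = adjoin M {w}" using adjoin_separating_element sub by blast
  also have "\<dots> \<subseteq> adjoin M S" using w adjoin_base[of M S] by (intro adjoin_least) auto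
  finally show "L \<subseteq> adjoin M S" .
qed

text \<open>Dedekind's theorem by the same interpolation: a vanishing combination, applied to the
  powers of a separating element \<open>w\<close> and weighted with the coefficients of the
  polynomial that vanishes at all conjugates except \<open>g0 w\<close>, leaves the single term of
  \<open>g0\<close>.\<close>

lemma linear_independence:
  assumes "g0 \<in> G" "\<epsilon> g0 \<noteq> 0"
  shows "\<exists>z\<in>L. (\<Sum>g\<in>G. \<epsilon> g * g z) \<noteq> 0"
proof (rule ccontr)
  assume H: "\<not> ?thesis"
  define d where "d g h = (SOME x. x \<in> L \<and> g x \<noteq> h x)" for g h :: "'w \<Rightarrow> 'w"
  have d: "d g h \<in> L \<and> g (d g h) \<noteq> h (d g h)" if "g \<in> G" "h \<in> G" "g \<noteq> h" for g h
  proof -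
    have "\<exists>x. x \<in> L \<and> g x \<noteq> h x"
      using that extensionalityI[OF galois_ext galois_ext, of g M L h M] by blast
    then show ?thesis unfolding d_def by (rule someI_ex)
  qed
  define S where "S = (\<Union>g\<in>G. \<Union>h\<in>G - {g}. {d g h})"
  have "finite S" "S \<subseteq> L" unfolding S_def using fin d by auto
  moreover have "\<exists>x\<in>S. g x \<noteq> h x" if "g \<in> G" "h \<in> G" "g \<noteq> h" for g h
    using that d[OF that] by (intro bexI[of _ "d g h"]) (auto simp: S_def)
  ultimately obtain w where w: "w \<in> adjoin M S" "inj_on (\<lambda>g. g w) G"
    using exists_separating_element by blast
  then have wL: "w \<in> L" using adjoin_least[OF L MsubL \<open>S \<subseteq> L\<close>] by auto
  define P where "P = conj_poly w (G - {g0})"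
  have "(\<Sum>g\<in>G. \<epsilon> g * g w ^ j) = 0" for j
  proof -
    have "w ^ j \<in> L" using wL L by (intro subfield_power)
    then have "(\<Sum>g\<in>G. \<epsilon> g * g (w ^ j)) = 0" using H by blast
    then show ?thesis using subfield_hom.power[OF hom wL, of _ j] by simp
  qed
  then have "(\<Sum>j\<le>Polynomial.degree P. Polynomial.coeff P j * (\<Sum>g\<in>G. \<epsilon> g * g w ^ j)) = 0" by simp
  then have "(\<Sum>g\<in>G. \<epsilon> g * poly P (g w)) = 0"
    unfolding poly_altdef sum_distrib_left by (subst sum.swap) (simp add: ac_simps)
  moreover have "(\<Sum>g\<in>G. \<epsilon> g * poly P (g w)) = (\<Sum>g\<in>{g0}. \<epsilon> g * poly P (g w))"
    unfolding P_def using fin conj_poly_others[OF wL w(2) assms(1)] assms(1)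
    by (intro sum.mono_neutral_right) auto
  ultimately show False using assms conj_poly_others[OF wL w(2) assms(1) assms(1)] by (simp add: P_def)
qed

text \<open>\<open>x i\<close> is the sum of \<open>g z\<close> over those \<open>g\<close> that
  carry the label \<open>a\<close> to \<open>i\<close>. Left multiplication by
  \<open>\<sigma>\<close> maps this set of automorphisms to the one for
  \<open>\<alpha> \<sigma> i\<close>, so the family is permuted as the labels are. Linear
  independence allows \<open>z\<close> to be chosen with \<open>x a\<close> and \<open>x b\<close>
  different.\<close>

lemma partial_traces:
  assumes act: "\<And>\<sigma> i. \<sigma> \<in> G \<Longrightarrow> i \<in> I \<Longrightarrow> \<alpha> \<sigma> i \<in> I" "\<And>\<sigma>. \<sigma> \<in> G \<Longrightarrow> inj_on (\<alpha> \<sigma>) I"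
      "\<And>\<sigma> \<tau> i. \<sigma> \<in> G \<Longrightarrow> \<tau> \<in> G \<Longrightarrow> i \<in> I \<Longrightarrow> \<alpha> (\<sigma> \<otimes>\<^bsub>galois_group M L\<^esub> \<tau>) i = \<alpha> \<sigma> (\<alpha> \<tau> i)"
    and base: "a \<in> I" "b \<in> I" "a \<noteq> b" "\<sigma>0 \<in> G" "\<alpha> \<sigma>0 a = a"
  shows "\<exists>x. (\<forall>i\<in>I. x i \<in> L) \<and> (\<forall>\<sigma>\<in>G. \<forall>i\<in>I. \<sigma> (x i) = x (\<alpha> \<sigma> i)) \<and> x a \<noteq> x b"
proof -
  \<comment> \<open>The coefficients of \<open>x a - x b\<close> as a combination of automorphisms;
    the value at \<open>\<sigma>0\<close> is 1.\<close>
  define \<epsilon> :: "('w \<Rightarrow> 'w) \<Rightarrow> 'w" where "\<epsilon> g = (if \<alpha> g a = a then 1 else 0) - (if \<alpha> g a = b then 1 else 0)" for g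
  have "\<epsilon> \<sigma>0 \<noteq> 0" using base by (simp add: \<epsilon>_def)
  then obtain z where z: "z \<in> L" "(\<Sum>g\<in>G. \<epsilon> g * g z) \<noteq> 0" using linear_independence base by blast
  define x where "x i = (\<Sum>g\<in>{g \<in> G. \<alpha> g a = i}. g z)" for i
  have if_sum: "(\<Sum>g\<in>G. (if \<alpha> g a = i then 1 else 0) * g z) = x i" for i
    unfolding x_def sum.inter_filter[OF fin] by (intro sum.cong) auto
  have "(\<Sum>g\<in>G. \<epsilon> g * g z) = x a - x b"
    unfolding \<epsilon>_def left_diff_distrib sum_subtractf if_sum ..
  then have "x a \<noteq> x b" using z by auto
  moreover have "x i \<in> L" for i unfolding x_def using z L in_L by (intro subfield_sum) auto
  moreover have "\<sigma> (x i) = x (\<alpha> \<sigma> i)" if s: "\<sigma> \<in> G" and i: "i \<in> I" for \<sigma> i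
  proof -
    interpret subfield_hom L \<sigma> by (rule hom[OF s])
    have bij: "bij_betw (\<lambda>g. \<sigma> \<otimes>\<^bsub>galois_group M L\<^esub> g) {g \<in> G. \<alpha> g a = i} {g \<in> G. \<alpha> g a = \<alpha> \<sigma> i}"
    proof (rule bij_betwI')
      show "(\<sigma> \<otimes>\<^bsub>galois_group M L\<^esub> g = \<sigma> \<otimes>\<^bsub>galois_group M L\<^esub> h) = (g = h)"
        if "g \<in> {g \<in> G. \<alpha> g a = i}" "h \<in> {g \<in> G. \<alpha> g a = i}" for g h using that s by auto
      show "\<sigma> \<otimes>\<^bsub>galois_group M L\<^esub> g \<in> {g \<in> G. \<alpha> g a = \<alpha> \<sigma> i}" if "g \<in> {g \<in> G. \<alpha> g a = i}" for g
        using that s act base by auto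
      fix h assume h: "h \<in> {g \<in> G. \<alpha> g a = \<alpha> \<sigma> i}"
      then obtain g where g: "g \<in> G" "h = \<sigma> \<otimes>\<^bsub>galois_group M L\<^esub> g"
        using bij_mult[OF s] unfolding bij_betw_def by blast
      then have "\<alpha> \<sigma> (\<alpha> g a) = \<alpha> \<sigma> i" using h act s base by auto
      then have "\<alpha> g a = i" using act(2)[OF s] act(1)[OF g(1) base(1)] i by (auto dest: inj_onD)
      then show "\<exists>g\<in>{g \<in> G. \<alpha> g a = i}. h = \<sigma> \<otimes>\<^bsub>galois_group M L\<^esub> g" using g by auto
    qed
    have "\<sigma> (x i) = (\<Sum>g\<in>{g \<in> G. \<alpha> g a = i}. (\<sigma> \<otimes>\<^bsub>galois_group M L\<^esub> g) z)"
      unfolding x_def using z in_L s by (subst sum) (auto simp: mult_apply)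
    also have "\<dots> = x (\<alpha> \<sigma> i)" unfolding x_def by (rule sum.reindex_bij_betw[OF bij, of "\<lambda>g. g z"])
    finally show ?thesis .
  qed
  ultimately show ?thesis by blast
qed

end

section \<open>Generators of cubic and quadratic subextensions\<close>

lemma cubic_discriminant:
  assumes "cubic_roots p q x"
  shows "((x 1 - x 2) * (x 1 - x 3) * (x 2 - x 3)) ^ 2 = - 4 * p ^ 3 - 27 * q ^ 2"
proof -
  have "((a - b) * (a - (- a - b)) * (b - (- a - b))) ^ 2 =
      - 4 * (a * b + a * (- a - b) + b * (- a - b)) ^ 3 - 27 * (- (a * b * (- a - b))) ^ 2" for a b :: 'a
    by (simp add: algebra_simps power2_eq_square power3_eq_cube)
  from this[of "x 1" "x 2", folded cubic_rootsD(4)[OF assms]] show ?thesis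
    unfolding cubic_rootsD(2,3)[OF assms] by simp
qed

text \<open>The root \<open>y 1\<close> determines the parameter through
  \<open>t (y^2 + y) = y^3 - 3 y - 1\<close>. The right-hand side contains
  \<open>y^2 + y + 1\<close>, whose zeros are the fixed points of
  \<open>y \<mapsto> - 1 / (1 + y)\<close>; the square of \<open>t^2 + 3 t + 9\<close> is the
  discriminant of Shanks' cubic.\<close>

lemma shanks_discriminant:
  assumes y: "shanks_roots t y"
  shows "(t ^ 2 + 3 * t + 9) * (y 1 ^ 2 + y 1) ^ 2 = (y 1 ^ 2 + y 1 + 1) ^ 3"
proof -
  have "(y 1 - y 1) * (y 1 - y 2) * (y 1 - y 3) = 0" by simp
  then have "y 1 ^ 3 - t * y 1 ^ 2 - (t + 3) * y 1 - 1 = 0"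
    unfolding cubic_expand shanks_roots_symmetric[OF y] shanks_rootsD(5)[OF y] by (simp add: algebra_simps)
  then have t: "t * (y 1 ^ 2 + y 1) = y 1 ^ 3 - 3 * y 1 - 1"
    by (simp add: algebra_simps)
  have *: "(t ^ 2 + 3 * t + 9) * u ^ 2 = (t * u) ^ 2 + 3 * (t * u) * u + 9 * u ^ 2" for u
    by (simp add: algebra_simps power2_eq_square)
  have "(t ^ 2 + 3 * t + 9) * (y 1 ^ 2 + y 1) ^ 2 =
      (y 1 ^ 3 - 3 * y 1 - 1) ^ 2 + 3 * (y 1 ^ 3 - 3 * y 1 - 1) * (y 1 ^ 2 + y 1) + 9 * (y 1 ^ 2 + y 1) ^ 2"
    unfolding * t ..
  also have "\<dots> = (y 1 ^ 2 + y 1 + 1) ^ 3"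
    by (simp add: algebra_simps power2_eq_square power3_eq_cube)
  finally show ?thesis .
qed

lemma shanks_inj:
  assumes y: "shanks_roots t y" and d: "t ^ 2 + 3 * t + 9 \<noteq> 0"
  shows "inj_on y {1..3}"
proof -
  \<comment> \<open>Two neighbours coincide only at a fixed point of the transformation, which
    forces \<open>t^2 + 3 t + 9 = 0\<close>. Rotation reduces the other pairs to this one.\<close>
  have *: "z 1 \<noteq> z 2" if z: "shanks_roots t z" for z
  proof
    assume "z 1 = z 2"
    then have eq: "z 1 = - 1 / (1 + z 1)" using shanks_rootsD(3)[OF z] by simp
    have n: "1 + z 1 \<noteq> 0" using shanks_rootsD(2)[OF z] by (auto simp: add_eq_0_iff)
    have "z 1 * (1 + z 1) = - 1" by (subst (1) eq) (use n in simp)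
    then have "z 1 ^ 2 + z 1 + 1 = 0" by (simp add: algebra_simps power2_eq_square)
    moreover have "(z 1 ^ 2 + z 1) ^ 2 \<noteq> 0"
      using shanks_rootsD(1)[OF z] n by (simp add: power2_eq_square flip: distrib_left[of "z 1" "z 1" 1, simplified])
        (metis mult_eq_0_iff distrib_left mult.right_neutral add.commute)
    ultimately show False using shanks_discriminant[OF z] d by simp
  qed
  have "y 1 \<noteq> y 2" "y 2 \<noteq> y 3" "y 3 \<noteq> y 1"
    using *[OF y] *[OF shanks_roots_rotate[OF y, of 1]] *[OF shanks_roots_rotate[OF y, of 2]]
    by (simp_all add: C3_cases)
  then show ?thesis unfolding atLeastAtMost_13 by (auto simp: inj_on_def)
qed

text \<open>Completing the cube in Shanks' polynomial.\<close>

lemma shanks_cubic_roots: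
  assumes y: "shanks_roots t y"
  shows "cubic_roots (- 3 * (t ^ 2 + 3 * t + 9)) (- ((2 * t + 3) * (t ^ 2 + 3 * t + 9))) (\<lambda>i. 3 * y i - t)"
proof -
  have 1: "(3 * a - t) + (3 * b - t) + (3 * c - t) = 3 * (a + b + c) - 3 * t"
    "(3 * a - t) * (3 * b - t) + (3 * a - t) * (3 * c - t) + (3 * b - t) * (3 * c - t) =
      9 * (a * b + a * c + b * c) - 6 * t * (a + b + c) + 3 * t ^ 2"
    "(3 * a - t) * (3 * b - t) * (3 * c - t) =
      27 * (a * b * c) - 9 * t * (a * b + a * c + b * c) + 3 * t ^ 2 * (a + b + c) - t ^ 3" for a b c :: 'a
    by (simp_all add: algebra_simps power2_eq_square power3_eq_cube)
  show ?thesis unfolding cubic_roots_def 1 shanks_roots_symmetric[OF y] shanks_rootsD(5)[OF y]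
    by (simp add: algebra_simps power2_eq_square power3_eq_cube)
qed

context finite_galois
begin

lemma orbit_zero:
  assumes trans: "\<And>i. i \<in> I \<Longrightarrow> \<exists>\<sigma>\<in>G. \<alpha> \<sigma> a = i" and a: "a \<in> I"
    and r: "\<And>i. i \<in> I \<Longrightarrow> r i \<in> L" "\<And>\<sigma> i. \<sigma> \<in> G \<Longrightarrow> i \<in> I \<Longrightarrow> \<sigma> (r i) = r (\<alpha> \<sigma> i)"
    and ij: "i \<in> I" "r i = 0" "j \<in> I"
  shows "r j = 0"
proof -
  obtain \<sigma> \<tau> where st: "\<sigma> \<in> G" "\<alpha> \<sigma> a = i" "\<tau> \<in> G" "\<alpha> \<tau> a = j" using trans ij by blast
  have "\<sigma> (r a) = 0" using r(2)[OF st(1) a] st ij by simp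
  then have "r a = 0" using subfield_hom.eq_0_iff[OF hom[OF st(1)] r(1)[OF a]] by simp
  then show "r j = 0" using r(2)[OF st(3) a] st subfield_hom.zero[OF hom[OF st(3)]] by simp
qed

text \<open>The nonzero second symmetric function is what both normal forms depend on: it is the
  linear coefficient to be rescaled for \<open>S3\<close>, and for \<open>C 3\<close> it yields
  \<open>t^2 + 3 t + 9 \<noteq> 0\<close>.\<close>

lemma trace_zero_triple:
  assumes act: "\<forall>\<sigma>\<in>G. \<forall>i\<in>{1..3}. \<alpha> \<sigma> i \<in> {1..3::nat}" "\<forall>\<sigma>\<in>G. inj_on (\<alpha> \<sigma>) {1..3}"
      "\<forall>\<sigma>\<in>G. \<forall>\<tau>\<in>G. \<forall>i\<in>{1..3}. \<alpha> (\<sigma> \<otimes>\<^bsub>galois_group M L\<^esub> \<tau>) i = \<alpha> \<sigma> (\<alpha> \<tau> i)"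
    and trans: "\<forall>i\<in>{1..3}. \<exists>\<sigma>\<in>G. \<alpha> \<sigma> 1 = i"
    and char: "(3::'w) \<noteq> 0"
  shows "\<exists>p. (\<forall>i\<in>{1..3}. p i \<in> L) \<and> (\<forall>\<sigma>\<in>G. \<forall>i\<in>{1..3}. \<sigma> (p i) = p (\<alpha> \<sigma> i)) \<and>
    p 1 + p 2 + p 3 = 0 \<and> p 1 * p 2 + p 1 * p 3 + p 2 * p 3 \<noteq> 0 \<and> (\<forall>i\<in>{1..3}. p i \<noteq> 0)"
proof -
  have 13: "1 \<in> {1..3::nat}" "2 \<in> {1..3::nat}" "3 \<in> {1..3::nat}" by auto
  obtain \<sigma>0 where s0: "\<sigma>0 \<in> G" "\<alpha> \<sigma>0 1 = 1" using trans 13 by blast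
  have "\<exists>x. (\<forall>i\<in>{1..3}. x i \<in> L) \<and> (\<forall>\<sigma>\<in>G. \<forall>i\<in>{1..3}. \<sigma> (x i) = x (\<alpha> \<sigma> i)) \<and> x 1 \<noteq> x 2"
    by (rule partial_traces[of "{1..3}" \<alpha> 1 2 \<sigma>0]) (blast intro: act[rule_format] 13 s0 | simp)+
  then obtain x where x: "\<forall>i\<in>{1..3}. x i \<in> L" "\<forall>\<sigma>\<in>G. \<forall>i\<in>{1..3}. \<sigma> (x i) = x (\<alpha> \<sigma> i)" "x 1 \<noteq> x 2"
    by blast
  define T where "T = (\<Sum>j\<in>{1..3}. x j)"
  have TL: "T \<in> L" unfolding T_def using x L by (intro subfield_sum) auto
  have T: "\<sigma> T = T" if s: "\<sigma> \<in> G" for \<sigma>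
  proof -
    have bij: "bij_betw (\<alpha> \<sigma>) {1..3} {1..3}"
    proof -
      have "\<alpha> \<sigma> ` {1..3} \<subseteq> {1..3}" "inj_on (\<alpha> \<sigma>) {1..3}" using act(1,2) s by blast+
      then show ?thesis by (simp add: bij_betw_def endo_inj_surj)
    qed
    have "\<sigma> T = (\<Sum>j\<in>{1..3}. x (\<alpha> \<sigma> j))"
      unfolding T_def using x s by (subst subfield_hom.sum[OF hom[OF s]]) auto
    also have "\<dots> = T" unfolding T_def by (rule sum.reindex_bij_betw[OF bij])
    finally show ?thesis .
  qed
  have nonzero: "\<forall>i\<in>{1..3}. p i \<noteq> 0"
    if p: "\<forall>i\<in>{1..3}. p i \<in> L" "\<forall>\<sigma>\<in>G. \<forall>i\<in>{1..3}. \<sigma> (p i) = p (\<alpha> \<sigma> i)" "\<exists>i\<in>{1..3}. p i \<noteq> 0" for p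
  proof (intro ballI notI)
    fix j assume j: "j \<in> {1..3}" "p j = 0"
    obtain i where i: "i \<in> {1..3}" "p i \<noteq> 0" using p(3) by blast
    have "p i = 0"
      by (rule orbit_zero[of "{1..3}" \<alpha> 1 p j i]) (use trans p(1,2) 13 i j in blast)+
    with i show False by simp
  qed
  \<comment> \<open>Three times the deviation from the mean; this has trace zero and, as 3 is
    nonzero, keeps \<open>q 1\<close> and \<open>q 2\<close> distinct.\<close>
  define q where "q i = 3 * x i - T" for i
  have q: "\<forall>i\<in>{1..3}. q i \<in> L" "\<forall>\<sigma>\<in>G. \<forall>i\<in>{1..3}. \<sigma> (q i) = q (\<alpha> \<sigma> i)"
  proof -
    show "\<forall>i\<in>{1..3}. q i \<in> L" unfolding q_def using x TL L
      by (auto intro!: subfield_diff subfield_mult subfield_numeral)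
    show "\<forall>\<sigma>\<in>G. \<forall>i\<in>{1..3}. \<sigma> (q i) = q (\<alpha> \<sigma> i)"
    proof (intro ballI)
      fix \<sigma> i assume s: "\<sigma> \<in> G" and i: "i \<in> {1..3::nat}"
      interpret subfield_hom L \<sigma> by (rule hom[OF s])
      have "x i \<in> L" using x i by auto
      then show "\<sigma> (q i) = q (\<alpha> \<sigma> i)" unfolding q_def using x(2) s i TL T[OF s] L
        by (simp add: diff mult numeral subfield_mult subfield_numeral)
    qed
  qed
  have sum0: "q 1 + q 2 + q 3 = 0" unfolding q_def T_def atLeastAtMost_13 by simp
  have neq: "q 1 \<noteq> q 2" using x(3) char by (simp add: q_def)
  then have "\<exists>i\<in>{1..3}. q i \<noteq> 0" using 13 by metis
  then have q0: "\<forall>i\<in>{1..3}. q i \<noteq> 0" using nonzero q by blast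
  show ?thesis
  proof (cases "q 1 * q 2 + q 1 * q 3 + q 2 * q 3 = 0")
    case False
    then show ?thesis using q sum0 q0 by blast
  next
    case e2: True
    \<comment> \<open>When the trace and the second symmetric function of the \<open>q i\<close>
      both vanish, \<open>q + q^2\<close> still has trace zero, and its second symmetric function is
      \<open>- 3\<close> times the product of the \<open>q i\<close>, which is nonzero.\<close>
    define p where "p i = q i + q i ^ 2" for i
    have pL: "\<forall>i\<in>{1..3}. p i \<in> L" unfolding p_def using q(1) L
      by (auto intro!: subfield_add subfield_power)
    have ps: "\<forall>\<sigma>\<in>G. \<forall>i\<in>{1..3}. \<sigma> (p i) = p (\<alpha> \<sigma> i)"
    proof (intro ballI)
      fix \<sigma> i assume s: "\<sigma> \<in> G" and i: "i \<in> {1..3::nat}"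
      interpret subfield_hom L \<sigma> by (rule hom[OF s])
      have "q i \<in> L" using q i by auto
      then show "\<sigma> (p i) = p (\<alpha> \<sigma> i)" unfolding p_def using q(2) s i L
        by (simp add: add power subfield_power)
    qed
    have q3: "q 3 = - q 1 - q 2" using minus_unique[OF sum0] by simp
    have id1: "(a + a^2) + (b + b^2) + (c + c^2) = (a + b + c) + (a + b + c)^2 - 2 * (a * b + a * c + b * c)"
      and id2: "(a + a^2) * (b + b^2) + (a + a^2) * (c + c^2) + (b + b^2) * (c + c^2) =
        (a * b + a * c + b * c) + (a + b + c) * (a * b + a * c + b * c) - 3 * (a * b * c)
        + (a * b + a * c + b * c)^2 - 2 * (a + b + c) * (a * b * c)" for a b c :: 'w
      by (simp_all add: algebra_simps power2_eq_square)
    have "p 1 + p 2 + p 3 = 0" unfolding p_def id1 sum0 e2 by simp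
    moreover have "p 1 * p 2 + p 1 * p 3 + p 2 * p 3 \<noteq> 0"
      unfolding p_def id2 sum0 e2 using q0 char by simp
    moreover have "\<exists>i\<in>{1..3}. p i \<noteq> 0"
    proof (rule ccontr)
      assume "\<not> (\<exists>i\<in>{1..3}. p i \<noteq> 0)"
      then have "p 1 = 0" "p 2 = 0" using 13 by blast+
      with calculation show False by simp
    qed
    ultimately show ?thesis using pL ps nonzero[OF pL ps] by blast
  qed
qed

text \<open>Multiplying the roots of \<open>X^3 + P X + Q\<close> by \<open>P / Q\<close> makes both
  coefficients equal to \<open>P^3 / Q^2\<close>. Hence every cubic with trace zero and nonzero
  \<open>P\<close> and \<open>Q\<close> is brought to the form \<open>X^3 + a X + a\<close>.\<close>

lemma S3_generator:
  assumes \<rho>: "\<rho> \<in> Group.hom (galois_group M L) S3" "\<rho> ` G = carrier S3" and char: "(3::'w) \<noteq> 0"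
  obtains a x where "a \<in> M" "a \<noteq> 0" "4 * a + 27 \<noteq> 0" "cubic_roots a a x" "\<forall>i\<in>{1..3}. x i \<in> L"
    "\<forall>\<sigma>\<in>G. \<forall>i\<in>{1..3}. \<sigma> (x i) = x (\<rho> \<sigma> i)" "inj_on x {1..3}"
proof -
  have 13: "1 \<in> {1..3::nat}" "2 \<in> {1..3::nat}" "3 \<in> {1..3::nat}" by auto
  have perm: "\<rho> \<sigma> permutes {1..3}" if "\<sigma> \<in> G" for \<sigma>
    using \<rho>(2) that sym_group_carrier by blast
  have surj: "\<exists>\<sigma>\<in>G. \<rho> \<sigma> = h" if "h permutes {1..3}" for h
    using \<rho>(2) that sym_group_carrier by (metis imageE)
  have mult: "\<rho> (\<sigma> \<otimes>\<^bsub>galois_group M L\<^esub> \<tau>) i = \<rho> \<sigma> (\<rho> \<tau> i)" if "\<sigma> \<in> G" "\<tau> \<in> G" for \<sigma> \<tau> i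
    using hom_mult[OF \<rho>(1) that] by (simp add: sym_group_mult)
  have trans: "\<forall>i\<in>{1..3}. \<exists>\<sigma>\<in>G. \<rho> \<sigma> 1 = i"
  proof
    fix i :: nat assume i: "i \<in> {1..3}"
    obtain \<sigma> where "\<sigma> \<in> G" "\<rho> \<sigma> = transpose 1 i" using surj[OF permutes_swap_id[OF 13(1) i]] by blast
    then show "\<exists>\<sigma>\<in>G. \<rho> \<sigma> 1 = i" by (intro bexI[of _ \<sigma>]) simp_all
  qed
  have act: "\<forall>\<sigma>\<in>G. \<forall>i\<in>{1..3}. \<rho> \<sigma> i \<in> {1..3}" "\<forall>\<sigma>\<in>G. inj_on (\<rho> \<sigma>) {1..3}"
      "\<forall>\<sigma>\<in>G. \<forall>\<tau>\<in>G. \<forall>i\<in>{1..3}. \<rho> (\<sigma> \<otimes>\<^bsub>galois_group M L\<^esub> \<tau>) i = \<rho> \<sigma> (\<rho> \<tau> i)"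
    using permutes_in_image[OF perm] permutes_inj_on[OF perm] mult by blast+
  obtain p where p: "\<forall>i\<in>{1..3}. p i \<in> L" "\<forall>\<sigma>\<in>G. \<forall>i\<in>{1..3}. \<sigma> (p i) = p (\<rho> \<sigma> i)"
    "p 1 + p 2 + p 3 = 0" "p 1 * p 2 + p 1 * p 3 + p 2 * p 3 \<noteq> 0" "\<forall>i\<in>{1..3}. p i \<noteq> 0"
    using trace_zero_triple[OF act trans char] by blast
  define P where "P = p 1 * p 2 + p 1 * p 3 + p 2 * p 3"
  define Q where "Q = - (p 1 * p 2 * p 3)"
  have PQ: "P \<noteq> 0" "Q \<noteq> 0" using p(4,5) 13 by (auto simp: P_def Q_def)
  have pc: "cubic_roots P Q p" using p(3) by (simp add: cubic_roots_def P_def Q_def)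
  have pL: "p 1 \<in> L" "p 2 \<in> L" "p 3 \<in> L" using p(1) 13 by blast+
  have PQM: "P \<in> M" "Q \<in> M"
  proof -
    have "P \<in> L" "Q \<in> L" unfolding P_def Q_def using pL L
      by (auto intro!: subfield_add subfield_mult subfield_uminus)
    moreover have "\<sigma> P = P \<and> \<sigma> Q = Q" if s: "\<sigma> \<in> G" for \<sigma>
    proof -
      interpret subfield_hom L \<sigma> by (rule hom[OF s])
      have ps: "\<sigma> (p 1) = p (\<rho> \<sigma> 1)" "\<sigma> (p 2) = p (\<rho> \<sigma> 2)" "\<sigma> (p 3) = p (\<rho> \<sigma> 3)"
        using p(2) s 13 by blast+
      have "cubic_roots P Q (p \<circ> \<rho> \<sigma>)" by (rule cubic_roots_permute[OF pc perm[OF s]])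
      then show ?thesis using pL L ps unfolding cubic_roots_def
        by (simp add: P_def Q_def add mult uminus subfield_add subfield_mult)
    qed
    ultimately show "P \<in> M" "Q \<in> M" using fixed by blast+
  qed
  define c where "c = P / Q"
  define a where "a = P ^ 3 / Q ^ 2"
  define x where "x i = c * p i" for i
  have c0: "c \<noteq> 0" and cM: "c \<in> M" using PQ PQM M by (auto simp: c_def intro: subfield_divide)
  have aM: "a \<in> M" unfolding a_def using PQM M by (intro subfield_divide subfield_power)
  have a0: "a \<noteq> 0" using PQ by (simp add: a_def)
  have "x 1 + x 2 + x 3 = c * (p 1 + p 2 + p 3)"
    "x 1 * x 2 + x 1 * x 3 + x 2 * x 3 = c ^ 2 * P" "x 1 * x 2 * x 3 = - (c ^ 3 * Q)"
    by (simp_all add: x_def P_def Q_def algebra_simps power2_eq_square power3_eq_cube)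
  moreover have "c ^ 2 * P = a" "c ^ 3 * Q = a"
    using PQ by (simp_all add: c_def a_def field_simps power2_eq_square power3_eq_cube)
  ultimately have xa: "cubic_roots a a x" using p(3) by (simp add: cubic_roots_def)
  have xL: "\<forall>i\<in>{1..3}. x i \<in> L" using p(1) cM MsubL L by (auto simp: x_def intro!: subfield_mult)
  have xs: "\<forall>\<sigma>\<in>G. \<forall>i\<in>{1..3}. \<sigma> (x i) = x (\<rho> \<sigma> i)"
  proof (intro ballI)
    fix \<sigma> i assume s: "\<sigma> \<in> G" and i: "i \<in> {1..3::nat}"
    interpret subfield_hom L \<sigma> by (rule hom[OF s])
    show "\<sigma> (x i) = x (\<rho> \<sigma> i)" unfolding x_def
      using mult[of c "p i"] cM MsubL p(1,2) i s galois_fix[OF s cM] by (auto simp: subset_iff)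
  qed
  have inj: "inj_on x {1..3}"
  proof -
    \<comment> \<open>A 3-cycle. If two roots coincided, applying it would make all three equal, and
      trace zero would give \<open>3 * x 1 = 0\<close>.\<close>
    define r :: "nat \<Rightarrow> nat" where "r = transpose 1 2 \<circ> transpose 2 3"
    have r: "r permutes {1..3}" unfolding r_def using 13
      by (intro permutes_compose permutes_swap_id)
    have r123: "r 1 = 2" "r 2 = 3" "r 3 = 1" by (simp_all add: r_def transpose_def)
    obtain \<sigma> where s: "\<sigma> \<in> G" "\<rho> \<sigma> = r" using surj[OF r] by blast
    have sx: "\<sigma> (x 1) = x 2" "\<sigma> (x 2) = x 3" "\<sigma> (x 3) = x 1"
      using xs[rule_format, OF s(1) 13(1)] xs[rule_format, OF s(1) 13(2)] xs[rule_format, OF s(1) 13(3)]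
      by (simp_all add: s(2) r123)
    have "x 1 \<noteq> 0" using c0 p(5) 13 by (simp add: x_def)
    moreover have "x 1 + x 1 + x 1 = 3 * x 1" by simp
    ultimately have "\<not> (x 1 = x 2 \<and> x 2 = x 3)" using char cubic_rootsD(1)[OF xa] by auto
    then have "x 1 \<noteq> x 2" "x 2 \<noteq> x 3" "x 3 \<noteq> x 1" using sx by metis+
    then show ?thesis unfolding atLeastAtMost_13 by (auto simp: inj_on_def)
  qed
  \<comment> \<open>The discriminant of \<open>X^3 + a X + a\<close> is
    \<open>- a^2 (4 a + 27)\<close>, and the roots are distinct.\<close>
  have "4 * a + 27 \<noteq> 0"
  proof
    assume "4 * a + 27 = 0"
    then have "- (a ^ 2) * (4 * a + 27) = 0" by simp
    then have "- 4 * a ^ 3 - 27 * a ^ 2 = 0" by (simp add: algebra_simps power2_eq_square power3_eq_cube)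
    then have "((x 1 - x 2) * (x 1 - x 3) * (x 2 - x 3)) ^ 2 = 0"
      using cubic_discriminant[OF xa] by simp
    then show False using inj_onD[OF inj, of 1 2] inj_onD[OF inj, of 1 3] inj_onD[OF inj, of 2 3] by auto
  qed
  with aM a0 xa xL xs inj show thesis by (intro that)
qed

text \<open>Ratios of consecutive members of a trace-zero triple form an orbit of the
  transformation: \<open>1 + p 1 / p 2 = - p 3 / p 2\<close>, so
  \<open>- 1 / (1 + p 1 / p 2) = p 2 / p 3\<close>.\<close>

lemma C3_generator:
  assumes \<rho>: "\<rho> \<in> Group.hom (galois_group M L) (C 3)" "\<rho> ` G = carrier (C 3)" and char: "(3::'w) \<noteq> 0"
  obtains t y where "t \<in> M" "shanks_roots t y" "t ^ 2 + 3 * t + 9 \<noteq> 0" "2 * t + 3 \<noteq> 0" "\<forall>i\<in>{1..3}. y i \<in> L"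
    "\<forall>\<sigma>\<in>G. \<forall>i\<in>{1..3}. \<sigma> (y i) = y (rot (\<rho> \<sigma>) i)" "inj_on y {1..3}"
proof -
  have 13: "1 \<in> {1..3::nat}" "2 \<in> {1..3::nat}" "3 \<in> {1..3::nat}" by auto
  have cases: "\<rho> \<sigma> = 0 \<or> \<rho> \<sigma> = 1 \<or> \<rho> \<sigma> = 2" if "\<sigma> \<in> G" for \<sigma>
    using \<rho>(2) that C3_cases by blast
  have surj: "\<exists>\<sigma>\<in>G. \<rho> \<sigma> = c" if "c \<in> carrier (C 3)" for c
    using \<rho>(2) that by (metis imageE)
  have mult: "rot (\<rho> (\<sigma> \<otimes>\<^bsub>galois_group M L\<^esub> \<tau>)) i = rot (\<rho> \<sigma>) (rot (\<rho> \<tau>) i)"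
    if "\<sigma> \<in> G" "\<tau> \<in> G" "i \<in> {1..3}" for \<sigma> \<tau> i
  proof -
    have "\<rho> (\<sigma> \<otimes>\<^bsub>galois_group M L\<^esub> \<tau>) = (\<rho> \<sigma> + \<rho> \<tau>) mod 3"
      using hom_mult[OF \<rho>(1) that(1,2)] by simp
    then show ?thesis using cases[OF that(1)] cases[OF that(2)] that(3) unfolding atLeastAtMost_13
      by (elim disjE insertE emptyE) simp_all
  qed
  have rin: "rot (\<rho> \<sigma>) i \<in> {1..3}" if "\<sigma> \<in> G" "i \<in> {1..3}" for \<sigma> i
    using cases[OF that(1)] that(2) unfolding atLeastAtMost_13 by (elim disjE insertE emptyE) simp_all
  have rinj: "inj_on (rot (\<rho> \<sigma>)) {1..3}" if "\<sigma> \<in> G" for \<sigma>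
    using cases[OF that] unfolding atLeastAtMost_13 by (elim disjE) (simp_all add: inj_on_def)
  have trans: "\<forall>i\<in>{1..3}. \<exists>\<sigma>\<in>G. rot (\<rho> \<sigma>) 1 = i"
  proof
    fix i :: nat assume i: "i \<in> {1..3}"
    have "\<exists>c\<in>carrier (C 3). rot c 1 = i"
      using i unfolding atLeastAtMost_13 by (elim insertE emptyE) (auto simp: C3_cases Bex_def)
    then show "\<exists>\<sigma>\<in>G. rot (\<rho> \<sigma>) 1 = i" using surj by blast
  qed
  have act: "\<forall>\<sigma>\<in>G. \<forall>i\<in>{1..3}. rot (\<rho> \<sigma>) i \<in> {1..3}" "\<forall>\<sigma>\<in>G. inj_on (rot (\<rho> \<sigma>)) {1..3}"
      "\<forall>\<sigma>\<in>G. \<forall>\<tau>\<in>G. \<forall>i\<in>{1..3}. rot (\<rho> (\<sigma> \<otimes>\<^bsub>galois_group M L\<^esub> \<tau>)) i = rot (\<rho> \<sigma>) (rot (\<rho> \<tau>) i)"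
    using rin rinj mult by blast+
  obtain p where p: "\<forall>i\<in>{1..3}. p i \<in> L" "\<forall>\<sigma>\<in>G. \<forall>i\<in>{1..3}. \<sigma> (p i) = p (rot (\<rho> \<sigma>) i)"
    "p 1 + p 2 + p 3 = 0" "p 1 * p 2 + p 1 * p 3 + p 2 * p 3 \<noteq> 0" "\<forall>i\<in>{1..3}. p i \<noteq> 0"
    using trace_zero_triple[OF act trans char] by blast
  have p0: "p 1 \<noteq> 0" "p 2 \<noteq> 0" "p 3 \<noteq> 0" using p(5) 13 by blast+
  have pL: "p 1 \<in> L" "p 2 \<in> L" "p 3 \<in> L" using p(1) 13 by blast+
  define y where "y i = p i / p (rot 1 i)" for i
  define t where "t = y 1 + y 2 + y 3"
  have yy: "y 1 = p 1 / p 2" "y 2 = p 2 / p 3" "y 3 = p 3 / p 1" by (simp_all add: y_def)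
  have p3: "p 3 = - (p 1 + p 2)" using minus_unique[OF p(3)] by simp
  then have n: "p 1 + p 2 \<noteq> 0" using p0(3) by (metis neg_equal_0_iff_equal)
  have y: "shanks_roots t y" unfolding shanks_roots_def t_def yy
  proof (intro conjI refl)
    have pe: "p 2 + p 1 = - p 3" "p 3 + p 2 = - p 1" using p3 by simp_all
    have p1: "1 + p 1 / p 2 = - p 3 / p 2" "1 + p 2 / p 3 = - p 1 / p 3"
      unfolding pe[symmetric] using p0 by (simp_all add: add_divide_distrib)
    show "p 1 / p 2 \<noteq> 0" using p0 by simp
    show "p 1 / p 2 \<noteq> - 1" using p1(1) p0 by auto
    show "p 2 / p 3 = - 1 / (1 + p 1 / p 2)" "p 3 / p 1 = - 1 / (1 + p 2 / p 3)"
      unfolding p1 using p0 by simp_all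
  qed
  have yL: "y 1 \<in> L" "y 2 \<in> L" "y 3 \<in> L" unfolding yy using pL L by (auto intro: subfield_divide)
  have yL': "\<forall>i\<in>{1..3}. y i \<in> L" unfolding ball_13 using yL by blast
  have ys: "\<forall>\<sigma>\<in>G. \<forall>i\<in>{1..3}. \<sigma> (y i) = y (rot (\<rho> \<sigma>) i)"
  proof (intro ballI)
    fix \<sigma> i assume s: "\<sigma> \<in> G" and i: "i \<in> {1..3::nat}"
    interpret subfield_hom L \<sigma> by (rule hom[OF s])
    have 1: "rot 1 i \<in> {1..3}" "rot (\<rho> \<sigma>) (rot 1 i) = rot 1 (rot (\<rho> \<sigma>) i)"
      using cases[OF s] i unfolding atLeastAtMost_13 by (elim disjE insertE emptyE; simp)+
    show "\<sigma> (y i) = y (rot (\<rho> \<sigma>) i)" unfolding y_def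
      using divide[OF p(1)[rule_format, OF i] p(1)[rule_format, OF 1(1)]]
        p(2)[rule_format, OF s i] p(2)[rule_format, OF s 1(1)] 1(2) by simp
  qed
  have tM: "t \<in> M"
  proof (rule fixed)
    show "t \<in> L" unfolding t_def using yL L by (intro subfield_add)
    fix \<sigma> assume s: "\<sigma> \<in> G"
    interpret subfield_hom L \<sigma> by (rule hom[OF s])
    have "\<rho> \<sigma> \<in> carrier (C 3)" using cases[OF s] C3_cases by blast
    from shanks_rootsD(5)[OF shanks_roots_rotate[OF y this]]
    show "\<sigma> t = t" using ys[rule_format, OF s 13(1)] ys[rule_format, OF s 13(2)]
        ys[rule_format, OF s 13(3)] yL L by (simp add: t_def add subfield_add)
  qed
  have d: "t ^ 2 + 3 * t + 9 \<noteq> 0"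
  proof
    assume "t ^ 2 + 3 * t + 9 = 0"
    then have "y 1 ^ 2 + y 1 + 1 = 0" using shanks_discriminant[OF y] by simp
    \<comment> \<open>This is where the nonzero second symmetric function of the triple is
      used.\<close>
    moreover have "y 1 ^ 2 + y 1 + 1 = - (p 1 * p 2 + p 1 * p 3 + p 2 * p 3) / p 2 ^ 2"
      unfolding yy p3 using p0 by (simp add: field_simps power2_eq_square)
    ultimately show False using p(4) p0(2) by (metis divide_eq_0_iff neg_equal_0_iff_equal power_eq_0_iff)
  qed
  have inj: "inj_on y {1..3}" by (rule shanks_inj[OF y d])
  \<comment> \<open>\<open>(2 t + 3) (t^2 + 3 t + 9)\<close> is the product of the elements
    \<open>3 * y i - t\<close>. If one of them vanished, all would by transitivity, and the
    \<open>y i\<close> would coincide.\<close>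
  have "2 * t + 3 \<noteq> 0"
  proof
    assume z: "2 * t + 3 = 0"
    define v where "v i = 3 * y i - t" for i
    have "v 1 * v 2 * v 3 = (2 * t + 3) * (t ^ 2 + 3 * t + 9)"
      using cubic_rootsD(3)[OF shanks_cubic_roots[OF y]] by (simp add: v_def)
    then have "v 1 = 0 \<or> v 2 = 0 \<or> v 3 = 0" using z by simp
    then obtain i where i: "i \<in> {1..3}" "v i = 0" using 13 by metis
    have vL: "v j \<in> L" if "j \<in> {1..3}" for j
      unfolding v_def using yL' that tM MsubL L by (intro subfield_diff subfield_mult subfield_numeral) auto
    have vs: "\<sigma> (v j) = v (rot (\<rho> \<sigma>) j)" if s: "\<sigma> \<in> G" and j: "j \<in> {1..3}" for \<sigma> j
    proof -
      interpret subfield_hom L \<sigma> by (rule hom[OF s])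
      have "y j \<in> L" "t \<in> L" using yL' j tM MsubL by auto
      then show ?thesis using ys[rule_format, OF s j] galois_fix[OF s tM] L
        by (simp add: v_def diff mult numeral subfield_mult subfield_numeral)
    qed
    have "v j = 0" if "j \<in> {1..3}" for j
      by (rule orbit_zero[of "{1..3}" "\<lambda>\<sigma>. rot (\<rho> \<sigma>)" 1 v i j]) (use trans 13 i that in \<open>blast intro: vL vs\<close>)+
    then have "3 * y 1 - t = 3 * y 2 - t" using 13 unfolding v_def by metis
    then have "y 1 = y 2" using char by simp
    then show False using inj_onD[OF inj, of 1 2] by auto
  qed
  with tM y d yL' ys inj show thesis by (intro that)
qed

text \<open>The difference of the two partial traces changes sign under the nontrivial class, so its
  square lies in \<open>M\<close>.\<close>

lemma C2_generator:
  assumes \<rho>: "\<rho> \<in> Group.hom (galois_group M L) (C 2)" "\<rho> ` G = carrier (C 2)" and char: "(2::'w) \<noteq> 0"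
  obtains d v where "d \<in> M" "d \<noteq> 0" "opposite_roots d v" "\<forall>i\<in>{1..2}. v i \<in> L"
    "\<forall>\<sigma>\<in>G. \<forall>i\<in>{1..2}. \<sigma> (v i) = v (flip (\<rho> \<sigma>) i)" "v 1 \<noteq> v 2"
proof -
  have 12: "1 \<in> {1..2::nat}" "2 \<in> {1..2::nat}" by auto
  have cases: "\<rho> \<sigma> = 0 \<or> \<rho> \<sigma> = 1" if "\<sigma> \<in> G" for \<sigma>
    using \<rho>(2) that C2_cases by blast
  have mult: "flip (\<rho> (\<sigma> \<otimes>\<^bsub>galois_group M L\<^esub> \<tau>)) i = flip (\<rho> \<sigma>) (flip (\<rho> \<tau>) i)"
    if "\<sigma> \<in> G" "\<tau> \<in> G" "i \<in> {1..2}" for \<sigma> \<tau> i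
  proof -
    have "\<rho> (\<sigma> \<otimes>\<^bsub>galois_group M L\<^esub> \<tau>) = (\<rho> \<sigma> + \<rho> \<tau>) mod 2"
      using hom_mult[OF \<rho>(1) that(1,2)] by simp
    then show ?thesis using cases[OF that(1)] cases[OF that(2)] that(3) unfolding atLeastAtMost_12
      by (elim disjE insertE emptyE) simp_all
  qed
  have fin: "flip (\<rho> \<sigma>) i \<in> {1..2}" if "\<sigma> \<in> G" "i \<in> {1..2}" for \<sigma> i
    using cases[OF that(1)] that(2) unfolding atLeastAtMost_12 by (elim disjE insertE emptyE) simp_all
  have finj: "inj_on (flip (\<rho> \<sigma>)) {1..2}" if "\<sigma> \<in> G" for \<sigma>
    using cases[OF that] unfolding atLeastAtMost_12 by (elim disjE) (simp_all add: inj_on_def)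
  obtain \<sigma>0 where s0: "\<sigma>0 \<in> G" "\<rho> \<sigma>0 = 0" using \<rho>(2) C2_cases by (metis imageE)
  have "\<exists>x. (\<forall>i\<in>{1..2}. x i \<in> L) \<and> (\<forall>\<sigma>\<in>G. \<forall>i\<in>{1..2}. \<sigma> (x i) = x (flip (\<rho> \<sigma>) i)) \<and> x 1 \<noteq> x 2"
    by (rule partial_traces[of "{1..2}" "\<lambda>\<sigma>. flip (\<rho> \<sigma>)" 1 2 \<sigma>0])
      (blast intro: fin finj mult 12 s0 | simp add: s0)+
  then obtain x where x: "\<forall>i\<in>{1..2}. x i \<in> L" "\<forall>\<sigma>\<in>G. \<forall>i\<in>{1..2}. \<sigma> (x i) = x (flip (\<rho> \<sigma>) i)" "x 1 \<noteq> x 2"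
    by blast
  define v where "v i = (if i = 1 then x 1 - x 2 else x 2 - x 1)" for i :: nat
  define d where "d = v 1 ^ 2"
  have v12: "v 1 = x 1 - x 2" "v 2 = x 2 - x 1" "v 2 = - v 1" by (simp_all add: v_def)
  have vL: "v 1 \<in> L" "v 2 \<in> L" unfolding v12 using x(1) 12 L by (auto intro!: subfield_diff)
  have vs: "\<sigma> (v 1) = v (flip (\<rho> \<sigma>) 1)" "\<sigma> (v 2) = v (flip (\<rho> \<sigma>) 2)" if s: "\<sigma> \<in> G" for \<sigma>
  proof -
    interpret subfield_hom L \<sigma> by (rule hom[OF s])
    have "x 1 \<in> L" "x 2 \<in> L" "\<sigma> (x 1) = x (flip (\<rho> \<sigma>) 1)" "\<sigma> (x 2) = x (flip (\<rho> \<sigma>) 2)"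
      using x 12 s by blast+
    then show "\<sigma> (v 1) = v (flip (\<rho> \<sigma>) 1)" "\<sigma> (v 2) = v (flip (\<rho> \<sigma>) 2)"
      using cases[OF s] by (auto simp: v_def diff)
  qed
  have "d \<in> M"
  proof (rule fixed)
    show "d \<in> L" unfolding d_def using vL L by (intro subfield_power)
    fix \<sigma> assume s: "\<sigma> \<in> G"
    interpret subfield_hom L \<sigma> by (rule hom[OF s])
    show "\<sigma> d = d" using cases[OF s] vs[OF s] vL v12(3) by (auto simp: d_def power)
  qed
  moreover have "v 1 \<noteq> 0" using x(3) by (simp add: v12)
  moreover have "v 1 \<noteq> v 2"
  proof
    assume "v 1 = v 2"
    then have "2 * v 1 = 0" using v12(3) by simp
    then show False using char \<open>v 1 \<noteq> 0\<close> by simp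
  qed
  ultimately show thesis using vL vs v12 unfolding atLeastAtMost_12
    by (intro that[of d v]) (auto simp: d_def opposite_roots_def atLeastAtMost_12)
qed

end

section \<open>The two families of sextics and their roots\<close>

text \<open>With the ratios of the roots known, \<open>p\<close> and \<open>q\<close> are a known
  multiple of \<open>y 1 ^ 2\<close> and of \<open>y 1 ^ 3\<close> respectively, so their quotient
  yields \<open>y 1\<close> itself.\<close>

lemma cubic_roots_in_subfield:
  assumes F: "is_subfield F" and y: "cubic_roots p q y" and pq: "p \<in> F" "q \<in> F" "p \<noteq> 0" "q \<noteq> 0"
    and r: "y 2 / y 1 \<in> F" "y 3 / y 1 \<in> F"
  shows "y ` {1..3} \<subseteq> F"
proof -
  define r2 r3 where "r2 = y 2 / y 1" and "r3 = y 3 / y 1"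
  have n: "y 1 \<noteq> 0" "y 2 \<noteq> 0" "y 3 \<noteq> 0" using cubic_rootsD(3)[OF y] pq by auto
  have y23: "y 2 = r2 * y 1" "y 3 = r3 * y 1" using n by (simp_all add: r2_def r3_def)
  have r0: "r2 \<noteq> 0" "r3 \<noteq> 0" using n by (simp_all add: r2_def r3_def)
  have q': "q = - (y 1 * y 2 * y 3)" using cubic_rootsD(3)[OF y] by simp
  have "y 1 * (p * (r2 * r3)) = - q * (r2 + r3 + r2 * r3)"
    unfolding q' cubic_rootsD(2)[OF y, symmetric] y23 by Groebner_Basis.algebra
  moreover have "p * (r2 * r3) \<noteq> 0" using pq r0 by simp
  ultimately have "y 1 = - q * (r2 + r3 + r2 * r3) / (p * (r2 * r3))"
    by (metis nonzero_mult_div_cancel_right)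
  then have 1: "y 1 \<in> F"
    using F pq r by (metis r2_def r3_def subfield_add subfield_divide subfield_mult subfield_uminus)
  have "y 2 \<in> F" "y 3 \<in> F" unfolding y23 by (intro subfield_mult F r[folded r2_def r3_def] 1)+
  with 1 show ?thesis unfolding image_13 by simp
qed

definition recip_deriv :: "'w::field \<Rightarrow> (nat \<Rightarrow> 'w) \<Rightarrow> nat \<Rightarrow> 'w" where
  "recip_deriv s x i = 1 / (3 * x i ^ 2 + s)"

text \<open>With \<open>D i\<close> the derivative at \<open>x i\<close>, the second symmetric
  function of the \<open>D i\<close> vanishes, which gives the reciprocals trace zero; the product
  of the \<open>D i\<close> is minus the discriminant, \<open>s^2 (4 s + 27) = s * A\<close>. The
  inverse formula comes from
  \<open>x i * (D i + 2 * s) = 3 * (x i ^ 3 + s * x i) = - 3 * s\<close>.\<close>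

lemma recip_deriv_roots:
  fixes s :: "'w::field"
  assumes x: "cubic_roots s s x" and s: "s \<noteq> 0" "4 * s + 27 \<noteq> 0" and char: "(3::'w) \<noteq> 0"
  defines "A \<equiv> s * (4 * s + 27)"
  shows "cubic_roots (- 3 / A) (- 1 / (s * A)) (recip_deriv s x)" (is ?c)
    and "i \<in> {1..3} \<Longrightarrow> x i = - 3 * s / (1 / recip_deriv s x i + 2 * s)"
proof -
  define D where "D i = 3 * x i ^ 2 + s" for i
  note e = cubic_rootsD(1-3)[OF x]
  have 1: "D 1 * D 2 * D 3 = s * A"
    unfolding D_def A_def using e by Groebner_Basis.algebra
  have 2: "D 1 * D 2 + D 1 * D 3 + D 2 * D 3 = 0"
    unfolding D_def A_def using e by Groebner_Basis.algebra
  have 3: "D 1 + D 2 + D 3 = - 3 * s"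
    unfolding D_def A_def using e by Groebner_Basis.algebra
  have "A \<noteq> 0" using s by (simp add: A_def)
  then have D0: "D 1 \<noteq> 0" "D 2 \<noteq> 0" "D 3 \<noteq> 0" using 1 s by auto
  have z: "recip_deriv s x i = 1 / D i" for i by (simp add: recip_deriv_def D_def)
  have "1 / D 1 + 1 / D 2 + 1 / D 3 = (D 1 * D 2 + D 1 * D 3 + D 2 * D 3) / (D 1 * D 2 * D 3)"
    using D0 by (simp add: field_simps)
  moreover have "1 / D 1 * (1 / D 2) + 1 / D 1 * (1 / D 3) + 1 / D 2 * (1 / D 3) = (D 1 + D 2 + D 3) / (D 1 * D 2 * D 3)"
    using D0 by (simp add: field_simps)
  moreover have "1 / D 1 * (1 / D 2) * (1 / D 3) = 1 / (D 1 * D 2 * D 3)" by simp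
  ultimately show ?c unfolding cubic_roots_def z 1 2 3 using s by (simp add: field_simps)
  show "x i = - 3 * s / (1 / recip_deriv s x i + 2 * s)" if i: "i \<in> {1..3}"
  proof -
    have "x i ^ 3 + s * x i + s = 0" using cubic_roots_iff[OF x] i by blast
    then have *: "x i * (D i + 2 * s) = - 3 * s" unfolding D_def by Groebner_Basis.algebra
    moreover have "- 3 * s \<noteq> 0" using s char by simp
    ultimately have "D i + 2 * s \<noteq> 0" by auto
    moreover have "1 / recip_deriv s x i = D i" by (simp add: z)
    ultimately show ?thesis using * by (metis nonzero_mult_div_cancel_right)
  qed
qed

text \<open>With \<open>U = X^3 + (p / A) X\<close> this is
  \<open>U^2 + (q / (s A)) U + (s q^2 - p^3) / (s A^3)\<close>. The second cubic
  \<open>X^3 + p X + q\<close> is left general so as to include both \<open>X^3 + t X + t\<close>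
  and Shanks' cubic with the quadratic term removed.\<close>

definition pairing_sextic :: "'w::field \<Rightarrow> 'w \<Rightarrow> 'w \<Rightarrow> 'w poly" where
  "pairing_sextic s p q = (let A = s * (4 * s + 27) in
     [: (s * q ^ 2 - p ^ 3) / (s * A ^ 3), p * q / (s * A ^ 2), p ^ 2 / A ^ 2, q / (s * A), 2 * p / A, 0, 1 :])"

text \<open>
  The six bijections between the indices of \<open>z\<close> and those of \<open>y\<close>, even ones first; the product
  of two symmetric groups of degree three permutes these sums as it permutes the bijections.
\<close>

definition pairing_roots :: "(nat \<Rightarrow> 'w::field) \<Rightarrow> (nat \<Rightarrow> 'w) \<Rightarrow> 'w list" where
  "pairing_roots z y =
    [(z 1 * y 1 + z 2 * y 2 + z 3 * y 3) / 3, (z 1 * y 2 + z 2 * y 3 + z 3 * y 1) / 3,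
     (z 1 * y 3 + z 2 * y 1 + z 3 * y 2) / 3, (z 1 * y 1 + z 2 * y 3 + z 3 * y 2) / 3,
     (z 1 * y 2 + z 2 * y 1 + z 3 * y 3) / 3, (z 1 * y 3 + z 2 * y 2 + z 3 * y 1) / 3]"

lemma depressed_cubic_product:
  fixes a :: "'w::comm_ring_1"
  assumes "a + b + c = 0" "a * b + a * c + b * c = p" "a * b * c = - q"
  shows "[:- a, 1:] * ([:- b, 1:] * [:- c, 1:]) = [:q, p, 0, 1:]"
  using assms by (simp add: algebra_simps) (simp add: minus_equation_iff add_eq_0_iff2)

text \<open>The unnormalized sums \<open>w1\<close>, \<open>w2\<close>, \<open>w3\<close> over the
  even bijections and \<open>w4\<close>, \<open>w5\<close>, \<open>w6\<close> over the odd ones have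
  the same first and second symmetric functions, so the two cubics differ only in their constant
  terms \<open>k\<close> and \<open>k'\<close>. The sum and the product of these two constants are
  rational in the coefficients of the given cubics.\<close>

lemma pairing_sextic_factorization:
  fixes s :: "'w::field"
  assumes z: "cubic_roots (- 3 / (s * (4 * s + 27))) (- 1 / (s * (s * (4 * s + 27)))) z"
    and s: "s \<noteq> 0" "4 * s + 27 \<noteq> 0" and char: "(3::'w) \<noteq> 0" and y: "cubic_roots p q y"
  shows "pairing_sextic s p q = (\<Prod>u\<leftarrow>pairing_roots z y. [:- u, 1:])"
proof -
  define A where "A = s * (4 * s + 27)"
  have A0: "A \<noteq> 0" using s by (simp add: A_def)
  define P where "P = - 3 / A"
  define Q where "Q = - 1 / (s * A)"
  have z': "z 1 + z 2 + z 3 = 0" "z 1 * z 2 + z 1 * z 3 + z 2 * z 3 = P" "z 1 * z 2 * z 3 = - Q"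
    using cubic_rootsD(1-3)[OF z] by (simp_all add: P_def Q_def A_def)
  note y' = cubic_rootsD(1-3)[OF y]
  define w1 w2 w3 w4 w5 w6 where
    w: "w1 = z 1 * y 1 + z 2 * y 2 + z 3 * y 3" "w2 = z 1 * y 2 + z 2 * y 3 + z 3 * y 1"
    "w3 = z 1 * y 3 + z 2 * y 1 + z 3 * y 2" "w4 = z 1 * y 1 + z 2 * y 3 + z 3 * y 2"
    "w5 = z 1 * y 2 + z 2 * y 1 + z 3 * y 3" "w6 = z 1 * y 3 + z 2 * y 2 + z 3 * y 1"
  have sum: "w1 + w2 + w3 = 0" "w4 + w5 + w6 = 0"
    unfolding w using z'(1) y'(1) by Groebner_Basis.algebra+
  have e2: "w1 * w2 + w1 * w3 + w2 * w3 = - 3 * P * p" "w4 * w5 + w4 * w6 + w5 * w6 = - 3 * P * p"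
    unfolding w z'(2)[symmetric] y'(2)[symmetric] using z'(1) y'(1) by Groebner_Basis.algebra+
  have z3: "z 3 = - z 1 - z 2" and y3: "y 3 = - y 1 - y 2"
    using cubic_rootsD(4)[OF z] cubic_rootsD(4)[OF y] .
  have PQ: "P = z 1 * z 2 + z 1 * z 3 + z 2 * z 3" "Q = - (z 1 * z 2 * z 3)" using z' by simp_all
  have pq: "p = y 1 * y 2 + y 1 * y 3 + y 2 * y 3" "q = - (y 1 * y 2 * y 3)" using y' by simp_all
  have e3: "w1 * w2 * w3 + w4 * w5 * w6 = 27 * Q * q"
    unfolding w PQ pq z3 y3 by Groebner_Basis.algebra
  have e33: "(w1 * w2 * w3) * (w4 * w5 * w6) = - 27 * p ^ 3 * Q ^ 2 - 27 * P ^ 3 * q ^ 2 - 4 * P ^ 3 * p ^ 3"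
    unfolding w PQ pq z3 y3 by Groebner_Basis.algebra
  define k k' where "k = - (w1 * w2 * w3) / 27" and "k' = - (w4 * w5 * w6) / 27"
  have c27: "(27::'w) \<noteq> 0" "(9::'w) \<noteq> 0"
  proof -
    have "(9::'w) = 3 * 3" "(27::'w) = 3 * 3 * 3" by simp_all
    then show "(27::'w) \<noteq> 0" "(9::'w) \<noteq> 0" using char by (metis mult_eq_0_iff)+
  qed
  \<comment> \<open>Since \<open>P = - 3 / A\<close>, the second symmetric function
    \<open>- 3 P p\<close> is \<open>9 p / A\<close>, and the scaling by 1/3 reduces it to
    \<open>p / A\<close>.\<close>
  have cub: "[:- (a / 3), 1:] * ([:- (b / 3), 1:] * [:- (c / 3), 1:]) = [:- (a * b * c) / 27, p / A, 0, 1:]"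
    if "a + b + c = 0" "a * b + a * c + b * c = - 3 * P * p" for a b c
  proof (rule depressed_cubic_product)
    show "a / 3 + b / 3 + c / 3 = 0" using that(1) by (simp flip: add_divide_distrib)
    have "a / 3 * (b / 3) + a / 3 * (c / 3) + b / 3 * (c / 3) = (a * b + a * c + b * c) / 9"
      by (simp add: add_divide_distrib)
    also have "\<dots> = (9 * (p / A)) / 9" unfolding that(2) P_def by simp
    also have "\<dots> = p / A" using c27 by simp
    finally show "a / 3 * (b / 3) + a / 3 * (c / 3) + b / 3 * (c / 3) = p / A" .
  qed simp
  have roots: "(\<Prod>u\<leftarrow>pairing_roots z y. [:- u, 1:]) =
      ([:- (w1 / 3), 1:] * ([:- (w2 / 3), 1:] * [:- (w3 / 3), 1:])) *
      ([:- (w4 / 3), 1:] * ([:- (w5 / 3), 1:] * [:- (w6 / 3), 1:]))"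
    unfolding pairing_roots_def w[symmetric] by (simp only: list.map prod_list.Cons prod_list.Nil mult_1_right mult.assoc)
  have kk: "k + k' = q / (s * A)"
  proof -
    have "k + k' = - (w1 * w2 * w3 + w4 * w5 * w6) / 27"
      by (simp add: k_def k'_def diff_divide_distrib)
    also have "\<dots> = (27 * (q / (s * A))) / 27" unfolding e3 Q_def by simp
    also have "\<dots> = q / (s * A)" using c27(1) by simp
    finally show ?thesis .
  qed
  have kk': "k * k' = (s * q ^ 2 - p ^ 3) / (s * A ^ 3)"
  proof -
    have "(729::'w) = 27 * 27" by simp
    then have c729: "(729::'w) \<noteq> 0" using c27(1) by (metis mult_eq_0_iff)
    have "k * k' = ((w1 * w2 * w3) * (w4 * w5 * w6)) / 729" by (simp add: k_def k'_def)
    also have "(w1 * w2 * w3) * (w4 * w5 * w6) = - 27 * p ^ 3 * (1 / (s ^ 2 * A ^ 2)) + 27 * 27 / A ^ 3 * q ^ 2 + 4 * 27 / A ^ 3 * p ^ 3"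
      unfolding e33 P_def Q_def by (simp add: power_divide power_mult_distrib)
    also have "\<dots> = (s * A * (- 27 * p ^ 3 * A + 729 * s ^ 2 * q ^ 2 + 108 * s ^ 2 * p ^ 3)) / (s ^ 3 * A ^ 4)"
      using s A0 by (simp add: field_simps power2_eq_square power3_eq_cube power4_eq_xxxx)
    \<comment> \<open>As \<open>27 A = 108 s^2 + 729 s\<close>, the term \<open>108 s^2 p^3\<close>
      cancels and a common factor 729 remains.\<close>
    also have "- 27 * p ^ 3 * A + 729 * s ^ 2 * q ^ 2 + 108 * s ^ 2 * p ^ 3 = 729 * s * (s * q ^ 2 - p ^ 3)"
      unfolding A_def by Groebner_Basis.algebra
    also have "s * A * (729 * s * (s * q ^ 2 - p ^ 3)) / (s ^ 3 * A ^ 4) / 729 = (s * q ^ 2 - p ^ 3) / (s * A ^ 3)"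
      using s A0 c729 by (simp add: field_simps power2_eq_square power3_eq_cube power4_eq_xxxx)
    finally show ?thesis .
  qed
  have "(\<Prod>u\<leftarrow>pairing_roots z y. [:- u, 1:]) = [:k, p / A, 0, 1:] * [:k', p / A, 0, 1:]"
    unfolding roots cub[OF sum(1) e2(1)] cub[OF sum(2) e2(2)] k_def k'_def ..
  also have "\<dots> = [:k * k', (k + k') * (p / A), (p / A) ^ 2, k + k', 2 * (p / A), 0, 1:]"
    by (simp add: algebra_simps power2_eq_square add_divide_distrib)
  also have "\<dots> = pairing_sextic s p q"
    unfolding kk kk' pairing_sextic_def Let_def A_def[symmetric]
    by (simp add: power2_eq_square power_divide ac_simps)
  finally show ?thesis ..
qed

text \<open>Exactly two bijections send \<open>i\<close> to \<open>j\<close>, and the sum of their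
  two roots is \<open>z i * y j\<close>: the other summands combine to the product of the remaining
  two \<open>z\<close> and the remaining two \<open>y\<close>, which is \<open>z i * y j\<close>
  once more by trace zero. These products give all ratios, from which
  \<open>cubic_roots_in_subfield\<close> recovers both triples.\<close>

lemma adjoin_pairing_roots:
  fixes s :: "'w::field"
  assumes M: "is_subfield M" "s \<in> M" "p \<in> M" "q \<in> M"
    and x: "cubic_roots s s x" and y: "cubic_roots p q y"
    and s: "s \<noteq> 0" "4 * s + 27 \<noteq> 0" and pq: "p \<noteq> 0" "q \<noteq> 0" and char: "(3::'w) \<noteq> 0"
  shows "adjoin M (set (pairing_roots (recip_deriv s x) y)) = adjoin M (x ` {1..3} \<union> y ` {1..3})"
proof (rule adjoin_eqI)
  define z where "z = recip_deriv s x"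
  define A where "A = s * (4 * s + 27)"
  note zr = recip_deriv_roots[OF x s char, folded z_def A_def]
  let ?F = "adjoin M (set (pairing_roots (recip_deriv s x) y))"
  let ?E = "adjoin M (x ` {1..3} \<union> y ` {1..3})"
  show "M \<subseteq> ?F" "M \<subseteq> ?E" by (rule adjoin_base)+
  have F: "is_subfield ?F" and E: "is_subfield ?E" by simp_all
  have A0: "A \<noteq> 0" using s by (simp add: A_def)
  have AM: "- 3 / A \<in> M" "- 1 / (s * A) \<in> M" unfolding A_def using M
    by (auto intro!: subfield_divide subfield_uminus subfield_mult subfield_add subfield_numeral subfield_one)
  have z0: "z 1 \<noteq> 0" "z 2 \<noteq> 0" "z 3 \<noteq> 0" using cubic_rootsD(3)[OF zr(1)] s A0 by auto
  have y0: "y 1 \<noteq> 0" "y 2 \<noteq> 0" "y 3 \<noteq> 0" using cubic_rootsD(3)[OF y] pq by auto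
  have uF: "u \<in> ?F" if "u \<in> set (pairing_roots z y)" for u
    using that adjoin_gens[of "set (pairing_roots z y)" M] by (auto simp: z_def)
  have prods: "z 1 * y 1 \<in> ?F" "z 1 * y 2 \<in> ?F" "z 1 * y 3 \<in> ?F" "z 2 * y 1 \<in> ?F" "z 3 * y 1 \<in> ?F"
  proof -
    have three: "a / 3 + b / 3 = c" if "a + b = 3 * c" for a b c :: 'w
      using that char by (simp flip: add_divide_distrib)
    note zs = cubic_rootsD(1)[OF zr(1)] and ys = cubic_rootsD(1)[OF y]
    have "(z 1 * y 1 + z 2 * y 2 + z 3 * y 3) / 3 + (z 1 * y 1 + z 2 * y 3 + z 3 * y 2) / 3 = z 1 * y 1"
      by (rule three) (use zs ys in Groebner_Basis.algebra)
    then show "z 1 * y 1 \<in> ?F" using subfield_add[OF F uF uF] by (metis list.set_intros pairing_roots_def)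
    have "(z 1 * y 2 + z 2 * y 3 + z 3 * y 1) / 3 + (z 1 * y 2 + z 2 * y 1 + z 3 * y 3) / 3 = z 1 * y 2"
      by (rule three) (use zs ys in Groebner_Basis.algebra)
    then show "z 1 * y 2 \<in> ?F" using subfield_add[OF F uF uF] by (metis list.set_intros pairing_roots_def)
    have "(z 1 * y 3 + z 2 * y 1 + z 3 * y 2) / 3 + (z 1 * y 3 + z 2 * y 2 + z 3 * y 1) / 3 = z 1 * y 3"
      by (rule three) (use zs ys in Groebner_Basis.algebra)
    then show "z 1 * y 3 \<in> ?F" using subfield_add[OF F uF uF] by (metis list.set_intros pairing_roots_def)
    have "(z 1 * y 3 + z 2 * y 1 + z 3 * y 2) / 3 + (z 1 * y 2 + z 2 * y 1 + z 3 * y 3) / 3 = z 2 * y 1"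
      by (rule three) (use zs ys in Groebner_Basis.algebra)
    then show "z 2 * y 1 \<in> ?F" using subfield_add[OF F uF uF] by (metis list.set_intros pairing_roots_def)
    have "(z 1 * y 2 + z 2 * y 3 + z 3 * y 1) / 3 + (z 1 * y 3 + z 2 * y 2 + z 3 * y 1) / 3 = z 3 * y 1"
      by (rule three) (use zs ys in Groebner_Basis.algebra)
    then show "z 3 * y 1 \<in> ?F" using subfield_add[OF F uF uF] by (metis list.set_intros pairing_roots_def)
  qed
  have "y 2 / y 1 = z 1 * y 2 / (z 1 * y 1)" "y 3 / y 1 = z 1 * y 3 / (z 1 * y 1)"
    "z 2 / z 1 = z 2 * y 1 / (z 1 * y 1)" "z 3 / z 1 = z 3 * y 1 / (z 1 * y 1)"
    using z0 y0 by simp_all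
  then have ratios: "y 2 / y 1 \<in> ?F" "y 3 / y 1 \<in> ?F" "z 2 / z 1 \<in> ?F" "z 3 / z 1 \<in> ?F"
    using prods subfield_divide[OF F] by metis+
  have MF: "a \<in> ?F" if "a \<in> M" for a using that adjoin_base by blast
  have yF: "y ` {1..3} \<subseteq> ?F"
    by (rule cubic_roots_in_subfield[OF F y]) (use M pq ratios MF in auto)
  have zF: "z ` {1..3} \<subseteq> ?F"
    by (rule cubic_roots_in_subfield[OF F zr(1)]) (use AM ratios MF s A0 char in auto)
  have "x i \<in> ?F" if i: "i \<in> {1..3}" for i
  proof -
    have "z i \<in> ?F" "s \<in> ?F" using zF i MF M by auto
    then show ?thesis
      by (subst zr(2)[OF i]) (intro subfield_divide subfield_mult subfield_uminus subfield_add
          subfield_numeral subfield_one F)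
  qed
  then show "x ` {1..3} \<union> y ` {1..3} \<subseteq> ?F" using yF by blast
  have xE: "x i \<in> ?E" "y i \<in> ?E" if "i \<in> {1..3}" for i
    using that adjoin_gens[of "x ` {1..3} \<union> y ` {1..3}" M] by auto
  have sE: "s \<in> ?E" using M adjoin_base by blast
  have zE: "z i \<in> ?E" if "i \<in> {1..3}" for i
    unfolding z_def recip_deriv_def using xE[OF that] sE
    by (intro subfield_divide subfield_mult subfield_power subfield_add subfield_numeral subfield_one E)
  have "z 1 \<in> ?E" "z 2 \<in> ?E" "z 3 \<in> ?E" "y 1 \<in> ?E" "y 2 \<in> ?E" "y 3 \<in> ?E"
    by (rule zE xE; simp)+
  then show "set (pairing_roots (recip_deriv s x) y) \<subseteq> ?E"
    unfolding pairing_roots_def z_def[symmetric]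
    by (auto intro!: subfield_divide subfield_add subfield_mult subfield_numeral)
qed

text \<open>This is \<open>(X^3 + p d X)^2 - d^3 q^2\<close>, the product of the two cubics obtained
  from \<open>X^3 + p X + q\<close> by multiplying its roots by either square root of
  \<open>d\<close>.\<close>

definition even_sextic :: "'w::field \<Rightarrow> 'w \<Rightarrow> 'w \<Rightarrow> 'w poly" where
  "even_sextic p q d = [: - (d ^ 3 * q ^ 2), 0, p ^ 2 * d ^ 2, 0, 2 * p * d, 0, 1 :]"

definition even_roots :: "(nat \<Rightarrow> 'w::field) \<Rightarrow> (nat \<Rightarrow> 'w) \<Rightarrow> 'w list" where
  "even_roots x v = [x 1 * v 1, x 2 * v 1, x 3 * v 1, x 1 * v 2, x 2 * v 2, x 3 * v 2]"

lemma even_sextic_factorization: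
  assumes x: "cubic_roots p q x" and v: "opposite_roots d v"
  shows "even_sextic p q d = (\<Prod>u\<leftarrow>even_roots x v. [:- u, 1:])"
proof -
  have v2: "v 2 = - v 1" "v 1 ^ 2 = d" using v by (auto simp: opposite_roots_def)
  define w where "w = v 1"
  note e = cubic_rootsD(1-3)[OF x]
  have 1: "[:- (x 1 * u), 1:] * ([:- (x 2 * u), 1:] * [:- (x 3 * u), 1:]) = [:u ^ 3 * q, p * u ^ 2, 0, 1:]" for u
  proof (rule depressed_cubic_product)
    show "x 1 * u + x 2 * u + x 3 * u = 0" using e(1) by Groebner_Basis.algebra
    show "x 1 * u * (x 2 * u) + x 1 * u * (x 3 * u) + x 2 * u * (x 3 * u) = p * u ^ 2"
      unfolding e(2)[symmetric] by Groebner_Basis.algebra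
    have "x 1 * u * (x 2 * u) * (x 3 * u) = u ^ 3 * (x 1 * x 2 * x 3)" by Groebner_Basis.algebra
    then show "x 1 * u * (x 2 * u) * (x 3 * u) = - (u ^ 3 * q)" unfolding e(3) by simp
  qed
  have "(\<Prod>u\<leftarrow>even_roots x v. [:- u, 1:]) =
      ([:- (x 1 * w), 1:] * ([:- (x 2 * w), 1:] * [:- (x 3 * w), 1:])) *
      ([:- (x 1 * - w), 1:] * ([:- (x 2 * - w), 1:] * [:- (x 3 * - w), 1:]))"
    unfolding even_roots_def v2(1) w_def[symmetric]
    by (simp only: list.map prod_list.Cons prod_list.Nil mult_1_right mult.assoc)
  also have "\<dots> = [:w ^ 3 * q, p * w ^ 2, 0, 1:] * [:- (w ^ 3 * q), p * w ^ 2, 0, 1:]"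
    unfolding 1 by simp
  also have "\<dots> = even_sextic p q (w ^ 2)"
    by (simp add: even_sextic_def) (simp add: algebra_simps numeral_eq_Suc One_nat_def)
  finally show ?thesis using v2(2) by (simp add: w_def)
qed

text \<open>The factor \<open>v 1\<close> cancels in ratios, so
  \<open>cubic_roots_in_subfield\<close> yields the \<open>x i\<close>, and then
  \<open>v 1 = (x 1 * v 1) / x 1\<close>.\<close>

lemma adjoin_even_roots:
  assumes M: "is_subfield M" "p \<in> M" "q \<in> M" and x: "cubic_roots p q x" and v: "v 2 = - v 1" "v 1 \<noteq> 0"
    and pq: "p \<noteq> 0" "q \<noteq> 0"
  shows "adjoin M (set (even_roots x v)) = adjoin M (x ` {1..3} \<union> v ` {1..2})"
proof (rule adjoin_eqI)
  let ?F = "adjoin M (set (even_roots x v))"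
  let ?E = "adjoin M (x ` {1..3} \<union> v ` {1..2})"
  show "M \<subseteq> ?F" "M \<subseteq> ?E" by (rule adjoin_base)+
  have F: "is_subfield ?F" and E: "is_subfield ?E" by simp_all
  have x0: "x 1 \<noteq> 0" using cubic_rootsD(3)[OF x] pq by auto
  have uF: "u \<in> ?F" if "u \<in> set (even_roots x v)" for u
    using that adjoin_gens[of "set (even_roots x v)" M] by auto
  have xv: "x 1 * v 1 \<in> ?F" "x 2 * v 1 \<in> ?F" "x 3 * v 1 \<in> ?F"
    by (rule uF; simp add: even_roots_def)+
  have "x 2 / x 1 = x 2 * v 1 / (x 1 * v 1)" "x 3 / x 1 = x 3 * v 1 / (x 1 * v 1)"
    using x0 v by simp_all
  then have r: "x 2 / x 1 \<in> ?F" "x 3 / x 1 \<in> ?F" using xv subfield_divide[OF F] by metis+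
  have MF: "a \<in> ?F" if "a \<in> M" for a using that adjoin_base by blast
  have xF: "x ` {1..3} \<subseteq> ?F"
    by (rule cubic_roots_in_subfield[OF F x]) (use M pq r MF in auto)
  have "v 1 = x 1 * v 1 / x 1" using x0 by simp
  then have "v 1 \<in> ?F" using xv(1) xF subfield_divide[OF F] by (metis image_13 insertI1 subsetD)
  then have "v ` {1..2} \<subseteq> ?F" unfolding atLeastAtMost_12 using v F by (auto intro: subfield_uminus)
  then show "x ` {1..3} \<union> v ` {1..2} \<subseteq> ?F" using xF by blast
  have "x 1 \<in> ?E" "x 2 \<in> ?E" "x 3 \<in> ?E" "v 1 \<in> ?E" "v 2 \<in> ?E"
    by (rule subsetD[OF adjoin_gens]; simp)+
  then show "set (even_roots x v) \<subseteq> ?E" unfolding even_roots_def by (auto intro!: subfield_mult)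
qed

section \<open>The displayed sextics as members of the two families\<close>

lemma sextic_monoms:
  "Polynomial.monom a6 6 + Polynomial.monom a4 4 + Polynomial.monom a3 3 + Polynomial.monom a2 2
     + Polynomial.monom a1 1 + Polynomial.monom a0 0 = [:a0, a1, a2, a3, a4, 0, a6:]"
  by (simp add: monom_Suc monom_0 numeral_eq_Suc One_nat_def)

lemma g_S3_S3_eq: "g_S3_S3 s t = pairing_sextic s t t"
  unfolding g_S3_S3_def sextic_monoms pairing_sextic_def Let_def
  by (simp add: power2_eq_square power3_eq_cube power4_eq_xxxx algebra_simps)

lemma g_S3_C3_eq:
  "g_S3_C3 s t = pairing_sextic s (- 3 * (t ^ 2 + 3 * t + 9)) (- ((2 * t + 3) * (t ^ 2 + 3 * t + 9)))"
proof -
  define d where "d = t ^ 2 + 3 * t + 9"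
  have 1: "d ^ 2 * (4 * s * t ^ 2 + 27 * t ^ 2 + 12 * s * t + 9 * s + 81 * t + 243) =
      s * ((2 * t + 3) * d) ^ 2 - (- 3 * d) ^ 3"
    unfolding d_def by Groebner_Basis.algebra
  have "g_S3_C3 s t = Polynomial.monom 1 6 + Polynomial.monom (- (6 * d / (s * (4 * s + 27)))) 4
      + Polynomial.monom (- ((2 * t + 3) * d / (s^2 * (4 * s + 27)))) 3
      + Polynomial.monom (9 * d^2 / (s^2 * (4 * s + 27)^2)) 2
      + Polynomial.monom (3 * (2 * t + 3) * d^2 / (s^3 * (4 * s + 27)^2)) 1
      + Polynomial.monom ((s * ((2 * t + 3) * d) ^ 2 - (- 3 * d) ^ 3) / (s^4 * (4 * s + 27)^3)) 0"
    unfolding g_S3_C3_def Let_def d_def[symmetric] 1 by (simp flip: minus_monom)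
  then show ?thesis unfolding sextic_monoms pairing_sextic_def Let_def d_def[symmetric]
    by (simp add: power2_eq_square power3_eq_cube power4_eq_xxxx mult.assoc mult.left_commute)
qed

lemma even_monoms:
  "Polynomial.monom a6 6 - Polynomial.monom a4 4 + Polynomial.monom a2 2 + Polynomial.monom a0 0 =
    [:a0, 0, a2, 0, - a4, 0, a6:]"
  "Polynomial.monom a6 6 - Polynomial.monom a4 4 + Polynomial.monom a2 2 - Polynomial.monom a0 0 =
    [:- a0, 0, a2, 0, - a4, 0, (a6::'a::comm_ring_1):]"
  by (simp_all add: monom_Suc monom_0 numeral_eq_Suc One_nat_def)

text \<open>The factor of \<open>t\<close> in the third argument,
  \<open>- 1 / (s^2 (4 s + 27))\<close>, is a square times the discriminant
  \<open>- s^2 (4 s + 27)\<close> of the cubic. Therefore \<open>t = 1\<close> is the case in which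
  the square root gives nothing new.\<close>

lemma g_S3_C2_eq:
  assumes "s \<noteq> 0" "4 * s + 27 \<noteq> 0"
  shows "g_S3_C2 s t = even_sextic s s (- t * (4 * s + 27) / (s * (4 * s + 27)) ^ 2)"
proof -
  define b where "b = 4 * s + 27"
  have "b \<noteq> 0" using assms by (simp add: b_def)
  then show ?thesis unfolding g_S3_C2_def even_monoms even_sextic_def b_def[symmetric]
    using assms(1) by (simp add: field_simps power2_eq_square power3_eq_cube power4_eq_xxxx)
qed

lemma g_S3_1_eq: "g_S3_1 s = g_S3_C2 s 1"
  by (simp add: g_S3_1_def g_S3_C2_def)

text \<open>Here \<open>d\<close> is the discriminant \<open>- s^2 (4 s + 27)\<close> divided by
  \<open>s^2\<close>.\<close>

lemma h_S3_eq: "h_S3 s = even_sextic s s (- (4 * s + 27))"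
proof -
  define b where "b = 4 * s + 27"
  show ?thesis unfolding h_S3_def even_monoms even_sextic_def b_def[symmetric]
    by (simp add: power2_eq_square power3_eq_cube)
qed

lemma g_C3_C2_eq:
  assumes "s ^ 2 + 3 * s + 9 \<noteq> 0"
  shows "g_C3_C2 s t = even_sextic (- 3 * (s ^ 2 + 3 * s + 9)) (- ((2 * s + 3) * (s ^ 2 + 3 * s + 9)))
    (t / (s ^ 2 + 3 * s + 9) ^ 2)"
proof -
  define d where "d = s ^ 2 + 3 * s + 9"
  have "d \<noteq> 0" using assms by (simp add: d_def)
  then show ?thesis unfolding g_C3_C2_def even_monoms even_sextic_def d_def[symmetric]
    by (simp add: field_simps power2_eq_square power3_eq_cube power4_eq_xxxx)
qed

section \<open>Isomorphisms between small groups\<close>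

lemma is_iso_if_hom_inj_card:
  assumes "f \<in> hom G H" "inj_on f (carrier G)" "card (carrier G) = card (carrier H)" "finite (carrier H)"
  shows "G \<cong> H"
proof -
  have "f ` carrier G \<subseteq> carrier H" using assms(1) by (auto simp: hom_def)
  moreover have "card (f ` carrier G) = card (carrier H)" using assms by (simp add: card_image)
  ultimately have "f ` carrier G = carrier H" using assms(4) by (simp add: card_subset_eq)
  then show ?thesis using assms by (intro is_isoI[of f] isoI) (auto simp: bij_betw_def)
qed

text \<open>The affine map \<open>i \<mapsto> d \<plusminus> i\<close> of the integers modulo 3, with 3 as the representative of 0.\<close>

definition affine3 :: "int \<Rightarrow> int \<Rightarrow> nat \<Rightarrow> nat" where
  "affine3 d h i = (if i \<in> {1..3} then nat ((d + (if h = 0 then int i else - int i) + 2) mod 3 + 1) else i)"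

lemma affine3_mod: "affine3 (d mod 3) h = affine3 d h"
proof -
  have *: "(d mod 3 + x + 2) mod 3 = (d + x + 2) mod 3" for x
    unfolding add.assoc by (rule mod_add_left_eq)
  show ?thesis unfolding affine3_def * ..
qed

lemma affine3_compose:
  assumes "h \<in> {0, 1}" "h' \<in> {0, 1}"
  shows "affine3 d h \<circ> affine3 d' h' = affine3 (d + (if h = 0 then d' else - d')) ((h + h') mod 2)"
proof
  fix i
  show "(affine3 d h \<circ> affine3 d' h') i = affine3 (d + (if h = 0 then d' else - d')) ((h + h') mod 2) i"
  proof (cases "i \<in> {1..3}")
    case True
    define e where "e = d' + (if h' = 0 then int i else - int i) + 2"
    have j: "affine3 d' h' i = nat (e mod 3 + 1)" using True by (simp add: affine3_def e_def)
    have e: "0 \<le> e mod 3" "e mod 3 < 3" by simp_all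
    then have jin: "nat (e mod 3 + 1) \<in> {1..3}" by auto
    have ji: "int (nat (e mod 3 + 1)) = e mod 3 + 1" using e by simp
    have "(d + (if h = 0 then e mod 3 + 1 else - (e mod 3 + 1)) + 2) mod 3 =
        (d + (if h = 0 then e + 1 else - (e + 1)) + 2) mod 3"
      by (auto simp: mod_simps) (presburger+)
    also have "\<dots> = (d + (if h = 0 then d' else - d') + (if (h + h') mod 2 = 0 then int i else - int i) + 2) mod 3"
    proof -
      \<comment> \<open>The offsets \<open>+ 2\<close> and \<open>+ 1\<close> that encode residues
        as labels add up to 3 and disappear modulo 3.\<close>
      have shift: "a mod 3 = b mod 3" if "a = b + 3 \<or> a = b - 3" for a b :: int using that by auto
      have c: "(d + (d' + j + 2 + 1) + 2) mod 3 = (d + d' + j + 2) mod 3"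
        "(d + (d' + - j + 2 + 1) + 2) mod 3 = (d + d' + - j + 2) mod 3"
        "(d + - (d' + j + 2 + 1) + 2) mod 3 = (d + - d' + - j + 2) mod 3"
        "(d + - (d' + - j + 2 + 1) + 2) mod 3 = (d + - d' + j + 2) mod 3" for j
        by (rule shift, simp)+
      have m: "(0 + 0) mod 2 = (0::int)" "(0 + 1) mod 2 = (1::int)" "(1 + 0) mod 2 = (1::int)" "(1 + 1) mod 2 = (0::int)"
        by simp_all
      show ?thesis using assms unfolding e_def
        by (elim insertE emptyE) (simp_all only: c m if_True if_False refl zero_neq_one one_neq_zero minus_minus)
    qed
    finally have eq: "(d + (if h = 0 then e mod 3 + 1 else - (e mod 3 + 1)) + 2) mod 3 = \<dots>" .
    have "(affine3 d h \<circ> affine3 d' h') i = nat ((d + (if h = 0 then e mod 3 + 1 else - (e mod 3 + 1)) + 2) mod 3 + 1)"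
      using jin by (simp only: o_def j affine3_def[of d h "nat (e mod 3 + 1)"] ji if_True)
    then show ?thesis using True unfolding eq
      by (simp only: affine3_def[of _ "(h + h') mod 2"] if_True)
  qed (simp only: o_def affine3_def if_False)
qed

lemma affine3_permutes: "affine3 d h permutes {1..3}"
proof (rule bij_imp_permutes)
  have "inj_on (affine3 d h) {1..3}"
    unfolding atLeastAtMost_13 inj_on_def affine3_def
    by (auto simp: atLeastAtMost_13 nat_eq_iff2) presburger+
  moreover have "affine3 d h ` {1..3} \<subseteq> {1..3}" by (auto simp: affine3_def nat_le_iff le_nat_iff)
  ultimately show "bij_betw (affine3 d h) {1..3} {1..3}" by (simp add: bij_betw_def endo_inj_surj)
qed (simp only: affine3_def if_False)

lemma affine3_inj:
  assumes "d \<in> {0..<3}" "d' \<in> {0..<3}" "h \<in> {0, 1}" "h' \<in> {0, 1}" "affine3 d h = affine3 d' h'"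
  shows "d = d' \<and> h = h'"
proof -
  have "affine3 d h 3 = affine3 d' h' 3" "affine3 d h 1 = affine3 d' h' 1" using assms(5) by simp_all
  moreover have "d = 0 \<or> d = 1 \<or> d = 2" "d' = 0 \<or> d' = 1 \<or> d' = 2" using assms by auto
  ultimately show ?thesis using assms(3,4) unfolding affine3_def by (elim disjE insertE emptyE) simp_all
qed

lemma card_S3: "card (carrier S3) = 6" "finite (carrier S3)"
proof -
  show "card (carrier S3) = 6"
    unfolding sym_group_def by (simp add: card_permutations fact_numeral)
  then show "finite (carrier S3)" by (metis card.infinite zero_neq_numeral)
qed

lemma C_carrier: "carrier (C 2) = {0, 1}" "carrier (C 3) = {0, 1, 2}"
  "carrier (C 6) = {0..<6}"
  by (auto simp: carrier_integer_mod_group)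

text \<open>In the coordinates \<open>a - b\<close> and \<open>a + b\<close>, independent because 2
  is invertible modulo 3, the swap negates the first and fixes the second. The first coordinate and
  the swap form the affine group of the integers modulo 3, which is \<open>S3\<close>; the second
  coordinate is the direct factor \<open>C 3\<close>.\<close>

lemma swap_semidirect_iso_S3_C3: "semidirect (C 3 \<times>\<times> C 3) (C 2) swap_action \<cong> S3 \<times>\<times> C 3"
proof (rule is_iso_if_hom_inj_card)
  let ?f = "\<lambda>((a, b), h). (affine3 (a - b) h, (a + b) mod 3)"
  let ?G = "semidirect (C 3 \<times>\<times> C 3) (C 2) swap_action"
  have carr: "carrier ?G = ({0, 1, 2} \<times> {0, 1, 2}) \<times> {0, 1}" by (simp add: semidirect_def C_carrier)
  show "?f \<in> hom ?G (S3 \<times>\<times> C 3)"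
  proof (rule homI)
    show "?f x \<in> carrier (S3 \<times>\<times> C 3)" if "x \<in> carrier ?G" for x
      using that affine3_permutes by (auto simp: sym_group_carrier carrier_integer_mod_group split: prod.splits)
    fix x y assume xy: "x \<in> carrier ?G" "y \<in> carrier ?G"
    obtain a b h a' b' h' where xy': "x = ((a, b), h)" "y = ((a', b'), h')" by (metis surj_pair)
    have h: "h \<in> {0, 1}" "h' \<in> {0, 1}" using xy unfolding carr xy' by auto
    have 1: "affine3 (u mod 3 - v mod 3) k = affine3 (u - v) k" for u v k
      using affine3_mod[of "u mod 3 - v mod 3" k] affine3_mod[of "u - v" k] by (simp add: mod_simps)
    show "?f (x \<otimes>\<^bsub>?G\<^esub> y) = ?f x \<otimes>\<^bsub>S3 \<times>\<times> C 3\<^esub> ?f y"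
      unfolding xy' using h(1)
      by (elim insertE emptyE; simp add: semidirect_def swap_action_def sym_group_mult
          affine3_compose[OF _ h(2)] 1 mod_simps; simp add: algebra_simps)
  qed
  show "inj_on ?f (carrier ?G)"
  proof (rule inj_onI)
    fix x y assume xy: "x \<in> carrier ?G" "y \<in> carrier ?G" and eq: "?f x = ?f y"
    obtain a b h a' b' h' where xy': "x = ((a, b), h)" "y = ((a', b'), h')" by (metis surj_pair)
    have h: "h \<in> {0, 1}" "h' \<in> {0, 1}" using xy unfolding carr xy' by auto
    have ab: "a = 0 \<or> a = 1 \<or> a = 2" "b = 0 \<or> b = 1 \<or> b = 2" "a' = 0 \<or> a' = 1 \<or> a' = 2" "b' = 0 \<or> b' = 1 \<or> b' = 2"
      using xy unfolding carr xy' by auto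
    have "affine3 ((a - b) mod 3) h = affine3 ((a' - b') mod 3) h'" "(a + b) mod 3 = (a' + b') mod 3"
      using eq unfolding xy' by (simp_all add: affine3_mod)
    then have "(a - b) mod 3 = (a' - b') mod 3" "h = h'"
      using affine3_inj[of "(a - b) mod 3" "(a' - b') mod 3" h h'] h by auto
    with ab \<open>(a + b) mod 3 = (a' + b') mod 3\<close> show "x = y" unfolding xy' by (elim disjE) simp_all
  qed
  show "card (carrier ?G) = card (carrier (S3 \<times>\<times> C 3))"
    unfolding carr by (simp add: card_cartesian_product card_S3 C_carrier)
qed (simp_all only: carrier_DirProd card_S3 C_carrier finite_cartesian_product finite.intros)

text \<open>A function on \<open>C 2\<close> is its pair of values, and translation by 1 exchanges
  the two.\<close>

lemma wreath_iso_swap_semidirect: "wreath (C 3) (C 2) \<cong> semidirect (C 3 \<times>\<times> C 3) (C 2) swap_action"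
proof (rule is_isoI, rule isoI)
  let ?f = "\<lambda>(f :: int \<Rightarrow> int, h :: int). ((f 0, f 1), h)"
  let ?W = "wreath (C 3) (C 2)" and ?G = "semidirect (C 3 \<times>\<times> C 3) (C 2) swap_action"
  have carrW: "carrier ?W = ({0, 1} \<rightarrow>\<^sub>E carrier (C 3)) \<times> {0, 1}"
    by (simp add: wreath_def semidirect_def C_carrier)
  have carrG: "carrier ?G = (carrier (C 3) \<times> carrier (C 3)) \<times> {0, 1}"
    by (simp add: semidirect_def C_carrier)
  show "?f \<in> hom ?W ?G"
  proof (rule homI)
    show "?f x \<in> carrier ?G" if "x \<in> carrier ?W" for x
      using that unfolding carrW carrG by (auto simp: PiE_iff)
    fix x y assume xy: "x \<in> carrier ?W" "y \<in> carrier ?W"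
    obtain f h f' h' where xy': "x = (f, h)" "y = (f', h')" by (metis surj_pair)
    have h: "h = 0 \<or> h = 1" "h' = 0 \<or> h' = 1" using xy unfolding carrW xy' by auto
    have inv: "inv\<^bsub>C 2\<^esub> 0 = 0" "inv\<^bsub>C 2\<^esub> 1 = 1" by (simp_all add: C_carrier)
    show "?f (x \<otimes>\<^bsub>?W\<^esub> y) = ?f x \<otimes>\<^bsub>?G\<^esub> ?f y"
      using h(1) unfolding xy' wreath_def semidirect_def
      by (elim disjE) (simp_all add: swap_action_def inv C_carrier)
  qed
  show "bij_betw ?f (carrier ?W) (carrier ?G)"
  proof (rule bij_betw_byWitness[where f' = "\<lambda>((a, b), h). (\<lambda>x\<in>{0, 1}. if x = 0 then a else b, h)"])
    show "\<forall>x\<in>carrier ?W. (\<lambda>((a, b), h). (\<lambda>x\<in>{0, 1}. if x = 0 then a else b, h)) (?f x) = x"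
      unfolding carrW by (auto simp: fun_eq_iff PiE_iff extensional_def)
    show "(\<lambda>((a, b), h). (\<lambda>x\<in>{0, 1}. if x = 0 then a else b, h)) ` carrier ?G \<subseteq> carrier ?W"
      unfolding carrW carrG by (auto simp: PiE_iff extensional_def split: if_splits)
  qed (unfold carrW carrG, auto simp: PiE_iff)
qed

text \<open>Closure of the source is enough to reverse an isomorphism. For the semidirect products
  it is verified in place of the group axioms.\<close>

lemma iso_sym_if_closed:
  assumes iso: "G \<cong> H" and closed: "\<And>x y. x \<in> carrier G \<Longrightarrow> y \<in> carrier G \<Longrightarrow> x \<otimes>\<^bsub>G\<^esub> y \<in> carrier G"
  shows "H \<cong> G"
proof -
  obtain f where f: "f \<in> hom G H" "bij_betw f (carrier G) (carrier H)"
    using iso by (auto simp: is_iso_def iso_def)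
  define g where "g = inv_into (carrier G) f"
  have g: "g u \<in> carrier G" "f (g u) = u" if "u \<in> carrier H" for u
    using that f(2) unfolding g_def bij_betw_def by (auto simp: inv_into_into f_inv_into_f)
  have gf: "g (f x) = x" if "x \<in> carrier G" for x
    using that f(2) unfolding g_def bij_betw_def by simp
  have "g \<in> hom H G"
  proof (rule homI)
    fix u v assume uv: "u \<in> carrier H" "v \<in> carrier H"
    have "f (g u \<otimes>\<^bsub>G\<^esub> g v) = u \<otimes>\<^bsub>H\<^esub> v" using hom_mult[OF f(1)] g uv by simp
    then show "g (u \<otimes>\<^bsub>H\<^esub> v) = g u \<otimes>\<^bsub>G\<^esub> g v" using gf closed g uv by metis
  qed (use g in auto)
  moreover have "bij_betw g (carrier H) (carrier G)" unfolding g_def by (rule bij_betw_inv_into[OF f(2)])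
  ultimately show ?thesis by (intro is_isoI isoI)
qed

lemma S3_C3_iso_wreath: "S3 \<times>\<times> C 3 \<cong> wreath (C 3) (C 2)"
proof (rule iso_sym_if_closed)
  show "wreath (C 3) (C 2) \<cong> S3 \<times>\<times> C 3"
    by (rule iso_trans[OF wreath_iso_swap_semidirect swap_semidirect_iso_S3_C3])
  have carrW: "carrier (wreath (C 3) (C 2)) = ({0, 1} \<rightarrow>\<^sub>E carrier (C 3)) \<times> {0, 1}"
    by (simp add: wreath_def semidirect_def C_carrier)
  fix x y assume xy: "x \<in> carrier (wreath (C 3) (C 2))" "y \<in> carrier (wreath (C 3) (C 2))"
  obtain f h f' h' where xy': "x = (f, h)" "y = (f', h')" by (metis surj_pair)
  have h: "h = 0 \<or> h = 1" "h' = 0 \<or> h' = 1" using xy unfolding carrW xy' by auto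
  show "x \<otimes>\<^bsub>wreath (C 3) (C 2)\<^esub> y \<in> carrier (wreath (C 3) (C 2))"
    unfolding carrW unfolding xy' wreath_def semidirect_def using h
    by (auto simp: carrier_integer_mod_group split: if_splits)
qed

lemma mod_6_eqI:
  fixes c c' :: int
  assumes "c \<in> {0..<6}" "c' \<in> {0..<6}" "c mod 3 = c' mod 3" "c mod 2 = c' mod 2"
  shows "c = c'"
proof -
  have "c = 0 \<or> c = 1 \<or> c = 2 \<or> c = 3 \<or> c = 4 \<or> c = 5"
    "c' = 0 \<or> c' = 1 \<or> c' = 2 \<or> c' = 3 \<or> c' = 4 \<or> c' = 5" using assms(1,2) by auto
  then show ?thesis using assms(3,4) by (elim disjE) simp_all
qed

text \<open>Reduction modulo 3 and modulo 2 splits the rotations. Inversion is trivial modulo 2, so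
  the reflections act only on the part modulo 3, where they complete the rotations to
  \<open>S3\<close>.\<close>

lemma S3_C2_iso_dihedral: "S3 \<times>\<times> C 2 \<cong> dihedral 6"
proof (rule iso_sym_if_closed)
  have carr: "carrier (dihedral 6) = {0..<6} \<times> {0, 1}" by (simp add: dihedral_def semidirect_def C_carrier)
  have inv6: "inv\<^bsub>C 6\<^esub> c = (- c) mod 6" if "c \<in> {0..<6}" for c using that by (simp add: C_carrier)
  show "x \<otimes>\<^bsub>dihedral 6\<^esub> y \<in> carrier (dihedral 6)" if "x \<in> carrier (dihedral 6)" "y \<in> carrier (dihedral 6)" for x y
    using that unfolding carr by (auto simp: dihedral_def semidirect_def)
  show "dihedral 6 \<cong> S3 \<times>\<times> C 2"
  proof (rule is_iso_if_hom_inj_card)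
    let ?f = "\<lambda>(c, h). (affine3 c h, c mod 2)"
    show "?f \<in> hom (dihedral 6) (S3 \<times>\<times> C 2)"
    proof (rule homI)
      show "?f x \<in> carrier (S3 \<times>\<times> C 2)" if "x \<in> carrier (dihedral 6)" for x
        using affine3_permutes by (auto simp: sym_group_carrier carrier_integer_mod_group split: prod.splits)
      fix x y assume xy: "x \<in> carrier (dihedral 6)" "y \<in> carrier (dihedral 6)"
      obtain c h c' h' where xy': "x = (c, h)" "y = (c', h')" by (metis surj_pair)
      have h: "h \<in> {0, 1}" "h' \<in> {0, 1}" and c: "c' \<in> {0..<6}" using xy unfolding carr xy' by auto
      have 1: "affine3 (u mod 6) k = affine3 u k" for u k
        using affine3_mod[of "u mod 6" k] affine3_mod[of u k] by (simp add: mod_mod_cancel)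
      have 2: "(c + (- c') mod 6) mod 6 = (c - c') mod 6" by (simp add: mod_simps)
      have 3: "(c + c') mod 6 mod 2 = (c mod 2 + c' mod 2) mod 2" "(c - c') mod 6 mod 2 = (c mod 2 + c' mod 2) mod 2"
        by (simp_all add: mod_mod_cancel mod_simps) presburger
      show "?f (x \<otimes>\<^bsub>dihedral 6\<^esub> y) = ?f x \<otimes>\<^bsub>S3 \<times>\<times> C 2\<^esub> ?f y"
        unfolding xy' using h(1)
        by (elim insertE emptyE)
          (simp_all add: dihedral_def semidirect_def sym_group_mult affine3_compose[OF _ h(2)] inv6[OF c] 1 2 3)
    qed
    show "inj_on ?f (carrier (dihedral 6))"
    proof (rule inj_onI)
      fix x y assume xy: "x \<in> carrier (dihedral 6)" "y \<in> carrier (dihedral 6)" and eq: "?f x = ?f y"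
      obtain c h c' h' where xy': "x = (c, h)" "y = (c', h')" by (metis surj_pair)
      have h: "h \<in> {0, 1}" "h' \<in> {0, 1}" and c: "c \<in> {0..<6}" "c' \<in> {0..<6}" using xy unfolding carr xy' by auto
      have "affine3 (c mod 3) h = affine3 (c' mod 3) h'" "c mod 2 = c' mod 2"
        using eq unfolding xy' by (simp_all add: affine3_mod)
      then have "c mod 3 = c' mod 3" "h = h'"
        using affine3_inj[of "c mod 3" "c' mod 3" h h'] h by auto
      moreover have "c = c'" using mod_6_eqI[OF c calculation(1) \<open>c mod 2 = c' mod 2\<close>] .
      ultimately show "x = y" unfolding xy' by simp
    qed
    show "card (carrier (dihedral 6)) = card (carrier (S3 \<times>\<times> C 2))"
      unfolding carr by (simp add: card_cartesian_product card_S3 C_carrier)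
  qed (simp add: card_S3 C_carrier)
qed

text \<open>Chinese remainder theorem.\<close>

lemma C3_C2_iso_C6: "C 3 \<times>\<times> C 2 \<cong> C 6"
proof (rule iso_sym_if_closed)
  show "x \<otimes>\<^bsub>C 6\<^esub> y \<in> carrier (C 6)" for x y by (simp add: C_carrier)
  show "C 6 \<cong> C 3 \<times>\<times> C 2"
  proof (rule is_iso_if_hom_inj_card)
    let ?f = "\<lambda>c :: int. (c mod 3, c mod 2)"
    show "?f \<in> hom (C 6) (C 3 \<times>\<times> C 2)"
    proof (rule homI)
      show "?f x \<in> carrier (C 3 \<times>\<times> C 2)" for x by (simp add: carrier_integer_mod_group)
      show "?f (x \<otimes>\<^bsub>C 6\<^esub> y) = ?f x \<otimes>\<^bsub>C 3 \<times>\<times> C 2\<^esub> ?f y" for x y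
        by (simp add: mod_mod_cancel mod_simps)
    qed
    show "inj_on ?f (carrier (C 6))"
    proof (rule inj_onI)
      fix c c' assume "c \<in> carrier (C 6)" "c' \<in> carrier (C 6)" "?f c = ?f c'"
      then show "c = c'" unfolding C_carrier by (rule_tac mod_6_eqI) simp_all
    qed
  qed (simp_all add: C_carrier)
qed

section \<open>Irreducibility and the action on the roots\<close>

lemma poly_linear_factors_eq_0_iff:
  "poly (\<Prod>u\<leftarrow>xs. [:- u, 1:]) (x::'a::idom) = 0 \<longleftrightarrow> x \<in> set xs"
  by (induction xs) auto

lemma degree_linear_factors: "Polynomial.degree (\<Prod>u\<leftarrow>xs. [:- u, 1:: 'a::idom:]) = length xs"
proof -
  have nz: "(\<Prod>u\<leftarrow>xs. [:- u, 1:: 'a:]) \<noteq> 0" for xs :: "'a list" by (auto simp: prod_list_zero_iff)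
  show ?thesis by (induction xs) (auto simp: degree_mult_eq nz simp del: mult_pCons_left)
qed

lemma rsquarefree_linear_factors_distinct:
  fixes xs :: "'a::idom list"
  assumes "rsquarefree (\<Prod>u\<leftarrow>xs. [:- u, 1:])"
  shows "distinct xs"
proof (rule ccontr)
  assume "\<not> distinct xs"
  then obtain as bs cs u where xs: "xs = as @ [u] @ bs @ [u] @ cs" using not_distinct_decomp by blast
  let ?P = "\<Prod>u\<leftarrow>xs. [:- u, 1:]"
  have "?P = [:- u, 1:] ^ 2 * ((\<Prod>u\<leftarrow>as. [:- u, 1:]) * (\<Prod>u\<leftarrow>bs. [:- u, 1:]) * (\<Prod>u\<leftarrow>cs. [:- u, 1:]))"
    unfolding xs power2_eq_square by (simp only: map_append prod_list.append list.map prod_list.Cons prod_list.Nil mult_1_right mult_1_left ac_simps)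
  then have "[:- u, 1:] ^ 2 dvd ?P" by (rule dvdI)
  moreover have "?P \<noteq> 0" using assms by (simp add: rsquarefree_def)
  ultimately have "2 \<le> Polynomial.order u ?P" by (simp only: order_divides simp_thms)
  moreover have "Polynomial.order u ?P = 0 \<or> Polynomial.order u ?P = 1"
    using assms unfolding rsquarefree_def by blast
  ultimately show False by linarith
qed

lemma is_subfield_range_to_ac: "is_subfield (range (to_ac :: 'a::field \<Rightarrow> _))"
  unfolding is_subfield_def
proof (intro conjI ballI)
  show "0 \<in> range (to_ac :: 'a \<Rightarrow> _)" "1 \<in> range (to_ac :: 'a \<Rightarrow> _)" by (metis rangeI to_ac_0, metis rangeI to_ac_1)
  fix x assume "x \<in> range (to_ac :: 'a \<Rightarrow> _)"
  then obtain u where u: "x = to_ac u" by auto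
  show "- x \<in> range (to_ac :: 'a \<Rightarrow> _)" "inverse x \<in> range (to_ac :: 'a \<Rightarrow> _)"
    unfolding u by (metis rangeI to_ac_minus, metis rangeI to_ac_inverse)
  fix y assume "y \<in> range (to_ac :: 'a \<Rightarrow> _)"
  then obtain v where v: "y = to_ac v" by auto
  show "x + y \<in> range (to_ac :: 'a \<Rightarrow> _)" "x * y \<in> range (to_ac :: 'a \<Rightarrow> _)"
    unfolding u v by (metis rangeI to_ac_add, metis rangeI to_ac_mult)
qed

lemma map_poly_to_ac_mult: "map_poly to_ac (p * q) = map_poly to_ac p * map_poly to_ac q"
  by (rule poly_eqI) (simp add: coeff_map_poly coeff_mult to_ac_sum)

lemma poly_over_map_to_ac: "poly_over (range to_ac) (map_poly to_ac p)"
  by (simp add: poly_over_def coeff_map_poly)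

text \<open>A nonconstant factor of \<open>F\<close> has some root \<open>r\<close>. By transitivity
  from \<open>r0\<close> every other root is a conjugate of \<open>r\<close>, hence a root of the
  same factor; as the roots are distinct, the factor has full degree. Transitivity is stated from
  one root \<open>r0\<close> only, and inverses and compositions connect any two.\<close>

lemma
  fixes F :: "'a::field poly" and H :: "'h monoid"
  assumes nm: "no_multiple_root F" and fact: "map_poly to_ac F = (\<Prod>u\<leftarrow>xs. [:- u, 1:])"
    and len: "length xs = n" and n: "n > 0" and H: "group H" and iso: "poly_galois_group F \<cong> H"
    and trans: "\<And>r. r \<in> set xs \<Longrightarrow> \<exists>\<sigma>\<in>carrier (poly_galois_group F). \<sigma> r0 = r" and r0: "r0 \<in> set xs"
  shows irreducible_if_transitive: "irreducible F"
    and transitive_galois_actionI: "transitive_galois_action n H F"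
proof -
  note atLeastAtMost_iff [simp del]
  define K where "K = range (to_ac :: 'a \<Rightarrow> _)"
  define L where "L = adjoin K (set xs)"
  let ?G = "galois_group K L"
  have roots: "ac_roots F = set xs" unfolding ac_roots_def fact poly_linear_factors_eq_0_iff by simp
  have Gal: "poly_galois_group F = ?G"
    by (simp add: poly_galois_group_def ac_splitting_field_def roots K_def L_def)
  have L: "is_subfield L" and KL: "K \<subseteq> L" and K: "is_subfield K"
    unfolding L_def K_def by (rule subfield_adjoin, rule adjoin_base, rule is_subfield_range_to_ac)
  have xL: "set xs \<subseteq> L" unfolding L_def by (rule adjoin_gens)
  have dist: "distinct xs" using nm unfolding no_multiple_root_def fact by (rule rsquarefree_linear_factors_distinct)
  then have card: "card (set xs) = n" using len by (simp add: distinct_card)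
  have deg: "Polynomial.degree F = n"
    using degree_linear_factors[of xs] len unfolding fact[symmetric] by (simp add: degree_map_poly)
  have root_image: "poly (map_poly to_ac a) (\<sigma> r) = 0"
    if "poly (map_poly to_ac a) r = 0" "\<sigma> \<in> carrier ?G" "r \<in> set xs" for a \<sigma> r
  proof -
    interpret subfield_hom L \<sigma> by (rule galois_hom[OF L that(2)])
    have "r \<in> L" using that xL by auto
    have "\<sigma> (poly (map_poly to_ac a) r) = poly (map_poly to_ac a) (\<sigma> r)"
      by (rule poly[OF poly_over_map_to_ac _ _ \<open>r \<in> L\<close>])
        (use KL galois_fix[OF that(2)] in \<open>auto simp: K_def\<close>)
    then show ?thesis using that zero by simp
  qed
  show "irreducible F"
  proof (rule irreducibleI)
    show "F \<noteq> 0" using deg n by auto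
    show "\<not> F dvd 1" using deg n is_unit_iff_degree[OF \<open>F \<noteq> 0\<close>] by simp
    fix a b assume ab: "F = a * b"
    show "a dvd 1 \<or> b dvd 1"
    proof (rule ccontr)
      assume H: "\<not> (a dvd 1 \<or> b dvd 1)"
      have ab0: "a \<noteq> 0" "b \<noteq> 0" using ab \<open>F \<noteq> 0\<close> by auto
      then have pos: "Polynomial.degree a > 0" "Polynomial.degree b > 0" using H using is_unit_iff_degree[OF ab0(1)] is_unit_iff_degree[OF ab0(2)] by auto
      have "Polynomial.degree (map_poly to_ac a) > 0" using pos by (simp add: degree_map_poly)
      then obtain r where r: "poly (map_poly to_ac a) r = 0" using alg_closed_imp_poly_has_root by blast
      then have "poly (map_poly to_ac F) r = 0" unfolding ab map_poly_to_ac_mult by simp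
      then have rx: "r \<in> set xs" unfolding fact poly_linear_factors_eq_0_iff .
      obtain \<sigma> where s: "\<sigma> \<in> carrier ?G" "\<sigma> r0 = r" using trans[OF rx] unfolding Gal by blast
      have "set xs \<subseteq> {x. poly (map_poly to_ac a) x = 0}"
      proof
        fix r' assume "r' \<in> set xs"
        then obtain \<tau> where t: "\<tau> \<in> carrier ?G" "\<tau> r0 = r'" using trans unfolding Gal by blast
        define \<rho> where "\<rho> = restrict (inv_into L \<sigma>) L"
        have \<rho>: "\<rho> \<in> carrier ?G" unfolding \<rho>_def by (rule galois_inverse[OF L KL s(1)])
        have "\<rho> r = r0" using s galois_bij[OF s(1)] xL rx r0
          by (auto simp: \<rho>_def bij_betw_def inv_into_f_f subset_iff)
        then have "poly (map_poly to_ac a) r0 = 0" using root_image[OF r \<rho> rx] by simp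
        from root_image[OF this t(1) r0] show "r' \<in> {x. poly (map_poly to_ac a) x = 0}" by (simp add: t)
      qed
      then have "n \<le> card {x. poly (map_poly to_ac a) x = 0}"
        using ab0 unfolding card[symmetric] by (intro card_mono poly_roots_finite) (auto simp: map_poly_eq_0_iff)
      also have "\<dots> \<le> Polynomial.degree (map_poly to_ac a)"
        using ab0 by (intro card_poly_roots_bound) (auto simp: map_poly_eq_0_iff)
      also have "\<dots> = Polynomial.degree a" by (simp add: degree_map_poly)
      finally show False using deg ab ab0 pos by (simp add: degree_mult_eq)
    qed
  qed
  have G: "group ?G" by (rule group_galois_group[OF L KL])
  then obtain \<psi> where psi: "\<psi> \<in> iso H ?G" using group.iso_sym[OF G] iso unfolding Gal is_iso_def by blast
  then have psi_hom: "\<psi> \<in> hom H ?G" and psi_bij: "bij_betw \<psi> (carrier H) (carrier ?G)" by (auto simp: iso_def)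
  have psi_in: "\<psi> x \<in> carrier ?G" if "x \<in> carrier H" for x using psi_bij that by (auto simp: bij_betw_def)
  obtain r where r: "bij_betw r {1..n} (set xs)"
    using ex_bij_betw_nat_finite_1[of "set xs"] card by auto
  have rin: "r i \<in> set xs" "r i \<in> L" if "i \<in> {1..n}" for i using r that xL by (auto simp: bij_betw_def)
  have rinj: "i = j" if "r i = r j" "i \<in> {1..n}" "j \<in> {1..n}" for i j
    using r that by (auto simp: bij_betw_def dest: inj_onD)
  have sroot: "\<sigma> u \<in> set xs" if "\<sigma> \<in> carrier ?G" "u \<in> set xs" for \<sigma> u
    using root_image[of F u \<sigma>] that unfolding fact poly_linear_factors_eq_0_iff by blast
  \<comment> \<open>The automorphism \<open>\<psi> x\<close>, read on labels through the numbering
    \<open>r\<close>.\<close>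
  define \<phi> where "\<phi> x i = (if i \<in> {1..n} then inv_into {1..n} r (\<psi> x (r i)) else i)" for x i
  have phi: "\<phi> x i \<in> {1..n}" "r (\<phi> x i) = \<psi> x (r i)" if x: "x \<in> carrier H" and i: "i \<in> {1..n}" for x i
  proof -
    have "\<psi> x (r i) \<in> r ` {1..n}" using sroot[OF psi_in[OF x] rin(1)[OF i]] r by (simp add: bij_betw_def)
    then show "\<phi> x i \<in> {1..n}" "r (\<phi> x i) = \<psi> x (r i)"
      using i by (simp_all add: \<phi>_def inv_into_into f_inv_into_f)
  qed
  have phi_out: "\<phi> x i = i" if "i \<notin> {1..n}" for x i using that by (simp only: \<phi>_def if_False)
  have phi_perm: "\<phi> x permutes {1..n}" if x: "x \<in> carrier H" for x
  proof (rule bij_imp_permutes)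
    have "inj_on (\<phi> x) {1..n}"
    proof (rule inj_onI)
      fix i j assume ij: "i \<in> {1..n}" "j \<in> {1..n}" "\<phi> x i = \<phi> x j"
      then have "\<psi> x (r i) = \<psi> x (r j)" using phi(2)[OF x] by metis
      then have "r i = r j" using galois_bij[OF psi_in[OF x]] rin(2) ij by (auto simp: bij_betw_def dest: inj_onD)
      then show "i = j" using rinj ij by blast
    qed
    moreover have "\<phi> x ` {1..n} \<subseteq> {1..n}" using phi(1)[OF x] by blast
    ultimately show "bij_betw (\<phi> x) {1..n} {1..n}" by (simp add: bij_betw_def endo_inj_surj)
  qed (rule phi_out)
  show "transitive_galois_action n H F"
    unfolding transitive_galois_action_def roots Gal
  proof (intro exI conjI)
    show "bij_betw r {1..n} (set xs)" by (rule r)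
    show "\<phi> \<in> mon H (sym_group n)"
      unfolding mon_def
    proof (intro CollectI conjI)
      show "\<phi> \<in> hom H (sym_group n)"
      proof (rule homI)
        fix x y assume xy: "x \<in> carrier H" "y \<in> carrier H"
        have xy': "x \<otimes>\<^bsub>H\<^esub> y \<in> carrier H" using group.is_monoid[OF H] xy by (simp add: monoid.m_closed)
        show "\<phi> (x \<otimes>\<^bsub>H\<^esub> y) = \<phi> x \<otimes>\<^bsub>sym_group n\<^esub> \<phi> y"
          unfolding sym_group_mult
        proof
          fix i
          show "\<phi> (x \<otimes>\<^bsub>H\<^esub> y) i = (\<phi> x \<circ> \<phi> y) i"
          proof (cases "i \<in> {1..n}")
            case True
            have "r (\<phi> (x \<otimes>\<^bsub>H\<^esub> y) i) = \<psi> x (\<psi> y (r i))"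
              using phi(2)[OF xy' True] hom_mult[OF psi_hom xy] psi_in xy rin(2)[OF True]
              by (simp add: galois_group_mult compose_def)
            also have "\<dots> = r (\<phi> x (\<phi> y i))" using phi xy True by simp
            finally show ?thesis using rinj phi xy xy' True by simp
          qed (simp add: phi_out)
        qed
      qed (simp add: sym_group_carrier phi_perm)
      show "inj_on \<phi> (carrier H)"
      proof (rule inj_onI)
        fix x y assume xy: "x \<in> carrier H" "y \<in> carrier H" "\<phi> x = \<phi> y"
        have "\<psi> x u = \<psi> y u" if u: "u \<in> set xs" for u
        proof -
          obtain i where "i \<in> {1..n}" "u = r i" using u r by (metis bij_betw_def imageE)
          then show ?thesis using phi(2)[OF xy(1)] phi(2)[OF xy(2)] xy(3) by metis
        qed
        then have "\<psi> x = \<psi> y" by (intro galois_eqI[OF L L_def[symmetric] psi_in psi_in] xy) auto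
        then show "x = y" using psi_bij xy by (auto simp: bij_betw_def dest: inj_onD)
      qed
    qed
    show "\<phi> ` carrier H = {p \<in> carrier (sym_group n). \<exists>\<sigma>\<in>carrier ?G. \<forall>i\<in>{1..n}. \<sigma> (r i) = r (p i)}"
    proof (intro equalityI subsetI)
      fix p assume "p \<in> \<phi> ` carrier H"
      then obtain x where x: "x \<in> carrier H" "p = \<phi> x" by auto
      then show "p \<in> {p \<in> carrier (sym_group n). \<exists>\<sigma>\<in>carrier ?G. \<forall>i\<in>{1..n}. \<sigma> (r i) = r (p i)}"
        using phi_perm[OF x(1)] phi(2)[OF x(1)] psi_in[OF x(1)]
        by (intro CollectI conjI bexI[of _ "\<psi> x"]) (simp_all add: sym_group_carrier)
    next
      fix p assume p: "p \<in> {p \<in> carrier (sym_group n). \<exists>\<sigma>\<in>carrier ?G. \<forall>i\<in>{1..n}. \<sigma> (r i) = r (p i)}"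
      then obtain \<sigma> where s: "\<sigma> \<in> carrier ?G" "\<forall>i\<in>{1..n}. \<sigma> (r i) = r (p i)" and pp: "p permutes {1..n}"
        by (auto simp: sym_group_carrier)
      obtain x where x: "x \<in> carrier H" "\<psi> x = \<sigma>" using psi_bij s(1) by (metis bij_betw_def imageE)
      have "\<phi> x i = p i" for i
      proof (cases "i \<in> {1..n}")
        case True
        then have "r (\<phi> x i) = r (p i)" using phi(2)[OF x(1)] s(2) x(2) by simp
        then show ?thesis using rinj phi(1)[OF x(1) True] permutes_in_image[OF pp] True by blast
      next
        case False
        then show ?thesis using phi_out permutes_not_in[OF pp] by simp
      qed
      then show "p \<in> \<phi> ` carrier H" using x(1) by (intro image_eqI[of _ _ x]) auto
    qed
    show "\<forall>i\<in>{1..n}. \<forall>j\<in>{1..n}. \<exists>x\<in>carrier H. \<phi> x i = j"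
    proof (intro ballI)
      fix i j assume ij: "i \<in> {1..n}" "j \<in> {1..n}"
      obtain \<sigma> \<tau> where st: "\<sigma> \<in> carrier ?G" "\<sigma> r0 = r i" "\<tau> \<in> carrier ?G" "\<tau> r0 = r j"
        using trans[OF rin(1)[OF ij(1)]] trans[OF rin(1)[OF ij(2)]] unfolding Gal by blast
      define \<rho> where "\<rho> = restrict (inv_into L \<sigma>) L"
      have \<rho>: "\<rho> \<in> carrier ?G" unfolding \<rho>_def by (rule galois_inverse[OF L KL st(1)])
      have "inj_on \<sigma> L" "r0 \<in> L" using galois_bij[OF st(1)] xL r0 by (auto simp: bij_betw_def)
      then have "inv_into L \<sigma> (r i) = r0" unfolding st(2)[symmetric] by (rule inv_into_f_f)
      then have "\<rho> (r i) = r0" using rin(2)[OF ij(1)] by (simp add: \<rho>_def)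
      moreover have "compose L \<tau> \<rho> \<in> carrier ?G" by (rule galois_compose[OF L KL st(3) \<rho>])
      then obtain x where x: "x \<in> carrier H" "\<psi> x = compose L \<tau> \<rho>"
        using psi_bij by (metis bij_betw_def imageE)
      ultimately have "r (\<phi> x i) = r j" using phi(2)[OF x(1) ij(1)] rin(2)[OF ij(1)] st
        by (simp add: compose_def)
      then show "\<exists>x\<in>carrier H. \<phi> x i = j" using rinj phi(1)[OF x(1) ij(1)] ij x(1) by blast
    qed
  qed
qed

section \<open>Specialization\<close>

text \<open>A common notion for the embedding of \<open>k\<close>, the evaluations of polynomials
  and the inclusions into fraction fields and algebraic closures.\<close>

definition ring_map :: "('p::comm_ring_1 \<Rightarrow> 'w::comm_ring_1) \<Rightarrow> bool" where
  "ring_map e \<longleftrightarrow> e 0 = 0 \<and> e 1 = 1 \<and> (\<forall>p q. e (p + q) = e p + e q) \<and> (\<forall>p q. e (p * q) = e p * e q)"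

lemma ring_map_uminus: "ring_map e \<Longrightarrow> e (- p) = - e p"
  unfolding ring_map_def by (metis add_eq_0_iff add.right_inverse)

lemma ring_map_sum: "ring_map e \<Longrightarrow> e (sum f A) = (\<Sum>i\<in>A. e (f i))"
  by (induction A rule: infinite_finite_induct) (auto simp: ring_map_def)

lemma ring_map_poly:
  assumes "ring_map e"
  shows "ring_map (\<lambda>p. poly (map_poly e p) x)"
proof -
  have e: "e 0 = 0" "e 1 = 1" "\<And>p q. e (p + q) = e p + e q" "\<And>p q. e (p * q) = e p * e q"
    using assms by (auto simp: ring_map_def)
  have "map_poly e (p + q) = map_poly e p + map_poly e q" for p q
    by (rule poly_eqI) (simp add: coeff_map_poly e)
  moreover have "map_poly e (p * q) = map_poly e p * map_poly e q" for p q
    by (rule poly_eqI) (simp add: coeff_map_poly e coeff_mult ring_map_sum[OF assms])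
  ultimately show ?thesis unfolding ring_map_def by (simp add: e map_poly_1')
qed

lemma ring_map_field_embedding:
  assumes "field_embedding \<iota>"
  shows "ring_map \<iota>"
proof -
  have "\<iota> 0 + \<iota> 0 = \<iota> 0 + 0" using assms unfolding field_embedding_def by (metis add_0 add_0_right)
  then have "\<iota> 0 = 0" by (simp only: add_left_cancel)
  then show ?thesis using assms by (auto simp: ring_map_def field_embedding_def)
qed

lemma ring_map_eval1: "field_embedding \<iota> \<Longrightarrow> ring_map (eval1 \<iota> a)"
  unfolding eval1_def by (intro ring_map_poly ring_map_field_embedding)

lemma ring_map_eval2: "field_embedding \<iota> \<Longrightarrow> ring_map (eval2 \<iota> (a, b))"
  unfolding eval2_def prod.case by (intro ring_map_poly ring_map_eval1)

text \<open>One coefficient of \<open>specializes_to\<close>. It is a relation because a fraction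
  has a value only where some representation has nonvanishing denominator; being compatible with the
  field operations, it allows whole formulas to be specialized without explicit
  denominators.\<close>

definition value_at :: "('p::idom \<Rightarrow> 'w::field) \<Rightarrow> 'p fract \<Rightarrow> 'w \<Rightarrow> bool" where
  "value_at e r v \<longleftrightarrow> (\<exists>p q. q \<noteq> 0 \<and> e q \<noteq> 0 \<and> r = Fract p q \<and> v = e p / e q)"

named_theorems value_intros

context
  fixes e :: "'p::idom \<Rightarrow> 'w::field"
  assumes e: "ring_map e"
begin

private lemma em: "e 0 = 0" "e 1 = 1" "e (p + q) = e p + e q" "e (p * q) = e p * e q"
  using e by (auto simp: ring_map_def)

lemma value_at_const: "value_at e (Fract p 1) (e p)"
  unfolding value_at_def by (rule exI[of _ p], rule exI[of _ 1]) (simp add: em)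

lemma value_at_0 [value_intros]: "value_at e 0 0"
  using value_at_const[of 0] by (simp add: em Zero_fract_def)

lemma value_at_1 [value_intros]: "value_at e 1 1"
  using value_at_const[of 1] by (simp add: em One_fract_def)

lemma value_at_add [value_intros]:
  assumes "value_at e r v" "value_at e r' v'"
  shows "value_at e (r + r') (v + v')"
proof -
  obtain p q where 1: "q \<noteq> 0" "e q \<noteq> 0" "r = Fract p q" "v = e p / e q" using assms by (auto simp: value_at_def)
  obtain p' q' where 2: "q' \<noteq> 0" "e q' \<noteq> 0" "r' = Fract p' q'" "v' = e p' / e q'" using assms by (auto simp: value_at_def)
  show ?thesis unfolding value_at_def using 1 2
    by (rule_tac exI[of _ "p * q' + p' * q"], rule_tac exI[of _ "q * q'"]) (simp add: em add_frac_eq)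
qed

lemma value_at_mult [value_intros]:
  assumes "value_at e r v" "value_at e r' v'"
  shows "value_at e (r * r') (v * v')"
proof -
  obtain p q where 1: "q \<noteq> 0" "e q \<noteq> 0" "r = Fract p q" "v = e p / e q" using assms by (auto simp: value_at_def)
  obtain p' q' where 2: "q' \<noteq> 0" "e q' \<noteq> 0" "r' = Fract p' q'" "v' = e p' / e q'" using assms by (auto simp: value_at_def)
  show ?thesis unfolding value_at_def using 1 2
    by (rule_tac exI[of _ "p * p'"], rule_tac exI[of _ "q * q'"]) (simp add: em)
qed

lemma value_at_uminus [value_intros]: "value_at e r v \<Longrightarrow> value_at e (- r) (- v)"
  unfolding value_at_def by (metis ring_map_uminus[OF e] minus_fract minus_divide_left)

lemma value_at_diff [value_intros]:
  "value_at e r v \<Longrightarrow> value_at e r' v' \<Longrightarrow> value_at e (r - r') (v - v')"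
  using value_at_add[of r v "- r'" "- v'"] value_at_uminus[of r' v'] by simp

lemma value_at_inverse:
  assumes "value_at e r v" "v \<noteq> 0"
  shows "value_at e (inverse r) (inverse v)"
proof -
  obtain p q where 1: "q \<noteq> 0" "e q \<noteq> 0" "r = Fract p q" "v = e p / e q" using assms by (auto simp: value_at_def)
  then have "e p \<noteq> 0" "p \<noteq> 0" using assms(2) em(1) by auto
  then show ?thesis unfolding value_at_def using 1
    by (rule_tac exI[of _ q], rule_tac exI[of _ p]) simp
qed

lemma value_at_divide [value_intros]:
  "value_at e r v \<Longrightarrow> value_at e r' v' \<Longrightarrow> v' \<noteq> 0 \<Longrightarrow> value_at e (r / r') (v / v')"
  using value_at_mult[of r v "inverse r'" "inverse v'"] value_at_inverse[of r' v'] by (simp add: divide_inverse)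

lemma value_at_power [value_intros]: "value_at e r v \<Longrightarrow> value_at e (r ^ n) (v ^ n)"
  by (induction n) (auto intro: value_intros)

lemma value_at_numeral [value_intros]: "value_at e (numeral n) (numeral n)"
proof -
  have "value_at e (of_nat m) (of_nat m)" for m by (induction m) (auto intro: value_intros)
  from this[of "numeral n"] show ?thesis by simp
qed

end

lemma specializes_to_iff: "specializes_to e F f \<longleftrightarrow> (\<forall>i. value_at e (Polynomial.coeff F i) (Polynomial.coeff f i))"
  unfolding specializes_to_def value_at_def ..

lemma specializes_to_pCons:
  "value_at e a b \<Longrightarrow> specializes_to e F f \<Longrightarrow> specializes_to e (pCons a F) (pCons b f)"
  unfolding specializes_to_iff by (auto simp: coeff_pCons split: nat.splits)

lemma specializes_to_0: "ring_map e \<Longrightarrow> specializes_to e 0 0"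
  unfolding specializes_to_iff by (simp add: value_at_0)

lemma value_at_vars:
  assumes "field_embedding \<iota>"
  shows "value_at (eval1 \<iota> a) var1_s a" "value_at (eval2 \<iota> (a, b)) var2_s a" "value_at (eval2 \<iota> (a, b)) var2_t b"
proof -
  have i: "\<iota> 0 = 0" "\<iota> 1 = 1" using ring_map_field_embedding[OF assms] by (auto simp: ring_map_def)
  have 1: "eval1 \<iota> a [:0, 1:] = a" by (simp add: eval1_def map_poly_pCons i)
  have e1: "eval1 \<iota> a 0 = 0" "eval1 \<iota> a 1 = 1" using ring_map_eval1[OF assms] by (auto simp: ring_map_def)
  have 2: "eval2 \<iota> (a, b) [:[:0, 1:]:] = a" "eval2 \<iota> (a, b) [:0, 1:] = b"
    by (simp_all add: eval2_def map_poly_pCons e1 1)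
  show "value_at (eval1 \<iota> a) var1_s a" "value_at (eval2 \<iota> (a, b)) var2_s a" "value_at (eval2 \<iota> (a, b)) var2_t b"
    using value_at_const[OF ring_map_eval1[OF assms], of a "[:0, 1:]"]
      value_at_const[OF ring_map_eval2[OF assms], of a b "[:[:0, 1:]:]"]
      value_at_const[OF ring_map_eval2[OF assms], of a b "[:0, 1:]"]
    by (simp_all only: 1 2 var1_s_def var2_s_def var2_t_def)
qed

lemma specializes_pairing_sextic:
  assumes e: "ring_map e" and v: "value_at e s a" "value_at e p p'" "value_at e q q'"
    and a: "a \<noteq> 0" "4 * a + 27 \<noteq> 0"
  shows "specializes_to e (pairing_sextic s p q) (pairing_sextic a p' q')"
  unfolding pairing_sextic_def Let_def using a
  by (intro specializes_to_pCons specializes_to_0 e v value_intros[OF e]) simp_all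

lemma specializes_even_sextic:
  assumes e: "ring_map e" and v: "value_at e p p'" "value_at e q q'" "value_at e d d'"
  shows "specializes_to e (even_sextic p q d) (even_sextic p' q' d')"
  unfolding even_sextic_def
  by (intro specializes_to_pCons specializes_to_0 e v value_intros[OF e])

section \<open>Rational function fields\<close>

text \<open>The coefficient ring is generic so that one development serves \<open>k(s)\<close>, with
  \<open>'p = 'k\<close>, and \<open>k(s,t)\<close>, with \<open>'p = 'k poly\<close>.\<close>

definition coef_frac :: "'p::idom \<Rightarrow> 'p poly fract" where
  "coef_frac a = Fract [:a:] 1"

definition var_frac :: "'p::idom poly fract" where
  "var_frac = Fract [:0, 1:] 1"

lemma ring_map_Fract: "ring_map (\<lambda>p :: 'p::idom. Fract p 1)"
  by (auto simp: ring_map_def Zero_fract_def One_fract_def)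

lemma ring_map_coef_frac: "ring_map coef_frac"
  unfolding ring_map_def coef_frac_def
  by (auto simp: Zero_fract_def One_fract_def one_pCons mult.commute)

lemma Fract_eq_0_iff: "Fract p 1 = 0 \<longleftrightarrow> p = (0::'p::idom)"
  by (simp add: Zero_fract_def eq_fract)

lemma coef_frac_simps:
  "coef_frac 0 = 0" "coef_frac 1 = 1" "coef_frac (a + b) = coef_frac a + coef_frac b"
  "coef_frac (a * b) = coef_frac a * coef_frac b" "coef_frac (- a) = - coef_frac a"
  "coef_frac a = 0 \<longleftrightarrow> a = 0"
  using ring_map_coef_frac ring_map_uminus[OF ring_map_coef_frac]
  by (auto simp: ring_map_def coef_frac_def Fract_eq_0_iff)

lemma Fract_pCons: "Fract (pCons a p) 1 = coef_frac a + var_frac * Fract p 1"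
  by (simp add: coef_frac_def var_frac_def)

lemma Fract_sum_monom:
  "Fract (\<Sum>i\<le>n. Polynomial.monom (a i) i) 1 = (\<Sum>i\<le>n. coef_frac (a i) * var_frac ^ i)"
proof -
  have "Fract (Polynomial.monom c i) 1 = coef_frac c * var_frac ^ i" for c :: 'a and i
  proof (induction i)
    case (Suc i)
    then show ?case unfolding monom_Suc Fract_pCons by (simp add: coef_frac_simps ac_simps)
  qed (simp add: monom_0 coef_frac_def)
  then show ?thesis by (simp add: ring_map_sum[OF ring_map_Fract])
qed

text \<open>The copy of the fraction field of \<open>'p\<close> inside that of
  \<open>'p poly\<close>; for \<open>'p = 'k poly\<close> this is \<open>k(s)\<close> inside
  \<open>k(s,t)\<close>.\<close>

definition base_frac :: "'p::idom poly fract set" where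
  "base_frac = {coef_frac a / coef_frac b | a b. b \<noteq> 0}"

lemma is_subfield_base_frac: "is_subfield base_frac"
  unfolding is_subfield_def
proof (intro conjI ballI)
  have I: "coef_frac a / coef_frac b \<in> base_frac" if "b \<noteq> 0" for a b :: 'a
    using that by (auto simp: base_frac_def)
  show "0 \<in> (base_frac :: 'a poly fract set)" "1 \<in> (base_frac :: 'a poly fract set)"
    using I[of 1 0] I[of 1 1] by (simp_all add: coef_frac_simps)
  fix x assume "x \<in> (base_frac :: 'a poly fract set)"
  then obtain a b where x: "x = coef_frac a / coef_frac b" "b \<noteq> 0" by (auto simp: base_frac_def)
  show "- x \<in> base_frac" using I[OF x(2), of "- a"] by (simp add: x coef_frac_simps)
  show "inverse x \<in> base_frac"
  proof (cases "a = 0")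
    case True
    then show ?thesis using I[of 1 0] by (simp add: x coef_frac_simps)
  next
    case False
    then show ?thesis using I[of a b] by (simp add: x)
  qed
  fix y assume "y \<in> (base_frac :: 'a poly fract set)"
  then obtain c d where y: "y = coef_frac c / coef_frac d" "d \<noteq> 0" by (auto simp: base_frac_def)
  show "x + y \<in> base_frac" using I[of "b * d" "a * d + c * b"] x y
    by (simp add: coef_frac_simps add_frac_eq)
  show "x * y \<in> base_frac" using I[of "b * d" "a * c"] x y
    by (simp add: coef_frac_simps)
qed

lemma is_subfield_to_ac_image:
  assumes "is_subfield F"
  shows "is_subfield (to_ac ` F)"
  unfolding is_subfield_def
proof (intro conjI ballI)
  show "0 \<in> to_ac ` F" "1 \<in> to_ac ` F"
    using assms by (metis image_eqI to_ac_0 subfield_zero, metis image_eqI to_ac_1 subfield_one)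
  fix x assume "x \<in> to_ac ` F"
  then obtain u where u: "x = to_ac u" "u \<in> F" by auto
  show "- x \<in> to_ac ` F" "inverse x \<in> to_ac ` F"
    unfolding u using u(2) assms
    by (metis image_eqI to_ac_minus subfield_uminus, metis image_eqI to_ac_inverse subfield_inverse)
  fix y assume "y \<in> to_ac ` F"
  then obtain v where v: "y = to_ac v" "v \<in> F" by auto
  show "x + y \<in> to_ac ` F" "x * y \<in> to_ac ` F"
    unfolding u v using u(2) v(2) assms
    by (metis image_eqI to_ac_add subfield_add, metis image_eqI to_ac_mult subfield_mult)
qed

text \<open>After clearing denominators, an algebraic relation becomes a polynomial over
  \<open>'p\<close> that is zero in the fraction field, so all its coefficients vanish, the leading
  one included.\<close>

lemma var_frac_transcendental:
  "\<not> algebraic_over (to_ac ` base_frac) (to_ac (var_frac :: 'p::idom poly fract))"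
proof
  let ?c = "\<lambda>a :: 'p. to_ac (coef_frac a)"
  assume "algebraic_over (to_ac ` base_frac) (to_ac (var_frac :: 'p poly fract))"
  then obtain p where p: "p \<noteq> 0" "poly_over (to_ac ` base_frac) p" "poly p (to_ac (var_frac :: 'p poly fract)) = 0"
    by (auto simp: algebraic_over_def)
  have "\<exists>d\<in>range ?c. d \<noteq> 0 \<and> (\<forall>i. d * Polynomial.coeff p i \<in> range ?c)"
  proof (rule common_denominator)
    show "1 \<in> range ?c" "0 \<in> range ?c"
      by (metis coef_frac_simps(2) rangeI to_ac_1, metis coef_frac_simps(1) rangeI to_ac_0)
    show "x * y \<in> range ?c" if xy: "x \<in> range ?c" "y \<in> range ?c" for x y
    proof -
      obtain a b where "x = ?c a" "y = ?c b" using xy by blast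
      then have "x * y = ?c (a * b)" by (simp add: coef_frac_simps)
      then show ?thesis by (rule image_eqI) simp
    qed
    show "\<exists>x\<in>range ?c. \<exists>y\<in>range ?c. y \<noteq> 0 \<and> Polynomial.coeff p i = x / y" for i
    proof -
      have "Polynomial.coeff p i \<in> to_ac ` base_frac" using p(2) by (simp add: poly_over_def)
      then obtain a b where "Polynomial.coeff p i = ?c a / ?c b" "b \<noteq> 0" by (auto simp: base_frac_def)
      then show ?thesis by (intro bexI[of _ "?c a"] bexI[of _ "?c b"]) (simp_all add: coef_frac_simps)
    qed
  qed
  then obtain d where d: "d \<noteq> 0" "\<forall>i. \<exists>a. d * Polynomial.coeff p i = ?c a" by blast
  then obtain a where a: "\<And>i. d * Polynomial.coeff p i = ?c (a i)" by metis
  define n where "n = Polynomial.degree p"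
  have "to_ac (Fract (\<Sum>i\<le>n. Polynomial.monom (a i) i) 1) = (\<Sum>i\<le>n. ?c (a i) * to_ac var_frac ^ i)"
    by (simp add: Fract_sum_monom to_ac_sum)
  also have "\<dots> = d * poly p (to_ac var_frac)"
    by (simp add: a[symmetric] poly_altdef n_def sum_distrib_left ac_simps)
  finally have "(\<Sum>i\<le>n. Polynomial.monom (a i) i) = 0" using p(3) by (simp add: Fract_eq_0_iff)
  then have "Polynomial.coeff (\<Sum>i\<le>n. Polynomial.monom (a i) i) n = 0" by simp
  then have "a n = 0" by (simp add: coeff_sum)
  then have "d * Polynomial.coeff p n = 0" using a[of n] by (simp add: coef_frac_simps)
  then show False using d p(1) by (simp add: n_def)
qed

lemma fract_in_subfield:
  assumes F: "is_subfield F" and c: "\<And>a. to_ac (coef_frac a) \<in> F" and X: "to_ac var_frac \<in> F"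
  shows "range to_ac \<subseteq> F"
proof -
  have *: "to_ac (Fract p 1) \<in> F" for p
  proof (induction p)
    case 0
    then show ?case using c[of 0] by (simp add: coef_frac_def)
  next
    case (pCons a p)
    then show ?case unfolding Fract_pCons using c X F by (simp add: subfield_add subfield_mult)
  qed
  show ?thesis
  proof
    fix x assume "x \<in> range (to_ac :: 'a poly fract \<Rightarrow> _)"
    then obtain u :: "'a poly fract" where u: "x = to_ac u" by auto
    obtain p q where "u = Fract p q" "q \<noteq> 0" by (cases u) auto
    then have "x = to_ac (Fract p 1) / to_ac (Fract q 1)" by (simp add: u flip: to_ac_divide)
    then show "x \<in> F" using * F by (simp add: subfield_divide)
  qed
qed

definition consts1 :: "'k::field poly fract alg_closure set" where
  "consts1 = range (\<lambda>c. to_ac (coef_frac c))"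

definition consts2 :: "'k::field poly poly fract alg_closure set" where
  "consts2 = range (\<lambda>c. to_ac (coef_frac [:c:]))"

lemma is_subfield_range_ring_map:
  fixes e :: "'k::field \<Rightarrow> 'w::field"
  assumes "ring_map e"
  shows "is_subfield (range e)"
proof -
  have e: "e 0 = 0" "e 1 = 1" "\<And>p q. e (p + q) = e p + e q" "\<And>p q. e (p * q) = e p * e q"
    using assms by (auto simp: ring_map_def)
  have inv: "e (inverse a) = inverse (e a)" for a
  proof (cases "a = 0")
    case False
    then have "e a * e (inverse a) = 1" using e(2,4) by (metis right_inverse)
    then show ?thesis by (rule inverse_unique[symmetric])
  qed (simp add: e)
  show ?thesis unfolding is_subfield_def
  proof (intro conjI ballI)
    show "0 \<in> range e" "1 \<in> range e" using e(1,2) by (metis rangeI)+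
    fix x assume "x \<in> range e"
    then obtain u where u: "x = e u" by auto
    show "- x \<in> range e" "inverse x \<in> range e" unfolding u
      by (metis rangeI ring_map_uminus[OF assms], metis rangeI inv)
    fix y assume "y \<in> range e"
    then obtain v where v: "y = e v" by auto
    show "x + y \<in> range e" "x * y \<in> range e" unfolding u v by (metis rangeI e(3), metis rangeI e(4))
  qed
qed

lemma is_subfield_consts:
  "is_subfield (consts1 :: 'k::field poly fract alg_closure set)"
  "is_subfield (consts2 :: 'k::field poly poly fract alg_closure set)"
proof -
  have "ring_map (\<lambda>c :: 'k. to_ac (coef_frac c))" by (simp add: ring_map_def coef_frac_simps)
  then show "is_subfield (consts1 :: 'k poly fract alg_closure set)"
    unfolding consts1_def by (rule is_subfield_range_ring_map)
  have "coef_frac [:c + d:] = coef_frac [:c:] + coef_frac [:d:]" for c d :: 'k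
    using coef_frac_simps(3)[of "[:c:]" "[:d:]"] by simp
  moreover have "coef_frac [:c * d:] = coef_frac [:c:] * coef_frac [:d:]" for c d :: 'k
    using coef_frac_simps(4)[of "[:c:]" "[:d:]"] by (simp add: mult.commute)
  moreover have "[:1 :: 'k:] = 1" by (simp add: one_pCons)
  then have "coef_frac [:1 :: 'k:] = 1" by (simp only: coef_frac_simps(2))
  ultimately have "ring_map (\<lambda>c :: 'k. to_ac (coef_frac [:c:]))"
    by (simp add: ring_map_def coef_frac_simps(1))
  then show "is_subfield (consts2 :: 'k poly poly fract alg_closure set)"
    unfolding consts2_def by (rule is_subfield_range_ring_map)
qed

lemma coef_frac_in_base_frac: "coef_frac a \<in> base_frac"
  unfolding base_frac_def by (rule CollectI, rule exI[of _ a], rule exI[of _ 1]) (simp add: coef_frac_simps)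

lemma to_ac_var1_transcendental: "\<not> algebraic_over consts1 (to_ac var1_s)"
proof -
  have "consts1 \<subseteq> to_ac ` (base_frac :: 'a poly fract set)"
    unfolding consts1_def using coef_frac_in_base_frac by blast
  then show ?thesis using var_frac_transcendental algebraic_over_mono
    unfolding var1_s_def var_frac_def[symmetric] by blast
qed

lemma range_to_ac_adjoin1: "range to_ac \<subseteq> adjoin consts1 {to_ac var1_s}"
proof (rule fract_in_subfield)
  show "to_ac (coef_frac a) \<in> adjoin consts1 {to_ac var1_s}" for a :: 'a
    using adjoin_base[of consts1] by (auto simp: consts1_def)
  show "to_ac var_frac \<in> adjoin consts1 {to_ac var1_s}"
    using adjoin_gens[of "{to_ac var1_s}" consts1] by (simp add: var1_s_def var_frac_def)
qed simp

lemma var2_s_eq: "var2_s = coef_frac [:0, 1:]"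
  by (simp add: var2_s_def coef_frac_def)

text \<open>The inner variable lies in the coefficient ring, so a relation between its powers is a
  relation between the monomials of \<open>k[s]\<close>.\<close>

lemma to_ac_var2_s_transcendental: "\<not> algebraic_over consts2 (to_ac (var2_s :: 'k::field poly poly fract))"
proof
  assume "algebraic_over consts2 (to_ac (var2_s :: 'k poly poly fract))"
  then obtain p where p: "p \<noteq> 0" "poly_over consts2 p" "poly p (to_ac (var2_s :: 'k poly poly fract)) = 0"
    by (auto simp: algebraic_over_def)
  have "\<forall>i. \<exists>c. Polynomial.coeff p i = to_ac (coef_frac [:c:])"
    using p(2) by (auto simp: poly_over_def consts2_def)
  then obtain c where c: "\<And>i. Polynomial.coeff p i = to_ac (coef_frac [:c i:])" by metis
  define n where "n = Polynomial.degree p"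
  have m: "coef_frac (Polynomial.monom a i) = coef_frac [:a:] * var2_s ^ i" for a :: 'k and i
  proof (induction i)
    case (Suc i)
    have "Polynomial.monom a (Suc i) = [:0, 1:] * Polynomial.monom a i" by (simp add: monom_Suc)
    then show ?case using Suc by (simp only: coef_frac_simps(4) var2_s_eq power_Suc ac_simps)
  qed (simp add: monom_0)
  have "to_ac (coef_frac (\<Sum>i\<le>n. Polynomial.monom (c i) i)) = poly p (to_ac var2_s)"
    by (simp add: ring_map_sum[OF ring_map_coef_frac] m to_ac_sum poly_altdef c n_def)
  then have "(\<Sum>i\<le>n. Polynomial.monom (c i) i) = 0" using p(3) by (simp add: coef_frac_simps)
  then have "Polynomial.coeff (\<Sum>i\<le>n. Polynomial.monom (c i) i) n = 0" by simp
  then have "c n = 0" by (simp add: coeff_sum)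
  then have "Polynomial.coeff p n = 0" using c[of n] by (simp add: coef_frac_simps)
  then show False using p(1) by (simp add: n_def)
qed

lemma to_ac_var2_t_transcendental:
  "\<not> algebraic_over (adjoin consts2 {to_ac var2_s}) (to_ac (var2_t :: 'k::field poly poly fract))"
proof -
  have c: "to_ac (coef_frac a) \<in> to_ac ` base_frac" for a :: "'k poly"
    using coef_frac_in_base_frac by blast
  have "adjoin consts2 {to_ac (var2_s :: 'k poly poly fract)} \<subseteq> to_ac ` base_frac"
    using c by (intro adjoin_least is_subfield_to_ac_image is_subfield_base_frac) (auto simp: consts2_def var2_s_eq)
  then show ?thesis using var_frac_transcendental algebraic_over_mono
    unfolding var2_t_def var_frac_def[symmetric] by blast
qed

lemma range_to_ac_adjoin2: "range to_ac \<subseteq> adjoin consts2 {to_ac var2_s, to_ac (var2_t :: 'k::field poly poly fract)}"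
proof (rule fract_in_subfield)
  let ?F = "adjoin consts2 {to_ac var2_s, to_ac (var2_t :: 'k poly poly fract)}"
  have g: "to_ac var2_s \<in> ?F" "to_ac var2_t \<in> ?F" using adjoin_gens[of "{to_ac var2_s, to_ac var2_t}" consts2] by auto
  show "to_ac (coef_frac a) \<in> ?F" for a :: "'k poly"
  proof (induction a)
    case 0
    then show ?case by (simp add: coef_frac_simps subfield_zero)
  next
    case (pCons c a)
    have "pCons c a = [:c:] + [:0, 1:] * a" by simp
    then have "coef_frac (pCons c a) = coef_frac [:c:] + var2_s * coef_frac a"
      by (simp only: coef_frac_simps var2_s_eq)
    moreover have "to_ac (coef_frac [:c:]) \<in> ?F" using adjoin_base[of consts2] by (auto simp: consts2_def)
    ultimately show ?case using pCons g by (simp add: subfield_add subfield_mult)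
  qed
  show "to_ac var_frac \<in> ?F" using g by (simp add: var2_t_def var_frac_def)
qed simp

section \<open>Galois groups over a field with two independent parameters\<close>

lemma algebraic_over_finite_adjoin:
  assumes "finite Y" "is_subfield F" "\<And>y. y \<in> Y \<Longrightarrow> algebraic_over F y" "algebraic_over (adjoin F Y) x"
  shows "algebraic_over F x"
  using assms
proof (induction Y arbitrary: F rule: finite_induct)
  case empty
  then show ?case by (simp add: adjoin_subfield)
next
  case (insert y Y)
  have "adjoin F (insert y Y) = adjoin (adjoin F {y}) Y" by (simp add: adjoin_adjoin)
  then have 1: "algebraic_over (adjoin (adjoin F {y}) Y) x" using insert.prems(3) by simp
  have "algebraic_over (adjoin F {y}) x"
  proof (rule insert.IH[OF _ _ 1])
    show "algebraic_over (adjoin F {y}) z" if "z \<in> Y" for z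
      using insert.prems(2)[of z] that algebraic_over_mono[OF adjoin_base] by simp
  qed simp
  then show ?case using algebraic_over_trans[OF insert.prems(1) insert.prems(2)[of y]] by simp
qed

text \<open>If \<open>s\<close> were algebraic over \<open>B(t)\<close>, exchange would make
  \<open>t\<close> algebraic over \<open>B(s)\<close>.\<close>

lemma transcendental_swap:
  assumes B: "is_subfield B" and s: "\<not> algebraic_over B s" and t: "\<not> algebraic_over (adjoin B {s}) t"
  shows "\<not> algebraic_over B t" "\<not> algebraic_over (adjoin B {t}) s"
proof -
  show "\<not> algebraic_over B t" using t algebraic_over_mono[OF adjoin_base] by blast
  show "\<not> algebraic_over (adjoin B {t}) s" using algebraic_exchange[OF B _ s] t by blast
qed

text \<open>Faithfulness is required of the action on the values \<open>x i\<close> and not merely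
  on the labels, so that an automorphism determines its group element.\<close>

definition frame :: "'h monoid \<Rightarrow> ('h \<Rightarrow> 'i \<Rightarrow> 'i) \<Rightarrow> 'i set \<Rightarrow> ('i \<Rightarrow> 'w) \<Rightarrow> bool" where
  "frame H \<alpha> I x \<longleftrightarrow> group H \<and> finite I \<and> (\<forall>h\<in>carrier H. \<forall>i\<in>I. \<alpha> h i \<in> I) \<and>
     (\<forall>h\<in>carrier H. \<forall>h'\<in>carrier H. \<forall>i\<in>I. \<alpha> (h \<otimes>\<^bsub>H\<^esub> h') i = \<alpha> h (\<alpha> h' i)) \<and>
     (\<forall>h\<in>carrier H. \<forall>h'\<in>carrier H. (\<forall>i\<in>I. x (\<alpha> h i) = x (\<alpha> h' i)) \<longrightarrow> h = h')"

text \<open>What the three families of roots have in common. The quantification over all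
  \<open>F\<close> is essential: with two parameters, \<open>F\<close> will be the base extended by
  the roots of the other family.\<close>

definition rational_frame :: "'w::field \<Rightarrow> 'h monoid \<Rightarrow> ('h \<Rightarrow> 'i \<Rightarrow> 'i) \<Rightarrow> 'i set \<Rightarrow> ('i \<Rightarrow> 'w) \<Rightarrow> bool" where
  "rational_frame s H \<alpha> I x \<longleftrightarrow> frame H \<alpha> I x \<and>
     (\<forall>F. is_subfield F \<longrightarrow> s \<in> adjoin F (x ` I) \<and> (\<forall>i\<in>I. algebraic_over (adjoin F {s}) (x i))) \<and>
     (\<forall>F h. is_subfield F \<longrightarrow> \<not> algebraic_over F s \<longrightarrow> h \<in> carrier H \<longrightarrow>
        (\<exists>\<sigma>\<in>carrier (galois_group (adjoin F {s}) (adjoin F (x ` I))). \<forall>i\<in>I. \<sigma> (x i) = x (\<alpha> h i))) \<and>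
     (\<forall>M L \<sigma>. is_subfield L \<longrightarrow> M \<subseteq> L \<longrightarrow> s \<in> M \<longrightarrow> x ` I \<subseteq> L \<longrightarrow> \<sigma> \<in> carrier (galois_group M L) \<longrightarrow>
        (\<exists>h\<in>carrier H. \<forall>i\<in>I. \<sigma> (x i) = x (\<alpha> h i)))"

lemma rational_frameD:
  assumes "rational_frame s H \<alpha> I x"
  shows "frame H \<alpha> I x" "is_subfield F \<Longrightarrow> s \<in> adjoin F (x ` I)"
    "is_subfield F \<Longrightarrow> i \<in> I \<Longrightarrow> algebraic_over (adjoin F {s}) (x i)"
    "is_subfield F \<Longrightarrow> \<not> algebraic_over F s \<Longrightarrow> h \<in> carrier H \<Longrightarrow>
      \<exists>\<sigma>\<in>carrier (galois_group (adjoin F {s}) (adjoin F (x ` I))). \<forall>i\<in>I. \<sigma> (x i) = x (\<alpha> h i)"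
    "is_subfield L \<Longrightarrow> M \<subseteq> L \<Longrightarrow> s \<in> M \<Longrightarrow> x ` I \<subseteq> L \<Longrightarrow> \<sigma> \<in> carrier (galois_group M L) \<Longrightarrow>
      \<exists>h\<in>carrier H. \<forall>i\<in>I. \<sigma> (x i) = x (\<alpha> h i)"
  using assms unfolding rational_frame_def by blast+

lemma frameD:
  assumes "frame H \<alpha> I x"
  shows "group H" "finite I" "h \<in> carrier H \<Longrightarrow> i \<in> I \<Longrightarrow> \<alpha> h i \<in> I"
    "h \<in> carrier H \<Longrightarrow> h' \<in> carrier H \<Longrightarrow> i \<in> I \<Longrightarrow> \<alpha> (h \<otimes>\<^bsub>H\<^esub> h') i = \<alpha> h (\<alpha> h' i)"
    "h \<in> carrier H \<Longrightarrow> h' \<in> carrier H \<Longrightarrow> (\<And>i. i \<in> I \<Longrightarrow> x (\<alpha> h i) = x (\<alpha> h' i)) \<Longrightarrow> h = h'"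
  using assms unfolding frame_def by blast+

lemma rational_frame_one_param:
  assumes B: "is_subfield B" "\<not> algebraic_over B s" and x: "rational_frame s H \<alpha> I x"
    and K: "K \<subseteq> adjoin B {s}" "B \<subseteq> K" "s \<in> K"
  shows "h \<in> carrier H \<Longrightarrow> \<exists>\<sigma>\<in>carrier (galois_group K (adjoin K (x ` I))). \<forall>i\<in>I. \<sigma> (x i) = x (\<alpha> h i)"
    and "galois_group K (adjoin K (x ` I)) \<cong> H"
proof -
  let ?L = "adjoin K (x ` I)"
  have s: "s \<in> adjoin B (x ` I)" by (rule rational_frameD(2)[OF x B(1)])
  have L: "?L = adjoin B (x ` I)"
  proof (rule adjoin_eqI)
    show "K \<subseteq> adjoin B (x ` I)"
      using K(1) adjoin_least[of "adjoin B (x ` I)" B "{s}"] adjoin_base[of B "x ` I"] s by auto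
    show "B \<subseteq> ?L" using K adjoin_base[of K "x ` I"] by auto
  qed (rule adjoin_gens)+
  show ex: "\<exists>\<sigma>\<in>carrier (galois_group K ?L). \<forall>i\<in>I. \<sigma> (x i) = x (\<alpha> h i)" if "h \<in> carrier H" for h
    unfolding L using rational_frameD(4)[OF x B that] galois_restrict_base[OF _ K(1)] by blast
  have xL: "x ` I \<subseteq> ?L" and KL: "K \<subseteq> ?L" by (rule adjoin_gens adjoin_base)+
  show "galois_group K ?L \<cong> H"
  proof (rule galois_group_iso_of_action[where x = x and I = I and \<alpha> = \<alpha>])
    show "\<exists>h\<in>carrier H. \<forall>i\<in>I. \<sigma> (x i) = x (\<alpha> h i)" if "\<sigma> \<in> carrier (galois_group K ?L)" for \<sigma>
      by (rule rational_frameD(5)[OF x subfield_adjoin KL K(3) xL that])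
    note fr = frameD[OF rational_frameD(1)[OF x]]
    show "h = h'" if "h \<in> carrier H" "h' \<in> carrier H" "\<And>i. i \<in> I \<Longrightarrow> x (\<alpha> h i) = x (\<alpha> h' i)" for h h'
      by (rule fr(5)[OF that])
  qed (use ex KL frameD(1,3,4)[OF rational_frameD(1)[OF x]] in simp_all)
qed

text \<open>Take \<open>F = B(Y)\<close>. Its elements are algebraic over \<open>B(t)\<close>, so
  \<open>s\<close> remains transcendental over it, and the automorphism supplied by the frame over
  \<open>F\<close> fixes \<open>Y\<close> pointwise.\<close>

lemma rational_frame_extend:
  assumes B: "is_subfield B" and s: "\<not> algebraic_over (adjoin B {t}) s" and x: "rational_frame s H \<alpha> I x"
    and h: "h \<in> carrier H" and Y: "finite Y" "\<And>u. u \<in> Y \<Longrightarrow> algebraic_over (adjoin B {t}) u" "t \<in> adjoin B Y"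
  shows "\<exists>\<sigma>\<in>carrier (galois_group (adjoin B {s, t}) (adjoin B (x ` I \<union> Y))).
      (\<forall>i\<in>I. \<sigma> (x i) = x (\<alpha> h i)) \<and> (\<forall>u\<in>Y. \<sigma> u = u)"
proof -
  let ?F = "adjoin B Y"
  have "?F \<subseteq> adjoin (adjoin B {t}) Y" by (intro adjoin_mono adjoin_base) simp
  then have sF: "\<not> algebraic_over ?F s"
    using s algebraic_over_finite_adjoin[OF Y(1) _ Y(2), of s] algebraic_over_mono by blast
  obtain \<sigma> where \<sigma>: "\<sigma> \<in> carrier (galois_group (adjoin ?F {s}) (adjoin ?F (x ` I)))" "\<forall>i\<in>I. \<sigma> (x i) = x (\<alpha> h i)"
    using rational_frameD(4)[OF x subfield_adjoin sF h] by blast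
  have FF: "?F \<subseteq> adjoin ?F {s}" by (rule adjoin_base)
  have "s \<in> adjoin ?F {s}" using adjoin_gens[of "{s}" ?F] by simp
  then have "adjoin B {s, t} \<subseteq> adjoin ?F {s}"
    using FF Y(3) adjoin_base[of B Y] by (intro adjoin_least subfield_adjoin) auto
  moreover have "adjoin ?F (x ` I) = adjoin B (x ` I \<union> Y)" by (simp add: adjoin_adjoin Un_commute)
  ultimately have "\<sigma> \<in> carrier (galois_group (adjoin B {s, t}) (adjoin B (x ` I \<union> Y)))"
    using galois_restrict_base[OF \<sigma>(1)] by simp
  moreover have "\<sigma> u = u" if "u \<in> Y" for u
    using galois_fix[OF \<sigma>(1)] FF adjoin_gens[of Y B] that by blast
  ultimately show ?thesis using \<sigma>(2) by blast
qed

text \<open>For a pair of group elements, an automorphism that moves only the first family is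
  composed with one that moves only the second. The two families become a single one over the
  disjoint sum of the labels.\<close>

lemma rational_frame_two_params:
  assumes B: "is_subfield B" and s: "\<not> algebraic_over B s" and t: "\<not> algebraic_over (adjoin B {s}) t"
    and x: "rational_frame s H \<alpha> I x" and y: "rational_frame t H' \<beta> J y"
    and K: "K \<subseteq> adjoin B {s, t}" "B \<subseteq> K" "s \<in> K" "t \<in> K"
  shows "h \<in> carrier H \<Longrightarrow> h' \<in> carrier H' \<Longrightarrow> \<exists>\<sigma>\<in>carrier (galois_group K (adjoin K (x ` I \<union> y ` J))).
      (\<forall>i\<in>I. \<sigma> (x i) = x (\<alpha> h i)) \<and> (\<forall>j\<in>J. \<sigma> (y j) = y (\<beta> h' j))"
    and "galois_group K (adjoin K (x ` I \<union> y ` J)) \<cong> H \<times>\<times> H'"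
proof -
  let ?L = "adjoin K (x ` I \<union> y ` J)"
  note fx = rational_frameD(1)[OF x] and fy = rational_frameD(1)[OF y]
  note sx = rational_frameD(2)[OF x B] and ty = rational_frameD(2)[OF y B]
  have L: "?L = adjoin B (x ` I \<union> y ` J)"
  proof (rule adjoin_eqI)
    have "s \<in> adjoin B (x ` I \<union> y ` J)" "t \<in> adjoin B (x ` I \<union> y ` J)"
      using sx ty adjoin_mono[of B B "x ` I" "x ` I \<union> y ` J"] adjoin_mono[of B B "y ` J" "x ` I \<union> y ` J"] by auto
    then show "K \<subseteq> adjoin B (x ` I \<union> y ` J)"
      using K(1) adjoin_least[of "adjoin B (x ` I \<union> y ` J)" B "{s, t}"] adjoin_base[of B "x ` I \<union> y ` J"] by auto
    show "B \<subseteq> ?L" using K adjoin_base[of K "x ` I \<union> y ` J"] by auto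
  qed (rule adjoin_gens)+
  have KL: "K \<subseteq> ?L" and gL: "x ` I \<union> y ` J \<subseteq> ?L" by (rule adjoin_base adjoin_gens)+
  have ex: "\<exists>\<sigma>\<in>carrier (galois_group K ?L).
      (\<forall>i\<in>I. \<sigma> (x i) = x (\<alpha> h i)) \<and> (\<forall>j\<in>J. \<sigma> (y j) = y (\<beta> h' j))"
    if h: "h \<in> carrier H" and h': "h' \<in> carrier H'" for h h'
  proof -
    have fin: "finite (x ` I)" "finite (y ` J)" using frameD(2)[OF fx] frameD(2)[OF fy] by auto
    have "\<exists>\<sigma>\<in>carrier (galois_group (adjoin B {s, t}) (adjoin B (x ` I \<union> y ` J))).
        (\<forall>i\<in>I. \<sigma> (x i) = x (\<alpha> h i)) \<and> (\<forall>u\<in>y ` J. \<sigma> u = u)"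
      by (rule rational_frame_extend[OF B transcendental_swap(2)[OF B s t] x h fin(2) _ ty])
        (use rational_frameD(3)[OF y B] in auto)
    then obtain \<sigma> where \<sigma>: "\<sigma> \<in> carrier (galois_group K ?L)" "\<forall>i\<in>I. \<sigma> (x i) = x (\<alpha> h i)" "\<forall>u\<in>y ` J. \<sigma> u = u"
      unfolding L using galois_restrict_base[OF _ K(1)] by blast
    have "\<exists>\<sigma>\<in>carrier (galois_group (adjoin B {t, s}) (adjoin B (y ` J \<union> x ` I))).
        (\<forall>i\<in>J. \<sigma> (y i) = y (\<beta> h' i)) \<and> (\<forall>u\<in>x ` I. \<sigma> u = u)"
      by (rule rational_frame_extend[OF B t y h' fin(1) _ sx])
        (use rational_frameD(3)[OF x B] in auto)
    then obtain \<tau> where \<tau>: "\<tau> \<in> carrier (galois_group K ?L)" "\<forall>i\<in>J. \<tau> (y i) = y (\<beta> h' i)" "\<forall>u\<in>x ` I. \<tau> u = u"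
      unfolding L using galois_restrict_base[OF _ K(1)] by (metis insert_commute Un_commute)
    have "compose ?L \<sigma> \<tau> \<in> carrier (galois_group K ?L)"
      by (rule galois_compose[OF subfield_adjoin KL \<sigma>(1) \<tau>(1)])
    moreover have "compose ?L \<sigma> \<tau> (x i) = x (\<alpha> h i)" if "i \<in> I" for i
      using that gL \<tau>(3) \<sigma>(2) by (simp add: compose_def image_subset_iff)
    moreover have "compose ?L \<sigma> \<tau> (y j) = y (\<beta> h' j)" if "j \<in> J" for j
      using that gL \<tau>(2) \<sigma>(3) frameD(3)[OF fy h'] by (simp add: compose_def image_subset_iff)
    ultimately show ?thesis by blast
  qed
  then show "h \<in> carrier H \<Longrightarrow> h' \<in> carrier H' \<Longrightarrow> \<exists>\<sigma>\<in>carrier (galois_group K ?L).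
      (\<forall>i\<in>I. \<sigma> (x i) = x (\<alpha> h i)) \<and> (\<forall>j\<in>J. \<sigma> (y j) = y (\<beta> h' j))" .
  define \<gamma> where "\<gamma> g k = (case k of Inl i \<Rightarrow> Inl (\<alpha> (fst g) i) | Inr j \<Rightarrow> Inr (\<beta> (snd g) j))" for g k
  define w where "w = case_sum x y"
  have all_x: "\<exists>h\<in>carrier H. \<forall>i\<in>I. \<sigma> (x i) = x (\<alpha> h i)" and all_y: "\<exists>h\<in>carrier H'. \<forall>j\<in>J. \<sigma> (y j) = y (\<beta> h j)"
    if "\<sigma> \<in> carrier (galois_group K ?L)" for \<sigma>
    using rational_frameD(5)[OF x subfield_adjoin KL K(3) _ that]
      rational_frameD(5)[OF y subfield_adjoin KL K(4) _ that] gL by simp_all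
  show "galois_group K ?L \<cong> H \<times>\<times> H'"
  proof (rule galois_group_iso_of_action[where x = w and I = "I <+> J" and \<alpha> = \<gamma>])
    show "group (H \<times>\<times> H')" by (intro DirProd_group frameD(1)[OF fx] frameD(1)[OF fy])
    have "w ` (I <+> J) = x ` I \<union> y ` J" by (simp add: w_def Plus_def image_Un image_image)
    then show "adjoin K (w ` (I <+> J)) = ?L" by simp
    show "\<gamma> g k \<in> I <+> J" if "g \<in> carrier (H \<times>\<times> H')" "k \<in> I <+> J" for g k
      using that frameD(3)[OF fx] frameD(3)[OF fy] by (auto simp: \<gamma>_def)
    show "\<gamma> (g \<otimes>\<^bsub>H \<times>\<times> H'\<^esub> g') k = \<gamma> g (\<gamma> g' k)"
      if "g \<in> carrier (H \<times>\<times> H')" "g' \<in> carrier (H \<times>\<times> H')" "k \<in> I <+> J" for g g' k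
      using that frameD(4)[OF fx] frameD(4)[OF fy] by (auto simp: \<gamma>_def)
    show "g = g'" if g: "g \<in> carrier (H \<times>\<times> H')" "g' \<in> carrier (H \<times>\<times> H')"
      and eq: "\<And>k. k \<in> I <+> J \<Longrightarrow> w (\<gamma> g k) = w (\<gamma> g' k)" for g g'
    proof (rule prod_eqI)
      have "x (\<alpha> (fst g) i) = x (\<alpha> (fst g') i)" if "i \<in> I" for i
        using eq[OF InlI[OF that]] by (simp add: w_def \<gamma>_def)
      then show "fst g = fst g'" using frameD(5)[OF fx, of "fst g" "fst g'"] g by auto
      have "y (\<beta> (snd g) j) = y (\<beta> (snd g') j)" if "j \<in> J" for j
        using eq[OF InrI[OF that]] by (simp add: w_def \<gamma>_def)
      then show "snd g = snd g'" using frameD(5)[OF fy, of "snd g" "snd g'"] g by auto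
    qed
    show "\<exists>\<sigma>\<in>carrier (galois_group K ?L). \<forall>k\<in>I <+> J. \<sigma> (w k) = w (\<gamma> g k)" if gc: "g \<in> carrier (H \<times>\<times> H')" for g
    proof -
      obtain \<sigma> where "\<sigma> \<in> carrier (galois_group K ?L)" "\<forall>i\<in>I. \<sigma> (x i) = x (\<alpha> (fst g) i)" "\<forall>j\<in>J. \<sigma> (y j) = y (\<beta> (snd g) j)"
        using ex[of "fst g" "snd g"] gc by auto
      then show ?thesis by (intro bexI[of _ \<sigma>]) (auto simp: w_def \<gamma>_def)
    qed
    show "\<exists>g\<in>carrier (H \<times>\<times> H'). \<forall>k\<in>I <+> J. \<sigma> (w k) = w (\<gamma> g k)" if s: "\<sigma> \<in> carrier (galois_group K ?L)" for \<sigma>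
    proof -
      obtain h h' where "h \<in> carrier H" "\<forall>i\<in>I. \<sigma> (x i) = x (\<alpha> h i)" "h' \<in> carrier H'" "\<forall>j\<in>J. \<sigma> (y j) = y (\<beta> h' j)"
        using all_x[OF s] all_y[OF s] by blast
      then show ?thesis by (intro bexI[of _ "(h, h')"]) (auto simp: w_def \<gamma>_def)
    qed
  qed (use KL in auto)
qed

lemma rational_frame_S3:
  assumes x: "cubic_roots s s x" and inj: "inj_on x {1..3}"
  shows "rational_frame s S3 (\<lambda>h. h) {1..3} x"
  unfolding rational_frame_def
proof (intro conjI allI impI)
  note atLeastAtMost_iff [simp del]
  show "frame S3 (\<lambda>h. h) {1..3} x"
    unfolding frame_def
  proof (intro conjI ballI impI)
    show "h i \<in> {1..3}" if "h \<in> carrier S3" "i \<in> {1..3}" for h i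
      using that permutes_in_image[of h "{1..3}" i] by (simp add: sym_group_carrier)
    show "h = h'" if h: "h \<in> carrier S3" "h' \<in> carrier S3" and eq: "\<forall>i\<in>{1..3}. x (h i) = x (h' i)" for h h'
    proof
      fix i
      show "h i = h' i"
      proof (cases "i \<in> {1..3}")
        case True
        then have "h i \<in> {1..3}" "h' i \<in> {1..3}" using h permutes_in_image[of h "{1..3}" i] permutes_in_image[of h' "{1..3}" i]
          by (simp_all add: sym_group_carrier)
        then show ?thesis using inj_onD[OF inj] eq True by blast
      qed (use h in \<open>simp add: sym_group_carrier permutes_not_in\<close>)
    qed
  qed (simp_all add: sym_group_is_group sym_group_mult)
  fix F :: "'a set" assume F: "is_subfield F"
  have "x i \<in> adjoin F (x ` {1..3})" if "i \<in> {1..3}" for i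
    by (rule subsetD[OF adjoin_gens]) (use that in auto)
  then have "x 1 * x 2 + x 1 * x 3 + x 2 * x 3 \<in> adjoin F (x ` {1..3})"
    by (intro subfield_add subfield_mult subfield_adjoin) (simp_all add: atLeastAtMost_13)
  then show "s \<in> adjoin F (x ` {1..3})" unfolding cubic_rootsD(2)[OF x] .
  show "\<forall>i\<in>{1..3}. algebraic_over (adjoin F {s}) (x i)"
  proof
    fix i assume i: "i \<in> {1..3::nat}"
    have "s \<in> adjoin F {s}" using adjoin_gens[of "{s}" F] by simp
    then have "poly_over (adjoin F {s}) [:s, s, 0, 1:]"
      by (intro poly_over_closed(8)) (auto intro: poly_over_closed(1) subfield_zero subfield_one)
    moreover have "poly [:s, s, 0, 1:] (x i) = x i ^ 3 + s * x i + s"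
      by (simp add: algebra_simps power3_eq_cube)
    moreover have "x i ^ 3 + s * x i + s = 0" using cubic_roots_iff[OF x] i by blast
    ultimately show "algebraic_over (adjoin F {s}) (x i)" unfolding algebraic_over_def by (metis pCons_eq_0_iff zero_neq_one)
  qed
next
  fix F h assume "is_subfield F" "\<not> algebraic_over F s" "h \<in> carrier S3"
  then show "\<exists>\<sigma>\<in>carrier (galois_group (adjoin F {s}) (adjoin F (x ` {1..3}))). \<forall>i\<in>{1..3}. \<sigma> (x i) = x (h i)"
    by (intro S3_automorphism x) (simp_all add: sym_group_carrier)
next
  fix M L \<sigma> assume "is_subfield L" "M \<subseteq> L" "s \<in> M" "x ` {1..3} \<subseteq> L" "\<sigma> \<in> carrier (galois_group M L)"
  then show "\<exists>h\<in>carrier S3. \<forall>i\<in>{1..3}. \<sigma> (x i) = x (h i)" by (intro galois_S3_action[OF _ _ x _ _ _ _ inj])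
qed

lemma rot_closed: "c \<in> carrier (C 3) \<Longrightarrow> i \<in> {1..3} \<Longrightarrow> rot c i \<in> {1..3}"
  by (auto simp: C3_cases atLeastAtMost_13)

lemma flip_closed: "c \<in> carrier (C 2) \<Longrightarrow> i \<in> {1..2} \<Longrightarrow> flip c i \<in> {1..2}"
  by (auto simp: C2_cases atLeastAtMost_12)

lemma rational_frame_C3:
  assumes y: "shanks_roots t y" and inj: "inj_on y {1..3}"
  shows "rational_frame t (C 3) rot {1..3} y"
  unfolding rational_frame_def
proof (intro conjI allI impI)
  note atLeastAtMost_iff [simp del]
  show "frame (C 3) rot {1..3} y"
    unfolding frame_def
  proof (intro conjI ballI impI)
    show "rot (c \<otimes>\<^bsub>C 3\<^esub> c') i = rot c (rot c' i)" if "c \<in> carrier (C 3)" "c' \<in> carrier (C 3)" "i \<in> {1..3}" for c c' i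
      using that unfolding C3_cases atLeastAtMost_13 by (elim disjE insertE emptyE) simp_all
    show "c = c'" if c: "c \<in> carrier (C 3)" "c' \<in> carrier (C 3)" and eq: "\<forall>i\<in>{1..3}. y (rot c i) = y (rot c' i)" for c c'
    proof -
      have "rot c 1 = rot c' 1" using inj_onD[OF inj, of "rot c 1" "rot c' 1"] eq rot_closed c
        by (simp add: atLeastAtMost_13)
      then show ?thesis using c unfolding C3_cases by (elim disjE) simp_all
    qed
  qed (simp_all add: rot_closed)
  fix F :: "'a set" assume F: "is_subfield F"
  have "y i \<in> adjoin F (y ` {1..3})" if "i \<in> {1..3}" for i
    by (rule subsetD[OF adjoin_gens]) (use that in auto)
  then have "y 1 + y 2 + y 3 \<in> adjoin F (y ` {1..3})"
    by (intro subfield_add subfield_adjoin) (simp_all add: atLeastAtMost_13)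
  then show "t \<in> adjoin F (y ` {1..3})" unfolding shanks_rootsD(5)[OF y] .
  show "\<forall>i\<in>{1..3}. algebraic_over (adjoin F {t}) (y i)"
  proof
    fix i assume i: "i \<in> {1..3::nat}"
    have "t \<in> adjoin F {t}" using adjoin_gens[of "{t}" F] by simp
    then have "poly_over (adjoin F {t}) [:- 1, - (t + 3), - t, 1:]"
      by (intro poly_over_closed(8) subfield_adjoin poly_over_closed(1) subfield_uminus subfield_add
          subfield_numeral subfield_one)
    moreover have "poly [:- 1, - (t + 3), - t, 1:] (y i) = y i ^ 3 - t * y i ^ 2 - (t + 3) * y i - 1"
      by (simp add: algebra_simps power2_eq_square power3_eq_cube)
    moreover have "y i ^ 3 - t * y i ^ 2 - (t + 3) * y i - 1 = (y i - y 1) * (y i - y 2) * (y i - y 3)"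
      unfolding cubic_expand shanks_roots_symmetric[OF y] shanks_rootsD(5)[OF y] by (simp add: algebra_simps)
    moreover have "(y i - y 1) * (y i - y 2) * (y i - y 3) = 0" using i unfolding atLeastAtMost_13 by auto
    ultimately show "algebraic_over (adjoin F {t}) (y i)" unfolding algebraic_over_def by (metis pCons_eq_0_iff zero_neq_one)
  qed
next
  fix F c assume "is_subfield F" "\<not> algebraic_over F t" "c \<in> carrier (C 3)"
  then show "\<exists>\<sigma>\<in>carrier (galois_group (adjoin F {t}) (adjoin F (y ` {1..3}))). \<forall>i\<in>{1..3}. \<sigma> (y i) = y (rot c i)"
    by (intro C3_automorphism y)
next
  fix M L \<sigma> assume "is_subfield L" "M \<subseteq> L" "t \<in> M" "y ` {1..3} \<subseteq> L" "\<sigma> \<in> carrier (galois_group M L)"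
  then show "\<exists>c\<in>carrier (C 3). \<forall>i\<in>{1..3}. \<sigma> (y i) = y (rot c i)" by (intro galois_C3_action[OF _ _ y])
qed

lemma rational_frame_C2:
  assumes v: "opposite_roots d v" and neq: "v 1 \<noteq> v 2"
  shows "rational_frame d (C 2) flip {1..2} v"
  unfolding rational_frame_def
proof (intro conjI allI impI)
  note atLeastAtMost_iff [simp del]
  have v2: "v 2 = - v 1" "v 1 ^ 2 = d" using v by (auto simp: opposite_roots_def)
  show "frame (C 2) flip {1..2} v"
    unfolding frame_def
  proof (intro conjI ballI impI)
    show "flip (c \<otimes>\<^bsub>C 2\<^esub> c') i = flip c (flip c' i)" if "c \<in> carrier (C 2)" "c' \<in> carrier (C 2)" "i \<in> {1..2}" for c c' i
      using that unfolding C2_cases atLeastAtMost_12 by (elim disjE insertE emptyE) simp_all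
    show "c = c'" if c: "c \<in> carrier (C 2)" "c' \<in> carrier (C 2)" and eq: "\<forall>i\<in>{1..2}. v (flip c i) = v (flip c' i)" for c c'
      using c eq neq unfolding C2_cases atLeastAtMost_12 by (elim disjE) auto
  qed (simp_all add: flip_closed)
  fix F :: "'a set" assume F: "is_subfield F"
  have vi: "v 1 \<in> adjoin F (v ` {1..2})" by (rule subsetD[OF adjoin_gens]) (simp add: atLeastAtMost_12)
  show "d \<in> adjoin F (v ` {1..2})" unfolding v2(2)[symmetric] using vi by (intro subfield_power subfield_adjoin)
  show "\<forall>i\<in>{1..2}. algebraic_over (adjoin F {d}) (v i)"
  proof
    fix i assume i: "i \<in> {1..2::nat}"
    have "d \<in> adjoin F {d}" using adjoin_gens[of "{d}" F] by simp
    then have "poly_over (adjoin F {d}) [:- d, 0, 1:]"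
      by (intro poly_over_closed(8) subfield_adjoin poly_over_closed(1) subfield_uminus subfield_zero subfield_one)
    moreover have "poly [:- d, 0, 1:] (v i) = 0"
      using i v2 unfolding atLeastAtMost_12 by (auto simp: power2_eq_square)
    ultimately show "algebraic_over (adjoin F {d}) (v i)" unfolding algebraic_over_def by (metis pCons_eq_0_iff zero_neq_one)
  qed
next
  fix F c assume "is_subfield F" "\<not> algebraic_over F d" "c \<in> carrier (C 2)"
  then show "\<exists>\<sigma>\<in>carrier (galois_group (adjoin F {d}) (adjoin F (v ` {1..2}))). \<forall>i\<in>{1..2}. \<sigma> (v i) = v (flip c i)"
    by (intro C2_automorphism v)
next
  fix M L \<sigma> assume "is_subfield L" "M \<subseteq> L" "d \<in> M" "v ` {1..2} \<subseteq> L" "\<sigma> \<in> carrier (galois_group M L)"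
  then show "\<exists>c\<in>carrier (C 2). \<forall>i\<in>{1..2}. \<sigma> (v i) = v (flip c i)" by (intro galois_C2_action[OF _ _ v]) (auto simp: image_subset_iff)
qed

section \<open>The sextics over the rational function field\<close>

lemma ex_cubic_roots: "\<exists>x. cubic_roots p q (x :: nat \<Rightarrow> 'w::alg_closed_field)"
proof -
  obtain a where a: "poly [:q, p, 0, 1:] a = 0" using alg_closed_imp_poly_has_root[of "[:q, p, 0, 1:]"] by auto
  \<comment> \<open>The quotient of \<open>X^3 + p X + q\<close> by \<open>X - a\<close>.\<close>
  obtain b where b: "poly [:a ^ 2 + p, a, 1:] b = 0" using alg_closed_imp_poly_has_root[of "[:a ^ 2 + p, a, 1:]"] by auto
  define x where "x i = (if i = 1 then a else if i = 2 then b else - a - b)" for i :: nat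
  have x: "x 1 = a" "x 2 = b" "x 3 = - a - b" by (simp_all add: x_def)
  have a': "a * (a ^ 2 + p) = - q" using a by (simp add: algebra_simps power2_eq_square eq_neg_iff_add_eq_0)
  have b': "b ^ 2 + a * b + a ^ 2 + p = 0" using b by (simp add: algebra_simps power2_eq_square)
  have "a * b + a * (- a - b) + b * (- a - b) = p"
  proof -
    have "a * b + a * (- a - b) + b * (- a - b) = p - (b ^ 2 + a * b + a ^ 2 + p)" by Groebner_Basis.algebra
    then show ?thesis using b' by simp
  qed
  moreover have "a * b * (- a - b) = - q"
  proof -
    have "a * b * (- a - b) = a * (a ^ 2 + p) - a * (b ^ 2 + a * b + a ^ 2 + p)" by Groebner_Basis.algebra
    then show ?thesis using a' b' by simp
  qed
  ultimately have "cubic_roots p q x" unfolding cubic_roots_def x by simp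
  then show ?thesis by blast
qed

lemma ex_opposite_roots: "\<exists>v. opposite_roots d (v :: nat \<Rightarrow> 'w::alg_closed_field)"
proof -
  obtain a where a: "poly [:- d, 0, 1:] a = 0" using alg_closed_imp_poly_has_root[of "[:- d, 0, 1:]"] by auto
  then have "a ^ 2 = d" by (simp add: power2_eq_square)
  then have "opposite_roots d (\<lambda>i. if i = 1 then a else - a)" by (simp add: opposite_roots_def)
  then show ?thesis by blast
qed

text \<open>Any root of the cubic starts an orbit. The orbit sum is
  \<open>(a^3 - 3 a - 1) / (a^2 + a)\<close>, and the cubic equation says that this equals
  \<open>t\<close>.\<close>

lemma ex_shanks_roots: "\<exists>y. shanks_roots t (y :: nat \<Rightarrow> 'w::alg_closed_field)"
proof -
  obtain a where "poly [:- 1, - (t + 3), - t, 1:] a = 0"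
    using alg_closed_imp_poly_has_root[of "[:- 1, - (t + 3), - t, 1:]"] by auto
  then have a: "a ^ 3 - t * a ^ 2 - (t + 3) * a - 1 = 0" by (simp add: algebra_simps power2_eq_square power3_eq_cube)
  have a0: "a \<noteq> 0" using a by auto
  have "a \<noteq> - 1"
  proof
    assume "a = - 1"
    with a show False by (simp add: algebra_simps)
  qed
  then have a1: "1 + a \<noteq> 0" by (simp add: add_eq_0_iff)
  define y where "y i = (if i = 1 then a else if i = 2 then - 1 / (1 + a) else - 1 / (1 + (- 1 / (1 + a))))" for i :: nat
  have y: "y 1 = a" "y 2 = - 1 / (1 + a)" "y 3 = - 1 / (1 + y 2)" by (simp_all add: y_def)
  have "1 + y 2 = a / (1 + a)" unfolding y using a1 by (simp add: field_simps)
  then have y3: "y 3 = - (1 + a) / a" using y(3) a0 a1 by simp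
  have "a + - 1 / (1 + a) + - (1 + a) / a = (a ^ 3 - 3 * a - 1) / (a ^ 2 + a)"
  proof -
    have n: "a ^ 2 + a = a * (1 + a)" by (simp add: algebra_simps power2_eq_square)
    show ?thesis unfolding n using a0 a1 by (simp add: divide_simps) Groebner_Basis.algebra
  qed
  also have "a ^ 3 - 3 * a - 1 = t * (a ^ 2 + a)" using a by (simp add: algebra_simps)
  also have "t * (a ^ 2 + a) / (a ^ 2 + a) = t"
  proof -
    have "a ^ 2 + a = a * (1 + a)" by (simp add: algebra_simps power2_eq_square)
    then have "a ^ 2 + a \<noteq> 0" using a0 a1 by simp
    then show ?thesis by simp
  qed
  finally have "y 1 + y 2 + y 3 = t" unfolding y(1,2) y3 .
  then have "shanks_roots t y" unfolding shanks_roots_def using a0 \<open>a \<noteq> - 1\<close> y by simp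
  then show ?thesis by blast
qed

lemma cubic_roots_inj:
  assumes x: "cubic_roots s s x" and s: "s \<noteq> 0" "4 * s + 27 \<noteq> 0"
  shows "inj_on x {1..3}"
proof -
  have "- 4 * s ^ 3 - 27 * s ^ 2 = - (s ^ 2) * (4 * s + 27)" by Groebner_Basis.algebra
  then have "(x 1 - x 2) * (x 1 - x 3) * (x 2 - x 3) \<noteq> 0" using cubic_discriminant[OF x] s by auto
  then show ?thesis unfolding atLeastAtMost_13 by (auto simp: inj_on_def)
qed

lemma transcendental_not_root:
  "\<not> algebraic_over F s \<Longrightarrow> p \<noteq> 0 \<Longrightarrow> poly_over F p \<Longrightarrow> poly p s \<noteq> 0"
  by (auto simp: algebraic_over_def)

text \<open>Each expression is a nonzero polynomial in \<open>s\<close>. Nonvanishing is read off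
  the constant terms or the leading 1, which also covers characteristic two, where
  \<open>4 s + 27\<close> and \<open>2 s + 3\<close> are constants.\<close>

lemma transcendental_neq_0:
  fixes s :: "'w::field"
  assumes F: "is_subfield F" and s: "\<not> algebraic_over F s" and char: "(3::'w) \<noteq> 0"
  shows "s \<noteq> 0" "4 * s + 27 \<noteq> 0" "2 * s + 3 \<noteq> 0" "s ^ 2 + 3 * s + 9 \<noteq> 0"
proof -
  have p: "poly_over F [:0, 1:]" "poly_over F [:27, 4:]" "poly_over F [:3, 2:]" "poly_over F [:9, 3, 1:]"
    by (intro poly_over_closed(8,1) subfield_zero subfield_one subfield_numeral F)+
  have "(27::'w) = 3 * 3 * 3" by simp
  then have "(27::'w) \<noteq> 0" using char by (metis mult_eq_0_iff)
  then show "s \<noteq> 0" "4 * s + 27 \<noteq> 0" "2 * s + 3 \<noteq> 0" "s ^ 2 + 3 * s + 9 \<noteq> 0"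
    using transcendental_not_root[OF s _ p(1)] transcendental_not_root[OF s _ p(2)]
      transcendental_not_root[OF s _ p(3)] transcendental_not_root[OF s _ p(4)] char
    by (simp_all add: algebra_simps power2_eq_square)
qed

text \<open>Serves to pass between the orbit \<open>y i\<close> of Shanks' cubic and the trace-zero
  roots \<open>3 * y i - t\<close>; for \<open>X^3 + s X + s\<close> it is applied with
  \<open>a = 1\<close> and \<open>b = 0\<close>.\<close>

lemma adjoin_affine_family:
  assumes K: "is_subfield K" "a \<in> K" "b \<in> K" "a \<noteq> 0" and w: "\<And>i. w i = a * y i + b"
  shows "adjoin K (A \<union> w ` J) = adjoin K (A \<union> y ` J)"
proof (rule adjoin_eqI)
  let ?E = "adjoin K (A \<union> y ` J)" and ?F = "adjoin K (A \<union> w ` J)"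
  show "K \<subseteq> ?E" "K \<subseteq> ?F" by (rule adjoin_base)+
  have ab: "a \<in> ?E" "b \<in> ?E" "a \<in> ?F" "b \<in> ?F"
    using K adjoin_base[of K "A \<union> y ` J"] adjoin_base[of K "A \<union> w ` J"] by auto
  have "w i \<in> ?E" if "i \<in> J" for i
    unfolding w using that ab adjoin_gens[of "A \<union> y ` J" K]
    by (intro subfield_add subfield_mult subfield_adjoin) auto
  then show "A \<union> w ` J \<subseteq> ?E" using adjoin_gens[of "A \<union> y ` J" K] by auto
  have "y i \<in> ?F" if "i \<in> J" for i
  proof -
    have "w i \<in> ?F" using that adjoin_gens[of "A \<union> w ` J" K] by auto
    then have "(w i - b) / a \<in> ?F" using ab by (intro subfield_divide subfield_diff subfield_adjoin)
    then show ?thesis using K w by simp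
  qed
  then show "A \<union> y ` J \<subseteq> ?F" using adjoin_gens[of "A \<union> w ` J" K] by auto
qed

lemma perm3_permutes:
  assumes "{a, b, c} = {1, 2, 3::nat}"
  shows "(\<lambda>i. if i = 1 then a else if i = 2 then b else if i = 3 then c else i) permutes {1..3}"
proof (rule bij_imp_permutes)
  let ?f = "\<lambda>i. if i = 1 then a else if i = 2 then b else if i = 3 then c else i"
  have "?f ` {1..3} = {1..3}" unfolding image_13 using assms by (simp add: atLeastAtMost_13)
  then show "bij_betw ?f {1..3} {1..3}" by (simp add: bij_betw_def eq_card_imp_inj_on)
qed auto

lemma ex_perm3:
  assumes "{a, b, c} = {1, 2, 3::nat}"
  shows "\<exists>h\<in>carrier S3. h 1 = a \<and> h 2 = b \<and> h 3 = c"
  using perm3_permutes[OF assms] by (intro bexI) (auto simp: sym_group_carrier)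

text \<open>Reordering the summands by the index of \<open>y\<close> shows that permuting the
  \<open>z\<close> alone already reaches all six roots, so the first factor \<open>S3\<close> acts
  transitively.\<close>

lemma pairing_roots_orbit:
  assumes "u \<in> set (pairing_roots z y)"
  shows "\<exists>h\<in>carrier S3. u = (z (h 1) * y 1 + z (h 2) * y 2 + z (h 3) * y 3) / 3"
proof -
  have "\<exists>a b c. {a, b, c} = {1, 2, 3} \<and> u = (z a * y 1 + z b * y 2 + z c * y 3) / 3"
  proof -
    have P: "{1, 2, 3} = {1, 2, 3::nat}" "{3, 1, 2} = {1, 2, 3::nat}" "{2, 3, 1} = {1, 2, 3::nat}"
      "{1, 3, 2} = {1, 2, 3::nat}" "{2, 1, 3} = {1, 2, 3::nat}" "{3, 2, 1} = {1, 2, 3::nat}" by auto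
    from assms consider
      "u = (z 1 * y 1 + z 2 * y 2 + z 3 * y 3) / 3" | "u = (z 3 * y 1 + z 1 * y 2 + z 2 * y 3) / 3"
      | "u = (z 2 * y 1 + z 3 * y 2 + z 1 * y 3) / 3" | "u = (z 1 * y 1 + z 3 * y 2 + z 2 * y 3) / 3"
      | "u = (z 2 * y 1 + z 1 * y 2 + z 3 * y 3) / 3" | "u = (z 3 * y 1 + z 2 * y 2 + z 1 * y 3) / 3"
      by (auto simp: pairing_roots_def ac_simps)
    then show ?thesis using P by cases metis+
  qed
  then obtain a b c where abc: "{a, b, c} = {1, 2, 3}" "u = (z a * y 1 + z b * y 2 + z c * y 3) / 3" by blast
  then show ?thesis using ex_perm3[OF abc(1)] by metis
qed

lemma ring_map_numeral: "ring_map e \<Longrightarrow> e (numeral n) = numeral n"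
proof -
  assume e: "ring_map e"
  have "e (of_nat m) = of_nat m" for m using e by (induction m) (auto simp: ring_map_def)
  from this[of "numeral n"] show ?thesis by simp
qed

lemma ring_map_eq_0_iff:
  fixes e :: "'k::field \<Rightarrow> 'w::field"
  assumes "ring_map e"
  shows "e a = 0 \<longleftrightarrow> a = 0"
proof -
  have "e a * e (inverse a) = 1" if "a \<noteq> 0"
    using assms that unfolding ring_map_def by (metis right_inverse)
  then have "a = 0" if "e a = 0" using that by (metis mult_zero_left zero_neq_one)
  then show ?thesis using assms by (auto simp: ring_map_def)
qed

lemma map_poly_pairing_sextic:
  "map_poly to_ac (pairing_sextic s p q) = pairing_sextic (to_ac s) (to_ac p) (to_ac q)"
  by (simp add: pairing_sextic_def Let_def map_poly_pCons)

lemma map_poly_even_sextic: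
  "map_poly to_ac (even_sextic p q d) = even_sextic (to_ac p) (to_ac q) (to_ac d)"
  by (simp add: even_sextic_def map_poly_pCons)

text \<open>The six roots generate the compositum of the two families, so its Galois group is the
  product. Transitivity uses only the factor \<open>S3\<close>, with the element \<open>e\<close> of
  \<open>H\<close> leaving the labels of \<open>y\<close> in place. The affine substitution lets
  \<open>y\<close> be either roots of \<open>X^3 + t X + t\<close> or an orbit of Shanks'
  transformation.\<close>

lemma
  fixes F :: "'a::field poly" and s t :: "'a alg_closure"
  assumes nm: "no_multiple_root F" and F: "map_poly to_ac F = pairing_sextic s p q"
    and B: "is_subfield B" "\<not> algebraic_over B s" "\<not> algebraic_over (adjoin B {s}) t"
    and K: "range to_ac \<subseteq> adjoin B {s, t}" "B \<subseteq> range to_ac" "s \<in> range to_ac" "t \<in> range to_ac"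
    and pq: "p \<in> range to_ac" "q \<in> range to_ac" "p \<noteq> 0" "q \<noteq> 0" and char: "(3::'a alg_closure) \<noteq> 0"
    and y: "rational_frame t H \<beta> {1..3} y" and e: "e \<in> carrier H" "\<And>i. i \<in> {1..3} \<Longrightarrow> \<beta> e i = i"
    and y': "cubic_roots p q (\<lambda>i. a * y i + b)" and ab: "a \<in> range to_ac" "b \<in> range to_ac" "a \<noteq> 0"
  shows pairing_sextic_irreducible: "irreducible F"
    and pairing_sextic_galois_group: "poly_galois_group F \<cong> S3 \<times>\<times> H"
    and pairing_sextic_action: "transitive_galois_action 6 (S3 \<times>\<times> H) F"
proof -
  define K where "K = range (to_ac :: 'a \<Rightarrow> _)"
  define w where "w i = a * y i + b" for i
  have Ksub: "is_subfield K" unfolding K_def by (rule is_subfield_range_to_ac)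
  note s0 = transcendental_neq_0(1,2)[OF B(1,2) char]
  obtain x where x: "cubic_roots s s x" using ex_cubic_roots by blast
  have inj: "inj_on x {1..3}" by (rule cubic_roots_inj[OF x s0])
  define z where "z = recip_deriv s x"
  define xs where "xs = pairing_roots z w"
  have w: "cubic_roots p q w" unfolding w_def by (rule y')
  have fact: "map_poly to_ac F = (\<Prod>u\<leftarrow>xs. [:- u, 1:])"
    unfolding F xs_def
    by (rule pairing_sextic_factorization[OF recip_deriv_roots(1)[OF x s0 char, folded z_def] s0 char w])
  define L where "L = adjoin K (x ` {1..3} \<union> y ` {1..3})"
  have "adjoin K (set xs) = adjoin K (x ` {1..3} \<union> w ` {1..3})"
    unfolding xs_def z_def
    by (rule adjoin_pairing_roots[OF Ksub _ _ _ x w s0 _ _ char]) (use K pq in \<open>auto simp: K_def\<close>)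
  also have "\<dots> = L" unfolding L_def by (rule adjoin_affine_family[OF Ksub _ _ _ w_def]) (use ab in \<open>auto simp: K_def\<close>)
  finally have LL: "adjoin K (set xs) = L" .
  have Gal: "poly_galois_group F = galois_group K L"
    unfolding poly_galois_group_def ac_splitting_field_def ac_roots_def fact poly_linear_factors_eq_0_iff
    by (simp add: LL K_def[symmetric])
  note two = rational_frame_two_params[OF B rational_frame_S3[OF x inj] y K, folded K_def, folded L_def]
  show iso: "poly_galois_group F \<cong> S3 \<times>\<times> H" unfolding Gal by (rule two(2))
  have L: "is_subfield L" unfolding L_def by simp
  have xL: "x i \<in> L" "y i \<in> L" if "i \<in> {1..3}" for i
    using that adjoin_gens[of "x ` {1..3} \<union> y ` {1..3}" K] by (auto simp: L_def)
  have KL: "K \<subseteq> L" unfolding L_def by (rule adjoin_base)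
  have abK: "a \<in> K" "b \<in> K" "s \<in> K" using ab K by (auto simp: K_def)
  define r0 where "r0 = (z 1 * w 1 + z 2 * w 2 + z 3 * w 3) / 3"
  have trans: "\<exists>\<sigma>\<in>carrier (poly_galois_group F). \<sigma> r0 = u" if u: "u \<in> set xs" for u
  proof -
    obtain h where h: "h \<in> carrier S3" "u = (z (h 1) * w 1 + z (h 2) * w 2 + z (h 3) * w 3) / 3"
      using pairing_roots_orbit u unfolding xs_def by blast
    obtain \<sigma> where \<sigma>: "\<sigma> \<in> carrier (galois_group K L)" "\<forall>i\<in>{1..3}. \<sigma> (x i) = x (h i)" "\<forall>i\<in>{1..3}. \<sigma> (y i) = y (\<beta> e i)"
      using two(1)[OF h(1) e(1)] by blast
    interpret subfield_hom L \<sigma> by (rule galois_hom[OF L \<sigma>(1)])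
    have abL: "a \<in> L" "b \<in> L" "s \<in> L" using abK KL by auto
    have fix_ab: "\<sigma> a = a" "\<sigma> b = b" "\<sigma> s = s" using abK galois_fix[OF \<sigma>(1)] by auto
    have wi: "\<sigma> (w i) = w i" "w i \<in> L" if i: "i \<in> {1..3}" for i
      using \<sigma>(3)[rule_format, OF i] e(2)[OF i] xL[OF i] abL fix_ab L
      by (simp_all add: w_def add mult subfield_mult subfield_add)
    have zi: "\<sigma> (z i) = z (h i)" "z i \<in> L" if i: "i \<in> {1..3}" for i
      using \<sigma>(2)[rule_format, OF i] xL(1)[OF i] abL fix_ab L
      by (simp_all add: z_def recip_deriv_def add mult divide power one numeral subfield_intros)
    have i: "1 \<in> {1..3::nat}" "2 \<in> {1..3::nat}" "3 \<in> {1..3::nat}" by auto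
    have "\<sigma> r0 = u" unfolding r0_def h(2)
      using wi[OF i(1)] wi[OF i(2)] wi[OF i(3)] zi[OF i(1)] zi[OF i(2)] zi[OF i(3)] L
      by (simp add: add mult divide numeral subfield_intros)
    then show ?thesis using \<sigma>(1) unfolding Gal by blast
  qed
  have r0: "r0 \<in> set xs" by (simp add: xs_def pairing_roots_def r0_def)
  have len: "length xs = 6" by (simp add: xs_def pairing_roots_def)
  have "group (S3 \<times>\<times> H)" using frameD(1)[OF rational_frameD(1)[OF y]] by (intro DirProd_group sym_group_is_group)
  note concl = irreducible_if_transitive[OF nm fact len _ this iso trans r0]
    transitive_galois_actionI[OF nm fact len _ this iso trans r0]
  show "irreducible F" "transitive_galois_action 6 (S3 \<times>\<times> H) F" by (rule concl; simp)+
qed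

text \<open>Transitivity needs both factors here: \<open>H\<close> moves the index of the cubic root
  and \<open>C 2\<close> the sign.\<close>

lemma
  fixes F :: "'a::field poly" and s d :: "'a alg_closure"
  assumes nm: "no_multiple_root F" and F: "map_poly to_ac F = even_sextic p q d"
    and B: "is_subfield B" "\<not> algebraic_over B s" "\<not> algebraic_over (adjoin B {s}) d"
    and K: "range to_ac \<subseteq> adjoin B {s, d}" "B \<subseteq> range to_ac" "s \<in> range to_ac" "d \<in> range to_ac"
    and pq: "p \<in> range to_ac" "q \<in> range to_ac" "p \<noteq> 0" "q \<noteq> 0"
    and x: "rational_frame s H \<alpha> {1..3} x" and \<alpha>: "\<And>i. i \<in> {1..3} \<Longrightarrow> \<exists>h\<in>carrier H. \<alpha> h 1 = i"
    and x': "cubic_roots p q (\<lambda>i. a * x i + b)" and ab: "a \<in> range to_ac" "b \<in> range to_ac" "a \<noteq> 0"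
  shows even_sextic_char: "(2 :: 'a alg_closure) \<noteq> 0"
    and even_sextic_irreducible: "irreducible F"
    and even_sextic_galois_group: "poly_galois_group F \<cong> H \<times>\<times> C 2"
    and even_sextic_action: "transitive_galois_action 6 (H \<times>\<times> C 2) F"
proof -
  define K where "K = range (to_ac :: 'a \<Rightarrow> _)"
  define w where "w i = a * x i + b" for i
  have Ksub: "is_subfield K" unfolding K_def by (rule is_subfield_range_to_ac)
  obtain v where v: "opposite_roots d v" using ex_opposite_roots by blast
  have v2: "v 2 = - v 1" "v 1 ^ 2 = d" using v by (auto simp: opposite_roots_def)
  have w: "cubic_roots p q w" unfolding w_def by (rule x')
  define xs where "xs = even_roots w v"
  have fact: "map_poly to_ac F = (\<Prod>u\<leftarrow>xs. [:- u, 1:])"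
    unfolding F xs_def by (rule even_sextic_factorization[OF w v])
  have "distinct xs" using nm unfolding no_multiple_root_def fact by (rule rsquarefree_linear_factors_distinct)
  \<comment> \<open>Absence of multiple roots separates \<open>v 1\<close> from
    \<open>v 2 = - v 1\<close>, and thereby excludes characteristic two.\<close>
  then have "w 1 * v 1 \<noteq> w 1 * v 2" by (simp add: xs_def even_roots_def)
  then have neq: "v 1 \<noteq> v 2" by auto
  then have v0: "v 1 \<noteq> 0" using v2 by auto
  show "(2 :: 'a alg_closure) \<noteq> 0"
  proof
    assume "(2 :: 'a alg_closure) = 0"
    then have "2 * v 1 = 0" by simp
    then have "v 1 + v 1 = 0" by simp
    then have "- v 1 = v 1" by (rule minus_unique)
    then show False using neq v2 by simp
  qed
  define L where "L = adjoin K (x ` {1..3} \<union> v ` {1..2})"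
  have "adjoin K (set xs) = adjoin K (w ` {1..3} \<union> v ` {1..2})"
    unfolding xs_def by (rule adjoin_even_roots[OF Ksub _ _ w v2(1) v0]) (use pq in \<open>auto simp: K_def\<close>)
  also have "\<dots> = L" unfolding L_def Un_commute[of _ "v ` {1..2}"]
    by (rule adjoin_affine_family[OF Ksub _ _ _ w_def]) (use ab in \<open>auto simp: K_def\<close>)
  finally have LL: "adjoin K (set xs) = L" .
  have Gal: "poly_galois_group F = galois_group K L"
    unfolding poly_galois_group_def ac_splitting_field_def ac_roots_def fact poly_linear_factors_eq_0_iff
    by (simp add: LL K_def[symmetric])
  note two = rational_frame_two_params[OF B x rational_frame_C2[OF v neq] K, folded K_def, folded L_def]
  show iso: "poly_galois_group F \<cong> H \<times>\<times> C 2" unfolding Gal by (rule two(2))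
  have L: "is_subfield L" unfolding L_def by simp
  have gL: "x ` {1..3} \<union> v ` {1..2} \<subseteq> L" unfolding L_def by (rule adjoin_gens)
  have KL: "K \<subseteq> L" unfolding L_def by (rule adjoin_base)
  have abK: "a \<in> K" "b \<in> K" using ab by (auto simp: K_def)
  have trans: "\<exists>\<sigma>\<in>carrier (poly_galois_group F). \<sigma> (w 1 * v 1) = u" if u: "u \<in> set xs" for u
  proof -
    have "\<exists>i\<in>{1..3}. \<exists>c\<in>carrier (C 2). u = w i * v (flip c 1)"
      using u unfolding xs_def even_roots_def atLeastAtMost_13 by (auto simp: C_carrier)
    then obtain i c where ic: "i \<in> {1..3}" "c \<in> carrier (C 2)" "u = w i * v (flip c 1)" by blast
    obtain h where h: "h \<in> carrier H" "\<alpha> h 1 = i" using \<alpha>[OF ic(1)] by blast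
    obtain \<sigma> where \<sigma>: "\<sigma> \<in> carrier (galois_group K L)" "\<forall>i\<in>{1..3}. \<sigma> (x i) = x (\<alpha> h i)" "\<forall>i\<in>{1..2}. \<sigma> (v i) = v (flip c i)"
      using two(1)[OF h(1) ic(2)] by blast
    interpret subfield_hom L \<sigma> by (rule galois_hom[OF L \<sigma>(1)])
    have "a \<in> L" "b \<in> L" "\<sigma> a = a" "\<sigma> b = b" using abK KL galois_fix[OF \<sigma>(1)] by auto
    moreover have "x 1 \<in> L" "v 1 \<in> L" using gL by auto
    moreover have "\<sigma> (x 1) = x i" "\<sigma> (v 1) = v (flip c 1)" using \<sigma>(2,3) h by simp_all
    ultimately have "\<sigma> (w 1 * v 1) = u" using L ic by (simp add: w_def add mult subfield_add subfield_mult)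
    then show ?thesis using \<sigma>(1) unfolding Gal by blast
  qed
  have r0: "w 1 * v 1 \<in> set xs" by (simp add: xs_def even_roots_def)
  have len: "length xs = 6" by (simp add: xs_def even_roots_def)
  have "group (H \<times>\<times> C 2)" using frameD(1)[OF rational_frameD(1)[OF x]] by (intro DirProd_group group_integer_mod_group)
  note concl = irreducible_if_transitive[OF nm fact len _ this iso trans r0]
    transitive_galois_actionI[OF nm fact len _ this iso trans r0]
  show "irreducible F" "transitive_galois_action 6 (H \<times>\<times> C 2) F" by (rule concl; simp)+
qed

text \<open>
  Here the square root of \<open>d\<close> is a multiple of the square root of the discriminant, on which
  the symmetric group acts by the sign.
\<close>

definition vandermonde3 :: "(nat \<Rightarrow> 'w::field) \<Rightarrow> 'w" where
  "vandermonde3 x = (x 1 - x 2) * (x 1 - x 3) * (x 2 - x 3)"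

text \<open>Even permutations preserve the Vandermonde product and odd ones negate it. A root of the
  cubic and a sign together determine a permutation, so the six sextic roots are indexed by
  \<open>S3\<close>.\<close>

lemma even_roots_orbit:
  assumes "u \<in> set (even_roots x v)" "v 1 = c * vandermonde3 x" "v 2 = - v 1"
  shows "\<exists>h\<in>carrier S3. u = x (h 1) * (c * vandermonde3 (x \<circ> h))"
proof -
  have "\<exists>i j k. {i, j, k} = {1, 2, 3} \<and> u = x i * (c * ((x i - x j) * (x i - x k) * (x j - x k)))"
  proof -
    have P: "{1, 2, 3} = {1, 2, 3::nat}" "{3, 1, 2} = {1, 2, 3::nat}" "{2, 3, 1} = {1, 2, 3::nat}"
      "{1, 3, 2} = {1, 2, 3::nat}" "{2, 1, 3} = {1, 2, 3::nat}" "{3, 2, 1} = {1, 2, 3::nat}" by auto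
    consider "u = x 1 * v 1" | "u = x 2 * v 1" | "u = x 3 * v 1" | "u = x 1 * - v 1" | "u = x 2 * - v 1" | "u = x 3 * - v 1"
      using assms(1,3) by (auto simp: even_roots_def)
    then show ?thesis unfolding assms(2) vandermonde3_def
    proof cases
      case 1
      show ?thesis by (rule exI[of _ 1], rule exI[of _ 2], rule exI[of _ 3]) (use 1 in simp)
    next
      case 2
      show ?thesis by (rule exI[of _ 2], rule exI[of _ 3], rule exI[of _ 1]) (intro conjI P, unfold 2, Groebner_Basis.algebra)
    next
      case 3
      show ?thesis by (rule exI[of _ 3], rule exI[of _ 1], rule exI[of _ 2]) (intro conjI P, unfold 3, Groebner_Basis.algebra)
    next
      case 4
      show ?thesis by (rule exI[of _ 1], rule exI[of _ 3], rule exI[of _ 2]) (intro conjI P, unfold 4, Groebner_Basis.algebra)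
    next
      case 5
      show ?thesis by (rule exI[of _ 2], rule exI[of _ 1], rule exI[of _ 3]) (intro conjI P, unfold 5, Groebner_Basis.algebra)
    next
      case 6
      show ?thesis by (rule exI[of _ 3], rule exI[of _ 2], rule exI[of _ 1]) (intro conjI P, unfold 6, Groebner_Basis.algebra)
    qed
  qed
  then obtain i j k where ijk: "{i, j, k} = {1, 2, 3}" "u = x i * (c * ((x i - x j) * (x i - x k) * (x j - x k)))" by blast
  then show ?thesis using ex_perm3[OF ijk(1)] by (metis comp_apply vandermonde3_def)
qed

text \<open>The third argument is \<open>c^2\<close> times the discriminant of
  \<open>X^3 + s X + s\<close>, so its square root \<open>c * vandermonde3 x\<close> already lies in
  the splitting field of the cubic. The factor \<open>c\<close> is left free because
  \<open>g_S3_1\<close> and \<open>h_S3\<close> differ exactly in it.\<close>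

lemma
  fixes F :: "'a::field poly" and s c :: "'a alg_closure"
  assumes F: "map_poly to_ac F = even_sextic s s (c ^ 2 * (- (s ^ 2) * (4 * s + 27)))"
    and B: "is_subfield B" "\<not> algebraic_over B s"
    and K: "range to_ac \<subseteq> adjoin B {s}" "B \<subseteq> range to_ac" "s \<in> range to_ac"
    and c: "c \<in> range to_ac" "c \<noteq> 0" and char: "(3::'a alg_closure) \<noteq> 0"
  shows single_galois_group: "poly_galois_group F \<cong> S3"
    and single_irreducible: "no_multiple_root F \<Longrightarrow> irreducible F"
    and single_action: "no_multiple_root F \<Longrightarrow> transitive_galois_action 6 S3 F"
    and single_splitting_field: "map_poly to_ac f = [:s, s, 0, 1:] \<Longrightarrow> ac_splitting_field f = ac_splitting_field F"
proof -
  define K where "K = range (to_ac :: 'a \<Rightarrow> _)"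
  have Ksub: "is_subfield K" unfolding K_def by (rule is_subfield_range_to_ac)
  note s0 = transcendental_neq_0(1,2)[OF B(1,2) char]
  obtain x where x: "cubic_roots s s x" using ex_cubic_roots by blast
  have inj: "inj_on x {1..3}" by (rule cubic_roots_inj[OF x s0])
  define v where "v i = (if i = 1 then c * vandermonde3 x else - (c * vandermonde3 x))" for i :: nat
  have v12: "v 1 = c * vandermonde3 x" "v 2 = - v 1" by (simp_all add: v_def)
  have disc: "vandermonde3 x ^ 2 = - (s ^ 2) * (4 * s + 27)"
    unfolding vandermonde3_def cubic_discriminant[OF x] by Groebner_Basis.algebra
  have v: "opposite_roots (c ^ 2 * (- (s ^ 2) * (4 * s + 27))) v"
    by (simp add: opposite_roots_def v_def power_mult_distrib disc)
  have "vandermonde3 x ^ 2 \<noteq> 0" unfolding disc using s0 by simp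
  then have v0: "v 1 \<noteq> 0" using c by (auto simp: v12)
  define xs where "xs = even_roots x v"
  have fact: "map_poly to_ac F = (\<Prod>u\<leftarrow>xs. [:- u, 1:])"
    unfolding F xs_def by (rule even_sextic_factorization[OF x v])
  define L where "L = adjoin K (x ` {1..3})"
  have L: "is_subfield L" and KL: "K \<subseteq> L" and xL: "x ` {1..3} \<subseteq> L"
    unfolding L_def by (simp, rule adjoin_base, rule adjoin_gens)
  have xi: "x 1 \<in> L" "x 2 \<in> L" "x 3 \<in> L" using xL by auto
  have cK: "c \<in> K" using c by (simp add: K_def)
  then have cL: "c \<in> L" using KL by auto
  have vL: "v i \<in> L" for i unfolding v_def vandermonde3_def using xi cL L
    by (auto intro!: subfield_uminus subfield_mult subfield_diff)
  have "adjoin K (set xs) = adjoin K (x ` {1..3} \<union> v ` {1..2})"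
    unfolding xs_def by (rule adjoin_even_roots[OF Ksub _ _ x v12(2) v0 s0(1) s0(1)]) (use K in \<open>auto simp: K_def\<close>)
  also have "\<dots> = L"
    unfolding adjoin_adjoin[symmetric] L_def[symmetric] by (rule adjoin_subfield[OF L]) (use vL in auto)
  finally have LL: "adjoin K (set xs) = L" .
  have SF: "ac_splitting_field F = L"
    unfolding ac_splitting_field_def ac_roots_def fact poly_linear_factors_eq_0_iff
    by (simp add: LL K_def[symmetric])
  have Gal: "poly_galois_group F = galois_group K L"
    unfolding poly_galois_group_def SF K_def ..
  note one = rational_frame_one_param[OF B rational_frame_S3[OF x inj] K, folded K_def, folded L_def]
  show iso: "poly_galois_group F \<cong> S3" unfolding Gal by (rule one(2))
  have trans: "\<exists>\<sigma>\<in>carrier (poly_galois_group F). \<sigma> (x 1 * v 1) = u" if u: "u \<in> set xs" for u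
  proof -
    obtain h where h: "h \<in> carrier S3" "u = x (h 1) * (c * vandermonde3 (x \<circ> h))"
      using even_roots_orbit[OF _ v12] u unfolding xs_def by blast
    obtain \<sigma> where \<sigma>: "\<sigma> \<in> carrier (galois_group K L)" "\<forall>i\<in>{1..3}. \<sigma> (x i) = x (h i)"
      using one(1)[OF h(1)] by blast
    interpret subfield_hom L \<sigma> by (rule galois_hom[OF L \<sigma>(1)])
    have "\<sigma> (x 1) = x (h 1)" "\<sigma> (x 2) = x (h 2)" "\<sigma> (x 3) = x (h 3)" "\<sigma> c = c"
      using \<sigma>(2) galois_fix[OF \<sigma>(1) cK] by simp_all
    then have "\<sigma> (x 1 * v 1) = u" unfolding v12 vandermonde3_def h(2)
      using xi cL L by (simp add: mult diff subfield_mult subfield_diff)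
    then show ?thesis using \<sigma>(1) unfolding Gal by blast
  qed
  have r0: "x 1 * v 1 \<in> set xs" by (simp add: xs_def even_roots_def)
  have len: "length xs = 6" by (simp add: xs_def even_roots_def)
  show "irreducible F" "transitive_galois_action 6 S3 F" if nm: "no_multiple_root F"
    using irreducible_if_transitive[OF nm fact len _ sym_group_is_group iso trans r0]
      transitive_galois_actionI[OF nm fact len _ sym_group_is_group iso trans r0] by simp_all
  show "ac_splitting_field f = ac_splitting_field F" if f: "map_poly to_ac f = [:s, s, 0, 1:]"
  proof -
    have "poly (map_poly to_ac f) z = z ^ 3 + s * z + s" for z
      unfolding f by (simp add: algebra_simps power3_eq_cube)
    then have "ac_roots f = x ` {1..3}"
      unfolding ac_roots_def using cubic_roots_iff[OF x] by auto
    then show ?thesis unfolding SF by (simp add: ac_splitting_field_def L_def K_def)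
  qed
qed

section \<open>Specialization to a given Galois extension\<close>

lemma lead_coeff_linear_factors: "Polynomial.lead_coeff (\<Prod>u\<leftarrow>xs. [:- u, 1:]) = (1::'w::field)"
  by (induction xs) (simp_all only: list.map prod_list.Nil prod_list.Cons lead_coeff_mult lead_coeff_1, simp)

lemma is_splitting_fieldI:
  assumes "poly_over M f" "f = (\<Prod>u\<leftarrow>xs. [:- u, 1:])" "adjoin M (set xs) = L"
  shows "is_splitting_field M L f"
proof -
  have "Polynomial.lead_coeff f = 1" unfolding assms(2) by (rule lead_coeff_linear_factors)
  then show ?thesis using assms unfolding is_splitting_field_def by (auto simp del: leading_coeff_0_iff)
qed

lemma poly_over_pairing_sextic:
  "is_subfield M \<Longrightarrow> s \<in> M \<Longrightarrow> p \<in> M \<Longrightarrow> q \<in> M \<Longrightarrow> poly_over M (pairing_sextic s p q)"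
  unfolding pairing_sextic_def Let_def
  by (intro poly_over_closed(8,1) subfield_intros) assumption+

lemma poly_over_even_sextic:
  "is_subfield M \<Longrightarrow> p \<in> M \<Longrightarrow> q \<in> M \<Longrightarrow> d \<in> M \<Longrightarrow> poly_over M (even_sextic p q d)"
  unfolding even_sextic_def
  by (intro poly_over_closed(8,1) subfield_intros) assumption+

lemma iso_DirProd_components:
  assumes "\<Phi> \<in> iso G (H \<times>\<times> H')" "group H" "group H'"
  shows "fst \<circ> \<Phi> \<in> Group.hom G H" "(fst \<circ> \<Phi>) ` carrier G = carrier H"
    and "snd \<circ> \<Phi> \<in> Group.hom G H'" "(snd \<circ> \<Phi>) ` carrier G = carrier H'"
proof -
  have \<Phi>: "\<Phi> \<in> Group.hom G (H \<times>\<times> H')" "\<Phi> ` carrier G = carrier H \<times> carrier H'"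
    using assms(1) by (auto simp: iso_def bij_betw_def)
  have "\<one>\<^bsub>H\<^esub> \<in> carrier H" "\<one>\<^bsub>H'\<^esub> \<in> carrier H'" using assms by (simp_all add: group.is_monoid)
  then show "(fst \<circ> \<Phi>) ` carrier G = carrier H" "(snd \<circ> \<Phi>) ` carrier G = carrier H'"
    unfolding image_comp[symmetric] \<Phi>(2) by force+
  show "fst \<circ> \<Phi> \<in> Group.hom G H" "snd \<circ> \<Phi> \<in> Group.hom G H'"
    using \<Phi>(1) by (auto simp: hom_def Pi_iff mult_DirProd' mem_Times_iff)
qed

context finite_galois
begin

text \<open>Two automorphisms that agree on both families have the same two components under
  \<open>\<Phi>\<close>, so the families separate the Galois group.\<close>

lemma adjoin_frames_eq_top:
  assumes \<Phi>: "\<Phi> \<in> iso (galois_group M L) (H \<times>\<times> H')"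
    and x: "frame H \<alpha> I x" "\<forall>i\<in>I. x i \<in> L" "\<forall>\<sigma>\<in>G. \<forall>i\<in>I. \<sigma> (x i) = x (\<alpha> ((fst \<circ> \<Phi>) \<sigma>) i)"
    and y: "frame H' \<beta> J y" "\<forall>j\<in>J. y j \<in> L" "\<forall>\<sigma>\<in>G. \<forall>j\<in>J. \<sigma> (y j) = y (\<beta> ((snd \<circ> \<Phi>) \<sigma>) j)"
  shows "adjoin M (x ` I \<union> y ` J) = L"
proof (rule adjoin_eq_top)
  show "finite (x ` I \<union> y ` J)" using frameD(2)[OF x(1)] frameD(2)[OF y(1)] by simp
  show "x ` I \<union> y ` J \<subseteq> L" using x(2) y(2) by auto
  fix g h assume gh: "g \<in> G" "h \<in> G" and eq: "\<And>u. u \<in> x ` I \<union> y ` J \<Longrightarrow> g u = h u"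
  have inj: "inj_on \<Phi> G" and im: "\<Phi> ` G = carrier H \<times> carrier H'" using \<Phi> by (auto simp: iso_def bij_betw_def)
  have mem: "\<Phi> k \<in> carrier H \<times> carrier H'" if "k \<in> G" for k using im that by blast
  have "fst (\<Phi> g) = fst (\<Phi> h)"
  proof (rule frameD(5)[OF x(1)])
    show "x (\<alpha> (fst (\<Phi> g)) i) = x (\<alpha> (fst (\<Phi> h)) i)" if "i \<in> I" for i
      using x(3)[rule_format, OF gh(1) that] x(3)[rule_format, OF gh(2) that] eq[of "x i"] that by simp
  qed (use mem gh in \<open>auto simp: mem_Times_iff\<close>)
  moreover have "snd (\<Phi> g) = snd (\<Phi> h)"
  proof (rule frameD(5)[OF y(1)])
    show "y (\<beta> (snd (\<Phi> g)) i) = y (\<beta> (snd (\<Phi> h)) i)" if "i \<in> J" for i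
      using y(3)[rule_format, OF gh(1) that] y(3)[rule_format, OF gh(2) that] eq[of "y i"] that by simp
  qed (use mem gh in \<open>auto simp: mem_Times_iff\<close>)
  ultimately show "g = h" using inj_onD[OF inj _ gh] by (simp add: prod_eq_iff)
qed

lemma adjoin_frame_eq_top:
  assumes \<Phi>: "\<Phi> \<in> iso (galois_group M L) H"
    and x: "frame H \<alpha> I x" "\<forall>i\<in>I. x i \<in> L" "\<forall>\<sigma>\<in>G. \<forall>i\<in>I. \<sigma> (x i) = x (\<alpha> (\<Phi> \<sigma>) i)"
  shows "adjoin M (x ` I) = L"
proof (rule adjoin_eq_top)
  show "finite (x ` I)" using frameD(2)[OF x(1)] by simp
  show "x ` I \<subseteq> L" using x(2) by auto
  fix g h assume gh: "g \<in> G" "h \<in> G" and eq: "\<And>u. u \<in> x ` I \<Longrightarrow> g u = h u"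
  have inj: "inj_on \<Phi> G" and im: "\<Phi> ` G = carrier H" using \<Phi> by (auto simp: iso_def bij_betw_def)
  have "\<Phi> g = \<Phi> h"
  proof (rule frameD(5)[OF x(1)])
    show "x (\<alpha> (\<Phi> g) i) = x (\<alpha> (\<Phi> h) i)" if "i \<in> I" for i
      using x(3)[rule_format, OF gh(1) that] x(3)[rule_format, OF gh(2) that] eq[of "x i"] that by simp
  qed (use im gh in auto)
  then show "g = h" using inj_onD[OF inj _ gh] by simp
qed

text \<open>The first component of \<open>\<Phi>\<close> yields the parameter \<open>a\<close> and
  the roots of \<open>X^3 + a X + a\<close>; the second family is passed in, since its construction
  depends on \<open>H\<close>.\<close>

lemma pairing_sextic_splitting_field:
  assumes \<Phi>: "\<Phi> \<in> iso (galois_group M L) (S3 \<times>\<times> H)" and char: "(3::'w) \<noteq> 0"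
    and y: "frame H \<beta> {1..3} y" "\<forall>j\<in>{1..3}. y j \<in> L"
      "\<forall>\<sigma>\<in>G. \<forall>j\<in>{1..3}. \<sigma> (y j) = y (\<beta> ((snd \<circ> \<Phi>) \<sigma>) j)"
    and y': "cubic_roots p q (\<lambda>i. c * y i + b)" and cb: "c \<in> M" "b \<in> M" "c \<noteq> 0"
    and pq: "p \<in> M" "q \<in> M" "p \<noteq> 0" "q \<noteq> 0"
  obtains a where "a \<in> M" "a \<noteq> 0" "4 * a + 27 \<noteq> 0" "is_splitting_field M L (pairing_sextic a p q)"
proof -
  note comp = iso_DirProd_components[OF \<Phi> sym_group_is_group frameD(1)[OF y(1)]]
  obtain a x where a: "a \<in> M" "a \<noteq> 0" "4 * a + 27 \<noteq> 0" and x: "cubic_roots a a x" "\<forall>i\<in>{1..3}. x i \<in> L"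
    "\<forall>\<sigma>\<in>G. \<forall>i\<in>{1..3}. \<sigma> (x i) = x ((fst \<circ> \<Phi>) \<sigma> i)" "inj_on x {1..3}"
    using S3_generator[OF comp(1,2) char] by blast
  define w where "w i = c * y i + b" for i
  have w: "cubic_roots p q w" unfolding w_def by (rule y')
  have "is_splitting_field M L (pairing_sextic a p q)"
  proof (rule is_splitting_fieldI)
    show "poly_over M (pairing_sextic a p q)" using a pq M by (intro poly_over_pairing_sextic)
    show "pairing_sextic a p q = (\<Prod>u\<leftarrow>pairing_roots (recip_deriv a x) w. [:- u, 1:])"
      by (rule pairing_sextic_factorization[OF recip_deriv_roots(1)[OF x(1) a(2,3) char] a(2,3) char w])
    have "adjoin M (set (pairing_roots (recip_deriv a x) w)) = adjoin M (x ` {1..3} \<union> w ` {1..3})"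
      by (rule adjoin_pairing_roots[OF M a(1) pq(1,2) x(1) w a(2,3) pq(3,4) char])
    also have "\<dots> = adjoin M (x ` {1..3} \<union> y ` {1..3})"
      by (rule adjoin_affine_family[OF M cb w_def])
    also have "\<dots> = L"
      by (rule adjoin_frames_eq_top[OF \<Phi> rational_frameD(1)[OF rational_frame_S3[OF x(1,4)]] x(2,3) y])
    finally show "adjoin M (set (pairing_roots (recip_deriv a x) w)) = L" .
  qed
  then show ?thesis using that a by blast
qed

lemma even_sextic_splitting_field:
  assumes \<Phi>: "\<Phi> \<in> iso (galois_group M L) (H \<times>\<times> C 2)" and char: "(2::'w) \<noteq> 0"
    and x: "frame H \<alpha> {1..3} x" "\<forall>i\<in>{1..3}. x i \<in> L"
      "\<forall>\<sigma>\<in>G. \<forall>i\<in>{1..3}. \<sigma> (x i) = x (\<alpha> ((fst \<circ> \<Phi>) \<sigma>) i)"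
    and x': "cubic_roots p q (\<lambda>i. c * x i + b)" and cb: "c \<in> M" "b \<in> M" "c \<noteq> 0"
    and pq: "p \<in> M" "q \<in> M" "p \<noteq> 0" "q \<noteq> 0"
  obtains d where "d \<in> M" "d \<noteq> 0" "is_splitting_field M L (even_sextic p q d)"
proof -
  note comp = iso_DirProd_components[OF \<Phi> frameD(1)[OF x(1)] group_integer_mod_group]
  obtain d v where d: "d \<in> M" "d \<noteq> 0" and v: "opposite_roots d v" "\<forall>i\<in>{1..2}. v i \<in> L"
    "\<forall>\<sigma>\<in>G. \<forall>i\<in>{1..2}. \<sigma> (v i) = v (flip ((snd \<circ> \<Phi>) \<sigma>) i)" "v 1 \<noteq> v 2"
    using C2_generator[OF comp(3,4) char] by blast
  have v12: "v 2 = - v 1" "v 1 \<noteq> 0" using v(1) d by (auto simp: opposite_roots_def)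
  define w where "w i = c * x i + b" for i
  have w: "cubic_roots p q w" unfolding w_def by (rule x')
  have "is_splitting_field M L (even_sextic p q d)"
  proof (rule is_splitting_fieldI)
    show "poly_over M (even_sextic p q d)" using d pq M by (intro poly_over_even_sextic)
    show "even_sextic p q d = (\<Prod>u\<leftarrow>even_roots w v. [:- u, 1:])"
      by (rule even_sextic_factorization[OF w v(1)])
    have "adjoin M (set (even_roots w v)) = adjoin M (w ` {1..3} \<union> v ` {1..2})"
      by (rule adjoin_even_roots[OF M pq(1,2) w v12 pq(3,4)])
    also have "\<dots> = adjoin M (x ` {1..3} \<union> v ` {1..2})"
      unfolding Un_commute[of _ "v ` {1..2}"] by (rule adjoin_affine_family[OF M cb w_def])
    also have "\<dots> = L"
      by (rule adjoin_frames_eq_top[OF \<Phi> x rational_frameD(1)[OF rational_frame_C2[OF v(1,4)]] v(2,3)])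
    finally show "adjoin M (set (even_roots w v)) = L" .
  qed
  then show ?thesis using that d by blast
qed

text \<open>The parameter \<open>a\<close> is obtained before \<open>c\<close>, because the two
  applications take \<open>c\<close> to be a function of \<open>a\<close>.\<close>

lemma single_sextic_splitting_field:
  assumes \<Phi>: "\<Phi> \<in> iso (galois_group M L) S3" and char: "(3::'w) \<noteq> 0"
  obtains a where "a \<in> M" "a \<noteq> 0" "4 * a + 27 \<noteq> 0"
    "\<And>c. c \<in> M \<Longrightarrow> c \<noteq> 0 \<Longrightarrow> is_splitting_field M L (even_sextic a a (c ^ 2 * (- (a ^ 2) * (4 * a + 27))))"
proof -
  have "\<Phi> \<in> Group.hom (galois_group M L) S3" "\<Phi> ` G = carrier S3"
    using \<Phi> by (auto simp: iso_def bij_betw_def)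
  then obtain a x where a: "a \<in> M" "a \<noteq> 0" "4 * a + 27 \<noteq> 0" and x: "cubic_roots a a x" "\<forall>i\<in>{1..3}. x i \<in> L"
    "\<forall>\<sigma>\<in>G. \<forall>i\<in>{1..3}. \<sigma> (x i) = x (\<Phi> \<sigma> i)" "inj_on x {1..3}"
    using S3_generator[OF _ _ char] by blast
  have top: "adjoin M (x ` {1..3}) = L"
    by (rule adjoin_frame_eq_top[where \<alpha> = "\<lambda>h. h", OF \<Phi> rational_frameD(1)[OF rational_frame_S3[OF x(1,4)]] x(2,3)])
  have xi: "x 1 \<in> L" "x 2 \<in> L" "x 3 \<in> L" using x(2) by auto
  have disc: "vandermonde3 x ^ 2 = - (a ^ 2) * (4 * a + 27)"
    unfolding vandermonde3_def cubic_discriminant[OF x(1)] by Groebner_Basis.algebra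
  have "is_splitting_field M L (even_sextic a a (c ^ 2 * (- (a ^ 2) * (4 * a + 27))))" if c: "c \<in> M" "c \<noteq> 0" for c
  proof (rule is_splitting_fieldI)
    define v where "v i = (if i = 1 then c * vandermonde3 x else - (c * vandermonde3 x))" for i :: nat
    have v12: "v 2 = - v 1" by (simp add: v_def)
    have v: "opposite_roots (c ^ 2 * (- (a ^ 2) * (4 * a + 27))) v"
      by (simp add: opposite_roots_def v_def power_mult_distrib disc)
    have "vandermonde3 x ^ 2 \<noteq> 0" unfolding disc using a by simp
    then have v0: "v 1 \<noteq> 0" using c by (auto simp: v_def)
    have cL: "c \<in> L" using c MsubL by auto
    have vL: "v i \<in> L" for i unfolding v_def vandermonde3_def using xi cL L
      by (auto intro!: subfield_uminus subfield_mult subfield_diff)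
    show "poly_over M (even_sextic a a (c ^ 2 * (- (a ^ 2) * (4 * a + 27))))"
      using a c M by (intro poly_over_even_sextic subfield_intros)
    show "even_sextic a a (c ^ 2 * (- (a ^ 2) * (4 * a + 27))) = (\<Prod>u\<leftarrow>even_roots x v. [:- u, 1:])"
      by (rule even_sextic_factorization[OF x(1) v])
    have "adjoin M (set (even_roots x v)) = adjoin M (x ` {1..3} \<union> v ` {1..2})"
      by (rule adjoin_even_roots[OF M a(1,1) x(1) v12 v0 a(2,2)])
    also have "\<dots> = L"
      unfolding adjoin_adjoin[symmetric] top by (rule adjoin_subfield[OF L]) (use vL in auto)
    finally show "adjoin M (set (even_roots x v)) = L" .
  qed
  then show ?thesis using that a by blast
qed

end

lemma k_generic_wrtI:
  fixes ev :: "('k::field \<Rightarrow> 'w::field) \<Rightarrow> 'pt \<Rightarrow> 'p::idom \<Rightarrow> 'w"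
  assumes "poly_galois_group F \<cong> G" and fin: "finite (carrier G)"
    and "\<And>\<iota> M L \<Phi>. field_embedding \<iota> \<Longrightarrow> range \<iota> \<subseteq> M \<Longrightarrow> finite_galois M L \<Longrightarrow> \<Phi> \<in> iso (galois_group M L) G \<Longrightarrow>
      \<exists>a\<in>pts M. \<exists>f. specializes_to (ev \<iota> a) F f \<and> is_splitting_field M L f"
  shows "k_generic_wrt ev pts F G"
  unfolding k_generic_wrt_def
proof (intro conjI allI impI assms(1); elim conjE)
  fix \<iota> :: "'k \<Rightarrow> 'w" and M L
  assume H: "field_embedding \<iota>" "range \<iota> \<subseteq> M" "infinite M" "galois_extension M L" "galois_group M L \<cong> G"
  then obtain \<Phi> where \<Phi>: "\<Phi> \<in> iso (galois_group M L) G" by (auto simp: is_iso_def)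
  then have "finite (carrier (galois_group M L))"
    using fin bij_betw_finite unfolding iso_def by blast
  then have "finite_galois M L" using H by unfold_locales
  then show "\<exists>a\<in>pts M. \<exists>f. specializes_to (ev \<iota> a) F f \<and> is_splitting_field M L f"
    using assms(3) H \<Phi> by blast
qed

section \<open>Genericity of the sextics\<close>

lemma of_nat_neq_0_if_CHAR_neq:
  assumes "prime p" "CHAR('k::field) \<noteq> p"
  shows "of_nat p \<noteq> (0::'k)"
proof
  assume "of_nat p = (0::'k)"
  then have "CHAR('k) dvd p" by (simp add: of_nat_eq_0_iff_char_dvd)
  then have "CHAR('k) = 1" using assms by (auto simp: prime_nat_iff)
  then show False using of_nat_eq_0_iff_char_dvd[of 1, where 'a = 'k] by simp
qed

lemma numeral_alg_closure_eq_0_iff: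
  "(numeral n :: 'k::field poly fract alg_closure) = 0 \<longleftrightarrow> (numeral n :: 'k) = 0"
  "(numeral n :: 'k poly poly fract alg_closure) = 0 \<longleftrightarrow> (numeral n :: 'k) = 0"
proof -
  have 1: "ring_map (\<lambda>c :: 'k. to_ac (coef_frac c))" by (simp add: ring_map_def coef_frac_simps)
  have "coef_frac [:c + d:] = coef_frac [:c:] + coef_frac [:d:]" for c d :: 'k
    using coef_frac_simps(3)[of "[:c:]" "[:d:]"] by simp
  moreover have "coef_frac [:c * d:] = coef_frac [:c:] * coef_frac [:d:]" for c d :: 'k
    using coef_frac_simps(4)[of "[:c:]" "[:d:]"] by (simp add: mult.commute)
  moreover have "coef_frac [:0::'k:] = 0" "coef_frac [:1::'k:] = 1"
    by (simp_all only: pCons_0_0 one_pCons[symmetric] coef_frac_simps)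
  ultimately have 2: "ring_map (\<lambda>c :: 'k. to_ac (coef_frac [:c:]))" by (simp add: ring_map_def)
  show "(numeral n :: 'k poly fract alg_closure) = 0 \<longleftrightarrow> (numeral n :: 'k) = 0"
    "(numeral n :: 'k poly poly fract alg_closure) = 0 \<longleftrightarrow> (numeral n :: 'k) = 0"
    using ring_map_eq_0_iff[OF 1, of "numeral n"] ring_map_eq_0_iff[OF 2, of "numeral n"]
      ring_map_numeral[OF 1, of n] ring_map_numeral[OF 2, of n] by simp_all
qed

lemma field_embedding_numeral_eq_0_iff:
  "field_embedding (\<iota> :: 'k::field \<Rightarrow> 'w::field) \<Longrightarrow> (numeral n :: 'w) = 0 \<longleftrightarrow> (numeral n :: 'k) = 0"
  using ring_map_eq_0_iff[of \<iota> "numeral n"] ring_map_numeral[of \<iota> n] ring_map_field_embedding[of \<iota>] by simp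

text \<open>For the even sextics the element whose square root is taken is \<open>t\<close> times a
  nonzero element of \<open>k(s)\<close>; it may serve as second parameter in place of
  \<open>t\<close>.\<close>

lemma transcendental_scale:
  fixes t :: "'w::field"
  assumes F: "is_subfield F" and t: "\<not> algebraic_over F t" and c: "c \<in> F" "c \<noteq> 0" and u: "u = c * t"
  shows "\<not> algebraic_over F u" "adjoin F {u} = adjoin F {t}"
proof -
  have "adjoin F ({} \<union> (\<lambda>_. u) ` {()}) = adjoin F ({} \<union> (\<lambda>_. t) ` {()})"
    by (rule adjoin_affine_family[OF F c(1) subfield_zero[OF F] c(2)]) (simp add: u)
  then show eq: "adjoin F {u} = adjoin F {t}" by simp
  have "t \<in> adjoin F {u}" using adjoin_gens[of "{t}" F] eq by auto
  then show "\<not> algebraic_over F u" using algebraic_over_adjoin[OF F] t by blast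
qed

lemma shanks_coeffs_neq_0:
  fixes t :: "'w::field"
  assumes "t ^ 2 + 3 * t + 9 \<noteq> 0" "2 * t + 3 \<noteq> 0" "(3::'w) \<noteq> 0"
  shows "- 3 * (t ^ 2 + 3 * t + 9) \<noteq> 0" "- ((2 * t + 3) * (t ^ 2 + 3 * t + 9)) \<noteq> 0"
  unfolding mult_minus_left neg_equal_0_iff_equal mult_eq_0_iff using assms by blast+

lemma consts_subset_range: "consts1 \<subseteq> range to_ac" "consts2 \<subseteq> range to_ac"
  by (auto simp: consts1_def consts2_def)

lemma S3_orbit: "i \<in> {1..3} \<Longrightarrow> \<exists>h\<in>carrier S3. h 1 = i"
  using ex_perm3[of 1 2 3] ex_perm3[of 2 1 3] ex_perm3[of 3 2 1] unfolding atLeastAtMost_13 by auto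

lemma C3_orbit: "i \<in> {1..3} \<Longrightarrow> \<exists>c\<in>carrier (C 3). rot c 1 = i"
  unfolding atLeastAtMost_13 by (rule bexI[of _ "int i - 1"]) (auto simp: C3_cases)

lemma id_in_S3: "id \<in> carrier S3"
  by (simp add: sym_group_carrier permutes_id)

lemma finite_S3_C: "finite (carrier S3)" "finite (carrier (C 2))" "finite (carrier (C 3))"
  "finite (carrier G) \<Longrightarrow> finite (carrier H) \<Longrightarrow> finite (carrier (G \<times>\<times> H))"
  by (simp_all add: card_S3 C_carrier)

context
  fixes s t :: "'k::field poly poly fract"
  assumes st: "s = var2_s" "t = var2_t" and char3: "(3::'k) \<noteq> 0"
begin

private lemma chars:
  "(3 :: 'k poly poly fract alg_closure) \<noteq> 0" "field_embedding (\<iota> :: 'k \<Rightarrow> 'w::field) \<Longrightarrow> (3 :: 'w) \<noteq> 0"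
  using char3 by (simp_all add: numeral_alg_closure_eq_0_iff field_embedding_numeral_eq_0_iff)

private lemma params:
  "\<not> algebraic_over consts2 (to_ac s)" "\<not> algebraic_over (adjoin consts2 {to_ac s}) (to_ac t)"
  "range to_ac \<subseteq> adjoin consts2 {to_ac s, to_ac t}"
  unfolding st by (rule to_ac_var2_s_transcendental to_ac_var2_t_transcendental range_to_ac_adjoin2)+

private lemma vals:
  "field_embedding \<iota> \<Longrightarrow> value_at (eval2 \<iota> (a, b)) s a" "field_embedding \<iota> \<Longrightarrow> value_at (eval2 \<iota> (a, b)) t b"
  unfolding st by (rule value_at_vars; assumption)+

private lemmas s_neq_0 = transcendental_neq_0[OF is_subfield_consts(2) params(1) chars(1)]
private lemmas t_neq_0 = transcendental_neq_0[OF subfield_adjoin params(2) chars(1)]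

private lemma neq_0: "s \<noteq> 0" "4 * s + 27 \<noteq> 0" "s ^ 2 + 3 * s + 9 \<noteq> 0"
proof -
  have "to_ac (4 * s + 27) \<noteq> 0" "to_ac (s ^ 2 + 3 * s + 9) \<noteq> 0" using s_neq_0 by simp_all
  then show "s \<noteq> 0" "4 * s + 27 \<noteq> 0" "s ^ 2 + 3 * s + 9 \<noteq> 0" using s_neq_0 by (auto simp del: to_ac_add)
qed

lemma g_S3_S3_generic:
  assumes nm: "no_multiple_root (g_S3_S3 s t)"
  shows "irreducible (g_S3_S3 s t)" "k_generic2 TYPE('w::field) (g_S3_S3 s t) (S3 \<times>\<times> S3)"
    "transitive_galois_action 6 (S3 \<times>\<times> S3) (g_S3_S3 s t)"
proof -
  let ?S = "to_ac s" and ?T = "to_ac t"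
  obtain y where y: "cubic_roots ?T ?T y" using ex_cubic_roots by blast
  have inj: "inj_on y {1..3}" by (rule cubic_roots_inj[OF y t_neq_0(1,2)])
  have F: "map_poly to_ac (g_S3_S3 s t) = pairing_sextic ?S ?T ?T"
    by (simp only: g_S3_S3_eq map_poly_pairing_sextic)
  have y': "cubic_roots ?T ?T (\<lambda>i. 1 * y i + 0)" using y by simp
  have r: "(1 :: 'k poly poly fract alg_closure) \<in> range to_ac" "(0 :: 'k poly poly fract alg_closure) \<in> range to_ac"
    using is_subfield_range_to_ac by (auto simp: is_subfield_def)
  note concl = pairing_sextic_irreducible pairing_sextic_galois_group pairing_sextic_action
  note concl = concl[OF nm F is_subfield_consts(2) params consts_subset_range(2) rangeI rangeI rangeI rangeI
      t_neq_0(1,1) chars(1) rational_frame_S3[OF y inj] id_in_S3 _ y' r one_neq_zero, simplified]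
  show "irreducible (g_S3_S3 s t)" "transitive_galois_action 6 (S3 \<times>\<times> S3) (g_S3_S3 s t)" by (rule concl)+
  show "k_generic2 TYPE('w) (g_S3_S3 s t) (S3 \<times>\<times> S3)"
    unfolding k_generic2_def
  proof (rule k_generic_wrtI[OF concl(2)])
    show "finite (carrier (S3 \<times>\<times> S3))" by (intro finite_S3_C)
    fix \<iota> :: "'k \<Rightarrow> 'w" and M L \<Phi>
    assume \<iota>: "field_embedding \<iota>" "range \<iota> \<subseteq> M" and g: "finite_galois M L"
      and \<Phi>: "\<Phi> \<in> iso (galois_group M L) (S3 \<times>\<times> S3)"
    interpret finite_galois M L by (rule g)
    note char = chars(2)[OF \<iota>(1)]
    obtain b y where b: "b \<in> M" "b \<noteq> 0" "4 * b + 27 \<noteq> 0" and y: "cubic_roots b b y" "\<forall>i\<in>{1..3}. y i \<in> L"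
        "\<forall>\<sigma>\<in>G. \<forall>i\<in>{1..3}. \<sigma> (y i) = y ((snd \<circ> \<Phi>) \<sigma> i)" "inj_on y {1..3}"
      using S3_generator[OF iso_DirProd_components(3,4)[OF \<Phi> sym_group_is_group sym_group_is_group] char] by blast
    have y': "cubic_roots b b (\<lambda>i. 1 * y i + 0)" using y by simp
    obtain a where a: "a \<in> M" "a \<noteq> 0" "4 * a + 27 \<noteq> 0" "is_splitting_field M L (pairing_sextic a b b)"
      using pairing_sextic_splitting_field[where \<beta> = "\<lambda>h. h", OF \<Phi> char
          rational_frameD(1)[OF rational_frame_S3[OF y(1,4)]] y(2,3) y'
          subfield_one[OF M] subfield_zero[OF M] one_neq_zero b(1,1,2,2)] by blast
    have "specializes_to (eval2 \<iota> (a, b)) (g_S3_S3 s t) (pairing_sextic a b b)"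
      unfolding g_S3_S3_eq by (intro specializes_pairing_sextic ring_map_eval2 vals \<iota> a)
    then show "\<exists>a\<in>M \<times> M. \<exists>f. specializes_to (eval2 \<iota> a) (g_S3_S3 s t) f \<and> is_splitting_field M L f"
      using a b by blast
  qed
qed

lemma g_S3_C3_generic:
  assumes nm: "no_multiple_root (g_S3_C3 s t)"
  shows "irreducible (g_S3_C3 s t)" "k_generic2 TYPE('w::field) (g_S3_C3 s t) (S3 \<times>\<times> C 3)"
    "transitive_galois_action 6 (S3 \<times>\<times> C 3) (g_S3_C3 s t)"
proof -
  let ?S = "to_ac s" and ?T = "to_ac t"
  define p where "p u = - 3 * (u ^ 2 + 3 * u + 9)" for u :: "'k poly poly fract alg_closure"
  define q where "q u = - ((2 * u + 3) * (u ^ 2 + 3 * u + 9))" for u :: "'k poly poly fract alg_closure"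
  obtain y where y: "shanks_roots ?T y" using ex_shanks_roots by blast
  have inj: "inj_on y {1..3}" by (rule shanks_inj[OF y t_neq_0(4)])
  have F: "map_poly to_ac (g_S3_C3 s t) = pairing_sextic ?S (p ?T) (q ?T)"
    unfolding g_S3_C3_eq map_poly_pairing_sextic by (simp add: p_def q_def)
  have y': "cubic_roots (p ?T) (q ?T) (\<lambda>i. 3 * y i + - ?T)"
    using shanks_cubic_roots[OF y] by (simp add: p_def q_def)
  have e: "0 \<in> carrier (C 3)" by (simp add: C3_cases)
  have R: "is_subfield (range (to_ac :: 'k poly poly fract \<Rightarrow> _))" by (rule is_subfield_range_to_ac)
  have r: "3 \<in> range (to_ac :: 'k poly poly fract \<Rightarrow> _)" "- ?T \<in> range to_ac"
    "p ?T \<in> range to_ac" "q ?T \<in> range to_ac"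
    unfolding p_def q_def by (intro subfield_intros R rangeI)+
  have pq: "p ?T \<noteq> 0" "q ?T \<noteq> 0"
    unfolding p_def q_def by (rule shanks_coeffs_neq_0[OF t_neq_0(4,3) chars(1)])+
  have e0: "rot 0 i = i" if "i \<in> {1..3}" for i using that unfolding atLeastAtMost_13 by auto
  note concl = pairing_sextic_irreducible pairing_sextic_galois_group pairing_sextic_action
  note concl = concl[OF nm F is_subfield_consts(2) params consts_subset_range(2) rangeI rangeI r(3,4)
      pq chars(1) rational_frame_C3[OF y inj] e e0 y' r(1,2) chars(1)]
  show "irreducible (g_S3_C3 s t)" "transitive_galois_action 6 (S3 \<times>\<times> C 3) (g_S3_C3 s t)"
    by (rule concl; assumption)+
  have iso: "poly_galois_group (g_S3_C3 s t) \<cong> S3 \<times>\<times> C 3" by (rule concl; assumption)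
  show "k_generic2 TYPE('w) (g_S3_C3 s t) (S3 \<times>\<times> C 3)"
    unfolding k_generic2_def
  proof (rule k_generic_wrtI[OF iso])
    show "finite (carrier (S3 \<times>\<times> C 3))" by (intro finite_S3_C)
    fix \<iota> :: "'k \<Rightarrow> 'w" and M L \<Phi>
    assume \<iota>: "field_embedding \<iota>" "range \<iota> \<subseteq> M" and g: "finite_galois M L"
      and \<Phi>: "\<Phi> \<in> iso (galois_group M L) (S3 \<times>\<times> C 3)"
    interpret finite_galois M L by (rule g)
    note char = chars(2)[OF \<iota>(1)]
    obtain b y where "b \<in> M" "shanks_roots b y" "b ^ 2 + 3 * b + 9 \<noteq> 0" "2 * b + 3 \<noteq> 0"
      "\<forall>i\<in>{1..3}. y i \<in> L" "\<forall>\<sigma>\<in>G. \<forall>i\<in>{1..3}. \<sigma> (y i) = y (rot ((snd \<circ> \<Phi>) \<sigma>) i)" "inj_on y {1..3}"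
      by (rule C3_generator[OF iso_DirProd_components(3,4)[OF \<Phi> sym_group_is_group group_integer_mod_group] char])
    note b = this(1,3,4) and y = this(2,5,6,7)
    let ?p = "- 3 * (b ^ 2 + 3 * b + 9)" and ?q = "- ((2 * b + 3) * (b ^ 2 + 3 * b + 9))"
    have y': "cubic_roots ?p ?q (\<lambda>i. 3 * y i + - b)" using shanks_cubic_roots[OF y(1)] by simp
    have m: "3 \<in> M" "- b \<in> M" "?p \<in> M" "?q \<in> M" by (intro subfield_intros b(1) M)+
    obtain a where a: "a \<in> M" "a \<noteq> 0" "4 * a + 27 \<noteq> 0" "is_splitting_field M L (pairing_sextic a ?p ?q)"
      using pairing_sextic_splitting_field[OF \<Phi> char
          rational_frameD(1)[OF rational_frame_C3[OF y(1,4)]] y(2,3) y' m(1,2) char m(3,4) shanks_coeffs_neq_0[OF b(2,3) char]] by blast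
    have "specializes_to (eval2 \<iota> (a, b)) (g_S3_C3 s t) (pairing_sextic a ?p ?q)"
      unfolding g_S3_C3_eq
      by (intro specializes_pairing_sextic ring_map_eval2 vals value_intros[OF ring_map_eval2] \<iota> a)
    then show "\<exists>a\<in>M \<times> M. \<exists>f. specializes_to (eval2 \<iota> a) (g_S3_C3 s t) f \<and> is_splitting_field M L f"
      using a b by blast
  qed
qed

lemma g_S3_C2_generic:
  assumes nm: "no_multiple_root (g_S3_C2 s t)"
  shows "irreducible (g_S3_C2 s t)" "k_generic2 TYPE('w::field) (g_S3_C2 s t) (S3 \<times>\<times> C 2)"
    "transitive_galois_action 6 (S3 \<times>\<times> C 2) (g_S3_C2 s t)"
proof -
  let ?S = "to_ac s" and ?T = "to_ac t"
  define d where "d = - ?T * (4 * ?S + 27) / (?S * (4 * ?S + 27)) ^ 2"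
  define c where "c = - (4 * ?S + 27) / (?S * (4 * ?S + 27)) ^ 2"
  have F: "map_poly to_ac (g_S3_C2 s t) = even_sextic ?S ?S d"
    unfolding g_S3_C2_eq[OF neq_0(1,2)] map_poly_even_sextic by (simp add: d_def)
  have E: "is_subfield (adjoin consts2 {?S})" by simp
  have SE: "?S \<in> adjoin consts2 {?S}" using adjoin_gens[of "{?S}" consts2] by auto
  have c: "c \<in> adjoin consts2 {?S}" unfolding c_def by (intro subfield_intros E SE)
  have c0: "c \<noteq> 0"
    unfolding c_def divide_eq_0_iff neg_equal_0_iff_equal power_eq_0_iff mult_eq_0_iff using s_neq_0(1,2) by blast
  have "- u * v / w = (- v / w) * u" for u v w :: "'z::field" by (simp add: mult.commute)
  then have dc: "d = c * ?T" unfolding c_def d_def by blast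
  note scale = transcendental_scale[OF E params(2) c c0 dc]
  have K: "range to_ac \<subseteq> adjoin consts2 {?S, d}"
    using params(3) scale(2) unfolding adjoin_adjoin by (simp add: insert_commute)
  obtain x where x: "cubic_roots ?S ?S x" using ex_cubic_roots by blast
  have inj: "inj_on x {1..3}" by (rule cubic_roots_inj[OF x s_neq_0(1,2)])
  have x': "cubic_roots ?S ?S (\<lambda>i. 1 * x i + 0)" using x by simp
  have R: "is_subfield (range (to_ac :: 'k poly poly fract \<Rightarrow> _))" by (rule is_subfield_range_to_ac)
  have r: "d \<in> range to_ac" "(1 :: 'k poly poly fract alg_closure) \<in> range to_ac" "(0 :: 'k poly poly fract alg_closure) \<in> range to_ac"
    unfolding d_def by (intro subfield_intros R rangeI)+
  note concl = even_sextic_char even_sextic_irreducible even_sextic_galois_group even_sextic_action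
  note concl = concl[OF nm F is_subfield_consts(2) params(1) scale(1) K consts_subset_range(2) rangeI r(1)
      rangeI rangeI s_neq_0(1,1) rational_frame_S3[OF x inj] S3_orbit x' r(2,3) one_neq_zero, simplified]
  show "irreducible (g_S3_C2 s t)" "transitive_galois_action 6 (S3 \<times>\<times> C 2) (g_S3_C2 s t)" by (rule concl)+
  show "k_generic2 TYPE('w) (g_S3_C2 s t) (S3 \<times>\<times> C 2)"
    unfolding k_generic2_def
  proof (rule k_generic_wrtI[OF concl(3)])
    show "finite (carrier (S3 \<times>\<times> C 2))" by (intro finite_S3_C)
    fix \<iota> :: "'k \<Rightarrow> 'w" and M L \<Phi>
    assume \<iota>: "field_embedding \<iota>" "range \<iota> \<subseteq> M" and g: "finite_galois M L"
      and \<Phi>: "\<Phi> \<in> iso (galois_group M L) (S3 \<times>\<times> C 2)"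
    interpret finite_galois M L by (rule g)
    \<comment> \<open>The second inequality holds in the closure of \<open>k(s,t)\<close> by the
      absence of multiple roots, and passes through \<open>k\<close> to the ambient field of
      \<open>M\<close>.\<close>
    have char: "(3 :: 'w) \<noteq> 0" "(2 :: 'w) \<noteq> 0"
      using chars(2)[OF \<iota>(1)] concl(1) \<iota>(1)
      by (simp_all add: numeral_alg_closure_eq_0_iff field_embedding_numeral_eq_0_iff)
    obtain a x where a: "a \<in> M" "a \<noteq> 0" "4 * a + 27 \<noteq> 0" and x: "cubic_roots a a x" "\<forall>i\<in>{1..3}. x i \<in> L"
        "\<forall>\<sigma>\<in>G. \<forall>i\<in>{1..3}. \<sigma> (x i) = x ((fst \<circ> \<Phi>) \<sigma> i)" "inj_on x {1..3}"
      using S3_generator[OF iso_DirProd_components(1,2)[OF \<Phi> sym_group_is_group group_integer_mod_group] char(1)] by blast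
    have x': "cubic_roots a a (\<lambda>i. 1 * x i + 0)" using x by simp
    obtain e where e: "e \<in> M" "is_splitting_field M L (even_sextic a a e)"
      using even_sextic_splitting_field[where \<alpha> = "\<lambda>h. h", OF \<Phi> char(2)
          rational_frameD(1)[OF rational_frame_S3[OF x(1,4)]] x(2,3) x'
          subfield_one[OF M] subfield_zero[OF M] one_neq_zero a(1,1,2,2)] by blast
    \<comment> \<open>Solves the formula of \<open>g_S3_C2_eq\<close> for the second
      parameter.\<close>
    define b where "b = - e * a ^ 2 * (4 * a + 27)"
    have b: "b \<in> M" unfolding b_def using e a M by (intro subfield_intros)
    have eb: "e = - b * (4 * a + 27) / (a * (4 * a + 27)) ^ 2"
      using a by (simp add: b_def power2_eq_square)
    have "specializes_to (eval2 \<iota> (a, b)) (g_S3_C2 s t) (even_sextic a a e)"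
      unfolding g_S3_C2_eq[OF neq_0(1,2)] eb
      by (intro specializes_even_sextic ring_map_eval2 vals value_intros[OF ring_map_eval2] \<iota>) (use a in simp)
    then show "\<exists>a\<in>M \<times> M. \<exists>f. specializes_to (eval2 \<iota> a) (g_S3_C2 s t) f \<and> is_splitting_field M L f"
      using a b e by blast
  qed
qed

lemma g_S3_1_generic:
  assumes nm: "no_multiple_root (g_S3_1 s)"
  shows "irreducible (g_S3_1 s)" "k_generic2 TYPE('w::field) (g_S3_1 s) S3" "transitive_galois_action 6 S3 (g_S3_1 s)"
proof -
  let ?S = "to_ac s" and ?T = "to_ac t"
  define c where "c = 1 / (?S * ?S * (4 * ?S + 27))"
  have cc: "- 1 * (4 * u + 27) / (u * (4 * u + 27)) ^ 2 = (1 / (u * u * (4 * u + 27))) ^ 2 * (- (u ^ 2) * (4 * u + 27))"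
    if "u \<noteq> 0" "4 * u + 27 \<noteq> 0" for u :: "'z::field"
  proof -
    define v where "v = 4 * u + 27"
    have "v \<noteq> 0" using that by (simp add: v_def)
    then show ?thesis unfolding v_def[symmetric] using that(1) by (simp add: field_simps power2_eq_square)
  qed
  have F: "map_poly to_ac (g_S3_1 s) = even_sextic ?S ?S (c ^ 2 * (- (?S ^ 2) * (4 * ?S + 27)))"
    unfolding g_S3_1_eq g_S3_C2_eq[OF neq_0(1,2)] map_poly_even_sextic c_def cc[OF s_neq_0(1,2), symmetric] by simp
  have R: "is_subfield (range (to_ac :: 'k poly poly fract \<Rightarrow> _))" by (rule is_subfield_range_to_ac)
  have c: "c \<in> range to_ac" unfolding c_def by (intro subfield_intros R rangeI)
  have c0: "c \<noteq> 0" using s_neq_0 by (simp add: c_def)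
  \<comment> \<open>Only \<open>s\<close> occurs in the polynomial, so \<open>k(s,t)\<close> is
    treated as a field in the one parameter \<open>s\<close> over the constants
    \<open>k(t)\<close>.\<close>
  have B: "is_subfield (adjoin consts2 {?T})" by simp
  have S: "\<not> algebraic_over (adjoin consts2 {?T}) ?S"
    by (rule transcendental_swap(2)[OF is_subfield_consts(2) params(1,2)])
  have K: "range to_ac \<subseteq> adjoin (adjoin consts2 {?T}) {?S}"
    using params(3) by (simp add: adjoin_adjoin insert_commute)
  have BK: "adjoin consts2 {?T} \<subseteq> range to_ac"
    by (intro adjoin_least R consts_subset_range) simp
  note single = F B S K BK rangeI c c0 chars(1)
  show "irreducible (g_S3_1 s)" "transitive_galois_action 6 S3 (g_S3_1 s)"
    by (rule single_irreducible[OF single nm], rule single_action[OF single nm])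
  show "k_generic2 TYPE('w) (g_S3_1 s) S3"
    unfolding k_generic2_def
  proof (rule k_generic_wrtI[OF single_galois_group[OF single] finite_S3_C(1)])
    fix \<iota> :: "'k \<Rightarrow> 'w" and M L \<Phi>
    assume \<iota>: "field_embedding \<iota>" "range \<iota> \<subseteq> M" and g: "finite_galois M L"
      and \<Phi>: "\<Phi> \<in> iso (galois_group M L) S3"
    interpret finite_galois M L by (rule g)
    obtain a where a: "a \<in> M" "a \<noteq> 0" "4 * a + 27 \<noteq> 0"
        "\<And>c. c \<in> M \<Longrightarrow> c \<noteq> 0 \<Longrightarrow> is_splitting_field M L (even_sextic a a (c ^ 2 * (- (a ^ 2) * (4 * a + 27))))"
      using single_sextic_splitting_field[OF \<Phi> chars(2)[OF \<iota>(1)]] by blast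
    have "1 / (a * a * (4 * a + 27)) \<in> M" using a(1) M by (intro subfield_intros)
    then have sf: "is_splitting_field M L (even_sextic a a (- 1 * (4 * a + 27) / (a * (4 * a + 27)) ^ 2))"
      unfolding cc[OF a(2,3)] using a by simp
    \<comment> \<open>The second coordinate of the point is arbitrary; \<open>a\<close> is at hand
      as an element of \<open>M\<close>.\<close>
    have "specializes_to (eval2 \<iota> (a, a)) (g_S3_1 s) (even_sextic a a (- 1 * (4 * a + 27) / (a * (4 * a + 27)) ^ 2))"
      unfolding g_S3_1_eq g_S3_C2_eq[OF neq_0(1,2)]
      by (intro specializes_even_sextic ring_map_eval2 vals value_intros[OF ring_map_eval2] \<iota>) (use a in simp)
    then show "\<exists>a\<in>M \<times> M. \<exists>f. specializes_to (eval2 \<iota> a) (g_S3_1 s) f \<and> is_splitting_field M L f"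
      using a(1) sf by blast
  qed
qed

lemma g_C3_C2_generic:
  assumes nm: "no_multiple_root (g_C3_C2 s t)"
  shows "irreducible (g_C3_C2 s t)" "k_generic2 TYPE('w::field) (g_C3_C2 s t) (C 3 \<times>\<times> C 2)"
    "transitive_galois_action 6 (C 3 \<times>\<times> C 2) (g_C3_C2 s t)"
proof -
  let ?S = "to_ac s" and ?T = "to_ac t"
  define p where "p u = - 3 * (u ^ 2 + 3 * u + 9)" for u :: "'k poly poly fract alg_closure"
  define q where "q u = - ((2 * u + 3) * (u ^ 2 + 3 * u + 9))" for u :: "'k poly poly fract alg_closure"
  define d where "d = ?T / (?S ^ 2 + 3 * ?S + 9) ^ 2"
  define c where "c = 1 / (?S ^ 2 + 3 * ?S + 9) ^ 2"
  have F: "map_poly to_ac (g_C3_C2 s t) = even_sextic (p ?S) (q ?S) d"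
    unfolding g_C3_C2_eq[OF neq_0(3)] map_poly_even_sextic by (simp add: p_def q_def d_def)
  have E: "is_subfield (adjoin consts2 {?S})" by simp
  have SE: "?S \<in> adjoin consts2 {?S}" using adjoin_gens[of "{?S}" consts2] by auto
  have c: "c \<in> adjoin consts2 {?S}" unfolding c_def by (intro subfield_intros E SE)
  have c0: "c \<noteq> 0" using s_neq_0 by (simp add: c_def)
  have dc: "d = c * ?T" by (simp add: c_def d_def)
  note scale = transcendental_scale[OF E params(2) c c0 dc]
  have K: "range to_ac \<subseteq> adjoin consts2 {?S, d}"
    using params(3) scale(2) unfolding adjoin_adjoin by (simp add: insert_commute)
  obtain x where x: "shanks_roots ?S x" using ex_shanks_roots by blast
  have inj: "inj_on x {1..3}" by (rule shanks_inj[OF x s_neq_0(4)])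
  have x': "cubic_roots (p ?S) (q ?S) (\<lambda>i. 3 * x i + - ?S)"
    using shanks_cubic_roots[OF x] by (simp add: p_def q_def)
  have R: "is_subfield (range (to_ac :: 'k poly poly fract \<Rightarrow> _))" by (rule is_subfield_range_to_ac)
  have r: "3 \<in> range (to_ac :: 'k poly poly fract \<Rightarrow> _)" "- ?S \<in> range to_ac"
    "p ?S \<in> range to_ac" "q ?S \<in> range to_ac" "d \<in> range to_ac"
    unfolding p_def q_def d_def by (intro subfield_intros R rangeI)+
  have pq: "p ?S \<noteq> 0" "q ?S \<noteq> 0"
    unfolding p_def q_def by (rule shanks_coeffs_neq_0[OF s_neq_0(4,3) chars(1)])+
  note concl = even_sextic_char even_sextic_irreducible even_sextic_galois_group even_sextic_action
  note concl = concl[OF nm F is_subfield_consts(2) params(1) scale(1) K consts_subset_range(2) rangeI r(5)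
      r(3,4) pq rational_frame_C3[OF x inj] C3_orbit x' r(1,2) chars(1)]
  show "irreducible (g_C3_C2 s t)" "transitive_galois_action 6 (C 3 \<times>\<times> C 2) (g_C3_C2 s t)" by (rule concl; assumption)+
  have iso: "poly_galois_group (g_C3_C2 s t) \<cong> C 3 \<times>\<times> C 2" and char2: "(2 :: 'k poly poly fract alg_closure) \<noteq> 0"
    by (rule concl; assumption)+
  show "k_generic2 TYPE('w) (g_C3_C2 s t) (C 3 \<times>\<times> C 2)"
    unfolding k_generic2_def
  proof (rule k_generic_wrtI[OF iso])
    show "finite (carrier (C 3 \<times>\<times> C 2))" by (intro finite_S3_C)
    fix \<iota> :: "'k \<Rightarrow> 'w" and M L \<Phi>
    assume \<iota>: "field_embedding \<iota>" "range \<iota> \<subseteq> M" and g: "finite_galois M L"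
      and \<Phi>: "\<Phi> \<in> iso (galois_group M L) (C 3 \<times>\<times> C 2)"
    interpret finite_galois M L by (rule g)
    have char: "(3 :: 'w) \<noteq> 0" "(2 :: 'w) \<noteq> 0"
      using chars(2)[OF \<iota>(1)] char2 \<iota>(1)
      by (simp_all add: numeral_alg_closure_eq_0_iff field_embedding_numeral_eq_0_iff)
    obtain a x where "a \<in> M" "shanks_roots a x" "a ^ 2 + 3 * a + 9 \<noteq> 0" "2 * a + 3 \<noteq> 0"
      "\<forall>i\<in>{1..3}. x i \<in> L" "\<forall>\<sigma>\<in>G. \<forall>i\<in>{1..3}. \<sigma> (x i) = x (rot ((fst \<circ> \<Phi>) \<sigma>) i)" "inj_on x {1..3}"
      by (rule C3_generator[OF iso_DirProd_components(1,2)[OF \<Phi> group_integer_mod_group group_integer_mod_group] char(1)])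
    note a = this(1,3,4) and x = this(2,5,6,7)
    let ?p = "- 3 * (a ^ 2 + 3 * a + 9)" and ?q = "- ((2 * a + 3) * (a ^ 2 + 3 * a + 9))"
    have x': "cubic_roots ?p ?q (\<lambda>i. 3 * x i + - a)" using shanks_cubic_roots[OF x(1)] by simp
    have m: "3 \<in> M" "- a \<in> M" "?p \<in> M" "?q \<in> M" by (intro subfield_intros a(1) M)+
    obtain e where e: "e \<in> M" "is_splitting_field M L (even_sextic ?p ?q e)"
      using even_sextic_splitting_field[OF \<Phi> char(2) rational_frameD(1)[OF rational_frame_C3[OF x(1,4)]]
          x(2,3) x' m(1,2) char(1) m(3,4) shanks_coeffs_neq_0[OF a(2,3) char(1)]] by blast
    \<comment> \<open>Solves the formula of \<open>g_C3_C2_eq\<close> for the second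
      parameter.\<close>
    define b where "b = e * (a ^ 2 + 3 * a + 9) ^ 2"
    have b: "b \<in> M" unfolding b_def using e a(1) M by (intro subfield_intros)
    have eb: "e = b / (a ^ 2 + 3 * a + 9) ^ 2" using a by (simp add: b_def)
    have "specializes_to (eval2 \<iota> (a, b)) (g_C3_C2 s t) (even_sextic ?p ?q e)"
      unfolding g_C3_C2_eq[OF neq_0(3)] eb
      by (intro specializes_even_sextic ring_map_eval2 vals value_intros[OF ring_map_eval2] \<iota>) (use a in simp)
    then show "\<exists>a\<in>M \<times> M. \<exists>f. specializes_to (eval2 \<iota> a) (g_C3_C2 s t) f \<and> is_splitting_field M L f"
      using a b e by blast
  qed
qed

end

lemma h_S3_generic:
  fixes s :: "'k::field poly fract"
  assumes s: "s = var1_s" and char3: "(3::'k) \<noteq> 0"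
  shows "k_generic1 TYPE('w::field) (h_S3 s) S3" "ac_splitting_field (f_S3 s) = ac_splitting_field (h_S3 s)"
proof -
  let ?S = "to_ac s"
  have S: "\<not> algebraic_over consts1 ?S" unfolding s by (rule to_ac_var1_transcendental)
  have char: "(3 :: 'k poly fract alg_closure) \<noteq> 0" using char3 by (simp add: numeral_alg_closure_eq_0_iff)
  note s_neq_0 = transcendental_neq_0[OF is_subfield_consts(1) S char]
  \<comment> \<open>For \<open>h_S3\<close> the free factor is \<open>c = 1 / s\<close>.\<close>
  have cc: "(1 / u) ^ 2 * (- (u ^ 2) * (4 * u + 27)) = - (4 * u + 27)" if "u \<noteq> 0" for u :: "'z::field"
    using that by (simp add: power_divide)
  have F: "map_poly to_ac (h_S3 s) = even_sextic ?S ?S ((1 / ?S) ^ 2 * (- (?S ^ 2) * (4 * ?S + 27)))"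
    unfolding h_S3_eq map_poly_even_sextic cc[OF s_neq_0(1)] by simp
  have R: "is_subfield (range (to_ac :: 'k poly fract \<Rightarrow> _))" by (rule is_subfield_range_to_ac)
  have c: "1 / ?S \<in> range to_ac" by (intro subfield_intros R rangeI)
  have c0: "1 / ?S \<noteq> 0" using s_neq_0 by simp
  have RA: "range to_ac \<subseteq> adjoin consts1 {?S}" unfolding s by (rule range_to_ac_adjoin1)
  note single = F is_subfield_consts(1) S RA consts_subset_range(1) rangeI c c0 char
  have "map_poly to_ac (f_S3 s) = [:?S, ?S, 0, 1:]"
  proof -
    have "f_S3 s = [:s, s, 0, 1:]" by (simp add: f_S3_def monom_altdef power3_eq_cube)
    then show ?thesis by (simp add: map_poly_pCons)
  qed
  then show "ac_splitting_field (f_S3 s) = ac_splitting_field (h_S3 s)"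
    by (rule single_splitting_field[OF single])
  show "k_generic1 TYPE('w) (h_S3 s) S3"
    unfolding k_generic1_def
  proof (rule k_generic_wrtI[OF single_galois_group[OF single] finite_S3_C(1)])
    fix \<iota> :: "'k \<Rightarrow> 'w" and M L \<Phi>
    assume \<iota>: "field_embedding \<iota>" "range \<iota> \<subseteq> M" and g: "finite_galois M L"
      and \<Phi>: "\<Phi> \<in> iso (galois_group M L) S3"
    interpret finite_galois M L by (rule g)
    have char: "(3 :: 'w) \<noteq> 0" using char3 \<iota>(1) by (simp add: field_embedding_numeral_eq_0_iff)
    obtain a where a: "a \<in> M" "a \<noteq> 0" "4 * a + 27 \<noteq> 0"
        "\<And>c. c \<in> M \<Longrightarrow> c \<noteq> 0 \<Longrightarrow> is_splitting_field M L (even_sextic a a (c ^ 2 * (- (a ^ 2) * (4 * a + 27))))"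
      using single_sextic_splitting_field[OF \<Phi> char] by blast
    have "1 / a \<in> M" using a(1) M by (intro subfield_intros)
    then have sf: "is_splitting_field M L (even_sextic a a (- (4 * a + 27)))"
      using a(4)[of "1 / a"] cc[OF a(2)] a(2) by simp
    have "specializes_to (eval1 \<iota> a) (h_S3 s) (even_sextic a a (- (4 * a + 27)))"
      unfolding h_S3_eq s
      by (intro specializes_even_sextic ring_map_eval1 value_at_vars value_intros[OF ring_map_eval1] \<iota>)
    then show "\<exists>a\<in>M. \<exists>f. specializes_to (eval1 \<iota> a) (h_S3 s) f \<and> is_splitting_field M L f"
      using a(1) sf by blast
  qed
qed

theorem mainTheorem14:
  fixes s t :: "'k::field poly poly fract"
    and s1 :: "'k poly fract"
  assumes "CHAR('k) \<noteq> 3"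
    and "s = var2_s" and "t = var2_t" and "s1 = var1_s"
  shows
    "(no_multiple_root (g_S3_S3 s t) \<longrightarrow>
        irreducible (g_S3_S3 s t) \<and>
        k_generic2 TYPE('w::field) (g_S3_S3 s t) (S3 \<times>\<times> S3) \<and>
        transitive_galois_action 6 (S3 \<times>\<times> S3) (g_S3_S3 s t))
   \<and> (no_multiple_root (g_S3_C3 s t) \<longrightarrow>
        irreducible (g_S3_C3 s t) \<and>
        k_generic2 TYPE('w) (g_S3_C3 s t) (S3 \<times>\<times> C 3) \<and>
        S3 \<times>\<times> C 3 \<cong> wreath (C 3) (C 2) \<and>
        wreath (C 3) (C 2) \<cong> semidirect (C 3 \<times>\<times> C 3) (C 2) swap_action \<and>
        transitive_galois_action 6 (S3 \<times>\<times> C 3) (g_S3_C3 s t))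
   \<and> (no_multiple_root (g_S3_C2 s t) \<longrightarrow>
        irreducible (g_S3_C2 s t) \<and>
        k_generic2 TYPE('w) (g_S3_C2 s t) (S3 \<times>\<times> C 2) \<and>
        S3 \<times>\<times> C 2 \<cong> dihedral 6 \<and>
        transitive_galois_action 6 (S3 \<times>\<times> C 2) (g_S3_C2 s t))
   \<and> (CHAR('k) \<noteq> 2 \<and> no_multiple_root (g_S3_1 s) \<longrightarrow>
        irreducible (g_S3_1 s) \<and>
        k_generic2 TYPE('w) (g_S3_1 s) S3 \<and>
        transitive_galois_action 6 S3 (g_S3_1 s) \<and>
        k_generic1 TYPE('w) (h_S3 s1) S3 \<and>
        ac_splitting_field (f_S3 s1) = ac_splitting_field (h_S3 s1))
   \<and> (no_multiple_root (g_C3_C2 s t) \<longrightarrow>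
        irreducible (g_C3_C2 s t) \<and>
        k_generic2 TYPE('w) (g_C3_C2 s t) (C 3 \<times>\<times> C 2) \<and>
        C 3 \<times>\<times> C 2 \<cong> C 6 \<and>
        transitive_galois_action 6 (C 3 \<times>\<times> C 2) (g_C3_C2 s t))"
proof -
  have char3: "(3::'k) \<noteq> 0" using of_nat_neq_0_if_CHAR_neq[OF _ assms(1)] by simp
  note st = assms(2,3) char3
  show ?thesis
  proof (intro conjI impI)
    show "irreducible (g_S3_S3 s t)" "k_generic2 TYPE('w) (g_S3_S3 s t) (S3 \<times>\<times> S3)"
        "transitive_galois_action 6 (S3 \<times>\<times> S3) (g_S3_S3 s t)"
      if "no_multiple_root (g_S3_S3 s t)"
      using g_S3_S3_generic[OF st that] by auto
    show "irreducible (g_S3_C3 s t)" "k_generic2 TYPE('w) (g_S3_C3 s t) (S3 \<times>\<times> C 3)"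
        "transitive_galois_action 6 (S3 \<times>\<times> C 3) (g_S3_C3 s t)"
      if "no_multiple_root (g_S3_C3 s t)"
      using g_S3_C3_generic[OF st that] by auto
    show "irreducible (g_S3_C2 s t)" "k_generic2 TYPE('w) (g_S3_C2 s t) (S3 \<times>\<times> C 2)"
        "transitive_galois_action 6 (S3 \<times>\<times> C 2) (g_S3_C2 s t)"
      if "no_multiple_root (g_S3_C2 s t)"
      using g_S3_C2_generic[OF st that] by auto
    show "irreducible (g_S3_1 s)" "k_generic2 TYPE('w) (g_S3_1 s) S3"
        "transitive_galois_action 6 S3 (g_S3_1 s)" "k_generic1 TYPE('w) (h_S3 s1) S3"
        "ac_splitting_field (f_S3 s1) = ac_splitting_field (h_S3 s1)"
      if "CHAR('k) \<noteq> 2 \<and> no_multiple_root (g_S3_1 s)"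
      using g_S3_1_generic[OF st conjunct2[OF that]] h_S3_generic[OF assms(4) char3] by auto
    show "irreducible (g_C3_C2 s t)" "k_generic2 TYPE('w) (g_C3_C2 s t) (C 3 \<times>\<times> C 2)"
        "transitive_galois_action 6 (C 3 \<times>\<times> C 2) (g_C3_C2 s t)"
      if "no_multiple_root (g_C3_C2 s t)"
      using g_C3_C2_generic[OF st that] by auto
  qed (rule S3_C3_iso_wreath wreath_iso_swap_semidirect S3_C2_iso_dihedral C3_C2_iso_C6)+
qed

end
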